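(* There is an algorithm that, given as input two forwards immersions of finite graphs $\gamma:\Gamma\to\Delta$ and $\lambda:\Lambda\to\Delta$, computes the graph map $s_\Gamma:\mathbb{S}_\Gamma\to\Gamma$ of long cycles of $\Gamma$ in $O(m^2\cdot n)$ time, where $$m=(\beta_1(\Gamma)+|\partial\Gamma|)+(\beta_1(\Lambda)+|\partial\Lambda|),\qquad n=|E(\Gamma)|+|E(\Lambda)|.$$
   Context: A graph is a directed graph $\Gamma=(V,E,o,t)$ with origin and target maps $o,t:E\to V$ (loops and multiple edges allowed). A graph map commutes with $o,t$; it is a forwards immersion if, at every vertex $v$, it is injective on the set of edges with origin $v$. $\beta_1$ is the first Betti number. $\partial\Gamma\subset V(\Gamma)$ is the set of vertices with indegree $0$ or outdegree $0$. A circle is a directed circular graph with $k\ge1$ consistently oriented edges; a cycle in $\Gamma$ is a graph map $S^1\to\Gamma$ from a circle; its degree is the largest degree of a covering $S^1\to S^1$ through which it factors; it is primitive if its degree is $1$. Long cycles: $s_\Gamma:\mathbb{S}_\Gamma\to\Gamma$ is the disjoint union, one for each isomorphism class over $\Gamma$, of all primitive cycles $g:S^1\to\Gamma$ with $\deg(\gamma\circ g)\ge12\cdot\beta_1(\Gamma)$; there are at most $\beta_1(\Gamma)$ of them. (It has the property that every cycle $f$ in $\Gamma$ with $\deg(\gamma\circ f)/\deg(f)\ge12\cdot\beta_1(\Gamma)$ factors through $s_\Gamma$.) Time is the number of elementary steps of a deterministic algorithm. *)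

theory Defs
  imports "Graph_Theory.Digraph" "HOL-Library.Function_Algebras" "HOL.Rat"
begin

section \<open>Graphs and graph maps\<close>

text \<open>Graphs are the \<^typ>\<open>('v, 'e) pre_digraph\<close>s satisfying \<^const>\<open>wf_digraph\<close>; loops and multiple
  edges are allowed. The record fields of a graph map are meaningful only on the vertices and arcs
  of its domain, so graph maps are compared by \<open>agree_on\<close> and not by equality.\<close>

record ('v, 'e, 'w, 'f) gmap =
  vmap :: "'v \<Rightarrow> 'w"
  emap :: "'e \<Rightarrow> 'f"

definition graph_map ::
    "('v, 'e) pre_digraph \<Rightarrow> ('w, 'f) pre_digraph \<Rightarrow> ('v, 'e, 'w, 'f) gmap \<Rightarrow> bool" where
  "graph_map G H f \<longleftrightarrow> wf_digraph G \<and> wf_digraph H \<and>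
     (\<forall>v\<in>verts G. vmap f v \<in> verts H) \<and>
     (\<forall>e\<in>arcs G. emap f e \<in> arcs H \<and>
        tail H (emap f e) = vmap f (tail G e) \<and> head H (emap f e) = vmap f (head G e))"

definition agree_on ::
    "('v, 'e) pre_digraph \<Rightarrow> ('v, 'e, 'w, 'f) gmap \<Rightarrow> ('v, 'e, 'w, 'f) gmap \<Rightarrow> bool" where
  "agree_on G f g \<longleftrightarrow>
     (\<forall>v\<in>verts G. vmap f v = vmap g v) \<and> (\<forall>e\<in>arcs G. emap f e = emap g e)"

definition gcomp ::
    "('w, 'f, 'x, 'h) gmap \<Rightarrow> ('v, 'e, 'w, 'f) gmap \<Rightarrow> ('v, 'e, 'x, 'h) gmap" (infixl \<open>\<circ>\<^sub>g\<close> 55) where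
  "g \<circ>\<^sub>g f = \<lparr>vmap = vmap g \<circ> vmap f, emap = emap g \<circ> emap f\<rparr>"

definition graph_iso ::
    "('v, 'e) pre_digraph \<Rightarrow> ('w, 'f) pre_digraph \<Rightarrow> ('v, 'e, 'w, 'f) gmap \<Rightarrow> bool" where
  "graph_iso G H f \<longleftrightarrow> graph_map G H f \<and>
     bij_betw (vmap f) (verts G) (verts H) \<and> bij_betw (emap f) (arcs G) (arcs H)"

definition iso_over ::
    "('v, 'e) pre_digraph \<Rightarrow> ('v, 'e, 'x, 'h) gmap \<Rightarrow>
     ('w, 'f) pre_digraph \<Rightarrow> ('w, 'f, 'x, 'h) gmap \<Rightarrow> bool" where
  "iso_over A a B b \<longleftrightarrow> (\<exists>\<phi>. graph_iso A B \<phi> \<and> agree_on A (b \<circ>\<^sub>g \<phi>) a)"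

definition forwards_immersion ::
    "('v, 'e) pre_digraph \<Rightarrow> ('w, 'f) pre_digraph \<Rightarrow> ('v, 'e, 'w, 'f) gmap \<Rightarrow> bool" where
  "forwards_immersion G H f \<longleftrightarrow>
     graph_map G H f \<and> (\<forall>v\<in>verts G. inj_on (emap f) (out_arcs G v))"

definition boundary :: "('v, 'e) pre_digraph \<Rightarrow> 'v set" where
  "boundary G = {v \<in> verts G. in_degree G v = 0 \<or> out_degree G v = 0}"

text \<open>The first homology of a graph (as a 1-dimensional cell complex) is the kernel of the boundary
  map \<open>C\<^sub>1 \<rightarrow> C\<^sub>0\<close>, which sends an edge to its head minus its tail. Coefficients are
  rational.\<close>

interpretation rat_fun: vector_space "\<lambda>(r::rat) (c::'e \<Rightarrow> rat) e. r * c e"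
  by unfold_locales (simp_all add: fun_eq_iff algebra_simps)

definition H1 :: "('v, 'e) pre_digraph \<Rightarrow> ('e \<Rightarrow> rat) set" where
  "H1 G = {c. (\<forall>e. e \<notin> arcs G \<longrightarrow> c e = 0) \<and>
     (\<forall>v\<in>verts G. (\<Sum>e\<in>in_arcs G v. c e) - (\<Sum>e\<in>out_arcs G v. c e) = 0)}"

definition betti1 :: "('v, 'e) pre_digraph \<Rightarrow> nat" where
  "betti1 G = rat_fun.dim (H1 G)"

section \<open>Cycles and long cycles\<close>

definition circle :: "nat \<Rightarrow> (nat, nat) pre_digraph" where
  "circle k = \<lparr>verts = {..<k}, arcs = {..<k}, tail = (\<lambda>i. i), head = (\<lambda>i. Suc i mod k)\<rparr>"

definition is_cycle :: "('v, 'e) pre_digraph \<Rightarrow> nat \<Rightarrow> (nat, nat, 'v, 'e) gmap \<Rightarrow> bool" where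
  "is_cycle G k f \<longleftrightarrow> k \<ge> 1 \<and> graph_map (circle k) G f"

definition covering ::
    "('v, 'e) pre_digraph \<Rightarrow> ('w, 'f) pre_digraph \<Rightarrow> ('v, 'e, 'w, 'f) gmap \<Rightarrow> bool" where
  "covering G H p \<longleftrightarrow> graph_map G H p \<and>
     (\<forall>v\<in>verts G. bij_betw (emap p) (out_arcs G v) (out_arcs H (vmap p v)) \<and>
                  bij_betw (emap p) (in_arcs G v) (in_arcs H (vmap p v)))"

text \<open>A circle is connected, so the degree of a covering onto it may be read off from the fibre
  over the vertex 0.\<close>

definition circle_covering :: "nat \<Rightarrow> nat \<Rightarrow> (nat, nat, nat, nat) gmap \<Rightarrow> nat \<Rightarrow> bool" where
  "circle_covering k l p d \<longleftrightarrow>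
     k \<ge> 1 \<and> l \<ge> 1 \<and> covering (circle k) (circle l) p \<and>
     d = card {v \<in> verts (circle k). vmap p v = 0}"

definition cycle_degree :: "('v, 'e) pre_digraph \<Rightarrow> nat \<Rightarrow> (nat, nat, 'v, 'e) gmap \<Rightarrow> nat" where
  "cycle_degree G k f =
     Max {d. \<exists>l p g. circle_covering k l p d \<and> is_cycle G l g \<and> agree_on (circle k) (g \<circ>\<^sub>g p) f}"

definition primitive_cycle :: "('v, 'e) pre_digraph \<Rightarrow> nat \<Rightarrow> (nat, nat, 'v, 'e) gmap \<Rightarrow> bool" where
  "primitive_cycle G k f \<longleftrightarrow> is_cycle G k f \<and> cycle_degree G k f = 1"

definition long_cycle ::
    "('v, 'e) pre_digraph \<Rightarrow> ('w, 'f) pre_digraph \<Rightarrow> ('v, 'e, 'w, 'f) gmap \<Rightarrow>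
     nat \<Rightarrow> (nat, nat, 'v, 'e) gmap \<Rightarrow> bool" where
  "long_cycle G D \<gamma> k g \<longleftrightarrow> primitive_cycle G k g \<and> cycle_degree D k (\<gamma> \<circ>\<^sub>g g) \<ge> 12 * betti1 G"

type_synonym ('v, 'e) cyc = "nat \<times> (nat, nat, 'v, 'e) gmap"

definition cycles_union ::
    "('v, 'e) cyc set \<Rightarrow> (('v, 'e) cyc \<times> nat, ('v, 'e) cyc \<times> nat) pre_digraph" where
  "cycles_union R =
     \<lparr>verts = (SIGMA c:R. verts (circle (fst c))),
      arcs = (SIGMA c:R. arcs (circle (fst c))),
      tail = (\<lambda>(c, i). (c, tail (circle (fst c)) i)),
      head = (\<lambda>(c, i). (c, head (circle (fst c)) i))\<rparr>"

definition cycles_union_map :: "(('v, 'e) cyc \<times> nat, ('v, 'e) cyc \<times> nat, 'v, 'e) gmap" where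
  "cycles_union_map = \<lparr>vmap = (\<lambda>(c, i). vmap (snd c) i), emap = (\<lambda>(c, i). emap (snd c) i)\<rparr>"

definition long_cycle_representatives ::
    "('v, 'e) pre_digraph \<Rightarrow> ('w, 'f) pre_digraph \<Rightarrow> ('v, 'e, 'w, 'f) gmap \<Rightarrow>
     ('v, 'e) cyc set \<Rightarrow> bool" where
  "long_cycle_representatives G D \<gamma> R \<longleftrightarrow>
     (\<forall>c\<in>R. long_cycle G D \<gamma> (fst c) (snd c)) \<and>
     (\<forall>k g. long_cycle G D \<gamma> k g \<longrightarrow>
        (\<exists>!c. c \<in> R \<and> iso_over (circle k) g (circle (fst c)) (snd c)))"

text \<open>The map \<open>s\<^sub>\<Gamma>\<close> of long cycles is defined only up to isomorphism over \<open>\<Gamma>\<close>; the following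
  says that \<open>s : S \<rightarrow> G\<close> is such a map.\<close>

definition long_cycles_map ::
    "('v, 'e) pre_digraph \<Rightarrow> ('w, 'f) pre_digraph \<Rightarrow> ('v, 'e, 'w, 'f) gmap \<Rightarrow>
     ('a, 'b) pre_digraph \<Rightarrow> ('a, 'b, 'v, 'e) gmap \<Rightarrow> bool" where
  "long_cycles_map G D \<gamma> S s \<longleftrightarrow>
     (\<exists>R. long_cycle_representatives G D \<gamma> R \<and> iso_over S s (cycles_union R) cycles_union_map)"

section \<open>Algorithms\<close>

text \<open>Structured programs for a random access machine with uniform cost. As in the machine of Cook
  and Reckhow, the only arithmetic is addition and (truncated) subtraction; there is no
  multiplication. A program mentions finitely many variables and arrays of natural numbers; array
  names are part of the program text and cannot be computed.\<close>

type_synonym name = string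

record state =
  var :: "name \<Rightarrow> nat"
  arr :: "name \<Rightarrow> nat \<Rightarrow> nat"

datatype atom = Const nat | Var name

datatype test = Less atom atom | Equal atom atom

datatype com =
    Skip
  | Move name atom
  | Add name atom atom
  | Sub name atom atom
  | Load name name atom
  | Store name atom atom
  | Seq com com
  | Branch test com com
  | Loop test com

fun aval :: "state \<Rightarrow> atom \<Rightarrow> nat" where
  "aval s (Const n) = n"
| "aval s (Var x) = var s x"

fun tval :: "state \<Rightarrow> test \<Rightarrow> bool" where
  "tval s (Less a b) \<longleftrightarrow> aval s a < aval s b"
| "tval s (Equal a b) \<longleftrightarrow> aval s a = aval s b"

definition set_var :: "name \<Rightarrow> nat \<Rightarrow> state \<Rightarrow> state" where
  "set_var x n s = s\<lparr>var := (var s)(x := n)\<rparr>"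

definition set_arr :: "name \<Rightarrow> nat \<Rightarrow> nat \<Rightarrow> state \<Rightarrow> state" where
  "set_arr A i n s = s\<lparr>arr := (arr s)(A := (arr s A)(i := n))\<rparr>"

text \<open>\<open>exec c s t s'\<close>: started in \<open>s\<close>, the program \<open>c\<close> terminates in \<open>s'\<close> after exactly \<open>t\<close>
  elementary steps, a step being one instruction or one evaluation of a test.\<close>

inductive exec :: "com \<Rightarrow> state \<Rightarrow> nat \<Rightarrow> state \<Rightarrow> bool" where
  Skip: "exec Skip s 1 s"
| Move: "exec (Move x a) s 1 (set_var x (aval s a) s)"
| Add: "exec (Add x a b) s 1 (set_var x (aval s a + aval s b) s)"
| Sub: "exec (Sub x a b) s 1 (set_var x (aval s a - aval s b) s)"
| Load: "exec (Load x A a) s 1 (set_var x (arr s A (aval s a)) s)"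
| Store: "exec (Store A a b) s 1 (set_arr A (aval s a) (aval s b) s)"
| Seq: "exec c1 s t1 s1 \<Longrightarrow> exec c2 s1 t2 s2 \<Longrightarrow> exec (Seq c1 c2) s (t1 + t2) s2"
| BranchTrue: "tval s b \<Longrightarrow> exec c1 s t s1 \<Longrightarrow> exec (Branch b c1 c2) s (1 + t) s1"
| BranchFalse: "\<not> tval s b \<Longrightarrow> exec c2 s t s1 \<Longrightarrow> exec (Branch b c1 c2) s (1 + t) s1"
| LoopFalse: "\<not> tval s b \<Longrightarrow> exec (Loop b c) s 1 s"
| LoopTrue: "tval s b \<Longrightarrow> exec c s t1 s1 \<Longrightarrow> exec (Loop b c) s1 t2 s2 \<Longrightarrow>
    exec (Loop b c) s (1 + t1 + t2) s2"

inductive_cases SkipE: "exec Skip s t s'"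
inductive_cases MoveE: "exec (Move x a) s t s'"
inductive_cases AddE: "exec (Add x a b) s t s'"
inductive_cases SubE: "exec (Sub x a b) s t s'"
inductive_cases LoadE: "exec (Load x A a) s t s'"
inductive_cases StoreE: "exec (Store A a b) s t s'"
inductive_cases SeqE: "exec (Seq c1 c2) s t s'"
inductive_cases BranchE: "exec (Branch b c1 c2) s t s'"
inductive_cases LoopE: "exec (Loop b c) s t s'"

lemma exec_deterministic:
  "exec c s t s1 \<Longrightarrow> exec c s t' s2 \<Longrightarrow> t' = t \<and> s2 = s1"
proof (induction arbitrary: t' s2 rule: exec.induct)
  case (Seq c1 s t1 u1 c2 t2 u2)
  from Seq.prems obtain a b v where "t' = a + b" "exec c1 s a v" "exec c2 v b s2"
    by (rule SeqE)
  then show ?case using Seq.IH(1)[of a v] Seq.IH(2)[of b s2] by simp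
next
  case (BranchTrue s b c1 t u c2)
  from BranchTrue.prems obtain a where "t' = 1 + a" "exec c1 s a s2"
    by (rule BranchE) (use BranchTrue.hyps in simp_all)
  then show ?case using BranchTrue.IH[of a s2] by simp
next
  case (BranchFalse s b c2 t u c1)
  from BranchFalse.prems obtain a where "t' = 1 + a" "exec c2 s a s2"
    by (rule BranchE) (use BranchFalse.hyps in simp_all)
  then show ?case using BranchFalse.IH[of a s2] by simp
next
  case (LoopFalse s b c)
  from LoopFalse.prems show ?case by (rule LoopE) (use LoopFalse.hyps in simp_all)
next
  case (LoopTrue s b c t1 u1 t2 u2)
  from LoopTrue.prems obtain a d v where "t' = 1 + a + d" "exec c s a v" "exec (Loop b c) v d s2"
    by (rule LoopE) (use LoopTrue.hyps in simp_all)
  then show ?case using LoopTrue.IH(1)[of a v] LoopTrue.IH(2)[of d s2] by simp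
qed (erule SkipE MoveE AddE SubE LoadE StoreE, simp)+

section \<open>Input and output\<close>

text \<open>A finite graph is presented to an algorithm by numbering its vertices and its edges from 0.
  Each graph and each map is tabulated in arrays of its own; all other variables and array entries
  are 0 initially.\<close>

definition numbered_graph :: "(nat, nat) pre_digraph \<Rightarrow> bool" where
  "numbered_graph G \<longleftrightarrow>
     fin_digraph G \<and> verts G = {..<card (verts G)} \<and> arcs G = {..<card (arcs G)}"

definition table :: "nat \<Rightarrow> (nat \<Rightarrow> nat) \<Rightarrow> nat \<Rightarrow> nat" where
  "table n f = (\<lambda>i. if i < n then f i else 0)"

definition input_state ::
    "(nat, nat) pre_digraph \<Rightarrow> (nat, nat) pre_digraph \<Rightarrow> (nat, nat) pre_digraph \<Rightarrow>
     (nat, nat, nat, nat) gmap \<Rightarrow> (nat, nat, nat, nat) gmap \<Rightarrow> state" where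
  "input_state \<Gamma> \<Lambda> \<Delta> \<gamma> l =
     \<lparr>var = (\<lambda>_. 0)
        (''Gamma_verts'' := card (verts \<Gamma>), ''Gamma_arcs'' := card (arcs \<Gamma>),
         ''Lambda_verts'' := card (verts \<Lambda>), ''Lambda_arcs'' := card (arcs \<Lambda>),
         ''Delta_verts'' := card (verts \<Delta>), ''Delta_arcs'' := card (arcs \<Delta>)),
      arr = (\<lambda>_ _. 0)
        (''Gamma_tail'' := table (card (arcs \<Gamma>)) (tail \<Gamma>),
         ''Gamma_head'' := table (card (arcs \<Gamma>)) (head \<Gamma>),
         ''Lambda_tail'' := table (card (arcs \<Lambda>)) (tail \<Lambda>),
         ''Lambda_head'' := table (card (arcs \<Lambda>)) (head \<Lambda>),
         ''Delta_tail'' := table (card (arcs \<Delta>)) (tail \<Delta>),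
         ''Delta_head'' := table (card (arcs \<Delta>)) (head \<Delta>),
         ''gamma_vmap'' := table (card (verts \<Gamma>)) (vmap \<gamma>),
         ''gamma_emap'' := table (card (arcs \<Gamma>)) (emap \<gamma>),
         ''lambda_vmap'' := table (card (verts \<Lambda>)) (vmap l),
         ''lambda_emap'' := table (card (arcs \<Lambda>)) (emap l))\<rparr>"

definition output_graph :: "state \<Rightarrow> (nat, nat) pre_digraph" where
  "output_graph s =
     \<lparr>verts = {..<var s ''S_verts''}, arcs = {..<var s ''S_arcs''},
      tail = arr s ''S_tail'', head = arr s ''S_head''\<rparr>"

definition output_map :: "state \<Rightarrow> (nat, nat, nat, nat) gmap" where
  "output_map s = \<lparr>vmap = arr s ''s_vmap'', emap = arr s ''s_emap''\<rparr>"

definition size_m :: "('v, 'e) pre_digraph \<Rightarrow> ('w, 'f) pre_digraph \<Rightarrow> nat" where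
  "size_m \<Gamma> \<Lambda> = (betti1 \<Gamma> + card (boundary \<Gamma>)) + (betti1 \<Lambda> + card (boundary \<Lambda>))"

definition size_n :: "('v, 'e) pre_digraph \<Rightarrow> ('w, 'f) pre_digraph \<Rightarrow> nat" where
  "size_n \<Gamma> \<Lambda> = card (arcs \<Gamma>) + card (arcs \<Lambda>)"

text \<open>A running time is in \<open>O(m\<^sup>2 \<cdot> n)\<close> if it is at most \<open>C \<cdot> max 1 (m\<^sup>2 \<cdot> n)\<close> for a constant \<open>C\<close>.
  The maximum is there only for inputs without edges: for them \<open>m\<^sup>2 \<cdot> n = 0\<close>, although
  every algorithm makes at least one step. If there is an edge, then \<open>m\<^sup>2 \<cdot> n \<ge> 1\<close>.\<close>

definition time_bound :: "nat \<Rightarrow> nat \<Rightarrow> nat \<Rightarrow> nat" where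
  "time_bound C m n = C * max 1 (m^2 * n)"

end

theory Submission
  imports Defs
begin

text \<open>Label the edges of \<open>\<Gamma>\<close> by their images in \<open>\<Delta>\<close>. Since \<open>\<gamma>\<close> is a forwards immersion, a walk is
  determined by its origin and its label word. Let \<open>\<beta>\<close> be the Betti number of \<open>\<Gamma>\<close>. Consider a primitive
  cycle of length \<open>T\<close> whose label word has least period \<open>l\<close>, with \<open>T \<ge> 12 \<beta> l\<close>. Rank its positions by the
  lexicographic order of the label words read from them, and call a position top if it has the
  largest rank over its vertex. An Euler characteristic count shows that the step to the next
  position leaves the top positions fewer than \<open>\<beta>\<close> times. It follows that \<open>T \<le> 2 |E|\<close>, and that the cycle has a run of
  \<open>3 l\<close> steps avoiding any given set of at most \<open>2 \<beta>\<close> vertices.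

  A depth-first search chooses an out-edge at every vertex that is not a dead end. All but at
  most \<open>2 \<beta>\<close> of these vertices, the stops, have no other useful out-edge, and at most \<open>3 \<beta>\<close> edges leave
  the stops. So every long cycle contains one of these edges followed by \<open>3 l\<close> chosen edges. From each of
  these edges the algorithm follows the chosen edges to the next stop, computes the least period \<open>p\<close>
  of the labels read, and continues the walk with labels of period \<open>p\<close> for at most \<open>2 |E|\<close> steps, trying
  at most \<open>3 \<beta>\<close> edges at each step. If the starting edge is that of a long cycle, then \<open>p = l\<close> and the
  walk closes up to this cycle, unless it runs into a cycle already found with the same label
  period. This takes time \<open>O(\<beta>\<^sup>2 |E|)\<close>; the graph \<open>\<Lambda>\<close> is not needed, and it only increases \<open>m\<close>
  and \<open>n\<close>.\<close>

section \<open>The first Betti number\<close>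

text \<open>The difficulty is to spend only O(\<beta> |E|) on each of the O(\<beta>) starting arcs,
  although a long cycle may pass a vertex many times and out-degrees are not bounded by \<beta>. Two
  facts make this possible. In one turn, a primitive cycle is at a vertex at most once in each phase
  of its label period, so vertex and phase determine the rest of the walk. And all live arcs out of
  stops form one list of at most 3 \<beta> arcs, so the next arc can be found without reading all
  out-arcs of a vertex. The label period has to be known before labels can guide the walk. This is
  what the 3 l chosen arcs are for: they can be followed without looking at labels, and more than
  two periods of labels are enough to recognise the least period. The constant 12 is 4 * 3. One turn
  contains 4 \<beta> disjoint windows of 3 l steps. At most 2 \<beta> of them are spoiled by a top
  position over a forbidden vertex, and fewer than \<beta> by a step that leaves the top positions,
  so one window is free. Ranks must be lexicographic because prepending a common letter preserves
  this order; this is how top positions of a vertex are compared with those of the arcs that enter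
  it.\<close>

definition conn :: "('v, 'e) pre_digraph \<Rightarrow> 'v \<Rightarrow> 'v \<Rightarrow> bool" where
  "conn G = (\<lambda>u v. \<exists>e\<in>arcs G. u = tail G e \<and> v = head G e \<or> v = tail G e \<and> u = head G e)\<^sup>*\<^sup>*"

lemma conn_refl [simp]: "conn G u u"
  by (simp add: conn_def)

lemma conn_trans: "conn G u v \<Longrightarrow> conn G v w \<Longrightarrow> conn G u w"
  unfolding conn_def by simp

lemma conn_arc: "e \<in> arcs G \<Longrightarrow> conn G (tail G e) (head G e)"
  unfolding conn_def by (rule r_into_rtranclp) auto

lemma conn_arc': "e \<in> arcs G \<Longrightarrow> conn G (head G e) (tail G e)"
  unfolding conn_def by (rule r_into_rtranclp) auto

lemma conn_sym: "conn G u v \<Longrightarrow> conn G v u"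
  unfolding conn_def
  by (rule sympD[OF symp_rtranclp]) (auto intro!: sympI)

lemma conn_mono:
  assumes "conn G u v" "arcs G \<subseteq> arcs H" "tail H = tail G" "head H = head G"
  shows "conn H u v"
proof -
  let ?r = "\<lambda>G u v. \<exists>e\<in>arcs G. u = tail G e \<and> v = head G e \<or> v = tail G e \<and> u = head G e"
  have "?r G \<le> ?r H" using assms by auto
  from rtranclp_mono[OF this] assms(1) show ?thesis unfolding conn_def by auto
qed

lemma conn_label:
  assumes "conn G u v" "\<And>e. e \<in> arcs G \<Longrightarrow> lab (tail G e) = lab (head G e)"
  shows "lab u = lab v"
  using assms(1) unfolding conn_def
  by (induction rule: rtranclp_induct) (use assms(2) in force)+

definition bdry :: "('v, 'e) pre_digraph \<Rightarrow> ('e \<Rightarrow> rat) \<Rightarrow> 'v \<Rightarrow> rat" where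
  "bdry G c v = (\<Sum>e\<in>in_arcs G v. c e) - (\<Sum>e\<in>out_arcs G v. c e)"

lemma in_H1: "c \<in> H1 G \<longleftrightarrow> (\<forall>e. e \<notin> arcs G \<longrightarrow> c e = 0) \<and> (\<forall>v\<in>verts G. bdry G c v = 0)"
  by (simp add: H1_def bdry_def)

lemma bdry_alt:
  assumes "finite (arcs G)"
  shows "bdry G c v = (\<Sum>e\<in>arcs G. c e * (of_bool (head G e = v) - of_bool (tail G e = v)))"
proof -
  have "(\<Sum>e\<in>in_arcs G v. c e) = (\<Sum>e\<in>arcs G. c e * of_bool (head G e = v))"
    unfolding in_arcs_def using assms by (simp add: sum.If_cases of_bool_def if_distrib Int_def cong: if_cong)
  moreover have "(\<Sum>e\<in>out_arcs G v. c e) = (\<Sum>e\<in>arcs G. c e * of_bool (tail G e = v))"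
    unfolding out_arcs_def using assms by (simp add: sum.If_cases of_bool_def if_distrib Int_def cong: if_cong)
  ultimately show ?thesis by (simp add: bdry_def sum_subtractf right_diff_distrib)
qed

text \<open>Arcs of an undirected path are summed with sign, positive along the path and negative
  against it, and the boundary telescopes. Such a chain closes up to a homology class when an arc is
  added between vertices that are already connected.\<close>

lemma conn_chain:
  assumes "conn G u v" "finite (arcs G)"
  shows "\<exists>c. (\<forall>e. e \<notin> arcs G \<longrightarrow> c e = 0) \<and>
    (\<forall>x. bdry G c x = of_bool (x = v) - of_bool (x = u))"
  using assms(1) unfolding conn_def
proof (induction rule: rtranclp_induct)
  case base
  show ?case using assms(2) by (intro exI[of _ "\<lambda>_. 0"]) (auto simp: bdry_alt)
next
  case (step y z)
  from step.IH obtain c where c: "\<And>e. e \<notin> arcs G \<Longrightarrow> c e = 0"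
    "\<And>x. bdry G c x = of_bool (x = y) - of_bool (x = u)" by auto
  from step.hyps obtain e where e: "e \<in> arcs G"
    "y = tail G e \<and> z = head G e \<or> z = tail G e \<and> y = head G e" by auto
  define s :: rat where "s = (if y = tail G e \<and> z = head G e then 1 else - 1)"
  have "bdry G (\<lambda>f. c f + s * of_bool (f = e)) x = of_bool (x = z) - of_bool (x = u)" for x
  proof -
    have "bdry G (\<lambda>f. c f + s * of_bool (f = e)) x = bdry G c x +
      (\<Sum>f\<in>arcs G. s * of_bool (f = e) * (of_bool (head G f = x) - of_bool (tail G f = x)))"
      unfolding bdry_alt[OF assms(2)] by (simp add: sum.distrib[symmetric] distrib_right)
    also have "(\<Sum>f\<in>arcs G. s * of_bool (f = e) * (of_bool (head G f = x) - of_bool (tail G f = x))) =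
       (\<Sum>f\<in>arcs G. if f = e then s * (of_bool (head G e = x) - of_bool (tail G e = x)) else 0)"
      by (rule sum.cong) auto
    also have "\<dots> = s * (of_bool (head G e = x) - of_bool (tail G e = x))"
      using e(1) assms(2) by simp
    finally show ?thesis using e c(2)[of x] by (auto simp: s_def of_bool_def)
  qed
  then show ?case using c(1) e(1) by (intro exI[of _ "\<lambda>f. c f + s * of_bool (f = e)"]) auto
qed

text \<open>The arc \<open>e0\<close> is a bridge between two classes. Summing the boundary over the
  class of its head cancels every other arc, because both its ends or none lie in the class; only
  \<open>c e0\<close> survives.\<close>

lemma bdry_class_sum:
  assumes "fin_digraph G" and lab: "\<And>e. e \<in> arcs G \<Longrightarrow> e \<noteq> e0 \<Longrightarrow> lab (tail G e) = lab (head G e)"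
    and "c \<in> H1 G" "e0 \<in> arcs G" "lab (tail G e0) \<noteq> lab (head G e0)"
  shows "c e0 = 0"
proof -
  interpret fin_digraph G by fact
  define W where "W = {v \<in> verts G. lab v = lab (head G e0)}"
  have fW: "finite W" by (simp add: W_def)
  have "0 = (\<Sum>v\<in>W. bdry G c v)" using assms(3) by (simp add: in_H1 W_def)
  also have "\<dots> = (\<Sum>e\<in>arcs G. \<Sum>v\<in>W. c e * (of_bool (head G e = v) - of_bool (tail G e = v)))"
    unfolding bdry_alt[OF finite_arcs] by (rule sum.swap)
  also have "\<dots> = (\<Sum>e\<in>arcs G. if e = e0 then c e0 else 0)"
  proof (rule sum.cong[OF refl])
    fix e assume e: "e \<in> arcs G"
    have "(\<Sum>v\<in>W. of_bool (x = v)) = (of_bool (x \<in> W) :: rat)" for x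
      using fW by (simp add: of_bool_def)
    then have "(\<Sum>v\<in>W. c e * (of_bool (head G e = v) - of_bool (tail G e = v))) =
      c e * (of_bool (head G e \<in> W) - of_bool (tail G e \<in> W))"
      by (simp add: sum_distrib_left[symmetric] sum_subtractf)
    also have "\<dots> = (if e = e0 then c e0 else 0)"
      using e lab[OF e] assms(4,5) by (auto simp: W_def)
    finally show "(\<Sum>v\<in>W. c e * (of_bool (head G e = v) - of_bool (tail G e = v))) =
      (if e = e0 then c e0 else 0)" .
  qed
  also have "\<dots> = c e0" using assms(4) by simp
  finally show ?thesis by simp
qed

lemma H1_subspace: "fin_digraph G \<Longrightarrow> rat_fun.subspace (H1 G)"
proof -
  assume "fin_digraph G"
  then have "finite (arcs G)" by (simp add: fin_digraph_def fin_digraph_axioms_def)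
  then show ?thesis
    by (auto simp: rat_fun.subspace_def in_H1 bdry_alt distrib_right sum.distrib mult.assoc
      sum_distrib_left[symmetric])
qed

text \<open>Euler's formula by adding arcs one at a time. An arc inside a component adds one basis
  element of \<open>H1\<close>; an arc between two components is a bridge, merges them and leaves
  \<open>H1\<close> as it was. The function \<open>lab\<close> names the components, so the size of
  its image is their number.\<close>

lemma betti_structure:
  fixes G :: "('v, 'e) pre_digraph"
  assumes fin: "fin_digraph G"
  shows "\<exists>B (lab :: 'v \<Rightarrow> 'v). finite B \<and> rat_fun.independent B \<and> rat_fun.span B = H1 G \<and>
    (\<forall>e\<in>arcs G. lab (tail G e) = lab (head G e)) \<and>
    (\<forall>u\<in>verts G. \<forall>v\<in>verts G. lab u = lab v \<longrightarrow> conn G u v) \<and>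
    card B + card (verts G) = card (arcs G) + card (lab ` verts G)"
proof -
  interpret fin_digraph G by fact
  have "\<exists>B (lab :: 'v \<Rightarrow> 'v). finite B \<and> rat_fun.independent B \<and> rat_fun.span B = H1 (G\<lparr>arcs := A\<rparr>) \<and>
    (\<forall>e\<in>A. lab (tail G e) = lab (head G e)) \<and>
    (\<forall>u\<in>verts G. \<forall>v\<in>verts G. lab u = lab v \<longrightarrow> conn (G\<lparr>arcs := A\<rparr>) u v) \<and>
    card B + card (verts G) = card A + card (lab ` verts G)" if "finite A" "A \<subseteq> arcs G" for A
    using that
  proof (induction A rule: finite_induct)
    case empty
    have "H1 (G\<lparr>arcs := {}\<rparr>) = {\<lambda>_. 0}"
      by (auto simp: H1_def in_arcs_def out_arcs_def fun_eq_iff)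
    then show ?case
      by (intro exI[of _ "{}"] exI[of _ id]) (auto simp: zero_fun_def rat_fun.independent_empty)
  next
    case (insert e A)
    let ?G = "G\<lparr>arcs := A\<rparr>" and ?H = "G\<lparr>arcs := insert e A\<rparr>"
    have finH: "fin_digraph ?H" and finG: "fin_digraph ?G"
      using insert.hyps insert.prems by unfold_locales auto
    have e: "e \<in> arcs G" using insert.prems by auto
    from insert obtain B and lab :: "'v \<Rightarrow> 'v" where B: "finite B" "rat_fun.independent B"
      "rat_fun.span B = H1 ?G" and lab: "\<forall>e\<in>A. lab (tail G e) = lab (head G e)"
      "\<forall>u\<in>verts G. \<forall>v\<in>verts G. lab u = lab v \<longrightarrow> conn ?G u v" and
      card: "card B + card (verts G) = card A + card (lab ` verts G)" by auto
    have up: "conn ?G u v \<Longrightarrow> conn ?H u v" for u v by (erule conn_mono) auto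
    have bd: "bdry ?H c x = bdry ?G c x" if "c e = 0" for c x
      using insert.hyps that by (simp add: bdry_alt)
    have sub: "c \<in> H1 ?G \<longleftrightarrow> c \<in> H1 ?H \<and> c e = 0" for c
      proof (cases "c e = 0")
      case True
      then have "(f \<notin> A \<longrightarrow> c f = 0) \<longleftrightarrow> (f \<notin> insert e A \<longrightarrow> c f = 0)" for f by (cases "f = e") auto
      then show ?thesis using True bd[of c] by (simp add: in_H1)
    qed (use insert.hyps in \<open>auto simp: in_H1\<close>)
    show ?case
    proof (cases "lab (tail G e) = lab (head G e)")
      case True
      then have "conn ?G (head G e) (tail G e)" using lab(2) e by simp
      from conn_chain[OF this] insert.hyps obtain c where c: "\<And>f. f \<notin> A \<Longrightarrow> c f = 0"
        "\<And>x. bdry ?G c x = of_bool (x = tail G e) - of_bool (x = head G e)" by auto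
      \<comment> \<open>The chain \<open>c\<close> leads from the head of \<open>e\<close> back to
        its tail inside the old graph, so adding \<open>e\<close> once closes it up.\<close>
      define z where "z = c(e := 1)"
      have ze: "z e = 1" by (simp add: z_def)
      have "bdry ?H z x = 0" for x
      proof -
        have "(\<Sum>f\<in>A. z f * (of_bool (head G f = x) - of_bool (tail G f = x))) = bdry ?G c x"
          using insert.hyps by (auto simp: bdry_alt z_def intro!: sum.cong)
        then show ?thesis using insert.hyps c(2)[of x] by (auto simp: bdry_alt ze of_bool_def)
      qed
      then have z: "z \<in> H1 ?H" using c(1) by (auto simp: in_H1 z_def)
      have "z \<notin> rat_fun.span B" using B(3) sub ze by auto
      then have ind: "rat_fun.independent (insert z B)" and nB: "z \<notin> B"
        using B(2) rat_fun.independent_insertI rat_fun.span_base by auto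
      have "rat_fun.span (insert z B) = H1 ?H"
      proof
        have "B \<subseteq> H1 ?G" using B(3) rat_fun.span_superset by blast
        then show "rat_fun.span (insert z B) \<subseteq> H1 ?H"
          using z sub by (intro rat_fun.span_minimal H1_subspace finH) auto
        show "H1 ?H \<subseteq> rat_fun.span (insert z B)"
        proof
          fix y assume y: "y \<in> H1 ?H"
          \<comment> \<open>Subtracting this multiple of \<open>z\<close> kills the coefficient of
            \<open>e\<close>, which brings \<open>y\<close> back into the old homology.\<close>
          let ?y = "y - (\<lambda>f. y e * z f)"
          have "?y \<in> H1 ?H"
            using rat_fun.subspace_diff[OF H1_subspace[OF finH] y
              rat_fun.subspace_scale[OF H1_subspace[OF finH] z]] .
          then have "?y \<in> H1 ?G" using sub ze by simp
          then show "y \<in> rat_fun.span (insert z B)"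
            using B(3) by (auto simp: rat_fun.span_breakdown_eq)
        qed
      qed
      then show ?thesis using B(1) ind nB lab True card up insert.hyps
        by (intro exI[of _ "insert z B"] exI[of _ lab]) auto
    next
      case False
      let ?lab = "\<lambda>x. if lab x = lab (head G e) then lab (tail G e) else lab x"
      have "c \<in> H1 ?H \<Longrightarrow> c e = 0" for c
        by (rule bdry_class_sum[OF finH, of e lab]) (use lab False in auto)
      then have H: "H1 ?H = H1 ?G" using sub by blast
      have "?lab ` verts G = lab ` verts G - {lab (head G e)}"
        using False e by (auto simp: image_iff)
      then have c': "card (?lab ` verts G) + 1 = card (lab ` verts G)"
        using e card_Suc_Diff1[of "lab ` verts G" "lab (head G e)"] by simp
      have eH: "conn ?H (tail G e) (head G e)" "conn ?H (head G e) (tail G e)"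
        using conn_arc[of e ?H] conn_arc'[of e ?H] by auto
      have cc: "conn ?H u v" if uv: "u \<in> verts G" "v \<in> verts G" "?lab u = ?lab v" for u v
      proof -
        have *: "lab x = lab (head G e) \<Longrightarrow> x \<in> verts G \<Longrightarrow> conn ?H x (tail G e)" for x
          using lab(2) e up eH(2) conn_trans head_in_verts by metis
        have **: "lab x = lab (tail G e) \<Longrightarrow> x \<in> verts G \<Longrightarrow> conn ?H x (tail G e)" for x
          using lab(2) e up tail_in_verts by metis
        show ?thesis
        proof (cases "lab u = lab v")
          case True then show ?thesis using lab(2) up uv by auto
        next
          case False
          then have "conn ?H u (tail G e)" "conn ?H v (tail G e)"
            using uv * ** by (auto split: if_splits)
          then show ?thesis using conn_sym conn_trans by metis
        qed
      qed
      have "finite B \<and> rat_fun.independent B \<and> rat_fun.span B = H1 ?H \<and>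
        (\<forall>f\<in>insert e A. ?lab (tail G f) = ?lab (head G f)) \<and>
        (\<forall>u\<in>verts G. \<forall>v\<in>verts G. ?lab u = ?lab v \<longrightarrow> conn ?H u v) \<and>
        card B + card (verts G) = card (insert e A) + card (?lab ` verts G)"
        using B H lab(1) cc c' card insert.hyps by simp
      then show ?thesis by (intro exI)
    qed
  qed
  from this[of "arcs G"] show ?thesis by simp
qed

text \<open>Any two labellings that name the components separate the same pairs of vertices, so
  their images have the same size. This form is applied to the component numbers that the program
  computes.\<close>

lemma betti1_eq:
  fixes lab :: "'v \<Rightarrow> 'a"
  assumes fin: "fin_digraph G" and lab: "\<And>e. e \<in> arcs G \<Longrightarrow> lab (tail G e) = lab (head G e)"
    and c: "\<And>u v. u \<in> verts G \<Longrightarrow> v \<in> verts G \<Longrightarrow> lab u = lab v \<Longrightarrow> conn G u v"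
  shows "betti1 G + card (verts G) = card (arcs G) + card (lab ` verts G)"
proof -
  interpret fin_digraph G by fact
  from betti_structure[OF fin] obtain B and lab' :: "'v \<Rightarrow> 'v" where
    B: "finite B" "rat_fun.independent B" "rat_fun.span B = H1 G" and
    lab': "\<And>e. e \<in> arcs G \<Longrightarrow> lab' (tail G e) = lab' (head G e)"
      "\<And>u v. u \<in> verts G \<Longrightarrow> v \<in> verts G \<Longrightarrow> lab' u = lab' v \<Longrightarrow> conn G u v" and
    card: "card B + card (verts G) = card (arcs G) + card (lab' ` verts G)" by blast
  have k: "lab u = lab v \<longleftrightarrow> lab' u = lab' v" if "u \<in> verts G" "v \<in> verts G" for u v
    using that c lab'(2) conn_label[of G u v lab] conn_label[of G u v lab'] lab lab'(1) by metis
  have "card (lab ` verts G) = card (lab' ` verts G)"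
  proof (rule bij_betw_same_card)
    show "bij_betw (\<lambda>l. lab' (inv_into (verts G) lab l)) (lab ` verts G) (lab' ` verts G)"
      unfolding bij_betw_def
    proof
      show "inj_on (\<lambda>l. lab' (inv_into (verts G) lab l)) (lab ` verts G)"
        by (rule inj_onI) (metis f_inv_into_f inv_into_into k)
      show "(\<lambda>l. lab' (inv_into (verts G) lab l)) ` lab ` verts G = lab' ` verts G"
        unfolding image_image
        by (rule image_cong[OF refl]) (metis f_inv_into_f imageI inv_into_into k)
    qed
  qed
  moreover have "betti1 G = card B"
    unfolding betti1_def using B by (metis rat_fun.dim_eq_card_independent rat_fun.dim_span)
  ultimately show ?thesis using card by simp
qed

text \<open>Labels that are merely constant along arcs may fail to separate components, so there are
  at most as many labels as components. With a constant label this yields |E| + 1 \<le> \<beta> +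
  |V| for every nonempty graph, without a proof of connectedness.\<close>

lemma betti1_ge:
  fixes lab :: "'v \<Rightarrow> 'a"
  assumes fin: "fin_digraph G" and lab: "\<And>e. e \<in> arcs G \<Longrightarrow> lab (tail G e) = lab (head G e)"
  shows "card (arcs G) + card (lab ` verts G) \<le> betti1 G + card (verts G)"
proof -
  interpret fin_digraph G by fact
  from betti_structure[OF fin] obtain lab' :: "'v \<Rightarrow> 'v" where
    lab': "\<And>e. e \<in> arcs G \<Longrightarrow> lab' (tail G e) = lab' (head G e)"
      "\<And>u v. u \<in> verts G \<Longrightarrow> v \<in> verts G \<Longrightarrow> lab' u = lab' v \<Longrightarrow> conn G u v" by blast
  have "lab ` verts G \<subseteq> (\<lambda>l. lab (SOME v. v \<in> verts G \<and> lab' v = l)) ` (lab' ` verts G)"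
  proof
    fix l assume "l \<in> lab ` verts G"
    then obtain v where v: "v \<in> verts G" "l = lab v" by auto
    let ?w = "SOME w. w \<in> verts G \<and> lab' w = lab' v"
    have "?w \<in> verts G \<and> lab' ?w = lab' v" by (rule someI[of _ v]) (use v in simp)
    then have "conn G ?w v" using v lab'(2) by simp
    then have "lab ?w = lab v" using lab by (rule conn_label)
    then show "l \<in> (\<lambda>l. lab (SOME v. v \<in> verts G \<and> lab' v = l)) ` (lab' ` verts G)"
      using v by (auto simp: image_iff intro!: bexI[of _ v])
  qed
  then have "card (lab ` verts G) \<le> card (lab' ` verts G)"
    by (meson card_image_le card_mono finite_imageI finite_verts le_trans)
  then show ?thesis using betti1_eq[OF fin, of lab'] lab' by simp
qed

text \<open>Chains vanish off the arcs, so \<open>H1 G\<close> is literally a subset of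
  \<open>H1 H\<close>: extension by zero is the identity.\<close>

lemma betti1_subgraph:
  assumes "fin_digraph G" "fin_digraph H" "arcs G \<subseteq> arcs H" "verts G \<subseteq> verts H"
    "tail H = tail G" "head H = head G"
  shows "betti1 G \<le> betti1 H"
proof -
  interpret G: fin_digraph G by fact
  interpret H: fin_digraph H by fact
  have "H1 G \<subseteq> H1 H"
  proof
    fix c assume c: "c \<in> H1 G"
    have eq: "bdry H c v = bdry G c v" for v
      unfolding bdry_alt[OF G.finite_arcs] bdry_alt[OF H.finite_arcs] assms(5,6)
      by (rule sum.mono_neutral_right) (use assms c in \<open>auto simp: in_H1\<close>)
    have "bdry G c v = 0" if "v \<notin> verts G" for v
      unfolding bdry_alt[OF G.finite_arcs]
      by (rule sum.neutral) (use that in \<open>auto simp: G.head_in_verts G.tail_in_verts\<close>)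
    then show "c \<in> H1 H" using c eq assms(3) by (auto simp: in_H1)
  qed
  moreover from betti_structure[OF assms(2)] obtain B where
    B: "finite B" "rat_fun.independent B" "rat_fun.span B = H1 H" by blast
  ultimately have "rat_fun.dim (H1 G) \<le> card B" by (intro rat_fun.dim_le_card) auto
  also have "card B = betti1 H"
    unfolding betti1_def using B by (metis rat_fun.dim_eq_card_independent rat_fun.dim_span)
  finally show ?thesis by (simp add: betti1_def)
qed

section \<open>Cycles as periodic walks\<close>

definition period :: "(nat \<Rightarrow> 'a) \<Rightarrow> nat \<Rightarrow> bool" where
  "period h p \<longleftrightarrow> (\<forall>i. h (i + p) = h i)"

lemma period_mult: "period h p \<Longrightarrow> h (i + p * q) = h i"
proof (induction q)
  case (Suc q)
  have "h (i + p * Suc q) = h (i + p * q + p)" by (simp add: ac_simps)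
  then show ?case using Suc by (simp add: period_def)
qed simp

lemma period_mod: "period h p \<Longrightarrow> h (i mod p) = h i"
  using period_mult[of h p "i mod p" "i div p"] by simp

lemma period_cong: "period h p \<Longrightarrow> i mod p = j mod p \<Longrightarrow> h i = h j"
  by (metis period_mod)

lemma period_dvd: "period h p \<Longrightarrow> p dvd q \<Longrightarrow> period h q"
  unfolding period_def[of h q] by (auto simp: period_mult elim!: dvdE)

lemma period_comp: "period h p \<Longrightarrow> period (f \<circ> h) p"
  by (simp add: period_def)

text \<open>By Bezout, \<open>p * x\<close> exceeds \<open>q * y\<close> by the gcd; shifting
  forward by both multiples compares positions at that distance. The words are infinite, so no
  length condition as in the theorem of Fine and Wilf appears.\<close>

lemma period_gcd:
  assumes "period h p" "period h q" "p \<noteq> 0"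
  shows "period h (gcd p q)"
proof -
  from bezout_nat[OF assms(3), of q] obtain x y where xy: "p * x = q * y + gcd p q" by blast
  have "h (i + gcd p q) = h i" for i
    using period_mult[OF assms(2), of "i + gcd p q" y] period_mult[OF assms(1), of i x] xy
    by (simp add: ac_simps)
  then show ?thesis by (simp add: period_def)
qed

lemma period_add_cong:
  assumes "period h p" "i mod p = j mod p"
  shows "h (i + n) = h (j + n)"
  by (rule period_cong[OF assms(1)]) (metis assms(2) mod_add_left_eq)

text \<open>A closed walk is an infinite periodic sequence of arcs. In this form rotating a cycle is
  shifting its index, and coverings of circles become periods.\<close>

definition closed_walk :: "('v, 'e) pre_digraph \<Rightarrow> nat \<Rightarrow> (nat \<Rightarrow> 'e) \<Rightarrow> bool" where
  "closed_walk G T h \<longleftrightarrow> T \<ge> 1 \<and> period h T \<and>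
     (\<forall>i. h i \<in> arcs G \<and> head G (h i) = tail G (h (Suc i)))"

definition cycle_arcs :: "nat \<Rightarrow> (nat, nat, 'v, 'e) gmap \<Rightarrow> nat \<Rightarrow> 'e" where
  "cycle_arcs k g i = emap g (i mod k)"

definition cycle_map :: "('v, 'e) pre_digraph \<Rightarrow> (nat \<Rightarrow> 'e) \<Rightarrow> (nat, nat, 'v, 'e) gmap" where
  "cycle_map G h = \<lparr>vmap = \<lambda>i. tail G (h i), emap = h\<rparr>"

lemma circle_simps [simp]:
  "verts (circle k) = {..<k}" "arcs (circle k) = {..<k}" "tail (circle k) i = i"
  "head (circle k) i = Suc i mod k"
  by (simp_all add: circle_def)

lemma wf_circle: "wf_digraph (circle k)"
  by unfold_locales auto

text \<open>\<open>(v + k - 1) mod k\<close> is the predecessor of \<open>v\<close>, written so that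
  the subtraction does not truncate at 0.\<close>

lemma in_arcs_circle:
  assumes "v < k" shows "in_arcs (circle k) v = {(v + k - 1) mod k}"
proof -
  have "Suc i mod k = v \<longleftrightarrow> i = (v + k - 1) mod k" if "i < k" for i
    using that assms by (cases "Suc i = k"; cases "v = 0") (auto simp: mod_if)
  then show ?thesis using assms by (auto simp: in_arcs_def)
qed

lemma out_arcs_circle: "v < k \<Longrightarrow> out_arcs (circle k) v = {v}"
  by (auto simp: out_arcs_def)

text \<open>The vertices of a cycle are the tails of its arcs, so a cycle carries the same
  information as its arc sequence.\<close>

lemma is_cycle_iff:
  "is_cycle G k g \<longleftrightarrow> wf_digraph G \<and> closed_walk G k (cycle_arcs k g) \<and>
     (\<forall>i<k. vmap g i = tail G (emap g i))"
proof
  assume c: "is_cycle G k g"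
  then have k: "k \<ge> 1" and gm: "graph_map (circle k) G g" by (auto simp: is_cycle_def)
  have m: "i mod k < k" for i using k by simp
  have "emap g (i mod k) \<in> arcs G \<and> head G (emap g (i mod k)) = tail G (emap g (Suc i mod k))" for i
    using gm m[of i] m[of "Suc i"] by (simp add: graph_map_def mod_Suc_eq)
  then show "wf_digraph G \<and> closed_walk G k (cycle_arcs k g) \<and> (\<forall>i<k. vmap g i = tail G (emap g i))"
    using k gm by (auto simp: closed_walk_def cycle_arcs_def period_def graph_map_def)
next
  assume a: "wf_digraph G \<and> closed_walk G k (cycle_arcs k g) \<and> (\<forall>i<k. vmap g i = tail G (emap g i))"
  then have k: "k \<ge> 1" and wf: "wf_digraph G" by (auto simp: closed_walk_def)
  have e: "emap g i \<in> arcs G \<and> head G (emap g i) = tail G (emap g (Suc i mod k))" if "i < k" for i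
  proof -
    have "cycle_arcs k g i \<in> arcs G \<and> head G (cycle_arcs k g i) = tail G (cycle_arcs k g (Suc i))"
      using a by (auto simp: closed_walk_def)
    then show ?thesis using that by (simp add: cycle_arcs_def)
  qed
  show "is_cycle G k g"
    using a k e wf by (auto simp: is_cycle_def graph_map_def wf_circle wf_digraph.tail_in_verts)
qed

lemma cycle_arcs_cycle_map: "period h k \<Longrightarrow> cycle_arcs k (cycle_map G h) = h"
  by (auto simp: cycle_arcs_def cycle_map_def period_mod)

lemma is_cycle_cycle_map: "wf_digraph G \<Longrightarrow> closed_walk G k h \<Longrightarrow> is_cycle G k (cycle_map G h)"
  unfolding is_cycle_iff closed_walk_def by (simp add: cycle_arcs_cycle_map) (simp add: cycle_map_def)

lemma mod_sum_zero_iff: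
  assumes "(a::nat) < l" "r < l"
  shows "(a + r) mod l = 0 \<longleftrightarrow> r = (l - a) mod l"
proof (cases "a = 0")
  case False
  then have "(l - a) mod l = l - a" using assms by simp
  moreover have "(a + r) mod l = (if a + r < l then a + r else a + r - l)"
    using assms by (simp add: mod_if)
  ultimately show ?thesis using assms False by (simp split: if_splits) arith
qed (use assms in simp)

text \<open>A graph map between circles commutes with the successor, so it is a rotation followed by
  reduction modulo \<open>l\<close>. The fibre over 0 is then a single residue class, which gives
  the degree.\<close>

lemma circle_coveringD:
  assumes "circle_covering k l p d"
  obtains c where "l dvd k" "d = k div l" "\<And>i. i < k \<Longrightarrow> vmap p i = (c + i) mod l"
    "\<And>i. i < k \<Longrightarrow> emap p i = vmap p i"
proof -
  from assms have k: "k \<ge> 1" and l: "l \<ge> 1" and gm: "graph_map (circle k) (circle l) p"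
    and d: "d = card {v \<in> {..<k}. vmap p v = 0}"
    by (auto simp: circle_covering_def covering_def)
  have e: "emap p i = vmap p i" if "i < k" for i using gm that by (simp add: graph_map_def)
  have "\<forall>i\<in>arcs (circle k). head (circle l) (emap p i) = vmap p (head (circle k) i)"
    using gm by (simp add: graph_map_def del: circle_simps)
  then have s: "vmap p (Suc i mod k) = Suc (vmap p i) mod l" if "i < k" for i
    using that e[OF that] by (metis circle_simps(2,4) lessThan_iff)
  have v0: "vmap p 0 < l" using gm k by (auto simp: graph_map_def)
  have v: "vmap p i = (vmap p 0 + i) mod l" if "i < k" for i
    using that
  proof (induction i)
    case 0 then show ?case using v0 by simp
  next
    case (Suc i) then show ?case using s[of i] by (simp add: mod_Suc_eq)
  qed
  \<comment> \<open>The head of the last arc is vertex 0 again; this is what forces \<open>l\<close>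
    to divide \<open>k\<close>.\<close>
  have "vmap p 0 = Suc ((vmap p 0 + (k - 1)) mod l) mod l"
    using s[of "k - 1"] v[of "k - 1"] k by simp
  also have "\<dots> = (vmap p 0 + k) mod l" using k by (simp add: mod_Suc_eq)
  finally have "vmap p 0 = (vmap p 0 + k) mod l" .
  then have "(vmap p 0 + k) mod l = vmap p 0 mod l" using v0 by simp
  then have dvd: "l dvd k"
    by (metis add.right_neutral mod_add_left_eq mod_eq_dvd_iff_nat add_diff_cancel_left' le_add1)
  have "card {v \<in> {..<k}. vmap p v = 0} = k div l"
  proof -
    from dvd obtain q where q: "k = l * q" by (auto elim: dvdE)
    define b where "b = (l - vmap p 0) mod l"
    have bl: "b < l" using l by (simp add: b_def)
    have "(vmap p 0 + i) mod l = 0 \<longleftrightarrow> i mod l = b" for i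
    proof -
      have "(vmap p 0 + i) mod l = 0 \<longleftrightarrow> (vmap p 0 + i mod l) mod l = 0" by (simp add: mod_add_right_eq)
      also have "\<dots> \<longleftrightarrow> i mod l = b"
        unfolding b_def by (rule mod_sum_zero_iff) (use v0 l in auto)
      finally show ?thesis .
    qed
    note zero = this
    have "{v \<in> {..<k}. vmap p v = 0} = (\<lambda>j. b + l * j) ` {..<q}"
    proof (intro set_eqI iffI, goal_cases)
      case (1 x)
      then have "x < k" "x mod l = b" using v[of x] zero[of x] by auto
      then have "x = b + l * (x div l)" "x div l < q"
        using q by (auto simp: less_mult_imp_div_less mult.commute)
      then show ?case by auto
    next
      case (2 x)
      then obtain j where j: "x = b + l * j" "j < q" by auto
      have "x mod l = b" using j bl by simp
      moreover have "x < k"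
      proof -
        have "x < l + l * j" using j bl by simp
        also have "\<dots> = l * Suc j" by simp
        also have "\<dots> \<le> l * q" using j by (intro mult_le_mono2) simp
        finally show ?thesis using q by simp
      qed
      ultimately show ?case using v[of x] zero[of x] by simp
    qed
    moreover have "inj_on (\<lambda>j. b + l * j) {..<q}" using l by (auto simp: inj_on_def)
    ultimately show ?thesis using q l by (simp add: card_image)
  qed
  then show ?thesis using that dvd d v e by blast
qed

lemma circle_coveringI:
  assumes "l \<ge> 1" "l dvd k" "k \<ge> 1"
  shows "circle_covering k l \<lparr>vmap = \<lambda>i. i mod l, emap = \<lambda>i. i mod l\<rparr> (k div l)" (is "circle_covering k l ?p _")
proof -
  have m: "i mod k mod l = i mod l" for i using assms by (simp add: mod_mod_cancel)
  have gm: "graph_map (circle k) (circle l) ?p"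
    using assms m by (auto simp: graph_map_def wf_circle mod_Suc_eq)
  have "covering (circle k) (circle l) ?p"
    unfolding covering_def
  proof (intro conjI gm ballI)
    fix v assume "v \<in> verts (circle k)"
    then have v: "v < k" by simp
    have vl: "v mod l < l" using assms by simp
    show "bij_betw (emap ?p) (out_arcs (circle k) v) (out_arcs (circle l) (vmap ?p v))"
      using v vl by (simp add: out_arcs_circle)
    have "(v + k - 1) mod k mod l = (v mod l + l - 1) mod l"
    proof -
      from assms obtain q where q: "k = l * q" by (auto elim: dvdE)
      then have "q \<ge> 1" using assms by (cases q) auto
      have "(v + k - 1) mod k mod l = (v + k - 1) mod l" by (rule m)
      also have "\<dots> = ((v mod l + l - 1) + l * (v div l + (q - 1))) mod l"
        using \<open>q \<ge> 1\<close> assms q by (cases q) (auto simp: algebra_simps)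
      also have "\<dots> = (v mod l + l - 1) mod l" by (rule mod_mult_self2)
      finally show ?thesis .
    qed
    then show "bij_betw (emap ?p) (in_arcs (circle k) v) (in_arcs (circle l) (vmap ?p v))"
      using v vl by (simp add: in_arcs_circle)
  qed
  moreover have "{v \<in> {..<k}. v mod l = 0} = (\<lambda>j. l * j) ` {..<k div l}"
  proof (intro set_eqI iffI, goal_cases)
    case (1 x)
    then obtain j where "x = l * j" by auto
    then show ?case using 1 assms by (auto elim!: dvdE)
  next
    case (2 x) then show ?case using assms by (auto elim!: dvdE)
  qed
  moreover have "inj_on (\<lambda>j. l * j) {..<k div l}" using assms by (auto simp: inj_on_def)
  ultimately show ?thesis using assms by (auto simp: circle_covering_def card_image)
qed

text \<open>Factoring through a covering onto the circle of length \<open>l\<close> means that the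
  arc sequence repeats after \<open>l\<close> steps; conversely a period \<open>l\<close> that
  divides \<open>k\<close> defines the cycle on the smaller circle.\<close>

lemma cycle_degree_set:
  assumes c: "is_cycle G k f"
  shows "{d. \<exists>l p g. circle_covering k l p d \<and> is_cycle G l g \<and> agree_on (circle k) (g \<circ>\<^sub>g p) f}
    = {k div l | l. l \<ge> 1 \<and> l dvd k \<and> period (cycle_arcs k f) l}" (is "?L = ?R")
proof
  have k: "k \<ge> 1" using c by (simp add: is_cycle_def)
  show "?L \<subseteq> ?R"
  proof clarify
    fix d l p g assume a: "circle_covering k l p d" "is_cycle G l g" "agree_on (circle k) (g \<circ>\<^sub>g p) f"
    from circle_coveringD[OF a(1)] obtain b where p: "l dvd k" "d = k div l"
      "\<And>i. i < k \<Longrightarrow> vmap p i = (b + i) mod l" "\<And>i. i < k \<Longrightarrow> emap p i = vmap p i" by blast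
    have "cycle_arcs k f i = emap g ((b + i) mod l)" for i
    proof -
      have ik: "i mod k < k" using k by simp
      have "cycle_arcs k f i = emap g (emap p (i mod k))"
        using a(3) ik by (simp add: agree_on_def gcomp_def cycle_arcs_def)
      also have "\<dots> = emap g ((b + i mod k) mod l)" using p ik by simp
      also have "(b + i mod k) mod l = (b + i) mod l"
        by (metis p(1) mod_add_right_eq mod_mod_cancel)
      finally show ?thesis .
    qed
    then have "period (cycle_arcs k f) l"
      by (simp add: period_def add.assoc[symmetric])
    moreover have "l \<ge> 1" using a by (simp add: is_cycle_def)
    ultimately show "\<exists>l. d = k div l \<and> 1 \<le> l \<and> l dvd k \<and> period (cycle_arcs k f) l" using p by auto
  qed
  show "?R \<subseteq> ?L"
  proof clarify
    fix l assume l: "1 \<le> l" "l dvd k" "period (cycle_arcs k f) l"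
    let ?h = "cycle_arcs k f"
    have c': "wf_digraph G" "closed_walk G k ?h" "\<And>i. i < k \<Longrightarrow> vmap f i = tail G (emap f i)"
      using c by (auto simp: is_cycle_iff)
    have "closed_walk G l ?h" using c'(2) l by (simp add: closed_walk_def)
    then have "is_cycle G l (cycle_map G ?h)" using c' by (intro is_cycle_cycle_map)
    moreover have "?h (i mod l) = emap f i" if "i < k" for i
      using period_mod[OF l(3), of i] that by (simp add: cycle_arcs_def)
    then have "agree_on (circle k) (cycle_map G ?h \<circ>\<^sub>g \<lparr>vmap = \<lambda>i. i mod l, emap = \<lambda>i. i mod l\<rparr>) f"
      using c'(3) by (auto simp: agree_on_def gcomp_def cycle_map_def)
    ultimately show "\<exists>l' p g. circle_covering k l' p (k div l) \<and> is_cycle G l' g \<and> agree_on (circle k) (g \<circ>\<^sub>g p) f"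
      using circle_coveringI[OF l(1,2) k] by blast
  qed
qed

lemma finite_degrees:
  assumes "(k::nat) \<ge> 1"
  shows "finite {k div l | l. l \<ge> 1 \<and> l dvd k \<and> P l}"
  by (rule finite_subset[of _ "(\<lambda>l. k div l) ` {..k}"]) (use assms in \<open>auto dest: dvd_imp_le\<close>)

text \<open>The degrees form a finite set, nonempty because of the trivial period \<open>k\<close>,
  so the maximum reaches \<open>N\<close> exactly if some member does. The product form replaces the
  division.\<close>

lemma cycle_degree_ge:
  assumes c: "is_cycle G k f"
  shows "N \<le> cycle_degree G k f \<longleftrightarrow> (\<exists>l\<ge>1. l dvd k \<and> period (cycle_arcs k f) l \<and> N * l \<le> k)"
proof -
  have k: "k \<ge> 1" and per: "period (cycle_arcs k f) k"
    using c by (auto simp: is_cycle_iff closed_walk_def)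
  let ?R = "{k div l | l. l \<ge> 1 \<and> l dvd k \<and> period (cycle_arcs k f) l}"
  have "k div k \<in> ?R" by (intro CollectI exI[of _ k]) (use k per in simp)
  then have "?R \<noteq> {}" by blast
  then have "N \<le> cycle_degree G k f \<longleftrightarrow> (\<exists>d\<in>?R. N \<le> d)"
    unfolding cycle_degree_def cycle_degree_set[OF c]
    by (intro Max_ge_iff finite_degrees k)
  also have "\<dots> \<longleftrightarrow> (\<exists>l\<ge>1. l dvd k \<and> period (cycle_arcs k f) l \<and> N \<le> k div l)" by auto
  also have "\<dots> \<longleftrightarrow> (\<exists>l\<ge>1. l dvd k \<and> period (cycle_arcs k f) l \<and> N * l \<le> k)"
    by (simp add: less_eq_div_iff_mult_less_eq cong: conj_cong)
  finally show ?thesis .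
qed

definition primitive_walk :: "nat \<Rightarrow> (nat \<Rightarrow> 'e) \<Rightarrow> bool" where
  "primitive_walk T h \<longleftrightarrow> (\<forall>p\<ge>1. period h p \<longrightarrow> T \<le> p)"

lemma primitive_walk_dvd:
  assumes "primitive_walk T h" "period h T" "period h p" "T \<ge> 1"
  shows "T dvd p"
proof -
  have "period h (gcd T p)" using assms by (intro period_gcd) auto
  moreover have "gcd T p \<ge> 1" using assms(4) by (simp add: Suc_le_eq)
  ultimately have "T \<le> gcd T p" using assms(1) by (simp add: primitive_walk_def)
  then have "gcd T p = T" using assms(4) by (simp add: gcd_le1_nat le_antisym)
  then show ?thesis by (metis gcd_dvd2)
qed

text \<open>Degree one speaks only of periods dividing \<open>k\<close>. A shorter period that does
  not divide \<open>k\<close> can be replaced by its gcd with \<open>k\<close>, which does.\<close>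

lemma primitive_cycle_iff:
  assumes c: "is_cycle G k f"
  shows "primitive_cycle G k f \<longleftrightarrow> primitive_walk k (cycle_arcs k f)"
proof -
  have k: "k \<ge> 1" and per: "period (cycle_arcs k f) k"
    using c by (auto simp: is_cycle_iff closed_walk_def)
  have "1 \<le> cycle_degree G k f" unfolding cycle_degree_ge[OF c] using k per by (intro exI[of _ k]) auto
  then have "primitive_cycle G k f \<longleftrightarrow> \<not> 2 \<le> cycle_degree G k f"
    using c by (auto simp: primitive_cycle_def)
  also have "\<dots> \<longleftrightarrow> primitive_walk k (cycle_arcs k f)"
    unfolding cycle_degree_ge[OF c]
  proof
    assume a: "\<not> (\<exists>l\<ge>1. l dvd k \<and> period (cycle_arcs k f) l \<and> 2 * l \<le> k)"
    show "primitive_walk k (cycle_arcs k f)"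
      unfolding primitive_walk_def
    proof (intro allI impI)
      fix p assume p: "1 \<le> p" "period (cycle_arcs k f) p"
      let ?g = "gcd k p"
      have g: "period (cycle_arcs k f) ?g" "?g \<ge> 1" "?g dvd k"
        using per p k by (auto intro!: period_gcd simp: Suc_le_eq)
      define q where "q = k div ?g"
      have q: "k = ?g * q" by (simp add: q_def)
      have "\<not> 2 * ?g \<le> k" using a g by blast
      then have "q < 2" using q by (metis mult.commute mult_le_mono1 not_less)
      then have "?g = k" using q k by (cases q) (auto simp: less_Suc_eq)
      then show "k \<le> p" using p by (metis One_nat_def dvd_imp_le gcd_dvd2 less_eq_Suc_le)
    qed
  next
    assume a: "primitive_walk k (cycle_arcs k f)"
    show "\<not> (\<exists>l\<ge>1. l dvd k \<and> period (cycle_arcs k f) l \<and> 2 * l \<le> k)"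
      using a by (force simp: primitive_walk_def)
  qed
  finally show ?thesis .
qed

text \<open>A label period \<open>l\<close> dividing \<open>T\<close> stands for a covering of
  degree \<open>T div l\<close> through which the image cycle factors.\<close>

definition long_walk ::
    "('v, 'e) pre_digraph \<Rightarrow> ('e \<Rightarrow> 'f) \<Rightarrow> nat \<Rightarrow> (nat \<Rightarrow> 'e) \<Rightarrow> bool" where
  "long_walk G lab T h \<longleftrightarrow> closed_walk G T h \<and> primitive_walk T h \<and>
     (\<exists>l\<ge>1. l dvd T \<and> period (lab \<circ> h) l \<and> 12 * betti1 G * l \<le> T)"

lemma long_cycle_iff:
  assumes gm: "graph_map G D \<gamma>"
  shows "long_cycle G D \<gamma> k g \<longleftrightarrow> is_cycle G k g \<and> long_walk G (emap \<gamma>) k (cycle_arcs k g)"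
proof (cases "is_cycle G k g")
  case c: True
  then have cw: "closed_walk G k (cycle_arcs k g)" and k: "k \<ge> 1"
    by (auto simp: is_cycle_iff closed_walk_def)
  have ca: "cycle_arcs k (\<gamma> \<circ>\<^sub>g g) = emap \<gamma> \<circ> cycle_arcs k g"
    by (auto simp: cycle_arcs_def gcomp_def)
  have cD: "is_cycle D k (\<gamma> \<circ>\<^sub>g g)"
    unfolding is_cycle_iff ca using c gm cw
    by (auto simp: is_cycle_iff closed_walk_def graph_map_def gcomp_def period_comp cycle_arcs_def)
      (metis mod_less)
  show ?thesis
    unfolding long_cycle_def primitive_cycle_iff[OF c] cycle_degree_ge[OF cD] ca long_walk_def
    using c cw by simp
qed (auto simp: long_cycle_def primitive_cycle_def)

text \<open>An isomorphism of circles is a rotation, so isomorphism over the graph means equal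
  length and equal arc sequences up to a shift.\<close>

lemma iso_over_circles:
  assumes g: "is_cycle G k g" and g': "is_cycle G k' g'"
  shows "iso_over (circle k) g (circle k') g' \<longleftrightarrow>
    k = k' \<and> (\<exists>s. \<forall>i. cycle_arcs k' g' (i + s) = cycle_arcs k g i)"
proof
  assume "iso_over (circle k) g (circle k') g'"
  then obtain \<phi> where iso: "graph_iso (circle k) (circle k') \<phi>"
    and ag: "agree_on (circle k) (g' \<circ>\<^sub>g \<phi>) g" by (auto simp: iso_over_def)
  have k: "k \<ge> 1" using g by (simp add: is_cycle_def)
  have "bij_betw (vmap \<phi>) {..<k} {..<k'}" using iso by (simp add: graph_iso_def)
  then have kk: "k = k'" using bij_betw_same_card by fastforce
  have e: "emap \<phi> i = vmap \<phi> i" if "i < k" for i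
    using iso that kk by (auto simp: graph_iso_def graph_map_def)
  have "\<forall>i\<in>arcs (circle k). head (circle k') (emap \<phi> i) = vmap \<phi> (head (circle k) i)"
    using iso by (simp add: graph_iso_def graph_map_def del: circle_simps)
  then have s: "vmap \<phi> (Suc i mod k) = Suc (vmap \<phi> i) mod k" if "i < k" for i
    using that e[OF that] kk by (metis circle_simps(2,4) lessThan_iff)
  have v0: "vmap \<phi> 0 < k" using iso k kk by (auto simp: graph_iso_def graph_map_def)
  have v: "vmap \<phi> i = (vmap \<phi> 0 + i) mod k" if "i < k" for i
    using that
  proof (induction i)
    case 0 then show ?case using v0 by simp
  next
    case (Suc i) then show ?case using s[of i] by (simp add: mod_Suc_eq)
  qed
  have "cycle_arcs k' g' (i + vmap \<phi> 0) = cycle_arcs k g i" for i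
  proof -
    have ik: "i mod k < k" using k by simp
    have "cycle_arcs k g i = emap g' (emap \<phi> (i mod k))"
      using ag ik by (simp add: agree_on_def gcomp_def cycle_arcs_def)
    also have "emap \<phi> (i mod k) = (i + vmap \<phi> 0) mod k"
      using e[OF ik] v[OF ik] by (simp add: add.commute mod_add_right_eq)
    finally show ?thesis by (simp add: cycle_arcs_def kk)
  qed
  then show "k = k' \<and> (\<exists>s. \<forall>i. cycle_arcs k' g' (i + s) = cycle_arcs k g i)" using kk by blast
next
  assume "k = k' \<and> (\<exists>s. \<forall>i. cycle_arcs k' g' (i + s) = cycle_arcs k g i)"
  then obtain s where kk: "k' = k" and s: "\<And>i. cycle_arcs k g' (i + s) = cycle_arcs k g i" by auto
  have k: "k \<ge> 1" using g by (simp add: is_cycle_def)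
  let ?\<phi> = "\<lparr>vmap = \<lambda>i. (i + s) mod k, emap = \<lambda>i. (i + s) mod k\<rparr>"
  have inj: "inj_on (\<lambda>i. (i + s) mod k) {..<k}"
  proof (rule inj_onI)
    fix x y assume "x \<in> {..<k}" "y \<in> {..<k}" "(x + s) mod k = (y + s) mod k"
    then obtain q1 q2 where "x + s + k * q1 = y + s + k * q2" by (auto simp: nat_mod_eq_iff)
    then have "x mod k = y mod k" unfolding nat_mod_eq_iff by (intro exI[of _ q1] exI[of _ q2]) simp
    then show "x = y" using \<open>x \<in> {..<k}\<close> \<open>y \<in> {..<k}\<close> by simp
  qed
  moreover have "(\<lambda>i. (i + s) mod k) ` {..<k} = {..<k}"
    by (rule endo_inj_surj[OF _ _ inj]) (use k in auto)
  ultimately have "bij_betw (\<lambda>i. (i + s) mod k) {..<k} {..<k}" by (simp add: bij_betw_def)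
  moreover have "(Suc i mod k + s) mod k = Suc ((i + s) mod k) mod k" for i
    by (metis add_Suc mod_Suc_eq mod_add_left_eq)
  ultimately have "graph_iso (circle k) (circle k) ?\<phi>"
    using k by (auto simp: graph_iso_def graph_map_def wf_circle)
  moreover have e: "emap g' ((i + s) mod k) = emap g i" if "i < k" for i
    using s[of i] that by (simp add: cycle_arcs_def)
  then have "vmap g' ((i + s) mod k) = vmap g i" if "i < k" for i
  proof -
    have "(i + s) mod k < k" using k by simp
    then have "vmap g' ((i + s) mod k) = tail G (emap g' ((i + s) mod k))"
      using g' kk by (simp add: is_cycle_iff)
    then show ?thesis using g that e[OF that] by (simp add: is_cycle_iff)
  qed
  then have "agree_on (circle k) (g' \<circ>\<^sub>g ?\<phi>) g"
    using e by (auto simp: agree_on_def gcomp_def)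
  ultimately show "iso_over (circle k) g (circle k') g'" unfolding iso_over_def kk by blast
qed

section \<open>Consecutive numbering of the disjoint union of cycles\<close>

definition block_start :: "'a list list \<Rightarrow> nat \<Rightarrow> nat" where
  "block_start L j = sum_list (map length (take j L))"

lemma block_start_Suc: "j < length L \<Longrightarrow> block_start L (Suc j) = block_start L j + length (L ! j)"
  by (simp add: block_start_def take_Suc_conv_app_nth)

lemma block_start_mono: "i \<le> j \<Longrightarrow> block_start L i \<le> block_start L j"
proof -
  assume "i \<le> j"
  then have "take j L = take i L @ take (j - i) (drop i L)" by (metis le_add_diff_inverse take_add)
  then show ?thesis by (simp add: block_start_def)
qed

lemma block_exists:
  "n < block_start L k \<Longrightarrow> k \<le> length L \<Longrightarrow> \<exists>j<k. \<exists>i<length (L ! j). n = block_start L j + i"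
proof (induction k)
  case 0 then show ?case by (simp add: block_start_def)
next
  case (Suc k)
  show ?case
  proof (cases "n < block_start L k")
    case True then show ?thesis using Suc by (metis Suc_leD less_Suc_eq)
  next
    case False
    then have "n = block_start L k + (n - block_start L k)" "n - block_start L k < length (L ! k)"
      using Suc.prems block_start_Suc[of k L] by auto
    then show ?thesis by blast
  qed
qed

lemma block_less:
  assumes "j < length L" "i < length (L ! j)"
  shows "block_start L j + i < block_start L (length L)"
  using assms block_start_Suc[of j L] block_start_mono[of "Suc j" "length L" L] by simp

lemma block_unique:
  assumes "j < length L" "i < length (L ! j)" "j' < length L" "i' < length (L ! j')"
    "block_start L j + i = block_start L j' + i'"
  shows "j = j' \<and> i = i'"
proof -
  have *: False if "a < b" "b < length L" "x < length (L ! a)"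
    "block_start L a + x = block_start L b + y" for a b x y
    using that block_start_Suc[of a L] block_start_mono[of "Suc a" b L] by simp
  show ?thesis using assms *[of j j' i i'] *[of j' j i' i] by (cases j j' rule: linorder_cases) auto
qed

text \<open>This is the whole obligation of the program: a list of arc words that are long cycles,
  of which no two are rotations of each other, in which every long cycle occurs up to rotation, and
  which are stored as consecutive blocks.\<close>

lemma long_cycles_mapI:
  assumes gm: "graph_map G D \<gamma>"
    and long: "\<And>us. us \<in> set L \<Longrightarrow> us \<noteq> [] \<and> long_walk G (emap \<gamma>) (length us) (\<lambda>i. us ! (i mod length us))"
    and distinct: "\<And>a b s. a < b \<Longrightarrow> b < length L \<Longrightarrow> length (L ! a) = length (L ! b) \<Longrightarrow>
      \<exists>i. L ! a ! ((i + s) mod length (L ! a)) \<noteq> L ! b ! (i mod length (L ! b))"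
    and complete: "\<And>T h. long_walk G (emap \<gamma>) T h \<Longrightarrow>
      \<exists>us\<in>set L. length us = T \<and> (\<exists>s. \<forall>i. us ! ((i + s) mod T) = h i)"
    and S: "verts S = {..<block_start L (length L)}" "arcs S = {..<block_start L (length L)}"
    and St: "\<And>j i. j < length L \<Longrightarrow> i < length (L ! j) \<Longrightarrow>
       tail S (block_start L j + i) = block_start L j + i \<and>
       head S (block_start L j + i) = block_start L j + Suc i mod length (L ! j) \<and>
       vmap s (block_start L j + i) = tail G (L ! j ! i) \<and> emap s (block_start L j + i) = L ! j ! i"
  shows "long_cycles_map G D \<gamma> S s"
proof -
  define cyc where "cyc us = (length us, \<lparr>vmap = \<lambda>i. tail G (us ! i), emap = \<lambda>i. us ! i\<rparr>)"
    for us :: "'b list"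
  define R where "R = cyc ` set L"
  have wf: "wf_digraph G" using gm by (simp add: graph_map_def)
  have ca: "cycle_arcs (fst (cyc us)) (snd (cyc us)) = (\<lambda>i. us ! (i mod length us))" for us
    by (auto simp: cycle_arcs_def cyc_def)
  have cyc: "is_cycle G (fst (cyc us)) (snd (cyc us))" if "us \<in> set L" for us
    using long[OF that] wf ca[of us] by (auto simp: is_cycle_iff long_walk_def) (simp_all add: cyc_def)
  have lc: "long_cycle G D \<gamma> (fst (cyc us)) (snd (cyc us))" if "us \<in> set L" for us
    unfolding long_cycle_iff[OF gm] ca using cyc[OF that] long[OF that] by (simp add: cyc_def)
  have iso: "iso_over (circle (fst (cyc us))) (snd (cyc us)) (circle (fst (cyc vs))) (snd (cyc vs)) \<longleftrightarrow>
     length us = length vs \<and> (\<exists>s. \<forall>i. vs ! ((i + s) mod length vs) = us ! (i mod length us))"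
    if "us \<in> set L" "vs \<in> set L" for us vs
    unfolding iso_over_circles[OF cyc[OF that(1)] cyc[OF that(2)]] ca by (simp add: cyc_def)
  have rot: "a = b" if ab: "a < length L" "b < length L" "length (L ! a) = length (L ! b)"
    and r: "\<And>i. L ! b ! ((i + s) mod length (L ! b)) = L ! a ! (i mod length (L ! a))" for a b s
  proof (rule ccontr)
    assume "a \<noteq> b"
    then consider "b < a" | "a < b" by linarith
    then show False
    proof cases
      case 1 then show False using distinct[of b a s] ab r by auto
    next
      case 2
      let ?n = "length (L ! a)"
      have "L ! a \<noteq> []" using long[of "L ! a"] ab(1) by simp
      then have n: "?n \<ge> 1" by (simp add: Suc_le_eq)
      \<comment> \<open>This is the inverse of the rotation by \<open>s\<close>: the two add up to a
        multiple of the length. It turns a rotation of the later word into one of the earlier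
        word.\<close>
      let ?t = "s * (?n - 1)"
      obtain i where i: "L ! a ! ((i + ?t) mod ?n) \<noteq> L ! b ! (i mod ?n)"
        using distinct[of a b ?t] 2 ab by auto
      have "(i + ?t + s) = i + s * ?n" using n by (cases ?n) (auto simp: algebra_simps)
      then have "(i + ?t + s) mod ?n = i mod ?n" by (simp only: mod_mult_self1)
      then show False using r[of "i + ?t"] i ab(3) by simp
    qed
  qed
  have cyc_inj: "a = b" if "a < length L" "b < length L" "cyc (L ! a) = cyc (L ! b)" for a b
  proof -
    have "length (L ! a) = length (L ! b)" "(\<lambda>i. L ! a ! i) = (\<lambda>i. L ! b ! i)"
      using that(3) by (auto simp: cyc_def)
    then show ?thesis using rot[of a b 0] that by (simp add: fun_eq_iff)
  qed
  have reps: "long_cycle_representatives G D \<gamma> R"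
    unfolding long_cycle_representatives_def
  proof (intro conjI allI impI)
    show "\<forall>c\<in>R. long_cycle G D \<gamma> (fst c) (snd c)" using lc by (auto simp: R_def)
    fix k g assume "long_cycle G D \<gamma> k g"
    then have g: "is_cycle G k g" "long_walk G (emap \<gamma>) k (cycle_arcs k g)"
      using long_cycle_iff[OF gm] by auto
    obtain us s where us: "us \<in> set L" "length us = k"
      "\<And>i. us ! ((i + s) mod k) = cycle_arcs k g i" using complete[OF g(2)] by blast
    have iso': "iso_over (circle k) g (circle (fst (cyc vs))) (snd (cyc vs)) \<longleftrightarrow>
       k = length vs \<and> (\<exists>s. \<forall>i. vs ! ((i + s) mod length vs) = cycle_arcs k g i)" if "vs \<in> set L" for vs
      unfolding iso_over_circles[OF g(1) cyc[OF that]] ca by (simp add: cyc_def)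
    show "\<exists>!c. c \<in> R \<and> iso_over (circle k) g (circle (fst c)) (snd c)"
    proof (rule ex1I[of _ "cyc us"])
      show "cyc us \<in> R \<and> iso_over (circle k) g (circle (fst (cyc us))) (snd (cyc us))"
        using us iso'[OF us(1)] by (auto simp: R_def)
      fix c assume "c \<in> R \<and> iso_over (circle k) g (circle (fst c)) (snd c)"
      then obtain vs where vs: "vs \<in> set L" "c = cyc vs"
        "iso_over (circle k) g (circle (fst (cyc vs))) (snd (cyc vs))" by (auto simp: R_def)
      then obtain s' where s': "k = length vs" "\<And>i. vs ! ((i + s') mod length vs) = cycle_arcs k g i"
        using iso' by auto
      obtain a b where a: "a < length L" "us = L ! a" and b: "b < length L" "vs = L ! b"
        using us(1) vs(1) by (auto simp: in_set_conv_nth)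
      have k: "k \<ge> 1" using g(1) by (simp add: is_cycle_def)
      \<comment> \<open>Undoes the rotation \<open>s\<close> that produced the given cycle from
        \<open>us\<close>, then applies the one that produces it from \<open>vs\<close>.\<close>
      let ?t = "s * (k - 1) + s'"
      have per: "period (\<lambda>i. us ! (i mod k)) k" by (simp add: period_def)
      have "vs ! ((i + ?t) mod k) = us ! (i mod k)" for i
      proof -
        have "vs ! ((i + ?t) mod k) = cycle_arcs k g (i + s * (k - 1))"
          using s'(2)[of "i + s * (k - 1)"] s'(1) by (simp add: add.assoc)
        also have "\<dots> = us ! ((i + s * (k - 1) + s) mod k)" using us(3) by simp
        also have "i + s * (k - 1) + s = i + s * k" using k by (cases k) (auto simp: algebra_simps)
        finally show ?thesis by (simp only: mod_mult_self1)
      qed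
      then have "a = b" using rot[of a b ?t] a b us(2) s'(1) by simp
      then show "c = cyc us" using a b vs by simp
    qed
  qed
  \<comment> \<open>Inverse of the flat numbering; \<open>block_unique\<close> makes the choice
    unambiguous.\<close>
  define \<psi> where "\<psi> n = (SOME ji. fst ji < length L \<and> snd ji < length (L ! fst ji) \<and>
     n = block_start L (fst ji) + snd ji)" for n
  have psi: "\<psi> (block_start L j + i) = (j, i)" if "j < length L" "i < length (L ! j)" for j i
    unfolding \<psi>_def
  proof (rule some_equality)
    fix ji assume "fst ji < length L \<and> snd ji < length (L ! fst ji) \<and>
      block_start L j + i = block_start L (fst ji) + snd ji"
    then show "ji = (j, i)" using block_unique[OF that, of "fst ji" "snd ji"] by (simp add: prod_eq_iff)
  qed (use that in simp)
  define f where "f n = (cyc (L ! fst (\<psi> n)), snd (\<psi> n))" for n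
  have f: "f (block_start L j + i) = (cyc (L ! j), i)" if "j < length L" "i < length (L ! j)" for j i
    using psi[OF that] by (simp add: f_def)
  let ?N = "block_start L (length L)"
  have bij: "bij_betw f {..<?N} (SIGMA c:R. {..<fst c})"
    unfolding bij_betw_def
  proof
    show "inj_on f {..<?N}"
    proof (rule inj_onI)
      fix x y assume "x \<in> {..<?N}" "y \<in> {..<?N}" and eq: "f x = f y"
      then obtain j i j' i' where x: "j < length L" "i < length (L ! j)" "x = block_start L j + i"
        and y: "j' < length L" "i' < length (L ! j')" "y = block_start L j' + i'"
        using block_exists[of x L "length L"] block_exists[of y L "length L"] by auto
      then have "cyc (L ! j) = cyc (L ! j')" "i = i'" using eq f by auto
      then show "x = y" using cyc_inj x y by blast
    qed
    show "f ` {..<?N} = (SIGMA c:R. {..<fst c})"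
    proof
      show "f ` {..<?N} \<subseteq> (SIGMA c:R. {..<fst c})"
      proof
        fix z assume "z \<in> f ` {..<?N}"
        then obtain n where "n < ?N" "z = f n" by auto
        then obtain j i where "j < length L" "i < length (L ! j)" "z = f (block_start L j + i)"
          using block_exists[of n L "length L"] by auto
        then show "z \<in> (SIGMA c:R. {..<fst c})" using f by (auto simp: R_def cyc_def)
      qed
      show "(SIGMA c:R. {..<fst c}) \<subseteq> f ` {..<?N}"
      proof
        fix z assume "z \<in> (SIGMA c:R. {..<fst c})"
        then obtain j i where ji: "j < length L" "i < length (L ! j)" "z = (cyc (L ! j), i)"
          by (auto simp: R_def cyc_def in_set_conv_nth)
        then have "z = f (block_start L j + i)" using f by simp
        then show "z \<in> f ` {..<?N}" using block_less[OF ji(1,2)] by auto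
      qed
    qed
  qed
  have tl: "Suc i mod length (L ! j) < length (L ! j)" if "j < length L" for i j
    using long[of "L ! j"] that by simp
  have wfS: "wf_digraph S"
  proof
    fix e assume "e \<in> arcs S"
    then obtain j i where ji: "j < length L" "i < length (L ! j)" "e = block_start L j + i"
      using S block_exists[of e L "length L"] by auto
    then show "tail S e \<in> verts S" "head S e \<in> verts S"
      using St[of j i] S block_less[of j L] tl[of j i] by auto
  qed
  have wfU: "wf_digraph (cycles_union R)"
    by unfold_locales (auto simp: cycles_union_def)
  have "graph_iso S (cycles_union R) \<lparr>vmap = f, emap = f\<rparr>"
    unfolding graph_iso_def graph_map_def
  proof (intro conjI ballI wfS wfU)
    show "bij_betw (vmap \<lparr>vmap = f, emap = f\<rparr>) (verts S) (verts (cycles_union R))"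
      "bij_betw (emap \<lparr>vmap = f, emap = f\<rparr>) (arcs S) (arcs (cycles_union R))"
      using bij S by (simp_all add: cycles_union_def)
    show "vmap \<lparr>vmap = f, emap = f\<rparr> v \<in> verts (cycles_union R)" if "v \<in> verts S" for v
      using bij S that by (auto simp: cycles_union_def bij_betw_def)
    fix e assume e: "e \<in> arcs S"
    show "emap \<lparr>vmap = f, emap = f\<rparr> e \<in> arcs (cycles_union R)"
      using bij S e by (auto simp: cycles_union_def bij_betw_def)
    obtain j i where ji: "j < length L" "i < length (L ! j)" "e = block_start L j + i"
      using S e block_exists[of e L "length L"] by auto
    show "tail (cycles_union R) (emap \<lparr>vmap = f, emap = f\<rparr> e) = vmap \<lparr>vmap = f, emap = f\<rparr> (tail S e)"
      "head (cycles_union R) (emap \<lparr>vmap = f, emap = f\<rparr> e) = vmap \<lparr>vmap = f, emap = f\<rparr> (head S e)"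
      using ji St[of j i] f[of j i] f[of j "Suc i mod length (L ! j)"] tl[of j i]
      by (auto simp: cycles_union_def cyc_def)
  qed
  moreover have "agree_on S (cycles_union_map \<circ>\<^sub>g \<lparr>vmap = f, emap = f\<rparr>) s"
    unfolding agree_on_def S
  proof (intro conjI ballI)
    fix n assume "n \<in> {..<?N}"
    then obtain j i where ji: "j < length L" "i < length (L ! j)" "n = block_start L j + i"
      using block_exists[of n L "length L"] by auto
    then show "vmap (cycles_union_map \<circ>\<^sub>g \<lparr>vmap = f, emap = f\<rparr>) n = vmap s n"
      "emap (cycles_union_map \<circ>\<^sub>g \<lparr>vmap = f, emap = f\<rparr>) n = emap s n"
      using St[of j i] f[of j i] by (auto simp: cycles_union_map_def gcomp_def cyc_def)
  qed
  ultimately show ?thesis unfolding long_cycles_map_def iso_over_def using reps by blast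
qed

text \<open>The equality is known only from position \<open>i\<close> on. Adding
  \<open>T * i\<close>, a multiple of the period and at least \<open>i\<close>, carries any position
  into that range.\<close>

lemma shift_period:
  assumes per: "period h T" and T: "T \<ge> 1" and eq: "\<And>n. h (i + n) = h (j + n)" and le: "i \<le> j"
  shows "period h (j - i)"
  unfolding period_def
proof
  fix m
  have T0: "T * i = i + (T - 1) * i" using T by (cases T) auto
  have "h (m + (j - i)) = h (m + (j - i) + T * i)" using period_mult[OF per] by simp
  also have "m + (j - i) + T * i = j + (m + (T - 1) * i)" using T0 le by simp
  also have "h \<dots> = h (i + (m + (T - 1) * i))" using eq by simp
  also have "i + (m + (T - 1) * i) = m + T * i" using T0 by simp
  also have "h (m + T * i) = h m" by (rule period_mult[OF per])
  finally show "h (m + (j - i)) = h m" .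
qed

text \<open>The distance between two positions with the same future is a period, hence a multiple of
  the least one.\<close>

lemma shift_eq_mod:
  assumes "period h T" "T \<ge> 1" "primitive_walk T h" "\<And>n. h (i + n) = h (j + n)"
  shows "i mod T = j mod T"
proof -
  have *: "a mod T = b mod T" if "a \<le> b" "\<And>n. h (a + n) = h (b + n)" for a b
  proof -
    have "T dvd b - a"
      by (rule primitive_walk_dvd[OF assms(3,1) _ assms(2)]) (rule shift_period[OF assms(1,2) that(2,1)])
    then show ?thesis using that(1) by (metis mod_eq_dvd_iff_nat)
  qed
  show ?thesis
  proof (cases "i \<le> j")
    case True
    then show ?thesis using assms(4) by (rule *)
  next
    case False
    then have "j \<le> i" by simp
    then show ?thesis using assms(4)[symmetric] by (rule *[symmetric])
  qed
qed

section \<open>Long cycles\<close>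

text \<open>Reading the \<open>l\<close> letters from position \<open>i\<close> on as digits orders the rotations of a
  periodic word; prepending a letter is then compatible with the order.\<close>

lemma rotation_order:
  fixes a :: "nat \<Rightarrow> nat"
  assumes per: "period a l" and l: "l \<ge> 1"
  obtains \<rho> :: "nat \<Rightarrow> nat" where "period \<rho> l"
    "\<And>i j n. \<rho> i = \<rho> j \<Longrightarrow> a (i + n) = a (j + n)"
    "\<And>i j. a i = a j \<Longrightarrow> \<rho> (Suc i) \<le> \<rho> (Suc j) \<longleftrightarrow> \<rho> i \<le> \<rho> j"
proof -
  \<comment> \<open>Digits stay at most \<open>B - 2\<close>. With a digit \<open>B - 1\<close> a
    constant word could have the value \<open>M\<close> itself, whereas the decoding below needs
    values smaller than \<open>M\<close>.\<close>
  define B where "B = Max (a ` {..<l}) + 2"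
  have aB: "a i + 2 \<le> B" for i
  proof -
    have "a i = a (i mod l)" using period_mod[OF per] by simp
    also have "\<dots> \<le> Max (a ` {..<l})" using l by (intro Max_ge) auto
    finally show ?thesis by (simp add: B_def)
  qed
  define \<rho> where "\<rho> i = (\<Sum>j<l. a (i + j) * B ^ (l - 1 - j))" for i
  define M where "M = B ^ l - 1"
  have Bl: "B ^ l = M + 1" using aB[of 0] by (simp add: M_def)
  \<comment> \<open>Multiplying by the base moves the leading digit \<open>a i\<close> to weight
    \<open>B ^ l\<close>; in the next rotation it has weight 1 instead. The difference is
    \<open>a i * (B ^ l - 1)\<close>.\<close>
  have rec: "\<rho> (Suc i) + a i * M = B * \<rho> i" for i
  proof -
    let ?S = "\<Sum>j<Suc l. a (i + j) * B ^ (l - j)"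
    have "(\<Sum>j<l. a (i + j) * B ^ (l - j)) = B * \<rho> i"
      unfolding \<rho>_def sum_distrib_left
    proof (rule sum.cong[OF refl])
      fix j assume "j \<in> {..<l}"
      then have "l - j = Suc (l - 1 - j)" by auto
      then show "a (i + j) * B ^ (l - j) = B * (a (i + j) * B ^ (l - 1 - j))" by simp
    qed
    then have "?S = B * \<rho> i + a (i + l)" by simp
    moreover have "(\<Sum>j<l. a (i + Suc j) * B ^ (l - Suc j)) = \<rho> (Suc i)"
      unfolding \<rho>_def by (rule sum.cong) auto
    then have "?S = a i * B ^ l + \<rho> (Suc i)" by (subst sum.lessThan_Suc_shift) simp
    moreover have "a (i + l) = a i" using per by (simp add: period_def)
    ultimately show ?thesis using Bl by (simp add: algebra_simps)
  qed
  have geo: "(B - 1) * (\<Sum>j<n. B ^ (n - 1 - j)) + 1 = B ^ n" for n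
  proof (induction n)
    case (Suc n)
    have "(\<Sum>j<Suc n. B ^ (Suc n - 1 - j)) = B ^ n + (\<Sum>j<n. B ^ (n - 1 - j))"
      by (subst sum.lessThan_Suc_shift) simp
    then have "(B - 1) * (\<Sum>j<Suc n. B ^ (Suc n - 1 - j)) + 1 = (B - 1) * B ^ n + B ^ n"
      using Suc by (simp add: distrib_left)
    also have "\<dots> = B ^ Suc n" using aB[of 0] by (cases B) auto
    finally show ?case .
  qed simp
  have lt: "\<rho> i < M" for i
  proof -
    let ?g = "\<Sum>j<l. B ^ (l - 1 - j)"
    have "\<rho> i \<le> (\<Sum>j<l. (B - 2) * B ^ (l - 1 - j))"
      unfolding \<rho>_def
    proof (rule sum_mono)
      fix j show "a (i + j) * B ^ (l - 1 - j) \<le> (B - 2) * B ^ (l - 1 - j)"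
        using aB[of "i + j"] by (intro mult_right_mono) auto
    qed
    then have "\<rho> i \<le> (B - 2) * ?g" by (simp add: sum_distrib_left)
    moreover have "(B - 1) * ?g = M" using geo[of l] Bl by simp
    moreover have "(B - 2) * ?g + ?g = (B - 1) * ?g" using aB[of 0] by (cases B) (auto simp: Suc_diff_Suc algebra_simps)
    moreover have "?g \<ge> 1"
    proof -
      have "B ^ (l - 1 - 0) \<le> ?g" by (rule member_le_sum) (use l in auto)
      moreover have "B ^ (l - 1 - 0) \<ge> 1" using aB[of 0] by simp
      ultimately show ?thesis by simp
    qed
    ultimately show ?thesis by simp
  qed
  \<comment> \<open>By the recursion, quotient and remainder modulo \<open>M\<close> recover the
    letter and the rank of the next rotation from the rank of this one.\<close>
  have step: "a i = a j \<and> \<rho> (Suc i) = \<rho> (Suc j)" if "\<rho> i = \<rho> j" for i j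
  proof -
    have e: "\<rho> (Suc i) + a i * M = \<rho> (Suc j) + a j * M" using rec that by simp
    have "(\<rho> (Suc i) + a i * M) mod M = \<rho> (Suc i)" "(\<rho> (Suc j) + a j * M) mod M = \<rho> (Suc j)"
      using lt by simp_all
    moreover have "(\<rho> (Suc i) + a i * M) div M = a i" "(\<rho> (Suc j) + a j * M) div M = a j"
      using lt[of "Suc i"] lt[of "Suc j"] by simp_all
    ultimately show ?thesis using e by metis
  qed
  show ?thesis
  proof (rule that)
    show "period \<rho> l"
      unfolding period_def
    proof
      fix i
      have "a (i + l + j) = a (i + j)" for j
        using per[unfolded period_def, rule_format, of "i + j"] by (simp add: ac_simps)
      then show "\<rho> (i + l) = \<rho> i" by (simp add: \<rho>_def)
    qed
    show "a (i + n) = a (j + n)" if "\<rho> i = \<rho> j" for i j n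
      using that
    proof (induction n arbitrary: i j)
      case 0
      then show ?case using step[of i j] by simp
    next
      case (Suc n)
      from step[OF Suc.prems] have "a (Suc i + n) = a (Suc j + n)" by (intro Suc.IH) simp
      then show ?case by simp
    qed
    show "\<rho> (Suc i) \<le> \<rho> (Suc j) \<longleftrightarrow> \<rho> i \<le> \<rho> j" if "a i = a j" for i j
    proof -
      have "\<rho> (Suc i) \<le> \<rho> (Suc j) \<longleftrightarrow> \<rho> (Suc i) + a i * M \<le> \<rho> (Suc j) + a j * M"
        using that by simp
      also have "\<dots> \<longleftrightarrow> B * \<rho> i \<le> B * \<rho> j" by (simp only: rec)
      finally have "\<rho> (Suc i) \<le> \<rho> (Suc j) \<longleftrightarrow> B * \<rho> i \<le> B * \<rho> j" .
      then show ?thesis using aB[of 0] by simp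
    qed
  qed
qed

lemma long_walk_label_period:
  assumes "long_walk G lab T h"
  obtains l where "l \<ge> 1" "l dvd T" "period (lab \<circ> h) l" "primitive_walk l (lab \<circ> h)" "12 * betti1 G * l \<le> T"
proof -
  from assms obtain l0 where l0: "l0 \<ge> 1" "l0 dvd T" "period (lab \<circ> h) l0" "12 * betti1 G * l0 \<le> T"
    by (auto simp: long_walk_def)
  define l where "l = (LEAST p. p \<ge> 1 \<and> period (lab \<circ> h) p)"
  have l: "l \<ge> 1 \<and> period (lab \<circ> h) l" unfolding l_def by (rule LeastI[of _ l0]) (use l0 in simp)
  have p: "primitive_walk l (lab \<circ> h)" unfolding primitive_walk_def l_def by (auto intro: Least_le)
  then have "l \<le> l0" using l0 by (simp add: primitive_walk_def)
  then have "12 * betti1 G * l \<le> T" using l0(4) by (meson le_trans mult_le_mono2)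
  moreover have "l dvd T"
    using primitive_walk_dvd[OF p] l assms by (auto simp: long_walk_def closed_walk_def period_comp)
  ultimately show ?thesis using that l p by blast
qed

lemma card_shift_periodic:
  assumes "P (T::nat) \<longleftrightarrow> P 0"
  shows "card {i\<in>{..<T}. P (Suc i)} = card {i\<in>{..<T}. P i}"
proof -
  have c: "card {i\<in>{..<T}. R i} = (\<Sum>i<T. of_bool (R i))" for R
    by (simp add: of_bool_def sum.If_cases Int_def)
  have "(\<Sum>i<Suc T. of_bool (P i)) = of_bool (P 0) + (\<Sum>i<T. of_bool (P (Suc i)) :: nat)"
    by (rule sum.lessThan_Suc_shift)
  then show ?thesis unfolding c using assms by simp
qed

section \<open>Top positions of a primitive cycle with repetitive labels\<close>

locale repetitive_walk = fin_digraph G for G :: "('v, 'e) pre_digraph" +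
  fixes lab :: "'e \<Rightarrow> nat" and T l :: nat and h :: "nat \<Rightarrow> 'e"
  assumes lab_inj: "\<And>v. v \<in> verts G \<Longrightarrow> inj_on lab (out_arcs G v)"
    and cw: "closed_walk G T h" and prim: "primitive_walk T h"
    and l1: "l \<ge> 1" and ldvd: "l dvd T" and lper: "period (lab \<circ> h) l"
    and lprim: "primitive_walk l (lab \<circ> h)" and deg: "12 * betti1 G * l \<le> T"
begin

definition pos :: "nat \<Rightarrow> 'v" where "pos i = tail G (h i)"

lemma T1: "T \<ge> 1" and hper: "period h T" and harc: "h i \<in> arcs G"
  and hstep: "head G (h i) = pos (Suc i)"
  using cw by (auto simp: closed_walk_def pos_def)

lemma pos_per: "period pos T"
  using hper by (simp add: period_def pos_def)

text \<open>The phase fixes the next label, and arcs with a common tail have different labels, so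
  vertex and phase fix the next arc and then, by induction, all later ones.\<close>

lemma same_future:
  assumes "pos i = pos j" "i mod l = j mod l"
  shows "h (i + n) = h (j + n)"
proof -
  have "pos (i + n) = pos (j + n) \<and> h (i + n) = h (j + n)" for n
  proof (induction n)
    case 0
    have "lab (h i) = lab (h j)" using period_cong[OF lper assms(2)] by simp
    moreover have "h i \<in> out_arcs G (pos i)" "h j \<in> out_arcs G (pos i)"
      using harc assms(1) by (auto simp: out_arcs_def pos_def)
    ultimately show ?case using lab_inj[of "pos i"] assms(1) harc[of i]
      by (auto simp: pos_def dest: inj_onD)
  next
    case (Suc n)
    then have p: "pos (i + Suc n) = pos (j + Suc n)" using hstep[of "i + n"] hstep[of "j + n"] by simp
    have "lab (h (i + Suc n)) = lab (h (j + Suc n))"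
      using period_add_cong[OF lper assms(2), of "Suc n"] by simp
    moreover have "h (i + Suc n) \<in> out_arcs G (pos (i + Suc n))" "h (j + Suc n) \<in> out_arcs G (pos (i + Suc n))"
      using harc p by (auto simp: out_arcs_def pos_def)
    ultimately show ?case using lab_inj[of "pos (i + Suc n)"] p harc[of "i + Suc n"]
      by (auto simp: pos_def dest: inj_onD)
  qed
  then show ?thesis by blast
qed

text \<open>Positions with the same vertex and phase have the same future, and primitivity turns
  this into congruence modulo \<open>T\<close>: a vertex is met at most once per turn in each
  phase.\<close>

lemma same_pos: "pos i = pos j \<Longrightarrow> i mod l = j mod l \<Longrightarrow> i mod T = j mod T"
  by (rule shift_eq_mod[OF hper T1 prim]) (rule same_future)

definition rho :: "nat \<Rightarrow> nat" where
  "rho = (SOME \<rho>. period \<rho> l \<and> (\<forall>i j. \<rho> i = \<rho> j \<longrightarrow> i mod l = j mod l) \<and>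
     (\<forall>i j. lab (h i) = lab (h j) \<longrightarrow> (\<rho> (Suc i) \<le> \<rho> (Suc j) \<longleftrightarrow> \<rho> i \<le> \<rho> j)))"

text \<open>Equal ranks mean equal label futures; since \<open>l\<close> is the least label period,
  the phases then agree.\<close>

lemma rho_ex: "\<exists>\<rho> :: nat \<Rightarrow> nat. period \<rho> l \<and> (\<forall>i j. \<rho> i = \<rho> j \<longrightarrow> i mod l = j mod l) \<and>
     (\<forall>i j. lab (h i) = lab (h j) \<longrightarrow> (\<rho> (Suc i) \<le> \<rho> (Suc j) \<longleftrightarrow> \<rho> i \<le> \<rho> j))"
proof -
  obtain \<rho> :: "nat \<Rightarrow> nat" where r: "period \<rho> l"
    "\<And>i j n. \<rho> i = \<rho> j \<Longrightarrow> (lab \<circ> h) (i + n) = (lab \<circ> h) (j + n)"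
    "\<And>i j. (lab \<circ> h) i = (lab \<circ> h) j \<Longrightarrow> \<rho> (Suc i) \<le> \<rho> (Suc j) \<longleftrightarrow> \<rho> i \<le> \<rho> j"
    using rotation_order[OF lper l1] by blast
  have "i mod l = j mod l" if "\<rho> i = \<rho> j" for i j
    by (rule shift_eq_mod[OF lper l1 lprim]) (rule r(2)[OF that])
  moreover have "\<rho> (Suc i) \<le> \<rho> (Suc j) \<longleftrightarrow> \<rho> i \<le> \<rho> j" if "lab (h i) = lab (h j)" for i j
    by (rule r(3)) (simp add: that)
  ultimately show ?thesis using r(1) by blast
qed

lemma rho_per: "period rho l" and rho_phase: "rho i = rho j \<Longrightarrow> i mod l = j mod l"
  and rho_Suc: "lab (h i) = lab (h j) \<Longrightarrow> rho (Suc i) \<le> rho (Suc j) \<longleftrightarrow> rho i \<le> rho j"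
  using someI_ex[OF rho_ex, folded rho_def] by blast+

lemma rho_perT: "period rho T"
  using rho_per ldvd by (rule period_dvd)

text \<open>The parameter \<open>\<kappa>\<close> is instantiated with \<open>pos\<close> and with
  \<open>h\<close>, so that vertices and arcs of the image can be counted by the same lemma.\<close>

definition top :: "(nat \<Rightarrow> 'x) \<Rightarrow> nat \<Rightarrow> bool" where
  "top \<kappa> i \<longleftrightarrow> (\<forall>j. \<kappa> j = \<kappa> i \<longrightarrow> rho j \<le> rho i)"

lemma top_per: "period \<kappa> T \<Longrightarrow> top \<kappa> (i + T) = top \<kappa> i"
  using rho_perT by (simp add: top_def period_def)

lemma top_eq:
  assumes "top \<kappa> i" "top \<kappa> j" "\<kappa> i = \<kappa> j"
  shows "rho i = rho j"
proof (rule le_antisym)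
  show "rho i \<le> rho j" using assms(2,3) by (simp add: top_def)
  show "rho j \<le> rho i" using assms(1,3) by (simp add: top_def)
qed

text \<open>Over each value of \<open>\<kappa>\<close> the largest rank is attained exactly once per
  turn: two positions of equal rank have the same phase, and by \<open>same_pos\<close> they
  coincide modulo \<open>T\<close> if their vertices agree.\<close>

lemma card_top:
  assumes per: "period \<kappa> T" and pos: "\<And>i j. \<kappa> i = \<kappa> j \<Longrightarrow> pos i = pos j"
  shows "card {i\<in>{..<T}. top \<kappa> i} = card (\<kappa> ` {..<T})"
proof (rule bij_betw_same_card)
  show "bij_betw \<kappa> {i\<in>{..<T}. top \<kappa> i} (\<kappa> ` {..<T})"
    unfolding bij_betw_def
  proof
    show "inj_on \<kappa> {i\<in>{..<T}. top \<kappa> i}"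
    proof (rule inj_onI)
      fix i j assume i: "i \<in> {i\<in>{..<T}. top \<kappa> i}" and j: "j \<in> {i\<in>{..<T}. top \<kappa> i}" and eq: "\<kappa> i = \<kappa> j"
      have "rho i = rho j" by (rule top_eq[of \<kappa>]) (use i j eq in auto)
      then have "i mod T = j mod T" using same_pos[OF pos[OF eq]] rho_phase by blast
      then show "i = j" using i j by simp
    qed
    show "\<kappa> ` {i\<in>{..<T}. top \<kappa> i} = \<kappa> ` {..<T}"
    proof
      show "\<kappa> ` {..<T} \<subseteq> \<kappa> ` {i\<in>{..<T}. top \<kappa> i}"
      proof
        fix x assume "x \<in> \<kappa> ` {..<T}"
        then obtain i where i: "i < T" "x = \<kappa> i" by auto
        define S where "S = {j\<in>{..<T}. \<kappa> j = x}"
        have fS: "finite S" "S \<noteq> {}" using i by (auto simp: S_def)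
        then have "Max (rho ` S) \<in> rho ` S" by (intro Max_in) auto
        then obtain j where j: "j \<in> S" "rho j = Max (rho ` S)" by auto
        have "rho k \<le> rho j" if "\<kappa> k = \<kappa> j" for k
        proof -
          have "k mod T \<in> S" using that j T1 period_mod[OF per, of k] by (auto simp: S_def)
          then have "rho (k mod T) \<le> rho j" using j(2) fS by simp
          then show ?thesis using period_mod[OF rho_perT] by simp
        qed
        then have "top \<kappa> j" by (simp add: top_def)
        then show "x \<in> \<kappa> ` {i\<in>{..<T}. top \<kappa> i}" using j by (auto simp: S_def image_iff)
      qed
    qed auto
  qed
qed

lemma top_pos_arc: "top pos i \<Longrightarrow> top h i"
  by (simp add: top_def pos_def)

text \<open>Positions over one arc carry the same label, so \<open>rho_Suc\<close> pulls the
  comparison of their successors, which all lie over the head of the arc, back to the positions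
  themselves.\<close>

lemma top_pos_Suc_arc: "top pos (Suc i) \<Longrightarrow> top h i"
  using rho_Suc hstep unfolding top_def by metis

definition D :: "nat set" where
  "D = {i\<in>{..<T}. top pos i \<and> \<not> top pos (Suc i)}"

text \<open>Each arc of the image of the walk has one top position, and so has each vertex; since the
  arc into a top position of a vertex is itself top, \<open>D\<close> is bounded by minus the Euler characteristic
  of the image.\<close>

lemma card_D: "card D + 1 \<le> betti1 G"
proof -
  define H where "H = G\<lparr>verts := pos ` {..<T}, arcs := h ` {..<T}\<rparr>"
  have nz: "0 < T" using T1 by simp
  have mem: "pos i \<in> pos ` {..<T}" for i
    using period_mod[OF pos_per, of i] nz by (metis imageI lessThan_iff mod_less_divisor)
  have finH: "fin_digraph H"
  proof (unfold_locales)
    fix e assume "e \<in> arcs H"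
    then obtain i where "e = h i" by (auto simp: H_def)
    then show "tail H e \<in> verts H" "head H e \<in> verts H"
      using mem[of i] mem[of "Suc i"] hstep[of i] by (simp_all add: H_def pos_def)
  qed (auto simp: H_def)
  have "(\<lambda>_. 0 :: nat) ` verts H = {0}" using nz by (auto simp: H_def)
  then have "card (arcs H) + 1 \<le> betti1 H + card (verts H)"
    using betti1_ge[OF finH, of "\<lambda>_. 0 :: nat"] by simp
  also have "betti1 H \<le> betti1 G"
    by (rule betti1_subgraph[OF finH fin_digraph]) (use harc in \<open>auto simp: H_def pos_def\<close>)
  finally have euler: "card (h ` {..<T}) + 1 \<le> betti1 G + card (pos ` {..<T})"
    by (simp add: H_def)
  have cE: "card {i\<in>{..<T}. top h i} = card (h ` {..<T})"
    by (rule card_top[OF hper]) (simp add: pos_def)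
  have "card {i\<in>{..<T}. top pos i} = card (pos ` {..<T})" by (rule card_top[OF pos_per])
  then have cV: "card {i\<in>{..<T}. top pos (Suc i)} = card (pos ` {..<T})"
    using card_shift_periodic[of "top pos" T] top_per[OF pos_per, of 0] by simp
  have "card D + card {i\<in>{..<T}. top pos (Suc i)} = card (D \<union> {i\<in>{..<T}. top pos (Suc i)})"
    by (rule card_Un_disjoint[symmetric]) (auto simp: D_def)
  also have "\<dots> \<le> card {i\<in>{..<T}. top h i}"
    by (rule card_mono) (auto simp: D_def intro: top_pos_arc top_pos_Suc_arc)
  finally show ?thesis using cE cV euler by simp
qed

text \<open>A phase whose rank is the largest of all is top over whatever vertex it meets. Hence
  among any \<open>l\<close> consecutive positions beyond the first occurrence there is a top
  one.\<close>

lemma top_phase: "\<exists>i0<l. \<forall>q. top pos (i0 + l * q)"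
proof -
  have "Max (rho ` {..<l}) \<in> rho ` {..<l}" using l1 by (intro Max_in) (auto simp: lessThan_empty_iff)
  then obtain i0 where i0: "i0 < l" "rho i0 = Max (rho ` {..<l})" by auto
  have "rho j \<le> rho i0" for j
  proof -
    have "rho j = rho (j mod l)" using period_mod[OF rho_per] by simp
    also have "\<dots> \<le> rho i0" unfolding i0(2) using l1 by (intro Max_ge) auto
    finally show ?thesis .
  qed
  then have "top pos (i0 + l * q)" for q
    using period_mult[OF rho_per] by (simp add: top_def)
  then show ?thesis using i0(1) by blast
qed

lemma last_top:
  assumes "top pos a" "a \<le> i" "\<not> top pos i"
  shows "\<exists>k. a \<le> k \<and> k < i \<and> top pos k \<and> (\<forall>j. k < j \<and> j \<le> i \<longrightarrow> \<not> top pos j)"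
proof -
  let ?P = "\<lambda>k. k \<le> i \<and> top pos k"
  define k where "k = (GREATEST k. ?P k)"
  have P: "?P k" unfolding k_def by (rule GreatestI_nat[of ?P a i]) (use assms in auto)
  have le: "j \<le> k" if "?P j" for j unfolding k_def by (rule Greatest_le_nat[of ?P j i]) (use that in auto)
  show ?thesis
  proof (intro exI[of _ k] conjI allI impI)
    show "a \<le> k" using le[of a] assms by simp
    show "k < i" using P assms(3) by (metis le_neq_implies_less)
    show "top pos k" using P by simp
    show "\<not> top pos j" if "k < j \<and> j \<le> i" for j using le[of j] that by auto
  qed
qed

lemma D_mod: "top pos k \<Longrightarrow> \<not> top pos (Suc k) \<Longrightarrow> k mod T \<in> D"
proof -
  assume a: "top pos k" "\<not> top pos (Suc k)"
  have per: "period (top pos) T" using top_per[OF pos_per] by (simp add: period_def)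
  have "top pos (k mod T) = top pos k" by (rule period_mod[OF per])
  moreover have "top pos (Suc (k mod T)) = top pos (Suc k)"
    by (rule period_cong[OF per]) (simp add: mod_Suc_eq)
  ultimately show ?thesis using a T1 by (simp add: D_def)
qed

text \<open>A position that is not top comes fewer than \<open>l\<close> steps after a member of
  \<open>D\<close>, so there are at most \<open>\<beta> * l\<close> of these, a twelfth of the turn.
  Top positions are as many as the vertices of the image, each of which is the tail of an
  arc.\<close>

lemma length_bound: "T \<le> 2 * card (arcs G)"
proof -
  obtain i0 where i0: "i0 < l" "\<And>q. top pos (i0 + l * q)" using top_phase by blast
  have lT: "l \<le> T" using ldvd T1 by (intro dvd_imp_le) auto
  let ?N = "{i\<in>{..<T}. \<not> top pos i}"
  have "?N \<subseteq> (\<lambda>(k, m). (k + m) mod T) ` (D \<times> {1..<l})"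
  proof
    fix i assume i: "i \<in> ?N"
    \<comment> \<open>\<open>i0 + l * w\<close> is the last occurrence of the top phase up to
      \<open>i + T\<close>; adding \<open>T\<close> prevents the subtraction of \<open>i0\<close>
      from truncating.\<close>
    define w r where "w = (i + T - i0) div l" and "r = (i + T - i0) mod l"
    have "l * w + r = i + T - i0" "r < l" using l1 by (simp_all add: w_def r_def)
    then have "i0 + l * w \<le> i + T" "i + T < i0 + l * w + l" using i0(1) lT by linarith+
    moreover define a where "a = i0 + l * w"
    ultimately have a: "top pos a" "a \<le> i + T" "i + T < a + l" using i0 by auto
    have "\<not> top pos (i + T)" using i top_per[OF pos_per] by simp
    from last_top[OF a(1,2) this] obtain k where
      k: "a \<le> k" "k < i + T" "top pos k" "\<forall>j. k < j \<and> j \<le> i + T \<longrightarrow> \<not> top pos j" by blast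
    have "k mod T \<in> D" using k by (intro D_mod) auto
    moreover have "i + T - k \<in> {1..<l}" using k(1,2) a(3) by auto
    moreover have "(k mod T + (i + T - k)) mod T = i"
    proof -
      have "(k mod T + (i + T - k)) mod T = (k + (i + T - k)) mod T" by (rule mod_add_left_eq)
      also have "k + (i + T - k) = i + T" using k(2) by simp
      finally show ?thesis using i by simp
    qed
    ultimately show "i \<in> (\<lambda>(k, m). (k + m) mod T) ` (D \<times> {1..<l})"
      by (intro image_eqI[of _ _ "(k mod T, i + T - k)"]) simp_all
  qed
  moreover have fD: "finite D" by (simp add: D_def)
  ultimately have "card ?N \<le> card (D \<times> {1..<l})"
    by (meson card_image_le card_mono finite_SigmaI finite_atLeastLessThan finite_imageI le_trans)
  also have "\<dots> \<le> betti1 G * l" using card_D by (auto simp: card_cartesian_product intro!: mult_le_mono)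
  finally have N: "12 * card ?N \<le> T" using deg by simp
  have "T = card ({i\<in>{..<T}. top pos i} \<union> ?N)" by (subst card_lessThan[of T, symmetric]) (rule arg_cong[of _ _ card], auto)
  also have "\<dots> = card {i\<in>{..<T}. top pos i} + card ?N" by (rule card_Un_disjoint) auto
  also have "card {i\<in>{..<T}. top pos i} = card (pos ` {..<T})" by (rule card_top[OF pos_per])
  also have "card (pos ` {..<T}) \<le> card (arcs G)"
  proof -
    have "pos ` {..<T} \<subseteq> tail G ` arcs G" using harc by (auto simp: pos_def)
    then have "card (pos ` {..<T}) \<le> card (tail G ` arcs G)" by (intro card_mono) auto
    also have "\<dots> \<le> card (arcs G)" by (rule card_image_le) simp
    finally show ?thesis .
  qed
  finally show ?thesis using N by simp
qed

text \<open>Otherwise each of the 4 \<beta> windows would contain a position of \<open>Bad\<close>: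
  a visit to \<open>Q\<close> is either top, or the last top position before it is in
  \<open>D\<close>. A vertex of \<open>Q\<close> has one top position per turn, so
  \<open>Bad\<close> has at most 2 \<beta> + |D| < 3 \<beta> elements.\<close>

lemma window_free:
  assumes Q: "finite Q" "card Q \<le> 2 * betti1 G"
  shows "\<exists>s. \<forall>n<3 * l. pos (s + n) \<notin> Q"
proof (rule ccontr)
  assume neg: "\<not> ?thesis"
  obtain i0 where i0: "i0 < l" "\<And>q. top pos (i0 + l * q)" using top_phase by blast
  \<comment> \<open>Windows begin in the top phase, so the last top position before a visit to
    \<open>Q\<close> is in the same window.\<close>
  define st where "st t = i0 + l * (3 * t)" for t
  have st: "top pos (st t)" for t unfolding st_def by (rule i0(2))
  have st_Suc: "st (Suc t) = st t + 3 * l" for t by (simp add: st_def algebra_simps)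
  define Bad where "Bad = {i\<in>{..<T}. top pos i \<and> pos i \<in> Q} \<union> D"
  have "\<exists>x. st t \<le> x \<and> x < st t + 3 * l \<and> x mod T \<in> Bad" for t
  proof -
    from neg obtain n where n: "n < 3 * l" "pos (st t + n) \<in> Q" by blast
    show ?thesis
    proof (cases "top pos (st t + n)")
      case True
      have per: "period (top pos) T" using top_per[OF pos_per] by (simp add: period_def)
      have "(st t + n) mod T \<in> Bad"
        using True n T1 period_mod[OF per] period_mod[OF pos_per] by (simp add: Bad_def)
      then show ?thesis using n by (intro exI[of _ "st t + n"]) simp
    next
      case False
      from last_top[OF st[of t] le_add1 False] obtain k where "st t \<le> k" "k < st t + n" "top pos k"
        "\<forall>j. k < j \<and> j \<le> st t + n \<longrightarrow> \<not> top pos j" by auto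
      then show ?thesis using n D_mod[of k] by (intro exI[of _ k]) (auto simp: Bad_def)
    qed
  qed
  then obtain x where x: "\<And>t. st t \<le> x t" "\<And>t. x t < st t + 3 * l" "\<And>t. x t mod T \<in> Bad" by metis
  have fB: "finite Bad" by (simp add: Bad_def D_def)
  have mono: "st t + 3 * l \<le> st u" if "t < u" for t u
  proof -
    have "Suc t \<le> u" using that by simp
    then have "l * (3 * Suc t) \<le> l * (3 * u)" by (intro mult_le_mono2) simp
    then show ?thesis by (simp add: st_def algebra_simps)
  qed
  have "inj_on (\<lambda>t. x t mod T) {..<4 * betti1 G}"
  proof (rule linorder_inj_onI)
    fix t u assume tu: "t < u" "t \<in> {..<4 * betti1 G}" "u \<in> {..<4 * betti1 G}"
    have "x t < x u" using x(2)[of t] x(1)[of u] mono[OF tu(1)] by simp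
    \<comment> \<open>All these windows lie between \<open>i0\<close> and \<open>i0 + T\<close>, so
      different positions in them stay different modulo \<open>T\<close>.\<close>
    moreover have "x u < x t + T"
    proof -
      have "x u < st (4 * betti1 G)" using x(2)[of u] mono[of u "4 * betti1 G"] tu by simp
      also have "\<dots> \<le> i0 + T" using deg by (simp add: st_def algebra_simps)
      also have "i0 \<le> x t" using x(1)[of t] by (simp add: st_def)
      finally show ?thesis by simp
    qed
    ultimately have *: "0 < x u - x t" "x u - x t < T" by auto
    show "x t mod T \<noteq> x u mod T"
    proof
      assume "x t mod T = x u mod T"
      then have "T dvd x u - x t" using * by (metis mod_eq_dvd_iff_nat less_imp_le zero_less_diff)
      then show False using * by (auto dest: dvd_imp_le)
    qed
  qed (auto)
  then have "4 * betti1 G = card ((\<lambda>t. x t mod T) ` {..<4 * betti1 G})" by (simp add: card_image)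
  also have "\<dots> \<le> card Bad" by (rule card_mono[OF fB]) (use x(3) in auto)
  also have "\<dots> \<le> card {i\<in>{..<T}. top pos i \<and> pos i \<in> Q} + card D" unfolding Bad_def by (rule card_Un_le)
  also have "card {i\<in>{..<T}. top pos i \<and> pos i \<in> Q} \<le> card Q"
  proof (rule card_inj_on_le[OF _ _ Q(1)])
    show "inj_on pos {i\<in>{..<T}. top pos i \<and> pos i \<in> Q}"
    proof (rule inj_onI)
      fix i j assume i: "i \<in> {i\<in>{..<T}. top pos i \<and> pos i \<in> Q}"
        and j: "j \<in> {i\<in>{..<T}. top pos i \<and> pos i \<in> Q}" and eq: "pos i = pos j"
      have "rho i = rho j" by (rule top_eq[of pos]) (use i j eq in auto)
      then have "i mod T = j mod T" using same_pos[OF eq] rho_phase by blast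
      then show "i = j" using i j by simp
    qed
  qed auto
  finally show False using Q(2) card_D by simp
qed

text \<open>Go back from a free window to the last visit to \<open>Q\<close> before it; between that
  visit and the end of the window \<open>Q\<close> is avoided.\<close>

lemma free_run:
  assumes Q: "finite Q" "card Q \<le> 2 * betti1 G" and hit: "pos i \<in> Q"
  shows "\<exists>k. pos k \<in> Q \<and> (\<forall>n. 1 \<le> n \<and> n \<le> 3 * l \<longrightarrow> pos (k + n) \<notin> Q)"
proof -
  from window_free[OF Q] obtain s where s: "\<And>n. n < 3 * l \<Longrightarrow> pos (s + n) \<notin> Q" by blast
  have T: "i \<le> T * i" using T1 by simp
  \<comment> \<open>The free window is moved on by \<open>i + 1\<close> turns, so that it begins
    after the known visit at \<open>i\<close>.\<close>
  define b where "b = s + T * i + T * 1"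
  have pb: "pos (b + n) = pos (s + n)" for n
    using period_mult[OF pos_per, of "s + n" "i + 1"] by (simp add: b_def algebra_simps)
  let ?P = "\<lambda>k. k < b \<and> pos k \<in> Q"
  have "i < b" unfolding b_def using T T1 by linarith
  then have "?P i" using hit by simp
  define k where "k = (GREATEST k. ?P k)"
  have k: "?P k" unfolding k_def by (rule GreatestI_nat[of ?P i b]) (use \<open>?P i\<close> in auto)
  have le: "j \<le> k" if "?P j" for j unfolding k_def by (rule Greatest_le_nat[of ?P j b]) (use that in auto)
  have "pos (k + n) \<notin> Q" if n: "1 \<le> n" "n \<le> 3 * l" for n
  proof (cases "k + n < b")
    case True then show ?thesis using le[of "k + n"] n by auto
  next
    case False
    then have "k + n = b + (k + n - b)" "k + n - b < 3 * l" using k n by auto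
    then show ?thesis using pb[of "k + n - b"] s by metis
  qed
  then show ?thesis using k by blast
qed

end

section \<open>Programs with time credits\<close>

text \<open>Total correctness with \<open>k\<close> time credits. The postcondition sees the credits
  that are left, so an invariant can hold a potential, and correctness and running time are proved
  together.\<close>

definition wp :: "com \<Rightarrow> (state \<Rightarrow> nat \<Rightarrow> bool) \<Rightarrow> state \<Rightarrow> nat \<Rightarrow> bool" where
  "wp c Q s k \<longleftrightarrow> (\<exists>t s'. exec c s t s' \<and> t \<le> k \<and> Q s' (k - t))"

lemma wp_exec: "exec c s t s' \<Longrightarrow> wp c Q s k \<longleftrightarrow> t \<le> k \<and> Q s' (k - t)"
  unfolding wp_def using exec_deterministic by blast

lemmas wp_Skip = wp_exec[OF exec.Skip]
lemmas wp_Move = wp_exec[OF exec.Move]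
lemmas wp_Add = wp_exec[OF exec.Add]
lemmas wp_Sub = wp_exec[OF exec.Sub]
lemmas wp_Load = wp_exec[OF exec.Load]
lemmas wp_Store = wp_exec[OF exec.Store]

lemma wp_Seq: "wp (Seq a b) Q s k \<longleftrightarrow> wp a (wp b Q) s k"
proof
  assume "wp (Seq a b) Q s k"
  then obtain t s' where t: "exec (Seq a b) s t s'" "t \<le> k" "Q s' (k - t)" by (auto simp: wp_def)
  from t(1) obtain t1 t2 s1 where "t = t1 + t2" "exec a s t1 s1" "exec b s1 t2 s'" by (rule SeqE)
  then show "wp a (wp b Q) s k" using t unfolding wp_def
    by (intro exI[of _ t1] exI[of _ s1] conjI exI[of _ t2] exI[of _ s']) (auto simp: diff_diff_left)
next
  assume "wp a (wp b Q) s k"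
  then obtain t1 s1 t2 s2 where "exec a s t1 s1" "t1 \<le> k" "exec b s1 t2 s2" "t2 \<le> k - t1" "Q s2 (k - t1 - t2)"
    by (auto simp: wp_def)
  then show "wp (Seq a b) Q s k" unfolding wp_def
    by (intro exI[of _ "t1 + t2"] exI[of _ s2]) (auto intro: exec.Seq simp: diff_diff_left)
qed

lemma wp_Branch: "wp (Branch b c1 c2) Q s k \<longleftrightarrow>
  1 \<le> k \<and> (if tval s b then wp c1 Q s (k - 1) else wp c2 Q s (k - 1))"
proof
  assume "wp (Branch b c1 c2) Q s k"
  then obtain t s' where t: "exec (Branch b c1 c2) s t s'" "t \<le> k" "Q s' (k - t)" by (auto simp: wp_def)
  from t(1) show "1 \<le> k \<and> (if tval s b then wp c1 Q s (k - 1) else wp c2 Q s (k - 1))"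
    by (rule BranchE) (use t in \<open>auto simp: wp_def intro!: exI[of _ s'] exI[of _ "t - 1"]\<close>)
next
  assume a: "1 \<le> k \<and> (if tval s b then wp c1 Q s (k - 1) else wp c2 Q s (k - 1))"
  then obtain t s' where t: "exec (if tval s b then c1 else c2) s t s'" "t \<le> k - 1" "Q s' (k - 1 - t)"
    by (auto simp: wp_def split: if_splits)
  have "exec (Branch b c1 c2) s (1 + t) s'"
  proof (cases "tval s b")
    case True
    with t(1) have "exec c1 s t s'" by simp
    with True show ?thesis by (rule exec.BranchTrue)
  next
    case False
    with t(1) have "exec c2 s t s'" by simp
    with False show ?thesis by (rule exec.BranchFalse)
  qed
  then show "wp (Branch b c1 c2) Q s k" using a t unfolding wp_def
    by (intro exI[of _ "1 + t"] exI[of _ s']) auto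
qed

lemmas wp_simps = wp_Skip wp_Move wp_Add wp_Sub wp_Load wp_Store wp_Seq wp_Branch

lemma wp_weaken:
  assumes "wp c Q s j" "j \<le> k" "\<And>s' i. Q s' i \<Longrightarrow> i \<le> j \<Longrightarrow> Q' s' (i + (k - j))"
  shows "wp c Q' s k"
proof -
  from assms(1) obtain t s' where t: "exec c s t s'" "t \<le> j" "Q s' (j - t)" by (auto simp: wp_def)
  have "Q' s' (j - t + (k - j))" using assms(3)[OF t(3)] by simp
  moreover have "j - t + (k - j) = k - t" using t assms(2) by simp
  ultimately show ?thesis unfolding wp_def using t assms(2)
    by (intro exI[of _ t] exI[of _ s']) auto
qed

fun wvars :: "com \<Rightarrow> name set" where
  "wvars (Move x a) = {x}"
| "wvars (Add x a b) = {x}"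
| "wvars (Sub x a b) = {x}"
| "wvars (Load x A a) = {x}"
| "wvars (Seq c1 c2) = wvars c1 \<union> wvars c2"
| "wvars (Branch b c1 c2) = wvars c1 \<union> wvars c2"
| "wvars (Loop b c) = wvars c"
| "wvars _ = {}"

fun warrs :: "com \<Rightarrow> name set" where
  "warrs (Store A a b) = {A}"
| "warrs (Seq c1 c2) = warrs c1 \<union> warrs c2"
| "warrs (Branch b c1 c2) = warrs c1 \<union> warrs c2"
| "warrs (Loop b c) = warrs c"
| "warrs _ = {}"

text \<open>A syntactic bound on what a program changes. It lets the loop invariants mention only
  the data that the loop modifies.\<close>

definition frame :: "com \<Rightarrow> state \<Rightarrow> state \<Rightarrow> bool" where
  "frame c s s' \<longleftrightarrow> (\<forall>x. x \<notin> wvars c \<longrightarrow> var s' x = var s x) \<and>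
     (\<forall>A. A \<notin> warrs c \<longrightarrow> arr s' A = arr s A)"

lemma frame_refl: "frame c s s"
  by (simp add: frame_def)

lemma frame_trans: "frame c s s' \<Longrightarrow> frame c s' s'' \<Longrightarrow> frame c s s''"
  by (simp add: frame_def)

lemma frame_var: "frame c s s' \<Longrightarrow> x \<notin> wvars c \<Longrightarrow> var s' x = var s x"
  by (simp add: frame_def)

lemma frame_arr: "frame c s s' \<Longrightarrow> A \<notin> warrs c \<Longrightarrow> arr s' A = arr s A"
  by (simp add: frame_def)

lemma var_set_var [simp]: "var (set_var x n s) y = (if y = x then n else var s y)"
  by (simp add: set_var_def)

lemma arr_set_var [simp]: "arr (set_var x n s) = arr s"
  by (simp add: set_var_def)

lemma var_set_arr [simp]: "var (set_arr A i n s) = var s"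
  by (simp add: set_arr_def)

lemma arr_set_arr [simp]: "arr (set_arr A i n s) B = (if B = A then (arr s A)(i := n) else arr s B)"
  by (simp add: set_arr_def)

lemma exec_frame: "exec c s t s' \<Longrightarrow> frame c s s'"
  by (induction rule: exec.induct) (auto simp: frame_def)

lemma wp_frame:
  assumes "wp c Q s k" shows "wp c (\<lambda>s' j. Q s' j \<and> frame c s s') s k"
  using assms exec_frame unfolding wp_def by blast

text \<open>The test of each round costs a credit, so the credits themselves are the termination
  measure. The frame relates every intermediate state to the initial one.\<close>

lemma wp_Loop:
  assumes inv: "I s k"
    and step: "\<And>s' j. I s' j \<Longrightarrow> frame c s s' \<Longrightarrow> tval s' b \<Longrightarrow> 1 \<le> j \<and> wp c I s' (j - 1)"
    and stop: "\<And>s' j. I s' j \<Longrightarrow> frame c s s' \<Longrightarrow> \<not> tval s' b \<Longrightarrow> 1 \<le> j \<and> Q s' (j - 1)"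
  shows "wp (Loop b c) Q s k"
proof -
  have "wp (Loop b c) Q s' j" if "I s' j" "frame c s s'" for s' j
    using that
  proof (induction j arbitrary: s' rule: less_induct)
    case (less j)
    show ?case
    proof (cases "tval s' b")
      case True
      from step[OF less.prems True] obtain t1 s1 where j: "1 \<le> j" and
        t1: "exec c s' t1 s1" "t1 \<le> j - 1" "I s1 (j - 1 - t1)" by (auto simp: wp_def)
      have "frame c s s1" using less.prems(2) exec_frame[OF t1(1)] by (rule frame_trans)
      from less.IH[OF _ t1(3) this] j obtain t2 s2 where
        t2: "exec (Loop b c) s1 t2 s2" "t2 \<le> j - 1 - t1" "Q s2 (j - 1 - t1 - t2)"
        by (auto simp: wp_def)
      have "exec (Loop b c) s' (1 + t1 + t2) s2" using True t1(1) t2(1) by (rule exec.LoopTrue)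
      moreover have "j - 1 - t1 - t2 = j - (1 + t1 + t2)" by simp
      ultimately show ?thesis unfolding wp_def using t1 t2 j
        by (intro exI[of _ "1 + t1 + t2"] exI[of _ s2]) auto
    next
      case False
      then have "exec (Loop b c) s' 1 s'" by (rule exec.LoopFalse)
      then show ?thesis using stop[OF less.prems False] unfolding wp_def
        by (intro exI[of _ 1] exI[of _ s']) auto
    qed
  qed
  then show ?thesis using inv frame_refl by blast
qed

lemma wp_call:
  assumes "wp c (\<lambda>s' _. P s') s T" "T \<le> k" "\<And>s' j. P s' \<Longrightarrow> frame c s s' \<Longrightarrow> k - T \<le> j \<Longrightarrow> Q s' j"
  shows "wp c Q s k"
  by (rule wp_weaken[OF wp_frame[OF assms(1)] assms(2)]) (use assms(3) in auto)

section \<open>Adjacency lists and components\<close>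

notation Seq (infixr \<open>;;\<close> 60)

text \<open>One more than the largest index below \<open>c\<close> with value \<open>v\<close>, or 0
  if there is none. The shift by one makes 0 the end of a linked list, and an initially zero array a
  family of empty lists.\<close>

primrec last_below :: "(nat \<Rightarrow> nat) \<Rightarrow> nat \<Rightarrow> nat \<Rightarrow> nat" where
  "last_below f v 0 = 0"
| "last_below f v (Suc c) = (if f c = v then Suc c else last_below f v c)"

lemma last_below_le: "last_below f v c \<le> c"
  by (induction c) auto

lemma last_below_less: "f e = v \<Longrightarrow> e < c \<Longrightarrow> e < last_below f v c"
  by (induction c) (auto simp: less_Suc_eq)

lemma last_below_hit: "last_below f v c \<noteq> 0 \<Longrightarrow> f (last_below f v c - 1) = v"
  by (induction c) auto

locale labelled_graph = fin_digraph G for G :: "(nat, nat) pre_digraph" +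
  fixes lab :: "nat \<Rightarrow> nat" and nV nE :: nat
  assumes vertsG: "verts G = {..<nV}" and arcsG: "arcs G = {..<nE}"
    and lab_inj: "\<And>v. v < nV \<Longrightarrow> inj_on lab (out_arcs G v)"
begin

lemma tail_less [simp]: "e < nE \<Longrightarrow> tail G e < nV" and head_less [simp]: "e < nE \<Longrightarrow> head G e < nV"
  using tail_in_verts[of e] head_in_verts[of e] by (auto simp: vertsG arcsG)

definition inp :: "state \<Rightarrow> bool" where
  "inp s \<longleftrightarrow> var s ''Gamma_verts'' = nV \<and> var s ''Gamma_arcs'' = nE \<and>
     (\<forall>e<nE. arr s ''Gamma_tail'' e = tail G e \<and> arr s ''Gamma_head'' e = head G e \<and>
       arr s ''gamma_emap'' e = lab e)"

lemma inp_set_var [simp]: "x \<notin> {''Gamma_verts'', ''Gamma_arcs''} \<Longrightarrow> inp (set_var x n s) = inp s"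
  by (auto simp: inp_def)

lemma inp_frame:
  assumes "inp s" "frame c s s'"
    and "{''Gamma_verts'', ''Gamma_arcs''} \<inter> wvars c = {}"
    and "{''Gamma_tail'', ''Gamma_head'', ''gamma_emap''} \<inter> warrs c = {}"
  shows "inp s'"
  using assms by (auto simp: inp_def frame_def)

end

definition adjacency_prog :: com where
  "adjacency_prog = Move ''e'' (Const 0) ;;
    Loop (Less (Var ''e'') (Var ''Gamma_arcs''))
      (Load ''t'' ''Gamma_tail'' (Var ''e'') ;; Load ''x'' ''first'' (Var ''t'') ;;
       Store ''nxtO'' (Var ''e'') (Var ''x'') ;; Add ''y'' (Var ''e'') (Const 1) ;;
       Store ''first'' (Var ''t'') (Var ''y'') ;; Store ''fo'' (Var ''t'') (Var ''y'') ;;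
       Load ''t'' ''Gamma_head'' (Var ''e'') ;; Load ''x'' ''fi'' (Var ''t'') ;;
       Store ''nxtI'' (Var ''e'') (Var ''x'') ;; Store ''fi'' (Var ''t'') (Var ''y'') ;;
       Move ''e'' (Var ''y''))"

context labelled_graph begin

text \<open>The out-lists have two heads per vertex because both searches consume them:
  \<open>fo\<close> serves the components, \<open>first\<close> the directed search.\<close>

definition lists :: "state \<Rightarrow> nat \<Rightarrow> bool" where
  "lists s n \<longleftrightarrow> arr s ''first'' = (\<lambda>v. last_below (tail G) v n) \<and>
     arr s ''fo'' = (\<lambda>v. last_below (tail G) v n) \<and>
     arr s ''fi'' = (\<lambda>v. last_below (head G) v n) \<and>
     (\<forall>e<n. arr s ''nxtO'' e = last_below (tail G) (tail G e) e \<and>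
       arr s ''nxtI'' e = last_below (head G) (head G e) e)"

lemma adjacency_correct:
  assumes "inp s" "arr s ''first'' = (\<lambda>_. 0)" "arr s ''fo'' = (\<lambda>_. 0)" "arr s ''fi'' = (\<lambda>_. 0)"
  shows "wp adjacency_prog (\<lambda>s' _. lists s' nE) s (12 * nE + 3)"
  unfolding adjacency_prog_def wp_simps
proof (intro conjI, simp, rule wp_Loop[where
      I = "\<lambda>s k. var s ''e'' \<le> nE \<and> lists s (var s ''e'') \<and> 12 * (nE - var s ''e'') + 2 \<le> k"], goal_cases)
  case 1
  then show ?case using assms by (simp add: lists_def)
next
  case (2 s' j)
  then have inp: "inp s'" by (intro inp_frame[OF _ 2(2)]) (simp_all add: assms(1))
  from 2 inp have e: "var s' ''e'' < nE" by (simp add: inp_def)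
  then have "nE - var s' ''e'' = Suc (nE - Suc (var s' ''e''))" by simp
  then show ?case using 2 inp e
    by (auto simp: wp_simps inp_def lists_def fun_eq_iff less_Suc_eq)
next
  case (3 s' j)
  then have inp: "inp s'" by (intro inp_frame[OF _ 3(2)]) (simp_all add: assms(1))
  then show ?case using 3 by (auto simp: inp_def)
qed

end

text \<open>Each round of the loop is one step of an undirected depth-first search with stack \<open>SK\<close>; the lists
  \<open>fo\<close> and \<open>fi\<close> are consumed, so every arc is seen twice.\<close>

definition components_prog :: com where
  "components_prog = Move ''r'' (Const 0) ;; Move ''sp'' (Const 0) ;; Move ''c'' (Const 0) ;;
    Loop (Less (Var ''r'') (Var ''Gamma_verts''))
     (Branch (Equal (Var ''sp'') (Const 0))
       (Load ''x'' ''comp'' (Var ''r'') ;;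
        Branch (Equal (Var ''x'') (Const 0))
          (Add ''c'' (Var ''c'') (Const 1) ;; Store ''comp'' (Var ''r'') (Var ''c'') ;;
           Store ''SK'' (Const 0) (Var ''r'') ;; Move ''sp'' (Const 1))
          (Add ''r'' (Var ''r'') (Const 1)))
       (Sub ''q'' (Var ''sp'') (Const 1) ;; Load ''v'' ''SK'' (Var ''q'') ;;
        Load ''p'' ''fo'' (Var ''v'') ;;
        Branch (Less (Const 0) (Var ''p''))
          (Sub ''e'' (Var ''p'') (Const 1) ;; Load ''x'' ''nxtO'' (Var ''e'') ;;
           Store ''fo'' (Var ''v'') (Var ''x'') ;; Load ''y'' ''Gamma_head'' (Var ''e''))
          (Load ''p'' ''fi'' (Var ''v'') ;;
           Branch (Less (Const 0) (Var ''p''))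
             (Sub ''e'' (Var ''p'') (Const 1) ;; Load ''x'' ''nxtI'' (Var ''e'') ;;
              Store ''fi'' (Var ''v'') (Var ''x'') ;; Load ''y'' ''Gamma_tail'' (Var ''e''))
             (Move ''sp'' (Var ''q'') ;; Move ''y'' (Var ''v''))) ;;
        Load ''x'' ''comp'' (Var ''y'') ;;
        Branch (Equal (Var ''x'') (Const 0))
          (Store ''comp'' (Var ''y'') (Var ''c'') ;; Store ''SK'' (Var ''sp'') (Var ''y'') ;;
           Add ''sp'' (Var ''sp'') (Const 1))
          Skip))"

section \<open>Undirected search, component numbers and the Betti number\<close>

context labelled_graph begin

text \<open>\<open>fo u - 1\<close> is the next arc to be scanned at \<open>u\<close>, and
  \<open>fo (tf e) \<le> e\<close> says that \<open>e\<close> has been scanned from that end.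
  Abstracting from tails and heads makes one definition serve out-lists and in-lists.\<close>

definition half_search ::
    "(nat \<Rightarrow> nat) \<Rightarrow> (nat \<Rightarrow> nat) \<Rightarrow> (nat \<Rightarrow> nat) \<Rightarrow> (nat \<Rightarrow> nat) \<Rightarrow> bool" where
  "half_search tf hf cm fo \<longleftrightarrow>
     (\<forall>u<nV. fo u \<noteq> 0 \<longrightarrow> fo u \<le> nE \<and> tf (fo u - 1) = u) \<and>
     (\<forall>e<nE. fo (tf e) \<le> e \<longrightarrow> cm (tf e) \<noteq> 0 \<and> cm (hf e) = cm (tf e))"

text \<open>\<open>comp\<close> is 0 for unvisited vertices. Visited vertices off the stack have
  both lists exhausted; those on the stack all carry the current number \<open>c\<close>.\<close>

definition search_inv ::
    "(nat \<Rightarrow> nat) \<Rightarrow> (nat \<Rightarrow> nat) \<Rightarrow> (nat \<Rightarrow> nat) \<Rightarrow> (nat \<Rightarrow> nat) \<Rightarrow> (nat \<Rightarrow> nat) \<Rightarrow>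
     (nat \<Rightarrow> nat) \<Rightarrow> nat \<Rightarrow> nat \<Rightarrow> nat \<Rightarrow> bool" where
  "search_inv tf hf cm fo fi SK c sp r \<longleftrightarrow>
     r \<le> nV \<and> (\<forall>u<r. cm u \<noteq> 0) \<and> (sp > 0 \<longrightarrow> r < nV \<and> c > 0) \<and>
     (\<forall>j<sp. SK j < nV \<and> cm (SK j) = c) \<and>
     (\<forall>u<nV. cm u \<le> c) \<and> {1..c} \<subseteq> cm ` {..<nV} \<and>
     (\<forall>u<nV. cm u \<noteq> 0 \<longrightarrow> u \<in> SK ` {..<sp} \<or> fo u = 0 \<and> fi u = 0) \<and>
     half_search tf hf cm fo \<and> half_search hf tf cm fi \<and>
     (\<forall>u<nV. \<forall>w<nV. cm u = cm w \<longrightarrow> cm u \<noteq> 0 \<longrightarrow> conn G u w)"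

definition pending :: "(nat \<Rightarrow> nat) \<Rightarrow> (nat \<Rightarrow> nat) \<Rightarrow> nat" where
  "pending tf fo = card {e \<in> {..<nE}. e < fo (tf e)}"

definition unseen :: "(nat \<Rightarrow> nat) \<Rightarrow> nat" where
  "unseen f = card {u \<in> {..<nV}. f u = 0}"

lemma pending_advance:
  assumes "fo v = Suc e" "e < nE" "tf e = v"
  shows "pending tf (fo(v := last_below tf v e)) + 1 \<le> pending tf fo"
proof -
  have "{i \<in> {..<nE}. i < (fo(v := last_below tf v e)) (tf i)} \<subseteq> {i \<in> {..<nE}. i < fo (tf i)} - {e}"
  proof
    fix i assume i: "i \<in> {i \<in> {..<nE}. i < (fo(v := last_below tf v e)) (tf i)}"
    show "i \<in> {i \<in> {..<nE}. i < fo (tf i)} - {e}"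
    proof (cases "tf i = v")
      case True
      then have "i < e" using i last_below_le[of tf v e] by auto
      then show ?thesis using i True assms(1) by simp
    next
      case False
      then show ?thesis using i assms(3) by auto
    qed
  qed
  moreover have "e \<in> {i \<in> {..<nE}. i < fo (tf i)}" using assms by simp
  ultimately have "{i \<in> {..<nE}. i < (fo(v := last_below tf v e)) (tf i)} \<subset> {i \<in> {..<nE}. i < fo (tf i)}"
    by blast
  then show ?thesis unfolding pending_def Suc_eq_plus1[symmetric] Suc_le_eq by (intro psubset_card_mono) auto
qed

lemma unseen_visit: "f y = 0 \<Longrightarrow> y < nV \<Longrightarrow> a \<noteq> 0 \<Longrightarrow> unseen (f(y := a)) + 1 = unseen f"
proof -
  assume y: "f y = 0" "y < nV" "a \<noteq> 0"
  have "{u \<in> {..<nV}. f u = 0} = insert y {u \<in> {..<nV}. (f(y := a)) u = 0}" using y by auto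
  moreover have "y \<notin> {u \<in> {..<nV}. (f(y := a)) u = 0}" using y by auto
  ultimately show ?thesis unfolding unseen_def by simp
qed

text \<open>Reversing all arcs exchanges the two lists; by this symmetry the lemmas for out-arcs
  also settle the in-arcs.\<close>

lemma search_swap: "search_inv tf hf cm fo fi SK c sp r \<longleftrightarrow> search_inv hf tf cm fi fo SK c sp r"
  by (simp only: search_inv_def conj_ac)

text \<open>The ends of a scanned arc are already numbered, so numbering an unvisited vertex does
  not touch them.\<close>

lemma half_search_visit:
  assumes "half_search t h' cm f" "cm y = 0"
  shows "half_search t h' (cm(y := c)) f"
  unfolding half_search_def
proof (intro conjI allI impI)
  fix e assume "e < nE" "f (t e) \<le> e"
  then have *: "cm (t e) \<noteq> 0" "cm (h' e) = cm (t e)" using assms(1) by (simp_all add: half_search_def)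
  then have "t e \<noteq> y" "h' e \<noteq> y" using assms(2) by auto
  then show "(cm(y := c)) (t e) \<noteq> 0" "(cm(y := c)) (h' e) = (cm(y := c)) (t e)" using * by simp_all
qed (use assms in \<open>simp_all add: half_search_def\<close>)

lemma search_visit:
  assumes inv: "search_inv tf hf cm fo fi SK c sp r" and y: "y < nV" "cm y = 0"
    and c: "conn G y v" "v < nV" "cm v = c" and sp: "sp > 0"
  shows "search_inv tf hf (cm(y := c)) fo fi (SK(sp := y)) c (Suc sp) r"
proof -
  have half: "half_search t h' (cm(y := c)) f" if "half_search t h' cm f" for t h' f
    by (rule half_search_visit[OF that y(2)])
  have im: "{1..c} \<subseteq> (cm(y := c)) ` {..<nV}"
  proof
    fix i assume i: "i \<in> {1..c}"
    then obtain u where "u < nV" "cm u = i" using inv by (auto simp: search_inv_def)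
    then show "i \<in> (cm(y := c)) ` {..<nV}" using y i by (intro image_eqI[of _ _ u]) auto
  qed
  have cpos: "c > 0" using inv sp by (simp add: search_inv_def)
  have *: "conn G x v" if "x < nV" "(cm(y := c)) x = c" for x
  proof (cases "x = y")
    case True then show ?thesis using c by simp
  next
    case False then show ?thesis using that c cpos inv by (simp add: search_inv_def)
  qed
  have cy: "conn G u w" if "u < nV" "w < nV" "(cm(y := c)) u = (cm(y := c)) w" "(cm(y := c)) u \<noteq> 0" for u w
  proof (cases "(cm(y := c)) u = c")
    case True
    then have "conn G u v" "conn G w v" using *[of u] *[of w] that by simp_all
    then show ?thesis using conn_sym conn_trans by metis
  next
    case False
    then have "cm u = cm w" "cm u \<noteq> 0" using that by (auto split: if_splits)
    then show ?thesis using that inv unfolding search_inv_def by blast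
  qed
  have st: "u \<in> (SK(sp := y)) ` {..<Suc sp} \<or> fo u = 0 \<and> fi u = 0" if "u < nV" "(cm(y := c)) u \<noteq> 0" for u
  proof (cases "u = y")
    case True then show ?thesis by (intro disjI1 image_eqI[of _ _ sp]) auto
  next
    case False
    then have "u \<in> SK ` {..<sp} \<or> fo u = 0 \<and> fi u = 0" using that inv by (simp add: search_inv_def)
    then show ?thesis
    proof
      assume "u \<in> SK ` {..<sp}"
      then obtain j where "j < sp" "u = SK j" by auto
      then show ?thesis by (intro disjI1 image_eqI[of _ _ j]) auto
    qed simp
  qed
  show ?thesis
    unfolding search_inv_def
  proof (intro conjI half im)
    show "\<forall>u<nV. (cm(y := c)) u \<noteq> 0 \<longrightarrow> u \<in> (SK(sp := y)) ` {..<Suc sp} \<or> fo u = 0 \<and> fi u = 0"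
      using st by blast
    show "\<forall>u<nV. \<forall>w<nV. (cm(y := c)) u = (cm(y := c)) w \<longrightarrow> (cm(y := c)) u \<noteq> 0 \<longrightarrow> conn G u w"
      using cy by blast
  qed (use inv y sp in \<open>auto simp: search_inv_def less_Suc_eq\<close>)
qed

lemma search_advance:
  assumes inv: "search_inv tf hf cm fo fi SK c sp r" and e: "e < nE" "fo (tf e) = Suc e"
    and eq: "cm (hf e) = cm (tf e)" "cm (tf e) \<noteq> 0"
  shows "search_inv tf hf cm (fo(tf e := last_below tf (tf e) e)) fi SK c sp r"
proof -
  let ?fo = "fo(tf e := last_below tf (tf e) e)"
  have half: "half_search tf hf cm ?fo"
    unfolding half_search_def
  proof (intro conjI allI impI)
    fix u assume "u < nV" "?fo u \<noteq> 0"
    then show "?fo u \<le> nE" "tf (?fo u - 1) = u"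
      using inv e last_below_le[of tf "tf e" e] last_below_hit[of tf "tf e" e]
      by (auto simp: search_inv_def half_search_def split: if_splits)
  next
    fix i assume i: "i < nE" "?fo (tf i) \<le> i"
    have "cm (tf i) \<noteq> 0 \<and> cm (hf i) = cm (tf i)"
    proof (cases "tf i = tf e")
      case True
      show ?thesis
      proof (cases "i < e")
        case T: True
        then have "i < last_below tf (tf e) e" using True by (intro last_below_less)
        then show ?thesis using i True by simp
      next
        case False
        then show ?thesis
          using i True inv e eq by (cases "i = e") (auto simp: search_inv_def half_search_def)
      qed
    next
      case False
      then show ?thesis using i inv by (auto simp: search_inv_def half_search_def)
    qed
    then show "cm (tf i) \<noteq> 0" "cm (hf i) = cm (tf i)" by auto
  qed
  have stack: "tf e \<in> SK ` {..<sp} \<or> (\<not> tf e < nV)"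
    using inv e eq by (auto simp: search_inv_def)
  show ?thesis
    unfolding search_inv_def using inv[unfolded search_inv_def] half stack by auto
qed

text \<open>If the visited end is off the stack, its lists are exhausted, so the arc was already
  scanned from that side and its two ends have equal numbers.\<close>

lemma search_seen:
  assumes inv: "search_inv tf hf cm fo fi SK c sp r" and e: "e < nE" "hf e < nV"
    and c: "cm (tf e) = c" "cm (hf e) \<noteq> 0"
  shows "cm (hf e) = c"
proof (cases "hf e \<in> SK ` {..<sp}")
  case True
  then show ?thesis using inv by (auto simp: search_inv_def)
next
  case False
  then have "fi (hf e) = 0" using inv e c by (auto simp: search_inv_def)
  then have "cm (tf e) = cm (hf e)" using inv e by (auto simp: search_inv_def half_search_def)
  then show ?thesis using c by simp
qed

lemma search_root:
  assumes inv: "search_inv tf hf cm fo fi SK c 0 r" and r: "r < nV" "cm r = 0"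
  shows "search_inv tf hf (cm(r := Suc c)) fo fi (SK(0 := r)) (Suc c) 1 r"
proof -
  have le: "\<And>u. u < nV \<Longrightarrow> cm u \<le> c" using inv by (simp add: search_inv_def)
  have half: "half_search t h' (cm(r := Suc c)) f" if "half_search t h' cm f" for t h' f
    by (rule half_search_visit[OF that r(2)])
  have im: "{1..Suc c} \<subseteq> (cm(r := Suc c)) ` {..<nV}"
  proof
    fix i assume "i \<in> {1..Suc c}"
    then consider "i = Suc c" | "i \<in> {1..c}" by fastforce
    then show "i \<in> (cm(r := Suc c)) ` {..<nV}"
    proof cases
      case 1 then show ?thesis using r by (intro image_eqI[of _ _ r]) auto
    next
      case 2
      then obtain u where "u < nV" "cm u = i" using inv by (auto simp: search_inv_def)
      then show ?thesis using r 2 by (intro image_eqI[of _ _ u]) auto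
    qed
  qed
  have c': "conn G u w" if "u < nV" "w < nV" "(cm(r := Suc c)) u = (cm(r := Suc c)) w"
    "(cm(r := Suc c)) u \<noteq> 0" for u w
    using that inv le[of u] le[of w] by (auto simp: search_inv_def split: if_splits)
  show ?thesis
    unfolding search_inv_def using inv[unfolded search_inv_def] half im c' r le
    by (auto simp: le_Suc_eq)
qed

lemma search_next: "search_inv tf hf cm fo fi SK c 0 r \<Longrightarrow> r < nV \<Longrightarrow> cm r \<noteq> 0 \<Longrightarrow>
    search_inv tf hf cm fo fi SK c 0 (Suc r)"
  unfolding search_inv_def by (simp add: less_Suc_eq)

lemma search_pop:
  assumes inv: "search_inv tf hf cm fo fi SK c (Suc sp) r" and z: "fo (SK sp) = 0" "fi (SK sp) = 0"
  shows "search_inv tf hf cm fo fi SK c sp r"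
proof -
  have "u \<in> SK ` {..<sp} \<or> fo u = 0 \<and> fi u = 0" if "u < nV" "cm u \<noteq> 0" for u
  proof -
    have "u \<in> SK ` {..<Suc sp} \<or> fo u = 0 \<and> fi u = 0" using inv that by (simp add: search_inv_def)
    then show ?thesis using z by (auto simp: less_Suc_eq)
  qed
  then show ?thesis using inv unfolding search_inv_def by simp
qed

text \<open>With all lists exhausted, the numbers are constant along arcs, and equal numbers mean
  connected; so they label the components, and they fill \<open>{1..c}\<close>.\<close>

lemma search_final:
  assumes inv: "search_inv (tail G) (head G) cm fo fi SK c sp nV"
  shows "betti1 G + nV = nE + c"
proof -
  have sp: "sp = 0" using inv by (auto simp: search_inv_def)
  have "cm u \<in> {1..c}" if "u < nV" for u using inv that by (auto simp: search_inv_def Suc_le_eq)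
  then have im: "cm ` verts G = {1..c}" using inv by (auto simp: search_inv_def vertsG)
  have "betti1 G + card (verts G) = card (arcs G) + card (cm ` verts G)"
  proof (rule betti1_eq[OF fin_digraph])
    fix e assume "e \<in> arcs G"
    then have e: "e < nE" by (simp add: arcsG)
    then have "fo (tail G e) = 0" using inv sp tail_less[OF e] by (auto simp: search_inv_def)
    then show "cm (tail G e) = cm (head G e)" using inv e by (auto simp: search_inv_def half_search_def)
  next
    fix u v assume "u \<in> verts G" "v \<in> verts G" "cm u = cm v"
    then show "conn G u v" using inv by (auto simp: search_inv_def vertsG)
  qed
  then show ?thesis unfolding im by (simp add: vertsG arcsG)
qed

lemma search_init:
  "search_inv (tail G) (head G) (\<lambda>_. 0) (\<lambda>v. last_below (tail G) v nE) (\<lambda>v. last_below (head G) v nE) SK 0 0 0"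
proof -
  have "half_search t h' (\<lambda>_. 0) (\<lambda>v. last_below t v nE)" for t h'
    using last_below_le last_below_hit last_below_less[of t _ _ nE]
    by (auto simp: half_search_def) (meson leD)
  then show ?thesis by (simp add: search_inv_def)
qed


text \<open>Every round lowers this potential. An unseen vertex counts twice because visiting it
  also lengthens the stack by one.\<close>

definition search_pot :: "state \<Rightarrow> nat" where
  "search_pot s = (nV - var s ''r'') + 2 * unseen (arr s ''comp'') + var s ''sp'' +
     pending (tail G) (arr s ''fo'') + pending (head G) (arr s ''fi'')"

definition search_state :: "state \<Rightarrow> bool" where
  "search_state s \<longleftrightarrow> search_inv (tail G) (head G) (arr s ''comp'') (arr s ''fo'') (arr s ''fi'')
     (arr s ''SK'') (var s ''c'') (var s ''sp'') (var s ''r'')"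

text \<open>18 bounds the cost of one round, including the loop test, in both searches; the 2 pays
  for the final test.\<close>

lemma credit: "p' + 1 \<le> p \<Longrightarrow> 18 * p + 2 \<le> (j::nat) \<Longrightarrow> \<exists>K. j = 18 + K \<and> 18 * p' + 2 \<le> K"
  by (rule exI[of _ "j - 18"]) simp

lemma components_correct:
  assumes "inp s" "lists s nE" "arr s ''comp'' = (\<lambda>_. 0)"
  shows "wp components_prog (\<lambda>s' _. betti1 G + nV = nE + var s' ''c'') s (18 * (3 * nV + 2 * nE) + 5)"
  unfolding components_prog_def wp_simps
proof (intro conjI, simp, simp, simp, rule wp_Loop[where
      I = "\<lambda>s k. search_state s \<and> 18 * search_pot s + 2 \<le> k"], goal_cases)
  case 1
  have "unseen (\<lambda>_. 0) = nV" by (simp add: unseen_def)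
  moreover have "pending f g \<le> nE" for f g
    unfolding pending_def using card_mono[of "{..<nE}" "{e \<in> {..<nE}. e < g (f e)}"] by auto
  then have "pending (tail G) (arr s ''fo'') \<le> nE" "pending (head G) (arr s ''fi'') \<le> nE" by auto
  ultimately show ?case using assms search_init
    by (simp add: search_state_def search_pot_def lists_def)
next
  case (2 s' j)
  have inp: "inp s'" by (rule inp_frame[OF _ 2(2)]) (simp_all add: assms(1))
  have nxt: "arr s' ''nxtO'' e = last_below (tail G) (tail G e) e"
    "arr s' ''nxtI'' e = last_below (head G) (head G e) e" if "e < nE" for e
    using 2(2) assms(2) that by (auto simp: frame_def lists_def)
  define cm fo fi SK c sp r where defs: "cm = arr s' ''comp''" "fo = arr s' ''fo''" "fi = arr s' ''fi''"
    "SK = arr s' ''SK''" "c = var s' ''c''" "sp = var s' ''sp''" "r = var s' ''r''"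
  have inv: "search_inv (tail G) (head G) cm fo fi SK c sp r"
    using 2(1) by (simp add: search_state_def defs)
  have pot: "search_pot s' = (nV - r) + 2 * unseen cm + sp + pending (tail G) fo + pending (head G) fi"
    by (simp add: search_pot_def defs)
  have j: "18 * search_pot s' + 2 \<le> j" using 2(1) by simp
  have r: "r < nV" using 2(3) inp by (simp add: inp_def defs)
  note unf = wp_simps search_state_def search_pot_def defs[symmetric]
  let ?P = "\<lambda>d f sp g h. d + 2 * unseen f + sp + pending (tail G) g + pending (head G) h"
  show ?case
  proof (cases "sp = 0")
    case sp: True
    show ?thesis
    proof (cases "cm r = 0")
      case True
      have new: "search_inv (tail G) (head G) (cm(r := Suc c)) fo fi (SK(0 := r)) (Suc c) 1 r"
        using search_root inv sp r True by simp
      have extra: "unseen (cm(r := Suc c)) + 1 = unseen cm" using True r by (intro unseen_visit) auto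
      have "?P (nV - r) (cm(r := Suc c)) 1 fo fi + 1 \<le> search_pot s'" using pot sp extra by simp
      from credit[OF this j] obtain K where K: "j = 18 + K" "18 * (?P (nV - r) (cm(r := Suc c)) 1 fo fi) + 2 \<le> K" by blast
      show ?thesis unfolding K(1) using K(2) new True sp by (simp add: unf)
    next
      case False
      have new: "search_inv (tail G) (head G) cm fo fi SK c 0 (Suc r)"
        using search_next inv sp r False by simp
      have extra: "nV - r = Suc (nV - Suc r)" using r by simp
      have "?P (nV - Suc r) cm 0 fo fi + 1 \<le> search_pot s'" using pot sp extra by simp
      from credit[OF this j] obtain K where K: "j = 18 + K" "18 * (?P (nV - Suc r) cm 0 fo fi) + 2 \<le> K" by blast
      show ?thesis unfolding K(1) using K(2) new False sp by (simp add: unf)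
    qed
  next
    case sp: False
    define v where "v = SK (sp - 1)"
    have v: "v < nV" "cm v = c" "c > 0" using inv sp by (auto simp: search_inv_def v_def)
    have vst: "SK (sp - Suc 0) = v" by (simp add: v_def)
    show ?thesis
    proof (cases "fo v = 0")
      case fo: False
      have arc: "fo v \<le> nE \<and> tail G (fo v - 1) = v"
          using fo inv v(1) by (simp add: search_inv_def half_search_def)
        define e where "e = fo v - 1"
      have e: "fo v = Suc e" "e < nE" "tail G e = v" "fo v - Suc 0 = e"
        using fo arc by (auto simp: e_def)
      define y where "y = head G e"
      have y: "y < nV" using e by (simp add: y_def)
      have ld: "arr s' ''Gamma_head'' e = y" using inp e by (simp add: inp_def y_def)
      have pd: "pending (tail G) (fo(v := last_below (tail G) v e)) + 1 \<le> pending (tail G) fo"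
        by (rule pending_advance) (use e in auto)
      show ?thesis
      proof (cases "cm y = 0")
        case True
        have "conn G y v" using conn_arc'[of e G] e by (simp add: arcsG y_def)
        then have "search_inv (tail G) (head G) (cm(y := c)) fo fi (SK(sp := y)) c (Suc sp) r"
          using search_visit[OF inv y True] v sp by blast
        then have new: "search_inv (tail G) (head G) (cm(y := c)) (fo(v := last_below (tail G) v e)) fi (SK(sp := y)) c (Suc sp) r"
          using search_advance[of _ _ _ fo _ _ _ _ _ e] e v by (fastforce simp: y_def)
        have extra: "unseen (cm(y := c)) + 1 = unseen cm" using True y v by (intro unseen_visit) auto
        have "?P (nV - r) (cm(y := c)) (Suc sp) (fo(v := last_below (tail G) v e)) fi + 1 \<le> search_pot s'" using pot sp extra pd by simp
        from credit[OF this j] obtain K where K: "j = 18 + K" "18 * (?P (nV - r) (cm(y := c)) (Suc sp) (fo(v := last_below (tail G) v e)) fi) + 2 \<le> K" by blast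
        show ?thesis unfolding K(1) using K(2) new sp vst e fo ld True nxt[OF e(2)] by (simp add: unf)
      next
        case False
        then have "cm y = c" using search_seen[OF inv e(2)] e v y by (simp add: y_def)
        then have new: "search_inv (tail G) (head G) cm (fo(v := last_below (tail G) v e)) fi SK c sp r"
          using search_advance[OF inv e(2)] e v by (simp add: y_def)
        have "?P (nV - r) cm sp (fo(v := last_below (tail G) v e)) fi + 1 \<le> search_pot s'" using pot sp pd by simp
        from credit[OF this j] obtain K where K: "j = 18 + K" "18 * (?P (nV - r) cm sp (fo(v := last_below (tail G) v e)) fi) + 2 \<le> K" by blast
        show ?thesis unfolding K(1) using K(2) new sp vst e fo ld False nxt[OF e(2)] by (simp add: unf)
      qed
    next
      case fo: True
      show ?thesis
      proof (cases "fi v = 0")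
        case fi: False
        have arc: "fi v \<le> nE \<and> head G (fi v - 1) = v"
          using fi inv v(1) by (simp add: search_inv_def half_search_def)
        define e where "e = fi v - 1"
        have e: "fi v = Suc e" "e < nE" "head G e = v" "fi v - Suc 0 = e"
          using fi arc by (auto simp: e_def)
        define y where "y = tail G e"
        have y: "y < nV" using e by (simp add: y_def)
        have ld: "arr s' ''Gamma_tail'' e = y" using inp e by (simp add: inp_def y_def)
        have pd: "pending (head G) (fi(v := last_below (head G) v e)) + 1 \<le> pending (head G) fi"
          by (rule pending_advance) (use e in auto)
        note inv' = inv[THEN search_swap[THEN iffD1]]
        show ?thesis
        proof (cases "cm y = 0")
          case True
          have "conn G y v" using conn_arc[of e G] e by (simp add: arcsG y_def)
          then have "search_inv (head G) (tail G) (cm(y := c)) fi fo (SK(sp := y)) c (Suc sp) r"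
            using search_visit[OF inv' y True] v sp by blast
          then have "search_inv (head G) (tail G) (cm(y := c)) (fi(v := last_below (head G) v e)) fo (SK(sp := y)) c (Suc sp) r"
            using search_advance[of _ _ _ fi _ _ _ _ _ e] e v by (fastforce simp: y_def)
          then have new: "search_inv (tail G) (head G) (cm(y := c)) fo (fi(v := last_below (head G) v e)) (SK(sp := y)) c (Suc sp) r"
            by (rule search_swap[THEN iffD1])
          have extra: "unseen (cm(y := c)) + 1 = unseen cm" using True y v by (intro unseen_visit) auto
          have "?P (nV - r) (cm(y := c)) (Suc sp) fo (fi(v := last_below (head G) v e)) + 1 \<le> search_pot s'" using pot sp extra pd by simp
          from credit[OF this j] obtain K where K: "j = 18 + K" "18 * (?P (nV - r) (cm(y := c)) (Suc sp) fo (fi(v := last_below (head G) v e))) + 2 \<le> K" by blast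
          show ?thesis unfolding K(1) using K(2) new sp vst e fo fi ld True nxt[OF e(2)] by (simp add: unf)
        next
          case False
          then have "cm y = c" using search_seen[OF inv' e(2)] e v y by (simp add: y_def)
          then have "search_inv (head G) (tail G) cm (fi(v := last_below (head G) v e)) fo SK c sp r"
            using search_advance[OF inv' e(2)] e v by (simp add: y_def)
          then have new: "search_inv (tail G) (head G) cm fo (fi(v := last_below (head G) v e)) SK c sp r"
            by (rule search_swap[THEN iffD1])
          have "?P (nV - r) cm sp fo (fi(v := last_below (head G) v e)) + 1 \<le> search_pot s'" using pot sp pd by simp
          from credit[OF this j] obtain K where K: "j = 18 + K" "18 * (?P (nV - r) cm sp fo (fi(v := last_below (head G) v e))) + 2 \<le> K" by blast
          show ?thesis unfolding K(1) using K(2) new sp vst e fo fi ld False nxt[OF e(2)] by (simp add: unf)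
        qed
      next
        case fi: True
        have new: "search_inv (tail G) (head G) cm fo fi SK c (sp - 1) r"
          by (rule search_pop) (use inv sp fo fi in \<open>simp_all add: v_def\<close>)
        have "?P (nV - r) cm (sp - 1) fo fi + 1 \<le> search_pot s'" using pot sp  by simp
        from credit[OF this j] obtain K where K: "j = 18 + K" "18 * (?P (nV - r) cm (sp - 1) fo fi) + 2 \<le> K" by blast
        show ?thesis unfolding K(1) using K(2) new sp vst fo fi v by (simp add: unf)
      qed
    qed
  qed
next
  case (3 s' j)
  have inp: "inp s'" by (rule inp_frame[OF _ 3(2)]) (simp_all add: assms(1))
  have "var s' ''r'' = nV" using 3 inp by (auto simp: search_state_def search_inv_def inp_def)
  then have "search_inv (tail G) (head G) (arr s' ''comp'') (arr s' ''fo'') (arr s' ''fi'') (arr s' ''SK'')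
      (var s' ''c'') (var s' ''sp'') nV"
    using 3(1) by (simp add: search_state_def)
  then show ?case using 3(1) search_final by simp
qed

end

text \<open>The accessible part of the relation from tail to head: the vertices from which no
  infinite walk starts. Cycles therefore avoid it.\<close>

inductive dead_end :: "('v, 'e) pre_digraph \<Rightarrow> 'v \<Rightarrow> bool" for G where
  "(\<And>e. e \<in> arcs G \<Longrightarrow> tail G e = v \<Longrightarrow> dead_end G (head G e)) \<Longrightarrow> dead_end G v"

definition explore_prog :: com where
  "explore_prog = Move ''r'' (Const 0) ;; Move ''sp'' (Const 0) ;;
    Loop (Less (Var ''r'') (Var ''Gamma_verts''))
     (Branch (Equal (Var ''sp'') (Const 0))
       (Load ''x'' ''st'' (Var ''r'') ;;
        Branch (Equal (Var ''x'') (Const 0))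
          (Store ''st'' (Var ''r'') (Const 2) ;;
           Store ''SK'' (Const 0) (Var ''r'') ;; Move ''sp'' (Const 1))
          (Add ''r'' (Var ''r'') (Const 1)))
       (Sub ''q'' (Var ''sp'') (Const 1) ;; Load ''v'' ''SK'' (Var ''q'') ;;
        Load ''p'' ''first'' (Var ''v'') ;;
        Branch (Equal (Var ''p'') (Const 0))
          (Store ''st'' (Var ''v'') (Const 1) ;; Move ''sp'' (Var ''q''))
          (Sub ''e'' (Var ''p'') (Const 1) ;; Load ''y'' ''Gamma_head'' (Var ''e'') ;;
           Load ''z'' ''st'' (Var ''y'') ;;
           Branch (Equal (Var ''z'') (Const 0))
             (Store ''st'' (Var ''y'') (Const 2) ;; Store ''SK'' (Var ''sp'') (Var ''y'') ;;
              Add ''sp'' (Var ''sp'') (Const 1))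
             (Branch (Equal (Var ''z'') (Const 1))
               (Load ''x'' ''nxtO'' (Var ''e'') ;; Store ''first'' (Var ''v'') (Var ''x''))
               (Branch (Equal (Var ''z'') (Const 2))
                 (Store ''C'' (Var ''v'') (Var ''y'') ;; Store ''st'' (Var ''v'') (Const 3) ;;
                  Move ''sp'' (Var ''q''))
                 (Load ''x'' ''C'' (Var ''y'') ;; Store ''C'' (Var ''v'') (Var ''x'') ;;
                  Store ''st'' (Var ''v'') (Const 3) ;; Move ''sp'' (Var ''q'')))))))"

context labelled_graph begin

text \<open>The states of a vertex are 0 (unvisited), 1 (dead end), 2 (on the stack) and 3 (live). The
  arc \<open>first v - 1\<close> is the current arc of \<open>v\<close>, and the chosen one if \<open>v\<close> is live. As soon as a live vertex
  has its chosen head on the stack, the stack unwinds completely: all its vertices become live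
  with the same root \<open>C\<close>.\<close>

definition next_vert :: "(nat \<Rightarrow> nat) \<Rightarrow> nat \<Rightarrow> nat" where
  "next_vert first v = head G (first v - 1)"

text \<open>The top of the stack points to a live vertex with root \<open>y\<close>. From now on
  each round pops one vertex and passes \<open>y\<close> on, until the stack is empty.\<close>

definition unwinding ::
    "(nat \<Rightarrow> nat) \<Rightarrow> (nat \<Rightarrow> nat) \<Rightarrow> (nat \<Rightarrow> nat) \<Rightarrow> (nat \<Rightarrow> nat) \<Rightarrow> nat \<Rightarrow> nat \<Rightarrow> bool" where
  "unwinding first st C SK sp y \<longleftrightarrow> sp > 0 \<and> first (SK (sp - 1)) \<noteq> 0 \<and>
     st (next_vert first (SK (sp - 1))) = 3 \<and> C (next_vert first (SK (sp - 1))) = y"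

definition chosen_step :: "(nat \<Rightarrow> nat) \<Rightarrow> (nat \<Rightarrow> nat) \<Rightarrow> nat \<Rightarrow> nat \<Rightarrow> bool" where
  "chosen_step first st u w \<longleftrightarrow> st u = 3 \<and> w = next_vert first u"

text \<open>The alternatives with state 2 occur only during an unwinding: the root was met on the
  stack and has not yet been popped. When it is popped it becomes its own root.\<close>

definition live_ok ::
    "(nat \<Rightarrow> nat) \<Rightarrow> (nat \<Rightarrow> nat) \<Rightarrow> (nat \<Rightarrow> nat) \<Rightarrow> (nat \<Rightarrow> nat) \<Rightarrow> nat \<Rightarrow> nat \<Rightarrow> bool" where
  "live_ok first st C SK sp u \<longleftrightarrow> first u \<noteq> 0 \<and> C u < nV \<and>
     (st (next_vert first u) = 3 \<and> C (next_vert first u) = C u \<or>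
      st (next_vert first u) = 2 \<and> C u = next_vert first u \<and> unwinding first st C SK sp (C u)) \<and>
     (st (C u) = 3 \<and> C (C u) = C u \<or> st (C u) = 2 \<and> unwinding first st C SK sp (C u)) \<and>
     (chosen_step first st)\<^sup>*\<^sup>* u (C u)"

text \<open>The stack is a path of current arcs. The condition
  \<open>first (tail G e) \<le> e\<close> singles out the arcs that were already skipped.\<close>

definition explore_inv ::
    "(nat \<Rightarrow> nat) \<Rightarrow> (nat \<Rightarrow> nat) \<Rightarrow> (nat \<Rightarrow> nat) \<Rightarrow> (nat \<Rightarrow> nat) \<Rightarrow> nat \<Rightarrow> nat \<Rightarrow> bool" where
  "explore_inv first st C SK sp r \<longleftrightarrow>
     r \<le> nV \<and> (\<forall>u<r. st u \<noteq> 0) \<and> (sp > 0 \<longrightarrow> r < nV) \<and>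
     (\<forall>u<nV. st u \<le> 3) \<and>
     (\<forall>j<sp. SK j < nV \<and> st (SK j) = 2) \<and> inj_on SK {..<sp} \<and>
     (\<forall>u<nV. st u = 2 \<longrightarrow> u \<in> SK ` {..<sp}) \<and>
     (\<forall>j. Suc j < sp \<longrightarrow> first (SK j) \<noteq> 0 \<and> next_vert first (SK j) = SK (Suc j)) \<and>
     (\<forall>u<nV. first u \<noteq> 0 \<longrightarrow> first u \<le> nE \<and> tail G (first u - 1) = u) \<and>
     (\<forall>e<nE. first (tail G e) \<le> e \<longrightarrow> dead_end G (head G e)) \<and>
     (\<forall>u<nV. st u = 1 \<longrightarrow> dead_end G u) \<and>
     (\<forall>u<nV. st u = 3 \<longrightarrow> live_ok first st C SK sp u)"

lemma next_vert_less: "explore_inv first st C SK sp r \<Longrightarrow> u < nV \<Longrightarrow> first u \<noteq> 0 \<Longrightarrow> next_vert first u < nV"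
proof -
  assume "explore_inv first st C SK sp r" "u < nV" "first u \<noteq> 0"
  then have "first u \<le> nE" unfolding explore_inv_def by blast
  then have "first u - 1 < nE" using \<open>first u \<noteq> 0\<close> by simp
  then show ?thesis unfolding next_vert_def by (rule head_less)
qed

text \<open>Outside an unwinding, live vertices refer only to live vertices, so changes elsewhere
  cannot affect them.\<close>

lemma live_ok_settled:
  assumes ok: "live_ok first st C SK sp u" and nu: "\<And>y. \<not> unwinding first st C SK sp y"
    and f: "\<And>w. st w = 3 \<Longrightarrow> first' w = first w" and u: "st u = 3"
    and st: "\<And>w. st w = 3 \<Longrightarrow> st' w = 3 \<and> C' w = C w"
  shows "live_ok first' st' C' SK' sp' u"
proof -
  have a: "st (next_vert first u) = 3" "C (next_vert first u) = C u" "st (C u) = 3" "C (C u) = C u"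
    "first u \<noteq> 0" "C u < nV" "(chosen_step first st)\<^sup>*\<^sup>* u (C u)"
    using ok nu by (simp_all add: live_ok_def)
  have nx: "next_vert first' w = next_vert first w" if "st w = 3" for w
    using f[OF that] by (simp add: next_vert_def)
  have "chosen_step first st \<le> chosen_step first' st'"
    using nx st by (auto simp: chosen_step_def)
  from rtranclp_mono[OF this] have "(chosen_step first' st')\<^sup>*\<^sup>* u (C u)" using a(7) by blast
  then show ?thesis using a st[OF u] st[OF a(1)] st[OF a(3)] f[OF u] nx[OF u] by (simp add: live_ok_def)
qed

lemma stack_inj: "explore_inv first st C SK sp r \<Longrightarrow> inj_on SK {..<sp}"
  by (simp add: explore_inv_def)

lemma stack_distinct:
  assumes "explore_inv first st C SK (Suc q) r" "j < q" shows "SK j \<noteq> SK q"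
  using inj_onD[OF stack_inj[OF assms(1)], of j q] assms(2) by auto

lemma current_arc:
  assumes "explore_inv first st C SK sp r" "v < nV" "first v = Suc e"
  shows "e < nE \<and> tail G e = v"
proof -
  have "first v \<noteq> 0" using assms(3) by simp
  then have "first v \<le> nE \<and> tail G (first v - 1) = v"
    using assms(1,2) unfolding explore_inv_def by blast
  then show ?thesis using assms(3) by simp
qed

lemma explore_root:
  assumes inv: "explore_inv first st C SK 0 r" and r: "r < nV" "st r = 0"
  shows "explore_inv first (st(r := 2)) C (SK(0 := r)) 1 r"
proof -
  have nu: "\<not> unwinding first st C SK 0 y" for y by (simp add: unwinding_def)
  have two: "st u \<noteq> 2" if "u < nV" for u using inv that by (auto simp: explore_inv_def)
  have live: "live_ok first (st(r := 2)) C (SK(0 := r)) 1 u" if u: "u < nV" "(st(r := 2)) u = 3" for u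
  proof -
    have "st u = 3" using u by (simp split: if_splits)
    then have "live_ok first st C SK 0 u" using inv u by (simp add: explore_inv_def)
    then show ?thesis by (rule live_ok_settled[OF _ nu]) (use r \<open>st u = 3\<close> in auto)
  qed
  show ?thesis
    unfolding explore_inv_def
  proof (intro conjI)
    show "\<forall>u<nV. (st(r := 2)) u = 3 \<longrightarrow> live_ok first (st(r := 2)) C (SK(0 := r)) 1 u" using live by blast
    show "\<forall>u<nV. (st(r := 2)) u = 2 \<longrightarrow> u \<in> (SK(0 := r)) ` {..<1}" using two by auto
    show "inj_on (SK(0 := r)) {..<1}" by (auto simp: inj_on_def)
  qed (use inv r in \<open>simp_all add: explore_inv_def\<close>)
qed

lemma explore_next:
  assumes "explore_inv first st C SK 0 r" "r < nV" "st r \<noteq> 0"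
  shows "explore_inv first st C SK 0 (Suc r)"
  using assms unfolding explore_inv_def by (simp add: less_Suc_eq)

text \<open>An exhausted list means that every out-arc of \<open>v\<close> was skipped, so all its
  heads are dead ends.\<close>

lemma explore_dead:
  assumes inv: "explore_inv first st C SK (Suc q) r" and v: "v = SK q" and f: "first v = 0"
  shows "explore_inv first (st(v := 1)) C SK q r"
proof -
  have nu: "\<not> unwinding first st C SK (Suc q) y" for y using f v by (simp add: unwinding_def)
  have v': "v < nV" "st v = 2" using inv v by (simp_all add: explore_inv_def)
  have inj: "SK j \<noteq> v" if "j < q" for j
    using stack_distinct[OF inv that] v by simp
  have live: "live_ok first (st(v := 1)) C SK q u" if u: "u < nV" "(st(v := 1)) u = 3" for u
  proof -
    have "st u = 3" using u by (simp split: if_splits)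
    then have "live_ok first st C SK (Suc q) u" using inv u by (simp add: explore_inv_def)
    then show ?thesis by (rule live_ok_settled[OF _ nu]) (use v' \<open>st u = 3\<close> in auto)
  qed
  have dead: "dead_end G v"
  proof (rule dead_end.intros)
    fix e assume "e \<in> arcs G" "tail G e = v"
    then have "e < nE" "first (tail G e) \<le> e" using f by (simp_all add: arcsG)
    then show "dead_end G (head G e)" using inv by (simp add: explore_inv_def)
  qed
  have two: "u \<in> SK ` {..<q}" if "u < nV" "(st(v := 1)) u = 2" for u
  proof -
    have "st u = 2" "u \<noteq> v" using that by (auto split: if_splits)
    then have "u \<in> SK ` {..<Suc q}" using inv that by (simp add: explore_inv_def)
    then show ?thesis using v \<open>u \<noteq> v\<close> by (auto simp: less_Suc_eq)
  qed
  show ?thesis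
    unfolding explore_inv_def
  proof (intro conjI)
    show "\<forall>u<nV. (st(v := 1)) u = 3 \<longrightarrow> live_ok first (st(v := 1)) C SK q u" using live by blast
    show "\<forall>u<nV. (st(v := 1)) u = 2 \<longrightarrow> u \<in> SK ` {..<q}" using two by blast
    show "\<forall>u<nV. (st(v := 1)) u = 1 \<longrightarrow> dead_end G u" using inv dead by (simp add: explore_inv_def)
    show "inj_on SK {..<q}" by (rule inj_on_subset[OF stack_inj[OF inv]]) auto
    show "\<forall>j<q. SK j < nV \<and> (st(v := 1)) (SK j) = 2" using inv inj by (simp add: explore_inv_def)
  qed (use inv in \<open>simp_all add: explore_inv_def\<close>)
qed

lemma explore_push:
  assumes inv: "explore_inv first st C SK (Suc q) r" and v: "v = SK q" and f: "first v \<noteq> 0"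
    and y: "y = next_vert first v" "st y = 0"
  shows "explore_inv first (st(y := 2)) C (SK(Suc q := y)) (Suc (Suc q)) r"
proof -
  have nu: "\<not> unwinding first st C SK (Suc q) y" for y using y v by (simp add: unwinding_def)
  have v': "v < nV" "st v = 2" using inv v by (simp_all add: explore_inv_def)
  have yV: "y < nV" using next_vert_less[OF inv v'(1) f] y by simp
  have live: "live_ok first (st(y := 2)) C (SK(Suc q := y)) (Suc (Suc q)) u" if u: "u < nV" "(st(y := 2)) u = 3" for u
  proof -
    have "st u = 3" using u by (simp split: if_splits)
    then have "live_ok first st C SK (Suc q) u" using inv u by (simp add: explore_inv_def)
    then show ?thesis by (rule live_ok_settled[OF _ nu]) (use y \<open>st u = 3\<close> in auto)
  qed
  have SK2: "st (SK j) = 2" if "j < Suc q" for j using inv that by (simp add: explore_inv_def)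
  have two: "u \<in> (SK(Suc q := y)) ` {..<Suc (Suc q)}" if "u < nV" "(st(y := 2)) u = 2" for u
  proof (cases "u = y")
    case True then show ?thesis by (intro image_eqI[of _ _ "Suc q"]) auto
  next
    case False
    then have "st u = 2" using that by simp
    then have "u \<in> SK ` {..<Suc q}" using inv that by (simp add: explore_inv_def)
    then obtain j where "j < Suc q" "u = SK j" by auto
    then show ?thesis by (intro image_eqI[of _ _ j]) auto
  qed
  have inj: "inj_on (SK(Suc q := y)) {..<Suc (Suc q)}"
  proof -
    have "inj_on SK {..<Suc q}" using inv by (simp add: explore_inv_def)
    then have "inj_on (SK(Suc q := y)) {..<Suc q}" by (simp add: inj_on_def)
    moreover have "y \<notin> (SK(Suc q := y)) ` {..<Suc q}" using SK2 y(2) by force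
    ultimately show ?thesis unfolding lessThan_Suc[of "Suc q"] by simp
  qed
  have chain: "\<forall>j. Suc j < Suc (Suc q) \<longrightarrow> first ((SK(Suc q := y)) j) \<noteq> 0 \<and>
      next_vert first ((SK(Suc q := y)) j) = (SK(Suc q := y)) (Suc j)"
  proof (intro allI impI)
    fix j assume "Suc j < Suc (Suc q)"
    then have "j \<le> q" by simp
    then consider "j = q" | "Suc j < Suc q" by linarith
    then show "first ((SK(Suc q := y)) j) \<noteq> 0 \<and> next_vert first ((SK(Suc q := y)) j) = (SK(Suc q := y)) (Suc j)"
    proof cases
      case 1 then show ?thesis using f v y by simp
    next
      case 2 then show ?thesis using inv by (simp add: explore_inv_def)
    qed
  qed
  show ?thesis
    unfolding explore_inv_def
  proof (intro conjI chain inj)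
    show "\<forall>u<nV. (st(y := 2)) u = 3 \<longrightarrow> live_ok first (st(y := 2)) C (SK(Suc q := y)) (Suc (Suc q)) u" using live by blast
    show "\<forall>u<nV. (st(y := 2)) u = 2 \<longrightarrow> u \<in> (SK(Suc q := y)) ` {..<Suc (Suc q)}" using two by blast
    show "\<forall>j<Suc (Suc q). (SK(Suc q := y)) j < nV \<and> (st(y := 2)) ((SK(Suc q := y)) j) = 2"
      using inv yV SK2 by (simp add: explore_inv_def less_Suc_eq)
  qed (use inv in \<open>simp_all add: explore_inv_def\<close>)
qed

text \<open>The list of \<open>v\<close> runs downwards without gaps, so arcs of \<open>v\<close>
  below \<open>e\<close> remain to be scanned and \<open>e\<close> is the only newly skipped
  one.\<close>

lemma explore_advance:
  assumes inv: "explore_inv first st C SK (Suc q) r" and v: "v = SK q" and f: "first v = Suc e"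
    and y: "st (head G e) = 1"
  shows "explore_inv (first(v := last_below (tail G) v e)) st C SK (Suc q) r"
proof -
  let ?first = "first(v := last_below (tail G) v e)"
  have nv: "next_vert first v = head G e" using f by (simp add: next_vert_def)
  have nu: "\<not> unwinding first st C SK (Suc q) y" for y using y nv v by (simp add: unwinding_def)
  have v': "v < nV" "st v = 2" using inv v by (simp_all add: explore_inv_def)
  have e: "e < nE" "tail G e = v" using current_arc[OF inv v'(1) f] by simp_all
  have live: "live_ok ?first st C SK (Suc q) u" if u: "u < nV" "st u = 3" for u
  proof -
    have "live_ok first st C SK (Suc q) u" using inv u by (simp add: explore_inv_def)
    then show ?thesis by (rule live_ok_settled[OF _ nu]) (use v' u in auto)
  qed
  have inj: "SK j \<noteq> v" if "j < q" for j
    using stack_distinct[OF inv that] v by simp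
  have dead: "dead_end G (head G i)" if i: "i < nE" "?first (tail G i) \<le> i" for i
  proof (cases "tail G i = v")
    case True
    consider "i < e" | "i = e" | "e < i" by linarith
    then show ?thesis
    proof cases
      case 1
      then have "i < last_below (tail G) v e" using True by (intro last_below_less)
      then show ?thesis using i True by simp
    next
      case 2
      then show ?thesis using inv y e head_less[OF e(1)] by (simp add: explore_inv_def)
    next
      case 3
      then have "first (tail G i) \<le> i" using True f by simp
      then show ?thesis using inv i by (simp add: explore_inv_def)
    qed
  next
    case False
    then show ?thesis using inv i by (simp add: explore_inv_def)
  qed
  have lb: "last_below (tail G) v e \<le> nE" "last_below (tail G) v e \<noteq> 0 \<Longrightarrow> tail G (last_below (tail G) v e - 1) = v"
    using last_below_le[of "tail G" v e] e last_below_hit[of "tail G" v e] by simp_all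
  have nx: "next_vert ?first (SK j) = next_vert first (SK j)" if "j < q" for j
    using inj[OF that] by (simp add: next_vert_def)
  show ?thesis
    unfolding explore_inv_def
  proof (intro conjI)
    show "\<forall>u<nV. st u = 3 \<longrightarrow> live_ok ?first st C SK (Suc q) u" using live by blast
    show "\<forall>i<nE. ?first (tail G i) \<le> i \<longrightarrow> dead_end G (head G i)" using dead by blast
    show "\<forall>u<nV. ?first u \<noteq> 0 \<longrightarrow> ?first u \<le> nE \<and> tail G (?first u - 1) = u"
      using inv lb by (simp add: explore_inv_def)
    show "\<forall>j. Suc j < Suc q \<longrightarrow> ?first (SK j) \<noteq> 0 \<and> next_vert ?first (SK j) = SK (Suc j)"
      using inv nx inj by (simp add: explore_inv_def)
  qed (use inv in \<open>simp_all add: explore_inv_def\<close>)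
qed

text \<open>Here \<open>c\<close> is the common root of all the vertices that the unwinding of the stack makes live.\<close>

lemma explore_live:
  assumes inv: "explore_inv first st C SK (Suc q) r" and v: "v = SK q" and f: "first v \<noteq> 0"
    and y: "y = next_vert first v"
    and c: "st y = 2 \<and> c = y \<or> st y = 3 \<and> c = C y"
  shows "explore_inv first (st(v := 3)) (C(v := c)) SK q r"
proof -
  let ?st = "st(v := 3)" and ?C = "C(v := c)"
  have v': "v < nV" "st v = 2" using inv v by (simp_all add: explore_inv_def)
  have yV: "y < nV" using next_vert_less[OF inv v'(1) f] y by simp
  have inj: "SK j \<noteq> v" if "j < q" for j
    using stack_distinct[OF inv that] v by simp
  have two: "u \<in> SK ` {..<q}" if "u < nV" "st u = 2" "u \<noteq> v" for u
  proof -
    have "u \<in> SK ` {..<Suc q}" using inv that by (simp add: explore_inv_def)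
    then show ?thesis using v that by (auto simp: less_Suc_eq)
  qed
  have unw: "unwinding first st C SK (Suc q) a \<Longrightarrow> st y = 3 \<and> a = c" for a
    using y v c by (auto simp: unwinding_def)
  \<comment> \<open>A vertex still on the stack shows that the popped stack is nonempty; its new top
    points to \<open>v\<close>, which is now live with root \<open>c\<close>.\<close>
  have unw': "unwinding first ?st ?C SK q c" if "u < nV" "st u = 2" "u \<noteq> v" for u
  proof -
    from two[OF that] obtain j where "j < q" by auto
    then obtain q' where q': "q = Suc q'" by (cases q) auto
    then have "first (SK q') \<noteq> 0" "next_vert first (SK q') = v"
      using inv v by (simp_all add: explore_inv_def)
    then show ?thesis using q' by (simp add: unwinding_def)
  qed
  have mono: "(chosen_step first ?st)\<^sup>*\<^sup>* a b" if "(chosen_step first st)\<^sup>*\<^sup>* a b" for a b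
  proof -
    have "chosen_step first st \<le> chosen_step first ?st" by (auto simp: chosen_step_def)
    from rtranclp_mono[OF this] show ?thesis using that by blast
  qed
  have cok: "c < nV" "?st c = 3 \<and> ?C c = c \<or> ?st c = 2 \<and> unwinding first ?st ?C SK q c"
    "(chosen_step first ?st)\<^sup>*\<^sup>* v c"
  proof -
    have step: "chosen_step first ?st v y" by (simp add: chosen_step_def y)
    have "c < nV \<and> (?st c = 3 \<and> ?C c = c \<or> ?st c = 2 \<and> unwinding first ?st ?C SK q c) \<and>
      (chosen_step first ?st)\<^sup>*\<^sup>* y c"
    proof (cases "st y = 2")
      case True
      then have cy: "c = y" using c by simp
      then show ?thesis
      proof (cases "y = v")
        case True then show ?thesis using cy yV by simp
      next
        case False then show ?thesis using cy yV \<open>st y = 2\<close> unw'[OF yV \<open>st y = 2\<close>] by simp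
      qed
    next
      case False
      then have y3: "st y = 3" "c = C y" using c by auto
      then have ok: "live_ok first st C SK (Suc q) y" using inv yV by (simp add: explore_inv_def)
      have cV: "c < nV" using ok y3 by (simp add: live_ok_def)
      have r: "(chosen_step first ?st)\<^sup>*\<^sup>* y c" using ok y3 mono by (simp add: live_ok_def)
      have "st c = 3 \<and> C c = c \<or> st c = 2" using ok y3 by (auto simp: live_ok_def)
      then show ?thesis
      proof
        assume "st c = 3 \<and> C c = c"
        then show ?thesis using cV r v' by auto
      next
        assume c2: "st c = 2"
        show ?thesis
        proof (cases "c = v")
          case True then show ?thesis using cV r by simp
        next
          case False then show ?thesis using c2 unw'[OF cV c2] cV r by simp
        qed
      qed
    qed
    then show "c < nV" "?st c = 3 \<and> ?C c = c \<or> ?st c = 2 \<and> unwinding first ?st ?C SK q c"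
      "(chosen_step first ?st)\<^sup>*\<^sup>* v c"
      using converse_rtranclp_into_rtranclp[of "chosen_step first ?st", OF step] by simp_all
  qed
  have live: "live_ok first ?st ?C SK q u" if u: "u < nV" "?st u = 3" for u
  proof (cases "u = v")
    case True
    have "?st y = 3 \<and> ?C y = c \<or> ?st y = 2 \<and> c = y \<and> unwinding first ?st ?C SK q c"
      using c unw'[OF yV] by (cases "y = v") auto
    then show ?thesis using True cok f by (simp add: live_ok_def y[symmetric])
  next
    case False
    then have u3: "st u = 3" using u by simp
    then have ok: "live_ok first st C SK (Suc q) u" using inv u by (simp add: explore_inv_def)
    define w where "w = next_vert first u"
    have base: "first u \<noteq> 0" "C u < nV" "(chosen_step first ?st)\<^sup>*\<^sup>* u (C u)"
      using ok mono by (simp_all add: live_ok_def)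
    have wV: "w < nV" using next_vert_less[OF inv u(1) base(1)] by (simp add: w_def)
    have 1: "?st w = 3 \<and> ?C w = C u \<or> ?st w = 2 \<and> C u = w \<and> unwinding first ?st ?C SK q (C u)"
    proof (cases "st w = 3")
      case True
      then have "w \<noteq> v" using v' by auto
      then show ?thesis using ok True by (simp add: live_ok_def w_def[symmetric])
    next
      case F: False
      then have w2: "st w = 2" "C u = w" "unwinding first st C SK (Suc q) (C u)"
        using ok by (auto simp: live_ok_def w_def[symmetric])
      then have cu: "C u = c" using unw by blast
      show ?thesis
      proof (cases "w = v")
        case True then show ?thesis using cu by simp
      next
        case False then show ?thesis using w2 cu unw'[OF wV w2(1)] by simp
      qed
    qed
    have 2: "?st (C u) = 3 \<and> ?C (C u) = C u \<or> ?st (C u) = 2 \<and> unwinding first ?st ?C SK q (C u)"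
    proof (cases "st (C u) = 3")
      case True
      then have "C u \<noteq> v" using v' by auto
      then show ?thesis using ok True by (simp add: live_ok_def)
    next
      case F: False
      then have w2: "st (C u) = 2" "unwinding first st C SK (Suc q) (C u)"
        using ok by (simp_all add: live_ok_def)
      then have "C u = c" using unw by blast
      then show ?thesis using cok(2) by simp
    qed
    show ?thesis using base 1 2 False by (simp add: live_ok_def w_def[symmetric])
  qed
  show ?thesis
    unfolding explore_inv_def
  proof (intro conjI)
    show "\<forall>u<nV. ?st u = 3 \<longrightarrow> live_ok first ?st ?C SK q u" using live by blast
    show "\<forall>u<nV. ?st u = 2 \<longrightarrow> u \<in> SK ` {..<q}" using two by simp
    show "inj_on SK {..<q}" by (rule inj_on_subset[OF stack_inj[OF inv]]) auto
    show "\<forall>j<q. SK j < nV \<and> ?st (SK j) = 2" using inv inj by (simp add: explore_inv_def)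
  qed (use inv in \<open>simp_all add: explore_inv_def\<close>)
qed

lemma explore_init: "explore_inv (\<lambda>v. last_below (tail G) v nE) (\<lambda>_. 0) C SK 0 0"
proof -
  have "\<not> last_below (tail G) (tail G e) nE \<le> e" if "e < nE" for e
    using last_below_less[of "tail G" e _ nE] that by (simp add: not_le)
  then show ?thesis using last_below_le[of "tail G" _ nE] last_below_hit[of "tail G" _ nE]
    by (simp add: explore_inv_def)
qed

definition explored :: "(nat \<Rightarrow> nat) \<Rightarrow> (nat \<Rightarrow> nat) \<Rightarrow> (nat \<Rightarrow> nat) \<Rightarrow> bool" where
  "explored first st C \<longleftrightarrow> (\<forall>v<nV. st v = 3 \<and> \<not> dead_end G v \<or> st v = 1 \<and> dead_end G v) \<and>
     (\<forall>v<nV. st v = 3 \<longrightarrow> first v \<noteq> 0 \<and> first v \<le> nE \<and> tail G (first v - 1) = v \<and>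
       st (next_vert first v) = 3 \<and> C (next_vert first v) = C v \<and>
       C v < nV \<and> st (C v) = 3 \<and> C (C v) = C v \<and> (chosen_step first st)\<^sup>*\<^sup>* v (C v))"

lemma explore_final:
  assumes inv: "explore_inv first st C SK sp nV"
  shows "explored first st C"
proof -
  have sp: "sp = 0" using inv by (auto simp: explore_inv_def)
  have nu: "\<not> unwinding first st C SK sp y" for y using sp by (simp add: unwinding_def)
  have st: "st v = 1 \<or> st v = 3" if "v < nV" for v
  proof -
    have "st v \<noteq> 0" "st v \<le> 3" "st v \<noteq> 2" using inv that sp by (auto simp: explore_inv_def)
    then show ?thesis by linarith
  qed
  have l: "first v \<noteq> 0 \<and> first v \<le> nE \<and> tail G (first v - 1) = v \<and>
       st (next_vert first v) = 3 \<and> C (next_vert first v) = C v \<and>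
       C v < nV \<and> st (C v) = 3 \<and> C (C v) = C v \<and> (chosen_step first st)\<^sup>*\<^sup>* v (C v)"
    if "v < nV" "st v = 3" for v
  proof -
    have "live_ok first st C SK sp v" using inv that unfolding explore_inv_def by blast
    then have "first v \<noteq> 0" and *: "st (next_vert first v) = 3 \<and> C (next_vert first v) = C v \<and>
       C v < nV \<and> st (C v) = 3 \<and> C (C v) = C v \<and> (chosen_step first st)\<^sup>*\<^sup>* v (C v)"
      using nu by (simp_all add: live_ok_def)
    then show ?thesis using inv that by (simp add: explore_inv_def)
  qed
  \<comment> \<open>The chosen arc of a live vertex leads to a live vertex, against rule induction
    on dead ends.\<close>
  have nd: "v < nV \<longrightarrow> st v \<noteq> 3" if "dead_end G v" for v
    using that
  proof (induction rule: dead_end.induct)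
    case (1 v)
    show ?case
    proof (intro impI notI)
      assume v: "v < nV" "st v = 3"
      from l[OF this] have "first v - 1 < nE" "tail G (first v - 1) = v" "st (head G (first v - 1)) = 3"
        by (auto simp: next_vert_def)
      then show False using 1[of "first v - 1"] head_less by (auto simp: arcsG)
    qed
  qed
  have "st v = 3 \<and> \<not> dead_end G v \<or> st v = 1 \<and> dead_end G v" if "v < nV" for v
    using st[OF that] nd[of v] inv that by (auto simp: explore_inv_def)
  then show ?thesis using l by (simp add: explored_def)
qed

definition explore_pot :: "state \<Rightarrow> nat" where
  "explore_pot s = (nV - var s ''r'') + 2 * unseen (arr s ''st'') + var s ''sp'' +
     pending (tail G) (arr s ''first'')"

definition explore_state :: "state \<Rightarrow> bool" where
  "explore_state s \<longleftrightarrow> explore_inv (arr s ''first'') (arr s ''st'') (arr s ''C'')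
     (arr s ''SK'') (var s ''sp'') (var s ''r'')"

lemma unseen_update: "f y \<noteq> 0 \<Longrightarrow> a \<noteq> 0 \<Longrightarrow> unseen (f(y := a)) = unseen f"
  unfolding unseen_def by (rule arg_cong[of _ _ card]) auto

lemma explore_correct:
  assumes "inp s" "arr s ''first'' = (\<lambda>v. last_below (tail G) v nE)" "arr s ''st'' = (\<lambda>_. 0)"
    and nxtO: "\<And>e. e < nE \<Longrightarrow> arr s ''nxtO'' e = last_below (tail G) (tail G e) e"
  shows "wp explore_prog (\<lambda>s' _. explored (arr s' ''first'') (arr s' ''st'') (arr s' ''C'')) s
    (18 * (3 * nV + nE) + 4)"
  unfolding explore_prog_def wp_simps
proof (intro conjI, simp, simp, rule wp_Loop[where
      I = "\<lambda>s k. explore_state s \<and> 18 * explore_pot s + 2 \<le> k"], goal_cases)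
  case 1
  have "unseen (\<lambda>_. 0) = nV" by (simp add: unseen_def)
  moreover have "pending (tail G) (arr s ''first'') \<le> nE"
    unfolding pending_def using card_mono[of "{..<nE}" "{e \<in> {..<nE}. e < arr s ''first'' (tail G e)}"] by auto
  ultimately show ?case using assms explore_init
    by (simp add: explore_state_def explore_pot_def)
next
  case (2 s' j)
  have inp: "inp s'" by (rule inp_frame[OF _ 2(2)]) (simp_all add: assms(1))
  have nxt: "arr s' ''nxtO'' e = last_below (tail G) (tail G e) e" if "e < nE" for e
    using frame_arr[OF 2(2), of "''nxtO''"] nxtO[OF that] by simp
  define first st C SK sp r where defs: "first = arr s' ''first''" "st = arr s' ''st''" "C = arr s' ''C''"
    "SK = arr s' ''SK''" "sp = var s' ''sp''" "r = var s' ''r''"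
  have inv: "explore_inv first st C SK sp r"
    using 2(1) by (simp add: explore_state_def defs)
  have pot: "explore_pot s' = (nV - r) + 2 * unseen st + sp + pending (tail G) first"
    by (simp add: explore_pot_def defs)
  have j: "18 * explore_pot s' + 2 \<le> j" using 2(1) by simp
  have r: "r < nV" using 2(3) inp by (simp add: inp_def defs)
  note unf = wp_simps explore_state_def explore_pot_def defs[symmetric]
  let ?P = "\<lambda>d f sp g. d + 2 * unseen f + sp + pending (tail G) g"
  show ?case
  proof (cases sp)
    case sp: 0
    show ?thesis
    proof (cases "st r = 0")
      case True
      have new: "explore_inv first (st(r := 2)) C (SK(0 := r)) 1 r"
        using explore_root inv sp r True by simp
      have "unseen (st(r := 2)) + 1 = unseen st" using True r by (intro unseen_visit) auto
      then have "?P (nV - r) (st(r := 2)) 1 first + 1 \<le> explore_pot s'" using pot sp by simp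
      from credit[OF this j] obtain K where K: "j = 18 + K" "18 * (?P (nV - r) (st(r := 2)) 1 first) + 2 \<le> K" by blast
      show ?thesis unfolding K(1) using K(2) new True sp by (simp add: unf)
    next
      case False
      have new: "explore_inv first st C SK 0 (Suc r)"
        using explore_next inv sp r False by simp
      have "nV - r = Suc (nV - Suc r)" using r by simp
      then have "?P (nV - Suc r) st 0 first + 1 \<le> explore_pot s'" using pot sp by simp
      from credit[OF this j] obtain K where K: "j = 18 + K" "18 * (?P (nV - Suc r) st 0 first) + 2 \<le> K" by blast
      show ?thesis unfolding K(1) using K(2) new False sp by (simp add: unf)
    qed
  next
    case sp: (Suc q)
    define v where "v = SK q"
    note inv = inv[unfolded sp]
    have v: "v < nV" "st v = 2" using inv by (simp_all add: explore_inv_def v_def)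
    have vst: "SK q = v" by (simp add: v_def)
    show ?thesis
    proof (cases "first v = 0")
      case True
      have new: "explore_inv first (st(v := 1)) C SK q r" by (rule explore_dead[OF inv v_def True])
      have "unseen (st(v := 1)) = unseen st" by (rule unseen_update) (use v in simp_all)
      then have "?P (nV - r) (st(v := 1)) q first + 1 \<le> explore_pot s'" using pot sp by simp
      from credit[OF this j] obtain K where K: "j = 18 + K" "18 * (?P (nV - r) (st(v := 1)) q first) + 2 \<le> K" by blast
      show ?thesis unfolding K(1) using K(2) new True sp vst by (simp add: unf)
    next
      case False
      define e where "e = first v - 1"
      have fe: "first v = Suc e" "first v - Suc 0 = e" using False by (simp_all add: e_def)
      have e: "e < nE" "tail G e = v" using current_arc[OF inv v(1) fe(1)] by simp_all
      define y where "y = next_vert first v"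
      have yh: "y = head G e" by (simp add: y_def next_vert_def e_def)
      have y: "y < nV" using e by (simp add: yh)
      have ld: "arr s' ''Gamma_head'' e = y" using inp e by (simp add: inp_def yh)
      have "st y \<le> 3" using inv y by (simp add: explore_inv_def)
      then consider "st y = 0" | "st y = 1" | "st y = 2" | "st y = 3" by linarith
      then show ?thesis
      proof cases
        case 1
        have new: "explore_inv first (st(y := 2)) C (SK(Suc q := y)) (Suc (Suc q)) r"
          by (rule explore_push[OF inv v_def False y_def 1])
        have "unseen (st(y := 2)) + 1 = unseen st" using 1 y by (intro unseen_visit) auto
        then have "?P (nV - r) (st(y := 2)) (Suc (Suc q)) first + 1 \<le> explore_pot s'" using pot sp by simp
        from credit[OF this j] obtain K where K: "j = 18 + K" "18 * (?P (nV - r) (st(y := 2)) (Suc (Suc q)) first) + 2 \<le> K" by blast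
        show ?thesis unfolding K(1) using K(2) new sp vst fe ld 1 by (simp add: unf)
      next
        case 2
        have new: "explore_inv (first(v := last_below (tail G) v e)) st C SK (Suc q) r"
          by (rule explore_advance[OF inv v_def fe(1)]) (use 2 yh in simp)
        have "pending (tail G) (first(v := last_below (tail G) v e)) + 1 \<le> pending (tail G) first"
          by (rule pending_advance) (use e fe in auto)
        then have "?P (nV - r) st (Suc q) (first(v := last_below (tail G) v e)) + 1 \<le> explore_pot s'" using pot sp by simp
        from credit[OF this j] obtain K where K: "j = 18 + K" "18 * (?P (nV - r) st (Suc q) (first(v := last_below (tail G) v e))) + 2 \<le> K" by blast
        show ?thesis unfolding K(1) using K(2) new sp vst fe ld 2 nxt[OF e(1)] e by (simp add: unf)
      next
        case 3
        have new: "explore_inv first (st(v := 3)) (C(v := y)) SK q r"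
          by (rule explore_live[OF inv v_def False y_def]) (use 3 in simp)
        have "unseen (st(v := 3)) = unseen st" by (rule unseen_update) (use v in simp_all)
        then have "?P (nV - r) (st(v := 3)) q first + 1 \<le> explore_pot s'" using pot sp by simp
        from credit[OF this j] obtain K where K: "j = 18 + K" "18 * (?P (nV - r) (st(v := 3)) q first) + 2 \<le> K" by blast
        show ?thesis unfolding K(1) using K(2) new sp vst fe ld 3 by (simp add: unf)
      next
        case 4
        have new: "explore_inv first (st(v := 3)) (C(v := C y)) SK q r"
          by (rule explore_live[OF inv v_def False y_def]) (use 4 in simp)
        have "unseen (st(v := 3)) = unseen st" by (rule unseen_update) (use v in simp_all)
        then have "?P (nV - r) (st(v := 3)) q first + 1 \<le> explore_pot s'" using pot sp by simp
        from credit[OF this j] obtain K where K: "j = 18 + K" "18 * (?P (nV - r) (st(v := 3)) q first) + 2 \<le> K" by blast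
        show ?thesis unfolding K(1) using K(2) new sp vst fe ld 4 by (simp add: unf)
      qed
    qed
  qed
next
  case (3 s' j)
  have inp: "inp s'" by (rule inp_frame[OF _ 3(2)]) (simp_all add: assms(1))
  have "var s' ''r'' = nV" using 3 inp by (auto simp: explore_state_def explore_inv_def inp_def)
  then have "explore_inv (arr s' ''first'') (arr s' ''st'') (arr s' ''C'') (arr s' ''SK'') (var s' ''sp'') nV"
    using 3(1) by (simp add: explore_state_def)
  then show ?case using 3(1) explore_final by simp
qed

end

lemma period_shift: "period f p \<Longrightarrow> period (\<lambda>n. f (k + n)) p"
  by (simp add: period_def add.assoc[symmetric])

lemma long_walk_shift:
  assumes "long_walk G lab T h"
  shows "long_walk G lab T (\<lambda>n. h (k + n))"
proof -
  have cw: "closed_walk G T h" and prim: "primitive_walk T h" using assms by (simp_all add: long_walk_def)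
  have per: "period h T" "T \<ge> 1" using cw by (simp_all add: closed_walk_def)
  obtain l where l: "l \<ge> 1" "l dvd T" "period (lab \<circ> h) l" "12 * betti1 G * l \<le> T"
    using assms by (auto simp: long_walk_def)
  have "closed_walk G T (\<lambda>n. h (k + n))"
    using cw period_shift[OF per(1)] by (simp add: closed_walk_def)
  moreover have "primitive_walk T (\<lambda>n. h (k + n))"
    unfolding primitive_walk_def
  proof (intro allI impI)
    fix p assume p: "1 \<le> p" "period (\<lambda>n. h (k + n)) p"
    have "period h (k + p - k)"
    proof (rule shift_period[OF per])
      fix n show "h (k + n) = h (k + p + n)"
        using p(2)[unfolded period_def, rule_format, of n] by (simp add: ac_simps)
    qed simp
    then show "T \<le> p" using prim p(1) by (simp add: primitive_walk_def)
  qed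
  moreover have "period (lab \<circ> (\<lambda>n. h (k + n))) l"
    using period_shift[OF l(3)] by (simp add: comp_def)
  ultimately show ?thesis using l by (auto simp: long_walk_def)
qed

section \<open>Stops and accepted cycles\<close>

definition prefix_period :: "(nat \<Rightarrow> 'a) \<Rightarrow> nat \<Rightarrow> nat \<Rightarrow> bool" where
  "prefix_period W p n \<longleftrightarrow> (\<forall>i. i + p < n \<longrightarrow> W (i + p) = W i)"

text \<open>The full length \<open>n\<close> is always a period of the first \<open>n\<close>
  letters, vacuously, so a least one exists for every nonempty prefix.\<close>

definition least_period :: "(nat \<Rightarrow> 'a) \<Rightarrow> nat \<Rightarrow> nat \<Rightarrow> bool" where
  "least_period W p n \<longleftrightarrow> 1 \<le> p \<and> p \<le> n \<and> prefix_period W p n \<and>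
     (\<forall>q. 1 \<le> q \<longrightarrow> q < p \<longrightarrow> \<not> prefix_period W q n)"

lemma prefix_period_cong:
  assumes "\<And>i. i < n \<Longrightarrow> W i = W' i"
  shows "prefix_period W p n = prefix_period W' p n"
  unfolding prefix_period_def
proof (intro all_cong)
  fix i assume "i + p < n"
  then show "W (i + p) = W i \<longleftrightarrow> W' (i + p) = W' i" using assms[of "i + p"] assms[of i] by simp
qed

lemma least_period_cong:
  "(\<And>i. i < n \<Longrightarrow> W i = W' i) \<Longrightarrow> least_period W p n = least_period W' p n"
  unfolding least_period_def using prefix_period_cong[of n W W'] by blast

lemma period_prefix: "period W p \<Longrightarrow> prefix_period W p n"
  by (simp add: period_def prefix_period_def)

lemma period_ext:
  assumes "period a l" "l \<ge> 1" "\<And>j. j < l \<Longrightarrow> a (m + j) = b j" "period b l"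
  shows "a (m + n) = b n"
proof -
  have "a (m + n) = a (m + n mod l)"
    by (rule period_cong[OF assms(1)]) (simp add: mod_add_right_eq)
  also have "\<dots> = b (n mod l)" using assms(2,3) by simp
  also have "\<dots> = b n" by (rule period_mod[OF assms(4)])
  finally show ?thesis .
qed

locale explored_graph = labelled_graph +
  fixes first st C :: "nat \<Rightarrow> nat"
  assumes expl: "explored first st C"
begin

definition live :: "nat \<Rightarrow> bool" where
  "live v \<longleftrightarrow> v < nV \<and> st v = 3"

definition live_arc :: "nat \<Rightarrow> bool" where
  "live_arc e \<longleftrightarrow> e < nE \<and> st (head G e) = 3"

definition chosen :: "nat \<Rightarrow> nat" where
  "chosen v = first v - 1"

text \<open>A stop has a live arc besides its chosen one, or is the root of a cycle of chosen arcs. So the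
  chosen arcs lead from every live vertex to a stop.\<close>

definition stop :: "nat \<Rightarrow> bool" where
  "stop v \<longleftrightarrow> (\<exists>e<nE. live_arc e \<and> tail G e = v \<and> (first v = Suc e \<longrightarrow> C v = v))"

definition starts :: "nat set" where
  "starts = {e. live_arc e \<and> stop (tail G e)}"

lemma live_chosen:
  assumes "live v"
  shows "first v = Suc (chosen v)" "chosen v < nE" "tail G (chosen v) = v" "live_arc (chosen v)"
    "C (head G (chosen v)) = C v" "live (C v)" "C (C v) = C v"
    "(chosen_step first st)\<^sup>*\<^sup>* v (C v)"
proof -
  have "first v \<noteq> 0 \<and> first v \<le> nE \<and> tail G (first v - 1) = v \<and>
       st (next_vert first v) = 3 \<and> C (next_vert first v) = C v \<and>
       C v < nV \<and> st (C v) = 3 \<and> C (C v) = C v \<and> (chosen_step first st)\<^sup>*\<^sup>* v (C v)"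
    using expl assms by (simp add: explored_def live_def)
  then show "first v = Suc (chosen v)" "chosen v < nE" "tail G (chosen v) = v" "live_arc (chosen v)"
    "C (head G (chosen v)) = C v" "live (C v)" "C (C v) = C v" "(chosen_step first st)\<^sup>*\<^sup>* v (C v)"
    by (auto simp: chosen_def live_arc_def live_def next_vert_def)
qed

lemma live_iff: "v < nV \<Longrightarrow> live v \<longleftrightarrow> \<not> dead_end G v"
  using expl by (auto simp: explored_def live_def)

lemma live_arc_ends:
  assumes "live_arc e" shows "e < nE" "live (head G e)" "live (tail G e)"
proof -
  show e: "e < nE" using assms by (simp add: live_arc_def)
  show h: "live (head G e)" using assms e by (simp add: live_arc_def live_def)
  have "\<not> dead_end G (tail G e)"
  proof
    assume "dead_end G (tail G e)"
    then have "dead_end G (head G e)" by cases (use e in \<open>simp add: arcsG\<close>)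
    then show False using h e live_iff[of "head G e"] by simp
  qed
  then show "live (tail G e)" using e live_iff by simp
qed

lemma not_stop_chosen:
  assumes "live_arc e" "\<not> stop (tail G e)"
  shows "e = chosen (tail G e)"
proof -
  have "first (tail G e) = Suc e" using assms by (auto simp: stop_def live_arc_def)
  then show ?thesis by (simp add: chosen_def)
qed

lemma stop_live: "stop v \<Longrightarrow> live v"
  using live_arc_ends by (auto simp: stop_def)

lemma root_stop: "live v \<Longrightarrow> C v = v \<Longrightarrow> stop v"
  using live_chosen[of v] by (auto simp: stop_def)

lemma label_inj:
  assumes "e < nE" "f < nE" "tail G e = tail G f" "lab e = lab f"
  shows "e = f"
proof -
  have "e \<in> out_arcs G (tail G f)" "f \<in> out_arcs G (tail G f)" using assms by (simp_all add: out_arcs_def arcsG)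
  then show ?thesis using lab_inj[of "tail G f"] assms by (simp add: inj_on_def)
qed

section \<open>Counting stops and starting arcs\<close>

definition extra :: "nat set" where
  "extra = {e. live_arc e \<and> first (tail G e) \<noteq> Suc e}"

lemma chosen_inj: "inj_on chosen {v. live v}"
  by (rule inj_onI) (metis live_chosen(3) mem_Collect_eq)

lemma finite_live: "finite {v. live v}"
  by (rule finite_subset[of _ "{..<nV}"]) (auto simp: live_def)

text \<open>The live part has one chosen arc for each vertex, so in the Euler inequality the
  vertices cancel against the chosen arcs and the remaining live arcs are left.\<close>

lemma card_extra: "card extra \<le> betti1 G"
proof (cases "\<exists>v. live v")
  case False
  then have "extra = {}" using live_arc_ends by (auto simp: extra_def)
  then show ?thesis by simp
next
  case True
  let ?L = "{v. live v}" and ?A = "{e. live_arc e}"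
  define H where "H = G\<lparr>verts := ?L, arcs := ?A\<rparr>"
  have fA: "finite ?A" by (rule finite_subset[of _ "{..<nE}"]) (auto simp: live_arc_def)
  have finH: "fin_digraph H"
    by unfold_locales (use live_arc_ends fA finite_live in \<open>simp_all add: H_def\<close>)
  have "(\<lambda>_. 0 :: nat) ` verts H = {0}" using True by (auto simp: H_def)
  then have "card (arcs H) + 1 \<le> betti1 H + card (verts H)"
    using betti1_ge[OF finH, of "\<lambda>_. 0 :: nat"] by simp
  also have "betti1 H \<le> betti1 G"
  proof (rule betti1_subgraph[OF finH fin_digraph])
    show "arcs H \<subseteq> arcs G" by (auto simp: H_def arcsG live_arc_def)
    show "verts H \<subseteq> verts G" by (auto simp: H_def vertsG live_def)
  qed (simp_all add: H_def)
  finally have *: "card ?A + 1 \<le> betti1 G + card ?L" by (simp add: H_def)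
  have A: "?A = extra \<union> chosen ` ?L"
  proof (intro equalityI subsetI)
    fix e assume "e \<in> ?A"
    then have e: "live_arc e" by simp
    show "e \<in> extra \<union> chosen ` ?L"
    proof (cases "first (tail G e) = Suc e")
      case True
      then have "e = chosen (tail G e)" by (simp add: chosen_def)
      then show ?thesis using live_arc_ends[OF e] by blast
    next
      case False
      then show ?thesis using e by (simp add: extra_def)
    qed
  qed (use live_chosen(4) in \<open>auto simp: extra_def\<close>)
  have "extra \<inter> chosen ` ?L = {}"
  proof -
    have "chosen v \<notin> extra" if "live v" for v using live_chosen(1,3)[OF that] by (simp add: extra_def)
    then show ?thesis by blast
  qed
  then have "card ?A = card extra + card (chosen ` ?L)"
    unfolding A using fA A by (intro card_Un_disjoint) (auto intro: finite_subset)
  also have "card (chosen ` ?L) = card ?L" by (rule card_image[OF chosen_inj])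
  finally show ?thesis using * by simp
qed

text \<open>The graph of the chosen arcs has as many arcs as vertices, and \<open>C\<close> is
  constant along them; so the Euler inequality bounds the number of values of \<open>C\<close>. Each
  root is a value.\<close>

lemma card_roots: "card {v. live v \<and> C v = v} \<le> betti1 G"
proof -
  let ?L = "{v. live v}"
  define H where "H = G\<lparr>verts := ?L, arcs := chosen ` ?L\<rparr>"
  have finH: "fin_digraph H"
  proof unfold_locales
    fix e assume "e \<in> arcs H"
    then obtain v where "live v" "e = chosen v" by (auto simp: H_def)
    then have "live_arc e" using live_chosen(4) by simp
    then show "tail H e \<in> verts H" "head H e \<in> verts H" using live_arc_ends by (simp_all add: H_def)
  qed (use finite_live in \<open>simp_all add: H_def\<close>)
  have "card (arcs H) + card (C ` verts H) \<le> betti1 H + card (verts H)"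
  proof (rule betti1_ge[OF finH])
    fix e assume "e \<in> arcs H"
    then obtain v where "live v" "e = chosen v" by (auto simp: H_def)
    then show "C (tail H e) = C (head H e)" using live_chosen(3,5)[of v] by (simp add: H_def)
  qed
  also have "betti1 H \<le> betti1 G"
  proof (rule betti1_subgraph[OF finH fin_digraph])
    show "arcs H \<subseteq> arcs G" using live_chosen(2) by (auto simp: H_def arcsG)
    show "verts H \<subseteq> verts G" by (auto simp: H_def vertsG live_def)
  qed (simp_all add: H_def)
  finally have "card (C ` ?L) \<le> betti1 G" using card_image[OF chosen_inj] by (simp add: H_def)
  moreover have "{v. live v \<and> C v = v} \<subseteq> C ` ?L" by force
  ultimately show ?thesis using finite_live by (meson card_mono finite_imageI le_trans)
qed

lemma finite_extra: "finite extra"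
  by (rule finite_subset[of _ "{..<nE}"]) (auto simp: extra_def live_arc_def)

lemma stop_subset: "{v. stop v} \<subseteq> tail G ` extra \<union> {v. live v \<and> C v = v}"
proof
  fix v assume "v \<in> {v. stop v}"
  then obtain e where e: "live_arc e" "tail G e = v" "first v = Suc e \<longrightarrow> C v = v" by (auto simp: stop_def)
  show "v \<in> tail G ` extra \<union> {v. live v \<and> C v = v}"
  proof (cases "first v = Suc e")
    case True
    then show ?thesis using e live_arc_ends(3)[OF e(1)] by simp
  next
    case False
    then have "e \<in> extra" using e by (simp add: extra_def)
    then show ?thesis using e(2) by blast
  qed
qed

lemma finite_stop: "finite {v. stop v}"
  by (rule finite_subset[OF _ finite_live]) (use stop_live in auto)

lemma card_stop: "card {v. stop v} \<le> 2 * betti1 G"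
proof -
  have "card {v. stop v} \<le> card (tail G ` extra \<union> {v. live v \<and> C v = v})"
    by (rule card_mono[OF _ stop_subset])
       (use finite_extra finite_live in \<open>simp add: finite_subset[of "{v. live v \<and> C v = v}" "{v. live v}"] subset_iff\<close>)
  also have "\<dots> \<le> card (tail G ` extra) + card {v. live v \<and> C v = v}" by (rule card_Un_le)
  also have "card (tail G ` extra) \<le> card extra" by (rule card_image_le[OF finite_extra])
  finally show ?thesis using card_extra card_roots by simp
qed

lemma starts_subset: "starts \<subseteq> extra \<union> chosen ` {v. stop v}"
proof
  fix e assume "e \<in> starts"
  then have e: "live_arc e" "stop (tail G e)" by (simp_all add: starts_def)
  show "e \<in> extra \<union> chosen ` {v. stop v}"
  proof (cases "first (tail G e) = Suc e")
    case True
    then have "e = chosen (tail G e)" by (simp add: chosen_def)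
    then show ?thesis using e by blast
  next
    case False
    then show ?thesis using e by (simp add: extra_def)
  qed
qed

text \<open>At most \<beta> arcs are extra, and each of the at most 2 \<beta> stops contributes its
  chosen arc.\<close>

lemma card_starts: "card starts \<le> 3 * betti1 G"
proof -
  have "card starts \<le> card (extra \<union> chosen ` {v. stop v})"
    by (rule card_mono[OF _ starts_subset]) (simp add: finite_extra finite_stop)
  also have "\<dots> \<le> card extra + card (chosen ` {v. stop v})" by (rule card_Un_le)
  also have "card (chosen ` {v. stop v}) \<le> card {v. stop v}" by (rule card_image_le[OF finite_stop])
  finally show ?thesis using card_extra card_stop by simp
qed

text \<open>A closed walk through a dead end would also pass the next vertex as a dead end, which
  rule induction excludes.\<close>

lemma closed_walk_live:
  assumes cw: "closed_walk G T h"
  shows "live_arc (h i)"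
proof -
  have a: "h i < nE" "head G (h i) = tail G (h (Suc i))" for i
    using cw by (auto simp: closed_walk_def arcsG)
  have "\<forall>i. tail G (h i) \<noteq> v" if "dead_end G v" for v
    using that
  proof (induction rule: dead_end.induct)
    case (1 v)
    show ?case
    proof (intro allI notI)
      fix i assume "tail G (h i) = v"
      then have "\<forall>j. tail G (h j) \<noteq> head G (h i)" by (intro 1(2)) (use a in \<open>simp_all add: arcsG\<close>)
      then show False using a(2)[of i] by metis
    qed
  qed
  then have "\<not> dead_end G (head G (h i))" using a(2)[of i] by metis
  then have "live (head G (h i))" using a(1)[of i] live_iff by simp
  then show ?thesis using a(1) by (simp add: live_arc_def live_def)
qed

text \<open>Without stops the walk would follow the chosen arcs from its origin, and these lead to
  the root, which is a stop.\<close>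

lemma closed_walk_stop:
  assumes cw: "closed_walk G T h"
  shows "\<exists>i. stop (tail G (h i))"
proof (rule ccontr)
  assume neg: "\<not> ?thesis"
  have la: "live_arc (h i)" for i by (rule closed_walk_live[OF cw])
  have nx: "next_vert first (tail G (h i)) = tail G (h (Suc i))" for i
  proof -
    have "h i = first (tail G (h i)) - 1" using not_stop_chosen[OF la] neg by (simp add: chosen_def)
    then have "next_vert first (tail G (h i)) = head G (h i)" unfolding next_vert_def by metis
    then show ?thesis using cw by (simp add: closed_walk_def)
  qed
  have "\<exists>i. w = tail G (h i)" if "(chosen_step first st)\<^sup>*\<^sup>* (tail G (h 0)) w" for w
    using that
  proof (induction rule: rtranclp_induct)
    case base then show ?case by blast
  next
    case (step y z)
    then obtain i where "y = tail G (h i)" by blast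
    then have "z = tail G (h (Suc i))" using step.hyps(2) nx by (simp add: chosen_step_def)
    then show ?case by blast
  qed
  moreover have l: "live (tail G (h 0))" using live_arc_ends[OF la] by simp
  ultimately obtain i where "C (tail G (h 0)) = tail G (h i)" using live_chosen(8)[OF l] by blast
  then show False using root_stop[of "C (tail G (h 0))"] live_chosen(6,7)[OF l] neg by simp
qed

text \<open>By \<open>free_run\<close>, every long cycle can be rotated such that it leaves a stop and then meets none for
  three periods of its labels; there it follows the chosen arcs.\<close>

definition witnessed :: "nat \<Rightarrow> nat \<Rightarrow> (nat \<Rightarrow> nat) \<Rightarrow> bool" where
  "witnessed T l h \<longleftrightarrow> repetitive_walk G lab T l h \<and> h 0 \<in> starts \<and>
     (\<forall>n. 1 \<le> n \<longrightarrow> n \<le> 3 * l \<longrightarrow> \<not> stop (tail G (h n)))"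

lemma long_walk_repetitive:
  assumes "long_walk G lab T h"
  obtains l where "repetitive_walk G lab T l h"
proof -
  obtain l where "l \<ge> 1" "l dvd T" "period (lab \<circ> h) l" "primitive_walk l (lab \<circ> h)" "12 * betti1 G * l \<le> T"
    by (rule long_walk_label_period[OF assms])
  then have "repetitive_walk G lab T l h"
    by unfold_locales (use lab_inj assms in \<open>simp_all add: vertsG long_walk_def\<close>)
  then show ?thesis by (rule that)
qed

lemma witness_exists:
  assumes "long_walk G lab T h"
  shows "\<exists>k l. witnessed T l (\<lambda>n. h (k + n))"
proof -
  obtain l where l: "repetitive_walk G lab T l h" by (rule long_walk_repetitive[OF assms])
  interpret r: repetitive_walk G lab T l h by (rule l)
  obtain i where "stop (tail G (h i))" using closed_walk_stop[OF r.cw] by blast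
  then have "r.pos i \<in> {v. stop v}" by (simp add: r.pos_def)
  from r.free_run[OF finite_stop card_stop this] obtain k where
    k: "stop (r.pos k)" "\<And>n. 1 \<le> n \<Longrightarrow> n \<le> 3 * l \<Longrightarrow> \<not> stop (r.pos (k + n))" by auto
  have lw: "long_walk G lab T (\<lambda>n. h (k + n))" by (rule long_walk_shift[OF assms])
  have "repetitive_walk G lab T l (\<lambda>n. h (k + n))"
  proof unfold_locales
    show "period (lab \<circ> (\<lambda>n. h (k + n))) l" using period_shift[OF r.lper] by (simp add: comp_def)
    show "primitive_walk l (lab \<circ> (\<lambda>n. h (k + n)))"
      unfolding primitive_walk_def
    proof (intro allI impI)
      fix p assume p: "1 \<le> p" "period (lab \<circ> (\<lambda>n. h (k + n))) p"
      have "period (lab \<circ> h) (k + p - k)"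
      proof (rule shift_period[OF r.lper r.l1])
        fix n show "(lab \<circ> h) (k + n) = (lab \<circ> h) (k + p + n)"
          using p(2)[unfolded period_def, rule_format, of n] by (simp add: ac_simps)
      qed simp
      then show "l \<le> p" using r.lprim p(1) by (simp add: primitive_walk_def)
    qed
  qed (use lw r.l1 r.ldvd r.deg r.lab_inj in \<open>simp_all add: long_walk_def\<close>)
  moreover have "h k \<in> starts" using closed_walk_live[OF r.cw] k(1) by (simp add: starts_def r.pos_def)
  ultimately have "witnessed T l (\<lambda>n. h (k + n))" using k(2) by (simp add: witnessed_def r.pos_def)
  then show ?thesis by blast
qed

text \<open>An accepted cycle \<open>us\<close> passes its starting arc \<open>e\<close> only once, and the least period of the labels of
  the ray from \<open>e\<close> to the next stop is a period of the whole cycle.\<close>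

definition accepted :: "nat \<Rightarrow> nat \<Rightarrow> nat list \<Rightarrow> bool" where
  "accepted e p us \<longleftrightarrow> us \<noteq> [] \<and> us ! 0 = e \<and> e \<in> starts \<and>
     (\<forall>i<length us. live_arc (us ! i) \<and> head G (us ! i) = tail G (us ! (Suc i mod length us))) \<and>
     (\<forall>i. 0 < i \<longrightarrow> i < length us \<longrightarrow> us ! i \<noteq> e) \<and>
     p dvd length us \<and> prefix_period (\<lambda>i. lab (us ! i)) p (length us) \<and> 12 * betti1 G * p \<le> length us \<and>
     (\<exists>L\<le>length us. least_period (\<lambda>i. lab (us ! i)) p L \<and>
        (\<forall>i. 0 < i \<longrightarrow> i < L \<longrightarrow> \<not> stop (tail G (us ! i))))"

definition loop_of :: "nat list \<Rightarrow> nat \<Rightarrow> nat" where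
  "loop_of us i = us ! (i mod length us)"

text \<open>A period of the finite word extends across the seam because it divides the
  length.\<close>

lemma accepted_label_period:
  assumes "accepted e p us"
  shows "period (lab \<circ> loop_of us) p" "1 \<le> p"
proof -
  let ?T = "length us"
  have d: "p dvd ?T" "prefix_period (\<lambda>i. lab (us ! i)) p ?T" "us \<noteq> []" and p: "1 \<le> p"
    using assms by (auto simp: accepted_def least_period_def)
  show "1 \<le> p" by (rule p)
  have T: "?T \<ge> 1" using d(3) by (simp add: Suc_le_eq)
  have pT: "p \<le> ?T" using d T by (intro dvd_imp_le) auto
  have low: "lab (us ! i) = lab (us ! (i mod p))" if "i < ?T" for i
    using that
  proof (induction i rule: less_induct)
    case (less i)
    show ?case
    proof (cases "i < p")
      case True then show ?thesis by simp
    next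
      case False
      then have "lab (us ! (i - p + p)) = lab (us ! (i - p))"
        using d(2)[unfolded prefix_period_def, rule_format, of "i - p"] less.prems by simp
      then have "lab (us ! i) = lab (us ! (i - p))" using False by simp
      also have "\<dots> = lab (us ! ((i - p) mod p))" using less False p by simp
      also have "(i - p) mod p = i mod p" using False by (simp add: le_mod_geq)
      finally show ?thesis .
    qed
  qed
  have "(lab \<circ> loop_of us) i = lab (us ! (i mod p))" for i
    using low[of "i mod ?T"] d(1,3) by (simp add: loop_of_def mod_mod_cancel)
  then show "period (lab \<circ> loop_of us) p" by (simp add: period_def)
qed

text \<open>A period \<open>q\<close> of the arcs brings \<open>e\<close> back at position
  \<open>q mod T\<close>; since \<open>e\<close> occurs only at 0, the length divides
  \<open>q\<close>. This is why the trace must stop at its first return.\<close>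

lemma accepted_long:
  assumes a: "accepted e p us"
  shows "long_walk G lab (length us) (loop_of us)"
proof -
  let ?T = "length us"
  have us: "us \<noteq> []" "us ! 0 = e" "p dvd ?T" "12 * betti1 G * p \<le> ?T"
    and w: "\<And>i. i < ?T \<Longrightarrow> live_arc (us ! i) \<and> head G (us ! i) = tail G (us ! (Suc i mod ?T))"
    and e: "\<And>i. 0 < i \<Longrightarrow> i < ?T \<Longrightarrow> us ! i \<noteq> e"
    using a by (simp_all add: accepted_def)
  have T: "?T \<ge> 1" using us(1) by (simp add: Suc_le_eq)
  have per: "period (loop_of us) ?T" by (simp add: period_def loop_of_def)
  have "loop_of us i \<in> arcs G \<and> head G (loop_of us i) = tail G (loop_of us (Suc i))" for i
  proof -
    have "i mod ?T < ?T" using us(1) by simp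
    from w[OF this] live_arc_ends(1) show ?thesis by (simp add: loop_of_def arcsG mod_Suc_eq)
  qed
  then have "closed_walk G ?T (loop_of us)" using T per by (simp add: closed_walk_def)
  moreover have "primitive_walk ?T (loop_of us)"
    unfolding primitive_walk_def
  proof (intro allI impI)
    fix q assume q: "1 \<le> q" "period (loop_of us) q"
    have "loop_of us (0 + q) = loop_of us 0" using q(2) unfolding period_def by blast
    then have "us ! (q mod ?T) = e" using us by (simp add: loop_of_def)
    moreover have "q mod ?T < ?T" using us(1) by simp
    ultimately have "q mod ?T = 0" using e[of "q mod ?T"] by blast
    then have "?T dvd q" by (simp add: dvd_eq_mod_eq_0)
    then show "?T \<le> q" using q(1) by (intro dvd_imp_le) auto
  qed
  ultimately show ?thesis
    unfolding long_walk_def using accepted_label_period[OF a] us by blast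
qed

text \<open>The gcd of \<open>p\<close> and \<open>q\<close> is a period of the whole label word,
  hence of the ray, where no period is smaller than \<open>p\<close>.\<close>

lemma least_period_dvd:
  assumes a: "accepted e p us" and q: "period (lab \<circ> loop_of us) q" "1 \<le> q"
  shows "p dvd q"
proof -
  obtain L where L: "L \<le> length us" "least_period (\<lambda>i. lab (us ! i)) p L"
    using a by (auto simp: accepted_def)
  let ?g = "gcd p q"
  have p: "1 \<le> p" "period (lab \<circ> loop_of us) p" using accepted_label_period[OF a] by simp_all
  have g: "period (lab \<circ> loop_of us) ?g" "1 \<le> ?g"
    using p q by (auto intro: period_gcd simp: Suc_le_eq)
  have "prefix_period (lab \<circ> loop_of us) ?g L" by (rule period_prefix[OF g(1)])
  also have "prefix_period (lab \<circ> loop_of us) ?g L = prefix_period (\<lambda>i. lab (us ! i)) ?g L"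
    by (rule prefix_period_cong) (use L(1) in \<open>simp add: loop_of_def\<close>)
  finally have "\<not> ?g < p" using L(2) g(2) by (auto simp: least_period_def)
  moreover have "?g \<le> p" using p(1) by (intro dvd_imp_le) auto
  ultimately have "?g = p" by simp
  then show ?thesis by (metis gcd_dvd2)
qed

text \<open>Rotations have the same label periods, so by \<open>least_period_dvd\<close> the two
  numbers divide each other and agree. But a rotation of \<open>us\<close> contains its starting arc
  \<open>e\<close>.\<close>

lemma accepted_distinct:
  assumes a: "accepted e p us" and b: "accepted e' p' us'" and ne: "p = p' \<Longrightarrow> e \<notin> set us'"
    and len: "length us = length us'"
  shows "\<exists>i. loop_of us (i + s) \<noteq> loop_of us' i"
proof (rule ccontr)
  assume "\<not> ?thesis"
  then have eq: "loop_of us (i + s) = loop_of us' i" for i by blast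
  let ?T = "length us"
  have T: "?T \<ge> 1" "us ! 0 = e" using a by (auto simp: accepted_def Suc_le_eq)
  have pa: "period (lab \<circ> loop_of us) p" "1 \<le> p" using accepted_label_period[OF a] by simp_all
  have pb: "period (lab \<circ> loop_of us') p'" "1 \<le> p'" using accepted_label_period[OF b] by simp_all
  have "period (lab \<circ> loop_of us') p"
    using pa(1) eq unfolding period_def comp_def by (metis (no_types, lifting) add.assoc add.commute)
  then have 1: "p' dvd p" using least_period_dvd[OF b _ pa(2)] by blast
  have per: "period (lab \<circ> loop_of us) ?T" by (simp add: period_def loop_of_def)
  have "period (lab \<circ> loop_of us) (s + p' - s)"
  proof (rule shift_period[OF per T(1)])
    fix n
    have "loop_of us (s + n) = loop_of us' n" "loop_of us (s + p' + n) = loop_of us' (n + p')"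
      using eq[of n] eq[of "n + p'"] by (simp_all add: ac_simps)
    then show "(lab \<circ> loop_of us) (s + n) = (lab \<circ> loop_of us) (s + p' + n)"
      using pb(1) by (simp add: period_def)
  qed simp
  then have "p dvd p'" using least_period_dvd[OF a _ pb(2)] by simp
  with 1 have "p = p'" by (simp add: dvd_antisym)
  moreover have "e \<in> set us'"
  proof -
    have "s * (?T - 1) + s = s * ?T" using T(1) by (cases ?T) auto
    then have "loop_of us (s * (?T - 1) + s) = e" using T(2) by (simp only: loop_of_def mod_mult_self2_is_0)
    then have "us' ! (s * (?T - 1) mod length us') = e" using eq[of "s * (?T - 1)"] by (simp add: loop_of_def)
    moreover have "s * (?T - 1) mod length us' < length us'"
      using b by (simp add: accepted_def)
    ultimately show ?thesis by (metis nth_mem)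
  qed
  ultimately show False using ne by blast
qed

text \<open>The cap \<open>2 * nE\<close> is the greatest possible length of a long cycle by
  \<open>length_bound\<close>, so cutting a ray there loses none.\<close>

definition ray_result :: "nat \<Rightarrow> (nat \<Rightarrow> nat) \<Rightarrow> (nat \<Rightarrow> nat) \<Rightarrow> nat \<Rightarrow> bool" where
  "ray_result e U W L \<longleftrightarrow> 1 \<le> L \<and> L \<le> 2 * nE \<and> U 0 = e \<and>
     (\<forall>i<L. live_arc (U i) \<and> W i = lab (U i)) \<and>
     (\<forall>i. Suc i < L \<longrightarrow> tail G (U (Suc i)) = head G (U i) \<and> \<not> stop (tail G (U (Suc i)))) \<and>
     (stop (head G (U (L - 1))) \<or> 2 * nE \<le> L)"

definition traced :: "nat \<Rightarrow> nat \<Rightarrow> (nat \<Rightarrow> nat) \<Rightarrow> (nat \<Rightarrow> nat) \<Rightarrow> nat \<Rightarrow> bool" where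
  "traced e p U W i \<longleftrightarrow> (\<forall>j<i. live_arc (U j) \<and> W j = lab (U j)) \<and>
     (\<forall>j. Suc j < i \<longrightarrow> tail G (U (Suc j)) = head G (U j)) \<and> prefix_period W p i \<and>
     (\<forall>j. 0 < j \<longrightarrow> j < i \<longrightarrow> U j \<noteq> e)"

definition continues :: "nat \<Rightarrow> (nat \<Rightarrow> nat) \<Rightarrow> (nat \<Rightarrow> nat) \<Rightarrow> nat \<Rightarrow> nat \<Rightarrow> bool" where
  "continues p U W i f \<longleftrightarrow> live_arc f \<and> tail G f = head G (U (i - 1)) \<and> lab f = W (i - p)"

lemma ray_resultD:
  assumes "ray_result e U W L"
  shows "1 \<le> L" "U 0 = e" "\<And>i. i < L \<Longrightarrow> live_arc (U i)"
    "\<And>i. Suc i < L \<Longrightarrow> tail G (U (Suc i)) = head G (U i) \<and> \<not> stop (tail G (U (Suc i)))"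
    "stop (head G (U (L - 1))) \<or> 2 * nE \<le> L"
  using assms unfolding ray_result_def by blast+

lemma ray_not_stop:
  assumes "ray_result e U W L" "0 < j" "j < L" shows "\<not> stop (tail G (U j))"
  using ray_resultD(4)[OF assms(1), of "j - 1", THEN conjunct2] assms(2,3) by simp

lemma ray_traced:
  assumes "ray_result e U W L" "e \<in> starts" "prefix_period W p L"
  shows "traced e p U W L"
proof -
  have "U j \<noteq> e" if "0 < j" "j < L" for j
  proof -
    have "\<not> stop (tail G (U j))" by (rule ray_not_stop[OF assms(1) that])
    then show ?thesis using assms(2) by (auto simp: starts_def)
  qed
  then show ?thesis using assms(1,3) by (simp add: ray_result_def traced_def)
qed

lemma trace_accepted:
  assumes ray: "ray_result e U W L" and lp: "least_period W p L" and tr: "traced e p U W i"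
    and e: "e \<in> starts" and Li: "L \<le> i" and cl: "tail G e = head G (U (i - 1))"
    and p: "p dvd i" "12 * betti1 G * p \<le> i"
  shows "accepted e p (map U [0..<i])"
proof -
  let ?us = "map U [0..<i]"
  have L: "1 \<le> L" "U 0 = e" using ray by (simp_all add: ray_result_def)
  have nth: "?us ! j = U j" if "j < i" for j using that by simp
  have Wj: "W j = lab (?us ! j)" if "j < i" for j using tr that by (simp add: traced_def)
  have walk: "live_arc (?us ! j) \<and> head G (?us ! j) = tail G (?us ! (Suc j mod length ?us))" if "j < i" for j
  proof (cases "Suc j < i")
    case True
    then show ?thesis using tr by (simp add: traced_def)
  next
    case False
    then have "j = i - 1" "Suc j mod i = 0" using that by (simp_all add: not_less le_Suc_eq)
    then show ?thesis using tr that cl L by (simp add: traced_def)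
  qed
  have ns: "\<not> stop (tail G (?us ! j))" if "0 < j" "j < L" for j
  proof -
    show ?thesis using ray_not_stop[OF ray that] that Li by simp
  qed
  have "prefix_period (\<lambda>j. lab (?us ! j)) p i"
    using tr prefix_period_cong[of i W "\<lambda>j. lab (?us ! j)" p] Wj by (simp add: traced_def)
  moreover have "least_period (\<lambda>j. lab (?us ! j)) p L"
    using lp least_period_cong[of L W "\<lambda>j. lab (?us ! j)" p] Wj Li by simp
  ultimately show ?thesis
    unfolding accepted_def
  proof (intro conjI exI[of _ L] e)
    show "?us \<noteq> []" "?us ! 0 = e" using L Li by simp_all
    show "p dvd length ?us" "12 * betti1 G * p \<le> length ?us" "L \<le> length ?us" using p Li by simp_all
    show "\<forall>j<length ?us. live_arc (?us ! j) \<and> head G (?us ! j) = tail G (?us ! (Suc j mod length ?us))"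
    proof (intro allI impI)
      fix j assume "j < length ?us"
      then have "j < i" by simp
      then show "live_arc (?us ! j) \<and> head G (?us ! j) = tail G (?us ! (Suc j mod length ?us))" by (rule walk)
    qed
    show "\<forall>j. 0 < j \<longrightarrow> j < length ?us \<longrightarrow> ?us ! j \<noteq> e" using tr by (simp add: traced_def)
    show "\<forall>j. 0 < j \<longrightarrow> j < L \<longrightarrow> \<not> stop (tail G (?us ! j))" using ns by blast
  qed simp_all
qed

lemma witnessed_facts:
  assumes "witnessed T l h"
  shows "1 \<le> T" "l \<le> T" "T \<le> 2 * nE" "1 \<le> l" "period h T" "period (lab \<circ> h) l" "h 0 \<in> starts"
    "live_arc (h i)" "head G (h i) = tail G (h (Suc i))"
    "1 \<le> n \<Longrightarrow> n \<le> 3 * l \<Longrightarrow> \<not> stop (tail G (h n))" "closed_walk G T h"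
proof -
  interpret r: repetitive_walk G lab T l h using assms by (simp add: witnessed_def)
  show "1 \<le> T" by (rule r.T1)
  then show "l \<le> T" using r.ldvd by (intro dvd_imp_le) auto
  show "T \<le> 2 * nE" using r.length_bound by (simp add: arcsG)
  show "1 \<le> l" "period h T" "period (lab \<circ> h) l" by (rule r.l1 r.hper r.lper)+
  show "h 0 \<in> starts" using assms by (simp add: witnessed_def)
  show "live_arc (h i)" by (rule closed_walk_live[OF r.cw])
  show "head G (h i) = tail G (h (Suc i))" using r.hstep by (simp add: r.pos_def)
  show "1 \<le> n \<Longrightarrow> n \<le> 3 * l \<Longrightarrow> \<not> stop (tail G (h n))" using assms by (simp add: witnessed_def)
  show "closed_walk G T h" by (rule r.cw)
qed

text \<open>Up to its first stop after position 0, the cycle can only use chosen arcs, exactly like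
  the ray. That stop comes after position \<open>3 * l\<close>, and at the latest at
  \<open>T\<close>, where the cycle is back at its starting stop.\<close>

lemma ray_follows:
  assumes w: "witnessed T l h" and ray: "ray_result (h 0) U W L"
  shows "3 * l + 1 \<le> L \<and> L \<le> T \<and> (\<forall>j<L. U j = h j)"
proof -
  note wf = witnessed_facts[OF w]
  have stT: "stop (tail G (h T))"
    using wf(5,7) unfolding period_def starts_def by (metis (mono_tags, lifting) add_0 mem_Collect_eq)
  define M where "M = (LEAST n. 1 \<le> n \<and> stop (tail G (h n)))"
  have M: "1 \<le> M \<and> stop (tail G (h M))" unfolding M_def by (rule LeastI[of _ T]) (use wf(1) stT in simp)
  have MT: "M \<le> T" unfolding M_def by (rule Least_le) (use wf(1) stT in simp)
  have lt: "\<not> stop (tail G (h n))" if "1 \<le> n" "n < M" for n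
    using not_less_Least[of n "\<lambda>n. 1 \<le> n \<and> stop (tail G (h n))"] that by (simp add: M_def)
  have lM: "3 * l + 1 \<le> M" using M wf(10)[of M] by linarith
  have r: "1 \<le> L" "U 0 = h 0" "\<And>i. i < L \<Longrightarrow> live_arc (U i)"
    "\<And>i. Suc i < L \<Longrightarrow> tail G (U (Suc i)) = head G (U i) \<and> \<not> stop (tail G (U (Suc i)))"
    "stop (head G (U (L - 1))) \<or> 2 * nE \<le> L"
    by (fact ray_resultD[OF ray])+
  have eq: "U j = h j" if "j < L" "j < M" for j
    using that
  proof (induction j)
    case 0 then show ?case using r(2) by simp
  next
    case (Suc j)
    then have t: "tail G (U (Suc j)) = tail G (h (Suc j))" using r(4)[of j] wf(9) by simp
    have "\<not> stop (tail G (h (Suc j)))" using lt Suc.prems by simp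
    then have "U (Suc j) = chosen (tail G (U (Suc j)))" "h (Suc j) = chosen (tail G (h (Suc j)))"
      using not_stop_chosen[OF r(3)[OF Suc.prems(1)]] not_stop_chosen[OF wf(8)[of "Suc j"]] t by metis+
    then show ?case using t by metis
  qed
  have "\<not> L < M"
  proof
    assume a: "L < M"
    then have "head G (U (L - 1)) = tail G (h L)" using eq[of "L - 1"] r(1) wf(9)[of "L - 1"] by simp
    then have "2 * nE \<le> L" using r(5) lt[of L] r(1) a by auto
    then show False using a MT wf(3) by simp
  qed
  moreover have "\<not> M < L"
  proof
    assume a: "M < L"
    obtain m where m: "M = Suc m" using M by (cases M) auto
    then have "tail G (U M) = tail G (h M)" using r(4)[of m] eq[of m] wf(9)[of m] a by simp
    moreover have "\<not> stop (tail G (U M))" using r(4)[of m, THEN conjunct2] a m by simp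
    ultimately show False using M by simp
  qed
  ultimately have "L = M" by simp
  then show ?thesis using lM MT eq by simp
qed

text \<open>The ray has label period \<open>l\<close>, so \<open>p \<le> l\<close>. Being longer
  than \<open>2 * l\<close>, it shows the shift by \<open>p\<close> on a full period of labels; then
  \<open>p\<close> is a period of all labels, and \<open>l\<close> is the least of these.\<close>

lemma ray_period:
  assumes w: "witnessed T l h" and ray: "ray_result (h 0) U W L" and lp: "least_period W p L"
  shows "p = l"
proof -
  interpret r: repetitive_walk G lab T l h using w by (simp add: witnessed_def)
  note rf = ray_follows[OF w ray]
  have W: "W j = (lab \<circ> h) j" if "j < L" for j using ray rf that by (simp add: ray_result_def)
  have lp': "least_period (lab \<circ> h) p L" using lp least_period_cong[of L W "lab \<circ> h" p] W by simp
  have "prefix_period (lab \<circ> h) l L" by (rule period_prefix[OF r.lper])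
  then have "\<not> l < p" using lp' r.l1 by (auto simp: least_period_def)
  then have pl: "p \<le> l" by simp
  have pp: "1 \<le> p" "prefix_period (lab \<circ> h) p L" using lp' by (simp_all add: least_period_def)
  have "(lab \<circ> h) (p + n) = (lab \<circ> h) n" for n
  proof (rule period_ext[OF r.lper r.l1 _ r.lper])
    fix j assume "j < l"
    then have "j + p < L" using pl rf by simp
    then show "(lab \<circ> h) (p + j) = (lab \<circ> h) j"
      using pp(2)[unfolded prefix_period_def, rule_format, of j] by (simp add: add.commute)
  qed
  then have "period (lab \<circ> h) p" by (simp add: period_def add.commute)
  then have "l \<le> p" using r.lprim pp(1) by (simp add: primitive_walk_def)
  then show ?thesis using pl by simp
qed

text \<open>Beyond the ray, period \<open>l\<close> prescribes the next label, and the label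
  determines the arc. The trace cannot outrun the cycle, since \<open>h T = h 0\<close> and a trace
  does not repeat its first arc.\<close>

lemma trace_follows:
  assumes w: "witnessed T l h" and ray: "ray_result (h 0) U W L" and tr: "traced (h 0) l U W i"
    and Li: "L \<le> i"
  shows "i \<le> T \<and> (\<forall>j<i. U j = h j)"
proof -
  note wf = witnessed_facts[OF w]
  note rf = ray_follows[OF w ray]
  have eq: "U j = h j" if "j < i" for j
    using that
  proof (induction j rule: less_induct)
    case (less j)
    show ?case
    proof (cases "j < L")
      case True then show ?thesis using rf by simp
    next
      case False
      then have lj: "3 * l + 1 \<le> j" using rf by simp
      obtain m where m: "j = Suc m" using lj by (cases j) auto
      have live: "live_arc (U j)" "W j = lab (U j)" "tail G (U j) = head G (U m)"
        using tr less.prems m by (simp_all add: traced_def)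
      have "tail G (U j) = tail G (h j)" using live(3) less.IH[of m] m less.prems wf(9)[of m] by simp
      moreover have "lab (U j) = lab (h j)"
      proof -
        have "W (j - l + l) = W (j - l)"
        proof -
          have "prefix_period W l i" using tr by (simp add: traced_def)
          moreover have "j - l + l < i" using less.prems lj by simp
          ultimately show ?thesis unfolding prefix_period_def by blast
        qed
        then have "W j = W (j - l)" using lj by simp
        also have "\<dots> = lab (h (j - l))" using tr less.prems less.IH[of "j - l"] lj wf(4) by (simp add: traced_def)
        also have "\<dots> = lab (h j)"
          using wf(6)[unfolded period_def, rule_format, of "j - l"] lj by simp
        finally show ?thesis using live by simp
      qed
      ultimately show ?thesis
        using label_inj live_arc_ends(1)[OF live(1)] live_arc_ends(1)[OF wf(8)] by blast
    qed
  qed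
  have "i \<le> T"
  proof (rule ccontr)
    assume "\<not> i \<le> T"
    then have T: "0 < T" "T < i" using wf(1) by simp_all
    have "h (0 + T) = h 0" using wf(5) unfolding period_def by blast
    then have "U T = h 0" using eq[OF T(2)] by simp
    then show False using tr T by (simp add: traced_def)
  qed
  then show ?thesis using eq by blast
qed

lemma continuation:
  assumes w: "witnessed T l h" and ray: "ray_result (h 0) U W L" and tr: "traced (h 0) l U W i"
    and Li: "L \<le> i"
  shows "continues l U W i f \<longleftrightarrow> f = h i"
proof -
  note wf = witnessed_facts[OF w]
  note rf = ray_follows[OF w ray]
  note tf = trace_follows[OF assms]
  have i: "3 * l + 1 \<le> i" using rf Li by simp
  have "head G (U (i - 1)) = tail G (h i)" using tf i wf(9)[of "i - 1"] by simp
  moreover have "W (i - l) = lab (h (i - l))" using tf tr i wf(4) by (simp add: traced_def)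
  moreover have "lab (h (i - l)) = lab (h i)"
    using wf(6)[unfolded period_def, rule_format, of "i - l"] i by simp
  ultimately have c: "continues l U W i f \<longleftrightarrow> live_arc f \<and> tail G f = tail G (h i) \<and> lab f = lab (h i)"
    by (simp add: continues_def)
  show ?thesis
    unfolding c using label_inj live_arc_ends(1) wf(8) by blast
qed

text \<open>While \<open>g\<close> meets no stop, both walks take chosen arcs. This covers one label
  period, so all later labels agree, and then so do the arcs.\<close>

lemma follow_same:
  assumes h: "closed_walk G T h" "period (lab \<circ> h) l" and g: "closed_walk G T' g" "period (lab \<circ> g) l"
    and l: "1 \<le> l" "l \<le> L" and ns: "\<And>n. 0 < n \<Longrightarrow> n < L \<Longrightarrow> \<not> stop (tail G (g n))"
    and i: "h i = g 0"
  shows "h (i + n) = g n"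
proof -
  have st: "head G (h j) = tail G (h (Suc j))" "head G (g j) = tail G (g (Suc j))" for j
    using h(1) g(1) by (simp_all add: closed_walk_def)
  have ray: "h (i + n) = g n" if "n < L" for n
    using that
  proof (induction n)
    case 0 then show ?case using i by simp
  next
    case (Suc n)
    then have t: "tail G (h (i + Suc n)) = tail G (g (Suc n))" using st(1)[of "i + n"] st(2)[of n] by simp
    then have "h (i + Suc n) = chosen (tail G (g (Suc n)))" "g (Suc n) = chosen (tail G (g (Suc n)))"
      using not_stop_chosen[OF closed_walk_live[OF h(1)], of "i + Suc n"]
        not_stop_chosen[OF closed_walk_live[OF g(1)], of "Suc n"] ns[of "Suc n"] Suc.prems by auto
    then show ?case by simp
  qed
  have lab: "(lab \<circ> h) (i + n) = (lab \<circ> g) n" for n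
    by (rule period_ext[OF h(2) l(1) _ g(2)]) (use ray l in simp)
  show ?thesis
  proof (induction n)
    case 0 then show ?case using i by simp
  next
    case (Suc n)
    then have t: "tail G (h (i + Suc n)) = tail G (g (Suc n))" using st(1)[of "i + n"] st(2)[of n] by simp
    show ?case
      by (rule label_inj[OF live_arc_ends(1)[OF closed_walk_live[OF h(1)]]
            live_arc_ends(1)[OF closed_walk_live[OF g(1)]] t])
        (use lab[of "Suc n"] in simp)
  qed
qed

text \<open>A return to the first arc repeats its stop-free run and hence, by
  \<open>follow_same\<close>, the entire future; primitivity makes it a full turn.\<close>

lemma return_length:
  assumes w: "witnessed T l h" and ray: "ray_result (h 0) U W L" and i: "h i = h 0" "0 < i" "i \<le> T"
  shows "i = T"
proof -
  interpret r: repetitive_walk G lab T l h using w by (simp add: witnessed_def)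
  note rf = ray_follows[OF w ray]
  have "h (i + n) = h n" for n
  proof (rule follow_same[OF r.cw r.lper r.cw r.lper r.l1 _ _ i(1)])
    show "l \<le> 3 * l + 1" by simp
    fix n assume "0 < n" "n < 3 * l + 1"
    then show "\<not> stop (tail G (h n))" using witnessed_facts(10)[OF w, of n] by simp
  qed
  then have "i mod T = 0 mod T" by (intro shift_eq_mod[OF r.hper r.T1 r.prim]) simp
  then have "T dvd i" by (simp add: dvd_eq_mod_eq_0)
  then show ?thesis using i by (simp add: dvd_imp_le le_antisym)
qed

text \<open>This justifies giving up a trace as soon as it reaches the starting arc of an accepted
  cycle with the same label period: \<open>follow_same\<close> identifies the two walks, and
  primitivity of both their lengths.\<close>

lemma duplicate:
  assumes w: "witnessed T l h" and a: "accepted (h i) l us"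
  shows "length us = T \<and> (\<forall>n. loop_of us n = h (i + n))"
proof -
  interpret r: repetitive_walk G lab T l h using w by (simp add: witnessed_def)
  have lw: "long_walk G lab (length us) (loop_of us)" by (rule accepted_long[OF a])
  then have cw: "closed_walk G (length us) (loop_of us)" and prim: "primitive_walk (length us) (loop_of us)"
    by (simp_all add: long_walk_def)
  have cw': "1 \<le> length us" "period (loop_of us) (length us)" using cw by (simp_all add: closed_walk_def)
  obtain L where L: "L \<le> length us" "least_period (\<lambda>i. lab (us ! i)) l L"
    "\<And>j. 0 < j \<Longrightarrow> j < L \<Longrightarrow> \<not> stop (tail G (us ! j))" and us0: "us ! 0 = h i"
    using a by (auto simp: accepted_def)
  have eq: "h (i + n) = loop_of us n" for n
  proof (rule follow_same[OF r.cw r.lper cw _ r.l1, where L = L])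
    show "period (lab \<circ> loop_of us) l" by (rule accepted_label_period(1)[OF a])
    show "l \<le> L" using L(2) by (simp add: least_period_def)
    show "h i = loop_of us 0" using us0 by (simp add: loop_of_def)
    fix j assume "0 < j" "j < L"
    then show "\<not> stop (tail G (loop_of us j))" using L(1) L(3)[of j] by (simp add: loop_of_def)
  qed
  have "period (\<lambda>n. h (i + n)) T" by (rule period_shift[OF r.hper])
  then have "period (loop_of us) T" by (simp add: eq)
  then have 1: "length us \<le> T" using prim r.T1 by (simp add: primitive_walk_def)
  have "period h (i + length us - i)"
  proof (rule shift_period[OF r.hper r.T1])
    fix n show "h (i + n) = h (i + length us + n)"
      using cw'(2)[unfolded period_def, rule_format, of n] eq[of n] eq[of "n + length us"] by (simp add: ac_simps)
  qed simp
  then have "T \<le> length us" using r.prim cw'(1) by (simp add: primitive_walk_def)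
  then show ?thesis using 1 eq by simp
qed

end

section \<open>Tracing cycles\<close>

definition stops_prog :: com where
  "stops_prog = Move ''e'' (Const 0) ;;
    Loop (Less (Var ''e'') (Var ''Gamma_arcs''))
      (Load ''h'' ''Gamma_head'' (Var ''e'') ;; Load ''x'' ''st'' (Var ''h'') ;;
       Branch (Equal (Var ''x'') (Const 3))
         (Load ''t'' ''Gamma_tail'' (Var ''e'') ;; Load ''x'' ''first'' (Var ''t'') ;;
          Add ''y'' (Var ''e'') (Const 1) ;;
          Branch (Equal (Var ''x'') (Var ''y''))
            (Load ''x'' ''C'' (Var ''t'') ;;
             Branch (Equal (Var ''x'') (Var ''t'')) (Store ''stop'' (Var ''t'') (Const 1)) Skip)
            (Store ''stop'' (Var ''t'') (Const 1)))
         Skip ;;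
       Add ''e'' (Var ''e'') (Const 1))"

definition starts_prog :: com where
  "starts_prog = Move ''e'' (Const 0) ;; Move ''kk'' (Const 0) ;;
    Loop (Less (Var ''e'') (Var ''Gamma_arcs''))
      (Load ''h'' ''Gamma_head'' (Var ''e'') ;; Load ''x'' ''st'' (Var ''h'') ;;
       Branch (Equal (Var ''x'') (Const 3))
         (Load ''t'' ''Gamma_tail'' (Var ''e'') ;; Load ''x'' ''stop'' (Var ''t'') ;;
          Branch (Equal (Var ''x'') (Const 1))
            (Store ''K'' (Var ''kk'') (Var ''e'') ;; Add ''kk'' (Var ''kk'') (Const 1))
            Skip)
         Skip ;;
       Add ''e'' (Var ''e'') (Const 1))"

definition ray_prog :: com where
  "ray_prog = Store ''U'' (Const 0) (Var ''e0'') ;; Load ''a'' ''gamma_emap'' (Var ''e0'') ;;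
    Store ''W'' (Const 0) (Var ''a'') ;; Load ''v'' ''Gamma_head'' (Var ''e0'') ;;
    Move ''L'' (Const 1) ;; Load ''z'' ''stop'' (Var ''v'') ;;
    Loop (Equal (Var ''z'') (Const 0))
      (Load ''e'' ''first'' (Var ''v'') ;; Sub ''e'' (Var ''e'') (Const 1) ;;
       Store ''U'' (Var ''L'') (Var ''e'') ;; Load ''a'' ''gamma_emap'' (Var ''e'') ;;
       Store ''W'' (Var ''L'') (Var ''a'') ;; Load ''v'' ''Gamma_head'' (Var ''e'') ;;
       Add ''L'' (Var ''L'') (Const 1) ;; Load ''z'' ''stop'' (Var ''v'') ;;
       Branch (Less (Var ''L'') (Var ''N'')) Skip (Move ''z'' (Const 1)))"

text \<open>The preprocessing of the Knuth-Morris-Pratt algorithm, expressed by periods instead of borders: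
  \<open>P i\<close> is the least period of the first \<open>i\<close> letters of \<open>W\<close>.\<close>

definition period_prog :: com where
  "period_prog = Store ''P'' (Const 1) (Const 1) ;; Move ''i'' (Const 1) ;; Move ''p'' (Const 1) ;;
    Loop (Less (Var ''i'') (Var ''L''))
      (Sub ''x'' (Var ''i'') (Var ''p'') ;; Load ''a'' ''W'' (Var ''i'') ;; Load ''y'' ''W'' (Var ''x'') ;;
       Branch (Equal (Var ''a'') (Var ''y''))
         (Add ''i'' (Var ''i'') (Const 1) ;; Store ''P'' (Var ''i'') (Var ''p''))
         (Branch (Equal (Var ''x'') (Const 0))
           (Add ''i'' (Var ''i'') (Const 1) ;; Move ''p'' (Var ''i'') ;; Store ''P'' (Var ''i'') (Var ''p''))
           (Load ''y'' ''P'' (Var ''x'') ;; Add ''p'' (Var ''p'') (Var ''y''))))"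

definition scan_loop :: com where
  "scan_loop = Loop (Less (Var ''k'') (Var ''kk''))
      (Load ''e'' ''K'' (Var ''k'') ;; Load ''x'' ''Gamma_tail'' (Var ''e'') ;;
       Branch (Equal (Var ''x'') (Var ''v''))
         (Load ''y'' ''gamma_emap'' (Var ''e'') ;;
          Branch (Equal (Var ''y'') (Var ''a'')) (Add ''t'' (Var ''e'') (Const 1)) Skip)
         Skip ;;
       Add ''k'' (Var ''k'') (Const 1))"

text \<open>At a vertex that is no stop, the chosen arc is the only live one; at a stop, all live
  out-arcs are in the list \<open>K\<close>. So these candidates suffice, and the scan takes
  O(\<beta>) steps whatever the out-degree is.\<close>

definition scan_prog :: com where
  "scan_prog = Move ''t'' (Const 0) ;; Load ''e'' ''first'' (Var ''v'') ;;
    Sub ''e'' (Var ''e'') (Const 1) ;; Load ''y'' ''gamma_emap'' (Var ''e'') ;;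
    Branch (Equal (Var ''y'') (Var ''a'')) (Add ''t'' (Var ''e'') (Const 1)) Skip ;;
    Move ''k'' (Const 0) ;; scan_loop"

text \<open>The search stops with \<open>z = 2\<close> if it returns to the arc \<open>e0\<close>, and with \<open>z = 1\<close> if it fails.
  The entry \<open>acc e\<close> is the label period of the cycle found from \<open>e\<close>, or 0 if there is none.\<close>

definition trace_step :: com where
  "trace_step = Branch (Equal (Var ''t'') (Const 0))
      (Move ''z'' (Const 1))
      (Sub ''e'' (Var ''t'') (Const 1) ;;
       Branch (Equal (Var ''e'') (Var ''e0''))
         (Move ''z'' (Const 2))
         (Load ''x'' ''acc'' (Var ''e'') ;;
          Branch (Equal (Var ''x'') (Var ''p''))
            (Move ''z'' (Const 1))
            (Store ''U'' (Var ''i'') (Var ''e'') ;; Store ''W'' (Var ''i'') (Var ''a'') ;;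
             Load ''v'' ''Gamma_head'' (Var ''e'') ;; Add ''i'' (Var ''i'') (Const 1) ;;
             Branch (Less (Var ''N'') (Var ''i'')) (Move ''z'' (Const 1)) Skip)))"

definition trace_prog :: com where
  "trace_prog = Move ''i'' (Var ''L'') ;; Move ''z'' (Const 0) ;;
    Loop (Equal (Var ''z'') (Const 0))
      (Sub ''x'' (Var ''i'') (Var ''p'') ;; Load ''a'' ''W'' (Var ''x'') ;; scan_prog ;;
       trace_step)"

lemma arr_set_other: "A \<noteq> B \<Longrightarrow> arr (set_arr A i n s) B = arr s B"
  by auto

lemma var_set_other: "x \<noteq> y \<Longrightarrow> var (set_var x n s) y = var s y"
  by auto

lemma credit_step: "c * (n - i) + d \<le> j \<Longrightarrow> i < n \<Longrightarrow> \<exists>K. j = c + K \<and> c * (n - Suc i) + d \<le> (K::nat)"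
proof -
  assume a: "c * (n - i) + d \<le> j" "i < n"
  then have "n - i = Suc (n - Suc i)" by simp
  then have "c * (n - i) = c + c * (n - Suc i)" by simp
  then show ?thesis using a by (intro exI[of _ "j - c"]) simp
qed

section \<open>Correctness of the programs for stops, starts and rays\<close>

context explored_graph begin

definition ginp :: "state \<Rightarrow> bool" where
  "ginp s \<longleftrightarrow> inp s \<and> arr s ''first'' = first \<and> arr s ''st'' = st \<and> arr s ''C'' = C"

lemma ginp_set [simp]:
  "x \<notin> {''Gamma_verts'', ''Gamma_arcs''} \<Longrightarrow> ginp (set_var x n s) = ginp s"
  "A \<notin> {''Gamma_tail'', ''Gamma_head'', ''gamma_emap'', ''first'', ''st'', ''C''} \<Longrightarrow> ginp (set_arr A i n s) = ginp s"
  by (simp_all add: ginp_def inp_def arr_set_other var_set_other del: arr_set_arr var_set_var)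

lemma ginp_frame:
  assumes "ginp s" "frame c s s'"
    and "{''Gamma_verts'', ''Gamma_arcs''} \<inter> wvars c = {}"
    and "{''Gamma_tail'', ''Gamma_head'', ''gamma_emap''} \<inter> warrs c = {}"
    and "''first'' \<notin> warrs c" "''st'' \<notin> warrs c" "''C'' \<notin> warrs c"
  shows "ginp s'"
proof -
  have "inp s" using assms(1) by (simp add: ginp_def)
  then have "inp s'" by (rule inp_frame[OF _ assms(2,3,4)])
  then show ?thesis
    using assms(1) frame_arr[OF assms(2,5)] frame_arr[OF assms(2,6)] frame_arr[OF assms(2,7)]
    by (simp add: ginp_def)
qed

lemma ginpD:
  assumes "ginp s"
  shows "var s ''Gamma_verts'' = nV" "var s ''Gamma_arcs'' = nE" "arr s ''first'' = first" "arr s ''st'' = st"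
    "arr s ''C'' = C" "e < nE \<Longrightarrow> arr s ''Gamma_tail'' e = tail G e" "e < nE \<Longrightarrow> arr s ''Gamma_head'' e = head G e"
    "e < nE \<Longrightarrow> arr s ''gamma_emap'' e = lab e"
  using assms by (simp_all add: ginp_def inp_def)

definition stop_upto :: "nat \<Rightarrow> nat \<Rightarrow> bool" where
  "stop_upto i v \<longleftrightarrow> (\<exists>e<i. live_arc e \<and> tail G e = v \<and> (first v = Suc e \<longrightarrow> C v = v))"

lemma stop_upto_Suc: "stop_upto (Suc i) v \<longleftrightarrow>
    stop_upto i v \<or> live_arc i \<and> tail G i = v \<and> (first v = Suc i \<longrightarrow> C v = v)"
  by (auto simp: stop_upto_def less_Suc_eq)

lemma stops_correct:
  assumes "ginp s" "arr s ''stop'' = (\<lambda>_. 0)"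
  shows "wp stops_prog (\<lambda>s' _. arr s' ''stop'' = (\<lambda>v. if stop v then 1 else 0)) s (14 * nE + 3)"
  unfolding stops_prog_def wp_simps
proof (intro conjI, simp, rule wp_Loop[where
      I = "\<lambda>s k. var s ''e'' \<le> nE \<and> arr s ''stop'' = (\<lambda>v. if stop_upto (var s ''e'') v then 1 else 0) \<and>
        14 * (nE - var s ''e'') + 2 \<le> k"], goal_cases)
  case 1
  then show ?case using assms by (simp add: stop_upto_def)
next
  case (2 s' j)
  have g: "ginp s'" by (rule ginp_frame[OF _ 2(2)]) (simp_all add: assms(1))
  define e where "e = var s' ''e''"
  have e: "e < nE" using 2(3) ginpD[OF g] by (simp add: e_def)
  have "14 * (nE - e) + 2 \<le> j" using 2(1) by (simp add: e_def)
  from credit_step[OF this e] obtain K where K: "j = 14 + K" "14 * (nE - Suc e) + 2 \<le> K" by blast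
  have st: "arr s' ''stop'' = (\<lambda>v. if stop_upto e v then 1 else 0)" using 2(1) by (simp add: e_def)
  note unf = wp_simps e_def[symmetric] ginpD[OF g] st e Suc_leI[OF e]
  let ?t = "tail G e"
  show ?case
  proof (cases "live_arc e \<and> (first ?t = Suc e \<longrightarrow> C ?t = ?t)")
    case True
    then have "(\<lambda>v. if stop_upto (Suc e) v then 1 else 0) = (\<lambda>v. if stop_upto e v then 1 else 0)(?t := (1::nat))"
      by (auto simp: fun_eq_iff stop_upto_Suc)
    then show ?thesis unfolding K(1) using K(2) True e by (simp add: unf live_arc_def)
  next
    case False
    then have "(\<lambda>v. if stop_upto (Suc e) v then 1 else 0) = (\<lambda>v. if stop_upto e v then 1 else (0::nat))"
      by (auto simp: fun_eq_iff stop_upto_Suc)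
    then show ?thesis unfolding K(1) using K(2) False e by (auto simp: unf live_arc_def)
  qed
next
  case (3 s' j)
  have g: "ginp s'" by (rule ginp_frame[OF _ 3(2)]) (simp_all add: assms(1))
  have "var s' ''e'' = nE" using 3 ginpD[OF g] by simp
  then show ?case using 3(1) by (simp add: stop_upto_def stop_def)
qed

definition stops_known :: "state \<Rightarrow> bool" where
  "stops_known s \<longleftrightarrow> ginp s \<and> arr s ''stop'' = (\<lambda>v. if stop v then 1 else 0)"

lemma stops_known_set [simp]:
  "x \<notin> {''Gamma_verts'', ''Gamma_arcs''} \<Longrightarrow> stops_known (set_var x n s) = stops_known s"
  "A \<notin> {''Gamma_tail'', ''Gamma_head'', ''gamma_emap'', ''first'', ''st'', ''C'', ''stop''} \<Longrightarrow>
    stops_known (set_arr A i n s) = stops_known s"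
  by (simp_all add: stops_known_def arr_set_other del: arr_set_arr)

lemma stops_known_frame:
  assumes "stops_known s" "frame c s s'"
    and "{''Gamma_verts'', ''Gamma_arcs''} \<inter> wvars c = {}"
    and "{''Gamma_tail'', ''Gamma_head'', ''gamma_emap''} \<inter> warrs c = {}"
    and "''first'' \<notin> warrs c" "''st'' \<notin> warrs c" "''C'' \<notin> warrs c" "''stop'' \<notin> warrs c"
  shows "stops_known s'"
proof -
  have "ginp s" using assms(1) by (simp add: stops_known_def)
  then have "ginp s'" by (rule ginp_frame[OF _ assms(2-7)])
  then show ?thesis using assms(1) frame_arr[OF assms(2,8)] by (simp add: stops_known_def)
qed

lemma stops_knownD: "stops_known s \<Longrightarrow> ginp s" "stops_known s \<Longrightarrow> arr s ''stop'' = (\<lambda>v. if stop v then 1 else 0)"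
  by (simp_all add: stops_known_def)

lemma starts_correct:
  assumes "stops_known s"
  shows "wp starts_prog (\<lambda>s' _. arr s' ''K'' ` {..<var s' ''kk''} = starts \<and>
    inj_on (arr s' ''K'') {..<var s' ''kk''}) s (12 * nE + 4)"
  unfolding starts_prog_def wp_simps
proof (intro conjI, simp, simp, rule wp_Loop[where
      I = "\<lambda>s k. var s ''e'' \<le> nE \<and> arr s ''K'' ` {..<var s ''kk''} = {e \<in> starts. e < var s ''e''} \<and>
        inj_on (arr s ''K'') {..<var s ''kk''} \<and> 12 * (nE - var s ''e'') + 2 \<le> k"], goal_cases)
  case 1
  then show ?case by simp
next
  case (2 s' j)
  have sk: "stops_known s'" by (rule stops_known_frame[OF _ 2(2)]) (simp_all add: assms(1))
  note g = stops_knownD(1)[OF sk] and st = stops_knownD(2)[OF sk]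
  define e K kk where defs: "e = var s' ''e''" "K = arr s' ''K''" "kk = var s' ''kk''"
  have e: "e < nE" using 2(3) ginpD[OF g] by (simp add: defs)
  have "12 * (nE - e) + 2 \<le> j" using 2(1) by (simp add: defs)
  from credit_step[OF this e] obtain R where R: "j = 12 + R" "12 * (nE - Suc e) + 2 \<le> R" by blast
  have K: "K ` {..<kk} = {f \<in> starts. f < e}" "inj_on K {..<kk}" using 2(1) by (simp_all add: defs)
  note unf = wp_simps defs[symmetric] ginpD[OF g] st e Suc_leI[OF e]
  show ?case
  proof (cases "e \<in> starts")
    case True
    have dk: "(K(kk := e)) ` {..<kk} = K ` {..<kk}" "{..<kk} - {kk} = {..<kk}" by (auto intro: image_cong)
    have "(K(kk := e)) ` {..<Suc kk} = insert e (K ` {..<kk})"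
      unfolding lessThan_Suc image_insert dk by simp
    then have im: "(K(kk := e)) ` {..<Suc kk} = {f \<in> starts. f < Suc e}"
      using K(1) True by (auto simp: less_Suc_eq)
    have ne: "e \<notin> K ` {..<kk}" unfolding K(1) by simp
    have "inj_on (K(kk := e)) {..<kk}" by (rule inj_on_fun_updI[OF K(2) ne])
    then have "inj_on (K(kk := e)) {..<Suc kk}"
      unfolding lessThan_Suc inj_on_insert dk using ne by simp
    moreover have "st (head G e) = 3" "stop (tail G e)" using True by (simp_all add: starts_def live_arc_def)
    ultimately show ?thesis unfolding R(1) using R(2) im by (simp add: unf)
  next
    case False
    then have "{f \<in> starts. f < Suc e} = {f \<in> starts. f < e}" by (auto simp: less_Suc_eq)
    moreover have "st (head G e) \<noteq> 3 \<or> \<not> stop (tail G e)"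
      using False e by (auto simp: starts_def live_arc_def)
    ultimately show ?thesis unfolding R(1) using R(2) K by (auto simp: unf)
  qed
next
  case (3 s' j)
  have sk: "stops_known s'" by (rule stops_known_frame[OF _ 3(2)]) (simp_all add: assms(1))
  have "var s' ''e'' = nE" using 3 ginpD[OF stops_knownD(1)[OF sk]] by simp
  moreover have "{e \<in> starts. e < nE} = starts" by (auto simp: starts_def live_arc_def)
  ultimately show ?case using 3(1) by simp
qed

definition ray_inv :: "nat \<Rightarrow> (nat \<Rightarrow> nat) \<Rightarrow> (nat \<Rightarrow> nat) \<Rightarrow> nat \<Rightarrow> nat \<Rightarrow> bool" where
  "ray_inv e U W L v \<longleftrightarrow> 1 \<le> L \<and> L \<le> 2 * nE \<and> U 0 = e \<and>
     (\<forall>i<L. live_arc (U i) \<and> W i = lab (U i)) \<and>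
     (\<forall>i. Suc i < L \<longrightarrow> tail G (U (Suc i)) = head G (U i) \<and> \<not> stop (tail G (U (Suc i)))) \<and>
     v = head G (U (L - 1))"

lemma ray_inv_live: "ray_inv e U W L v \<Longrightarrow> live v"
proof -
  assume "ray_inv e U W L v"
  then have i: "1 \<le> L" "\<forall>i<L. live_arc (U i) \<and> W i = lab (U i)" "v = head G (U (L - 1))"
    unfolding ray_inv_def by blast+
  have "live_arc (U (L - 1))" using i(1,2) by simp
  then show ?thesis unfolding i(3) by (rule live_arc_ends(2))
qed

lemma ray_inv_result:
  "ray_inv e U W L v \<Longrightarrow> stop v \<or> 2 * nE \<le> L \<Longrightarrow> ray_result e U W L \<and> v = head G (U (L - 1))"
  unfolding ray_inv_def ray_result_def by blast

lemma ray_inv_step: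
  assumes inv: "ray_inv e U W L v" and v: "\<not> stop v" "L < 2 * nE"
  shows "ray_inv e (U(L := chosen v)) (W(L := lab (chosen v))) (Suc L) (head G (chosen v))"
proof -
  note lv = live_chosen[OF ray_inv_live[OF inv]]
  have i: "1 \<le> L" "U 0 = e" "\<forall>i<L. live_arc (U i) \<and> W i = lab (U i)"
     "\<forall>i. Suc i < L \<longrightarrow> tail G (U (Suc i)) = head G (U i) \<and> \<not> stop (tail G (U (Suc i)))"
     "v = head G (U (L - 1))" using inv unfolding ray_inv_def by blast+
  let ?U = "U(L := chosen v)"
  have "tail G (?U (Suc i)) = head G (?U i) \<and> \<not> stop (tail G (?U (Suc i)))" if "Suc i < Suc L" for i
  proof (cases "Suc i = L")
    case True
    then have "v = head G (U i)" using i(5) by auto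
    then show ?thesis using True lv(3) v(1) by auto
  next
    case False
    then have "Suc i < L" using that by simp
    then show ?thesis using i(4) by auto
  qed
  moreover have "live_arc (?U i) \<and> (W(L := lab (chosen v))) i = lab (?U i)" if "i < Suc L" for i
    using i(3) lv(4) that by (cases "i = L") simp_all
  ultimately have "\<forall>i. Suc i < Suc L \<longrightarrow> tail G (?U (Suc i)) = head G (?U i) \<and> \<not> stop (tail G (?U (Suc i)))"
    "\<forall>i<Suc L. live_arc (?U i) \<and> (W(L := lab (chosen v))) i = lab (?U i)" by blast+
  moreover have "1 \<le> Suc L" "Suc L \<le> 2 * nE" "?U 0 = e" "head G (chosen v) = head G (?U (Suc L - 1))"
    using i(1,2) v(2) by simp_all
  ultimately show ?thesis unfolding ray_inv_def by blast
qed

lemma ray_correct: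
  assumes "stops_known s" "var s ''e0'' = e" "e \<in> starts" "var s ''N'' = 2 * nE"
  shows "wp ray_prog (\<lambda>s' _. ray_result e (arr s' ''U'') (arr s' ''W'') (var s' ''L'') \<and>
     var s' ''v'' = head G (arr s' ''U'' (var s' ''L'' - 1))) s (24 * nE + 10)"
proof -
  have le: "live_arc e" and eE: "e < nE" using assms(3) by (simp_all add: starts_def live_arc_def)
  note g0 = ginpD[OF stops_knownD(1)[OF assms(1)]]
  show ?thesis
  unfolding ray_prog_def wp_simps
  proof (intro conjI, simp, simp, simp, simp, simp, simp, rule wp_Loop[where
      I = "\<lambda>s k. ray_inv e (arr s ''U'') (arr s ''W'') (var s ''L'') (var s ''v'') \<and>
        (var s ''z'' = 0 \<longrightarrow> \<not> stop (var s ''v'') \<and> var s ''L'' < 2 * nE) \<and>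
        (var s ''z'' \<noteq> 0 \<longrightarrow> stop (var s ''v'') \<or> 2 * nE \<le> var s ''L'') \<and>
        12 * (2 * nE - var s ''L'') + 2 \<le> k"], goal_cases)
    case 1
    then show ?case using assms(2,3) le eE g0 stops_knownD(2)[OF assms(1)]
      by (simp add: ray_inv_def)
  next
    case (2 s' j)
    have sk: "stops_known s'" by (rule stops_known_frame[OF _ 2(2)]) (simp_all add: assms(1))
    note g = stops_knownD(1)[OF sk] and st = stops_knownD(2)[OF sk]
    have N: "var s' ''N'' = 2 * nE" using frame_var[OF 2(2), of "''N''"] assms(4) by simp
    define U W L v where defs: "U = arr s' ''U''" "W = arr s' ''W''" "L = var s' ''L''" "v = var s' ''v''"
    have inv: "ray_inv e U W L v" using 2(1) by (simp add: defs)
    have v: "\<not> stop v" "L < 2 * nE" using 2(1,3) by (simp_all add: defs)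
    have "12 * (2 * nE - L) + 2 \<le> j" using 2(1) by (simp add: defs)
    from credit_step[OF this v(2)] obtain R where R: "j = 12 + R" "12 * (2 * nE - Suc L) + 2 \<le> R" by blast
    note new = ray_inv_step[OF inv v]
    note lv = live_chosen[OF ray_inv_live[OF inv]]
    have fv: "first v - Suc 0 = chosen v" by (simp add: chosen_def)
    show ?case unfolding R(1) using R(2) new
      by (simp add: wp_simps defs[symmetric] ginpD[OF g] st N fv lv(2))
  next
    case (3 s' j)
    then show ?case using ray_inv_result by auto
  qed
qed

text \<open>Either \<open>p\<close> is known to be the least period of the first \<open>i\<close>
  letters, or, after a mismatch, all smaller numbers have been refuted for one letter more. The
  second case requires \<open>i < L\<close>, so at \<open>i = L\<close> the period is the
  least.\<close>

definition period_inv :: "(nat \<Rightarrow> nat) \<Rightarrow> (nat \<Rightarrow> nat) \<Rightarrow> nat \<Rightarrow> nat \<Rightarrow> nat \<Rightarrow> bool" where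
  "period_inv W P i p L \<longleftrightarrow> 1 \<le> p \<and> p \<le> i \<and> i \<le> L \<and> prefix_period W p i \<and>
     (\<forall>k. 1 \<le> k \<longrightarrow> k \<le> i \<longrightarrow> least_period W (P k) k) \<and>
     ((\<forall>q. 1 \<le> q \<longrightarrow> q < p \<longrightarrow> \<not> prefix_period W q i) \<or>
      i < L \<and> (\<forall>q. 1 \<le> q \<longrightarrow> q < p \<longrightarrow> \<not> prefix_period W q (Suc i)))"

lemma prefix_period_Suc: "prefix_period W p (Suc n) \<Longrightarrow> prefix_period W p n"
  by (simp add: prefix_period_def)

lemma period_inv_smaller:
  assumes "period_inv W P i p L" "1 \<le> q" "q < p" shows "\<not> prefix_period W q (Suc i)"
  using assms prefix_period_Suc unfolding period_inv_def by blast

lemma period_inv_match: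
  assumes inv: "period_inv W P i p L" and i: "i < L" and eq: "W i = W (i - p)"
  shows "period_inv W (P(Suc i := p)) (Suc i) p L"
proof -
  have p: "1 \<le> p" "p \<le> i" "prefix_period W p i" "\<forall>k. 1 \<le> k \<longrightarrow> k \<le> i \<longrightarrow> least_period W (P k) k"
    using inv unfolding period_inv_def by blast+
  have pp: "prefix_period W p (Suc i)"
    unfolding prefix_period_def
  proof (intro allI impI)
    fix j assume "j + p < Suc i"
    then consider "j + p < i" | "j + p = i" by linarith
    then show "W (j + p) = W j"
    proof cases
      case 1 then show ?thesis using p(3) unfolding prefix_period_def by blast
    next
      case 2
      then have "j = i - p" by simp
      then show ?thesis using eq 2 by metis
    qed
  qed
  have sm: "\<forall>q. 1 \<le> q \<longrightarrow> q < p \<longrightarrow> \<not> prefix_period W q (Suc i)"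
    using period_inv_smaller[OF inv] by blast
  have lp: "least_period W p (Suc i)" unfolding least_period_def using p(1,2) pp sm by simp
  have "\<forall>k. 1 \<le> k \<longrightarrow> k \<le> Suc i \<longrightarrow> least_period W ((P(Suc i := p)) k) k"
    using p(4) lp by (simp add: le_Suc_eq)
  then show ?thesis unfolding period_inv_def using p(1,2) pp sm i by simp
qed

text \<open>The candidate was the whole prefix and the next letter differs from the first, so no
  proper period survives.\<close>

lemma period_inv_fresh:
  assumes inv: "period_inv W P i i L" and i: "i < L" and ne: "W i \<noteq> W 0"
  shows "period_inv W (P(Suc i := Suc i)) (Suc i) (Suc i) L"
proof -
  have p: "1 \<le> i" "\<forall>k. 1 \<le> k \<longrightarrow> k \<le> i \<longrightarrow> least_period W (P k) k"
    using inv unfolding period_inv_def by blast+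
  have sm: "\<forall>q. 1 \<le> q \<longrightarrow> q < Suc i \<longrightarrow> \<not> prefix_period W q (Suc i)"
  proof (intro allI impI)
    fix q assume q: "1 \<le> q" "q < Suc i"
    show "\<not> prefix_period W q (Suc i)"
    proof (cases "q = i")
      case True
      then show ?thesis using ne unfolding prefix_period_def by (metis add_0 lessI)
    next
      case False
      then show ?thesis using period_inv_smaller[OF inv q(1)] q(2) by simp
    qed
  qed
  have pp: "prefix_period W (Suc i) (Suc i)" by (simp add: prefix_period_def)
  have lp: "least_period W (Suc i) (Suc i)" unfolding least_period_def using pp sm by simp
  have "\<forall>k. 1 \<le> k \<longrightarrow> k \<le> Suc i \<longrightarrow> least_period W ((P(Suc i := Suc i)) k) k"
    using p(2) lp by (simp add: le_Suc_eq)
  then show ?thesis unfolding period_inv_def using pp sm i by simp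
qed

text \<open>A period \<open>q > p\<close> of the longer prefix, combined with the period
  \<open>p\<close> of the shorter one, leaves the period \<open>q - p\<close> on the first
  \<open>i - p\<close> letters. So the next candidate exceeds \<open>p\<close> by the least period
  of that prefix, which is already tabulated.\<close>

lemma period_inv_mismatch:
  assumes inv: "period_inv W P i p L" and i: "i < L" and ne: "W i \<noteq> W (i - p)" and x: "i - p \<noteq> 0"
  shows "period_inv W P i (p + P (i - p)) L" "1 \<le> P (i - p)" "P (i - p) \<le> i - p"
proof -
  let ?x = "i - p"
  have p: "1 \<le> p" "p \<le> i" "prefix_period W p i" "\<forall>k. 1 \<le> k \<longrightarrow> k \<le> i \<longrightarrow> least_period W (P k) k"
    using inv unfolding period_inv_def by blast+
  have lp: "least_period W (P ?x) ?x" using p(4) x by simp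
  then show P: "1 \<le> P ?x" "P ?x \<le> ?x" by (simp_all add: least_period_def)
  have pp: "prefix_period W (p + P ?x) i"
    unfolding prefix_period_def
  proof (intro allI impI)
    fix j assume j: "j + (p + P ?x) < i"
    then have "j + P ?x < ?x" by linarith
    then have "W (j + P ?x) = W j" using lp unfolding least_period_def prefix_period_def by blast
    moreover have "W (j + P ?x + p) = W (j + P ?x)"
      using p(3)[unfolded prefix_period_def, rule_format, of "j + P ?x"] j by simp
    ultimately show "W (j + (p + P ?x)) = W j" by (simp add: ac_simps)
  qed
  have sm: "\<forall>q. 1 \<le> q \<longrightarrow> q < p + P ?x \<longrightarrow> \<not> prefix_period W q (Suc i)"
  proof (intro allI impI notI)
    fix q assume q: "1 \<le> q" "q < p + P ?x" and per: "prefix_period W q (Suc i)"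
    consider "q < p" | "q = p" | "p < q" by linarith
    then show False
    proof cases
      case 1 then show ?thesis using period_inv_smaller[OF inv q(1)] per by blast
    next
      case 2
      then have "W (?x + p) = W ?x" using per[unfolded prefix_period_def, rule_format, of ?x] p(2) by simp
      then show ?thesis using ne p(2) by simp
    next
      case 3
      have "prefix_period W (q - p) ?x"
        unfolding prefix_period_def
      proof (intro allI impI)
        fix j assume j: "j + (q - p) < ?x"
        then have "j + (q - p) + p < i" "j + (q - p) + p = j + q" using 3 by simp_all
        then have "W (j + q) = W (j + (q - p))" "W (j + q) = W j"
          using p(3)[unfolded prefix_period_def, rule_format, of "j + (q - p)"]
            per[unfolded prefix_period_def, rule_format, of j] by simp_all
        then show "W (j + (q - p)) = W j" by simp
      qed
      moreover have "1 \<le> q - p" "q - p < P ?x" using 3 q(2) by simp_all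
      ultimately show ?thesis using lp unfolding least_period_def by blast
    qed
  qed
  have "p + P ?x \<le> i" using P(2) p(2) by simp
  then show "period_inv W P i (p + P ?x) L"
    unfolding period_inv_def using p(1,4) pp sm i by simp
qed

lemma period_inv_final:
  assumes "period_inv W P L p L" shows "least_period W p L"
  using assms unfolding period_inv_def least_period_def by blast

lemma period_inv_init: "1 \<le> L \<Longrightarrow> period_inv W (P(1 := 1)) 1 1 L"
  by (simp add: period_inv_def least_period_def prefix_period_def le_Suc_eq)

lemma credit_two: "c * (n - i) + d \<le> j \<Longrightarrow> i < i' \<Longrightarrow> i' \<le> n \<Longrightarrow> \<exists>K. j = c + K \<and> c * (n - i') + d \<le> (K::nat)"
proof -
  assume a: "c * (n - i) + d \<le> j" "i < i'" "i' \<le> n"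
  then obtain K where K: "j = c + K" "c * (n - Suc i) + d \<le> K" using credit_step[of c n i d j] by auto
  have "c * (n - i') \<le> c * (n - Suc i)" using a by (intro mult_le_mono2) simp
  then have "c * (n - i') + d \<le> K" using K(2) by linarith
  then show ?thesis using K(1) by blast
qed

text \<open>Each round increases \<open>i + p\<close>, which never exceeds \<open>2 * L\<close>;
  this makes the running time linear.\<close>

lemma period_correct:
  assumes "1 \<le> var s ''L''"
  shows "wp period_prog (\<lambda>s' _. least_period (arr s ''W'') (var s' ''p'') (var s ''L'')) s (22 * var s ''L'' + 5)"
proof -
  define L W where LW: "L = var s ''L''" "W = arr s ''W''"
  have L: "1 \<le> L" using assms by (simp add: LW)
  show ?thesis
  unfolding period_prog_def wp_simps LW[symmetric]
  proof (intro conjI, simp, simp, simp, rule wp_Loop[where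
      I = "\<lambda>s k. period_inv W (arr s ''P'') (var s ''i'') (var s ''p'') L \<and>
        11 * (2 * L - (var s ''i'' + var s ''p'')) + 2 \<le> k"], goal_cases)
    case 1
    then show ?case using period_inv_init[OF L] by simp
  next
    case (2 s' j)
    have fr: "var s' ''L'' = L" "arr s' ''W'' = W"
      using frame_var[OF 2(2), of "''L''"] frame_arr[OF 2(2), of "''W''"] by (simp_all add: LW)
    define P i p where defs: "P = arr s' ''P''" "i = var s' ''i''" "p = var s' ''p''"
    have inv: "period_inv W P i p L" using 2(1) by (simp add: defs)
    have i: "i < L" using 2(3) fr by (simp add: defs)
    have p: "1 \<le> p" "p \<le> i" using inv by (simp_all add: period_inv_def)
    have j: "11 * (2 * L - (i + p)) + 2 \<le> j" using 2(1) by (simp add: defs)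
    note unf = wp_simps defs[symmetric] fr
    show ?case
    proof (cases "W i = W (i - p)")
      case True
      note new = period_inv_match[OF inv i True]
      from credit_two[OF j, of "Suc i + p"] i p obtain K where
        K: "j = 11 + K" "11 * (2 * L - (Suc i + p)) + 2 \<le> K" by auto
      show ?thesis unfolding K(1) using K(2) new True by (simp add: unf)
    next
      case ne: False
      show ?thesis
      proof (cases "i - p = 0")
        case True
        then have ip: "p = i" using p by simp
        have ne0: "W i \<noteq> W 0" using ne True by metis
        have new: "period_inv W (P(Suc i := Suc i)) (Suc i) (Suc i) L"
          by (rule period_inv_fresh[OF inv[unfolded ip] i ne0])
        from credit_two[OF j, of "Suc i + Suc i"] i ip obtain K where
          K: "j = 11 + K" "11 * (2 * L - (Suc i + Suc i)) + 2 \<le> K" by auto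
        show ?thesis unfolding K(1) using K(2) new ne0 ip by (simp add: unf)
      next
        case False
        note new = period_inv_mismatch[OF inv i ne False]
        have "i + p < i + (p + P (i - p))" "i + (p + P (i - p)) \<le> 2 * L" using new(2,3) i p by linarith+
        from credit_two[OF j this] obtain K where
          K: "j = 11 + K" "11 * (2 * L - (i + (p + P (i - p)))) + 2 \<le> K" by auto
        show ?thesis unfolding K(1) using K(2) new(1) ne False by (simp add: unf)
      qed
    qed
  next
    case (3 s' j)
    have "var s' ''L'' = L" using frame_var[OF 3(2), of "''L''"] by (simp add: LW)
    then have "var s' ''i'' = L" using 3(1,3) by (simp add: period_inv_def)
    then show ?case using 3(1) period_inv_final[of W "arr s' ''P''" L "var s' ''p''"] by simp
  qed
qed

section \<open>Finding the next arc and tracing a cycle\<close>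

definition start_list :: "state \<Rightarrow> bool" where
  "start_list s \<longleftrightarrow> stops_known s \<and> arr s ''K'' ` {..<var s ''kk''} = starts \<and>
    inj_on (arr s ''K'') {..<var s ''kk''}"

lemma start_list_set [simp]:
  "x \<notin> {''Gamma_verts'', ''Gamma_arcs'', ''kk''} \<Longrightarrow> start_list (set_var x n s) = start_list s"
  "A \<notin> {''Gamma_tail'', ''Gamma_head'', ''gamma_emap'', ''first'', ''st'', ''C'', ''stop'', ''K''} \<Longrightarrow>
    start_list (set_arr A i n s) = start_list s"
  by (simp_all add: start_list_def arr_set_other var_set_other del: arr_set_arr var_set_var)

lemma start_list_frame:
  assumes "start_list s" "frame c s s'"
    and "{''Gamma_verts'', ''Gamma_arcs''} \<inter> wvars c = {}"
    and "{''Gamma_tail'', ''Gamma_head'', ''gamma_emap''} \<inter> warrs c = {}"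
    and "''first'' \<notin> warrs c" "''st'' \<notin> warrs c" "''C'' \<notin> warrs c" "''stop'' \<notin> warrs c"
    and "''K'' \<notin> warrs c" "''kk'' \<notin> wvars c"
  shows "start_list s'"
proof -
  have "stops_known s" using assms(1) by (simp add: start_list_def)
  then have "stops_known s'" by (rule stops_known_frame[OF _ assms(2-8)])
  then show ?thesis using assms(1) frame_arr[OF assms(2,9)] frame_var[OF assms(2,10)] by (simp add: start_list_def)
qed

definition candidate :: "nat \<Rightarrow> nat \<Rightarrow> nat \<Rightarrow> bool" where
  "candidate v a f \<longleftrightarrow> live_arc f \<and> tail G f = v \<and> lab f = a"

lemma scan_loop_correct:
  assumes sl: "start_list s" and va: "var s ''v'' = v" "var s ''a'' = a" "var s ''kk'' = kk"
    and lv: "live v" and k0: "var s ''k'' = 0"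
    and t: "var s ''t'' = (if lab (chosen v) = a then Suc (chosen v) else 0)"
  shows "wp scan_loop (\<lambda>s' _. (var s' ''t'' = 0 \<longrightarrow> (\<forall>f. \<not> candidate v a f)) \<and>
     (var s' ''t'' \<noteq> 0 \<longrightarrow> candidate v a (var s' ''t'' - 1))) s (9 * kk + 2)"
proof -
  note lc = live_chosen[OF lv]
  define K where "K = arr s ''K''"
  have cand_ch: "candidate v a (chosen v) \<longleftrightarrow> lab (chosen v) = a" using lc by (simp add: candidate_def)
  have K0: "K ` {..<kk} = starts" using sl va by (simp add: start_list_def K_def)
  let ?I = "\<lambda>s' k. var s' ''k'' \<le> kk \<and>
        (var s' ''t'' = 0 \<longrightarrow> (\<forall>f. candidate v a f \<longrightarrow> f \<noteq> chosen v \<and> f \<notin> K ` {..<var s' ''k''})) \<and>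
        (var s' ''t'' \<noteq> 0 \<longrightarrow> candidate v a (var s' ''t'' - 1)) \<and> 9 * (kk - var s' ''k'') + 2 \<le> k"
  have I0: "?I s (9 * kk + 2)" using k0 t cand_ch by auto
  show ?thesis
    unfolding scan_loop_def
  proof (rule wp_Loop[where I = ?I], goal_cases)
    case 1
    then show ?case using I0 .
  next
    case (2 s' j)
    have sl': "start_list s'" by (rule start_list_frame[OF sl 2(2)]) simp_all
    have g: "ginp s'" using sl' by (simp add: start_list_def stops_known_def)
    have fr: "var s' ''v'' = v" "var s' ''a'' = a" "var s' ''kk'' = kk" "arr s' ''K'' = K"
      using va frame_var[OF 2(2), of "''v''"] frame_var[OF 2(2), of "''a''"]
        frame_var[OF 2(2), of "''kk''"] frame_arr[OF 2(2), of "''K''"] by (simp_all add: K_def)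
    define k t where defs: "k = var s' ''k''" "t = var s' ''t''"
    have k: "k < kk" using 2(3) fr by (simp add: defs)
    define f where "f = K k"
    have fs: "f \<in> starts" using K0 k by (auto simp: f_def)
    then have fl: "live_arc f" and fE: "f < nE" by (simp_all add: starts_def live_arc_def)
    have "9 * (kk - k) + 2 \<le> j" using 2(1) by (simp add: defs)
    from credit_step[OF this k] obtain R where R: "j = 9 + R" "9 * (kk - Suc k) + 2 \<le> R" by blast
    have I: "t = 0 \<longrightarrow> (\<forall>f. candidate v a f \<longrightarrow> f \<noteq> chosen v \<and> f \<notin> K ` {..<k})"
      "t \<noteq> 0 \<longrightarrow> candidate v a (t - 1)" using 2(1) by (simp_all add: defs)
    have im: "K ` {..<Suc k} = insert f (K ` {..<k})" by (simp add: lessThan_Suc f_def)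
    have cf: "candidate v a f \<longleftrightarrow> tail G f = v \<and> lab f = a" using fl by (simp add: candidate_def)
    note unf = wp_simps defs[symmetric] fr ginpD[OF g] fE f_def[symmetric] Suc_leI[OF k]
    show ?case
    proof (cases "candidate v a f")
      case True
      then have "tail G f = v" "lab f = a" using cf by simp_all
      then show ?thesis unfolding R(1) using R(2) True by (simp add: unf)
    next
      case False
      then have new: "t = 0 \<longrightarrow> (\<forall>f. candidate v a f \<longrightarrow> f \<noteq> chosen v \<and> f \<notin> K ` {..<Suc k})"
        unfolding im using I(1) by blast
      have "tail G f \<noteq> v \<or> lab f \<noteq> a" using False cf by simp
      then show ?thesis
      proof (cases "tail G f = v")
        case True
        then have "lab f \<noteq> a" using False cf by simp
        then show ?thesis unfolding R(1) using R(2) new I(2) True by (simp add: unf)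
      next
        case False
        then show ?thesis unfolding R(1) using R(2) new I(2) by (simp add: unf)
      qed
    qed
  next
    case (3 s' j)
    have "var s' ''kk'' = kk" using va(3) frame_var[OF 3(2), of "''kk''"] by simp
    then have k: "var s' ''k'' = kk" using 3(1,3) by simp
    \<comment> \<open>A candidate outside the list does not leave a stop, so it would have to be the
      chosen arc, which was examined before the loop.\<close>
    have "\<not> candidate v a f" if "var s' ''t'' = 0" for f
    proof
      assume c: "candidate v a f"
      then have "f \<noteq> chosen v" "f \<notin> starts" using 3(1) that k K0 by auto
      then have "\<not> stop v" "tail G f = v" "live_arc f" using c by (auto simp: candidate_def starts_def)
      then show False using not_stop_chosen[of f] \<open>f \<noteq> chosen v\<close> by simp
    qed
    then show ?case using 3(1) by simp
  qed
qed

lemma scan_correct: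
  assumes sl: "start_list s" and lv: "live (var s ''v'')"
  shows "wp scan_prog (\<lambda>s' _.
     (var s' ''t'' = 0 \<longrightarrow> (\<forall>f. \<not> candidate (var s ''v'') (var s ''a'') f)) \<and>
     (var s' ''t'' \<noteq> 0 \<longrightarrow> candidate (var s ''v'') (var s ''a'') (var s' ''t'' - 1))) s (9 * var s ''kk'' + 10)"
proof -
  define v where "v = var s ''v''"
  note lc = live_chosen[OF lv, folded v_def]
  have g0: "ginp s" using sl by (simp add: start_list_def stops_known_def)
  have ch: "first v - Suc 0 = chosen v" by (simp add: chosen_def)
  have kk: "9 * var s ''kk'' + 10 = 8 + (9 * var s ''kk'' + 2)" by simp
  define Q where "Q = (\<lambda>(s' :: state) (_ :: nat). (var s' ''t'' = 0 \<longrightarrow> (\<forall>f. \<not> candidate v (var s ''a'') f)) \<and>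
     (var s' ''t'' \<noteq> 0 \<longrightarrow> candidate v (var s ''a'') (var s' ''t'' - 1)))"
  have loop: "wp scan_loop Q s1 k1" if "9 * var s ''kk'' + 2 \<le> k1" "start_list s1" "var s1 ''v'' = v"
    "var s1 ''a'' = var s ''a''" "var s1 ''kk'' = var s ''kk''" "var s1 ''k'' = 0"
    "var s1 ''t'' = (if lab (chosen v) = var s ''a'' then Suc (chosen v) else 0)" for s1 k1
    by (rule wp_weaken[OF scan_loop_correct[OF that(2-5) lv[folded v_def] that(6,7)] that(1)]) (simp add: Q_def)
  have "wp scan_prog Q s (9 * var s ''kk'' + 10)"
    unfolding scan_prog_def kk
    by (cases "lab (chosen v) = var s ''a''")
      (simp_all add: wp_simps ginpD[OF g0] v_def[symmetric] ch lc(2), (rule loop; simp add: sl v_def)+)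
  then show ?thesis by (simp add: Q_def v_def)
qed

lemma traced_extend:
  assumes tr: "traced e p U W i" and i: "1 \<le> i" "1 \<le> p" "p \<le> i" and c: "continues p U W i f" and ne: "f \<noteq> e"
  shows "traced e p (U(i := f)) (W(i := lab f)) (Suc i)"
proof -
  let ?U = "U(i := f)" and ?W = "W(i := lab f)"
  have t: "\<forall>j<i. live_arc (U j) \<and> W j = lab (U j)" "\<forall>j. Suc j < i \<longrightarrow> tail G (U (Suc j)) = head G (U j)"
    "prefix_period W p i" "\<forall>j. 0 < j \<longrightarrow> j < i \<longrightarrow> U j \<noteq> e" using tr unfolding traced_def by blast+
  have cf: "live_arc f" "tail G f = head G (U (i - 1))" "lab f = W (i - p)" using c by (simp_all add: continues_def)
  have 1: "\<forall>j<Suc i. live_arc (?U j) \<and> ?W j = lab (?U j)" using t(1) cf(1) by (simp add: less_Suc_eq)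
  have 2: "\<forall>j. Suc j < Suc i \<longrightarrow> tail G (?U (Suc j)) = head G (?U j)"
  proof (intro allI impI)
    fix j assume j: "Suc j < Suc i"
    show "tail G (?U (Suc j)) = head G (?U j)"
    proof (cases "Suc j = i")
      case True then show ?thesis using cf(2) by auto
    next
      case False then show ?thesis using t(2) j by simp
    qed
  qed
  have 3: "prefix_period ?W p (Suc i)"
    unfolding prefix_period_def
  proof (intro allI impI)
    fix j assume j: "j + p < Suc i"
    show "?W (j + p) = ?W j"
    proof (cases "j + p = i")
      case True
      then have "j = i - p" "j \<noteq> i" using i(2) by simp_all
      then show ?thesis using True cf(3) by simp
    next
      case False
      then have "j + p < i" "j \<noteq> i" using j i(2) by simp_all
      then show ?thesis using t(3) False by (simp add: prefix_period_def)
    qed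
  qed
  have 4: "\<forall>j. 0 < j \<longrightarrow> j < Suc i \<longrightarrow> ?U j \<noteq> e" using t(4) ne by (simp add: less_Suc_eq)
  show ?thesis unfolding traced_def using 1 2 3 4 by blast
qed

lemma ray_result_cong:
  assumes "ray_result e U W L" "\<And>j. j < L \<Longrightarrow> U' j = U j" "\<And>j. j < L \<Longrightarrow> W' j = W j"
  shows "ray_result e U' W' L"
proof -
  note r = ray_resultD[OF assms(1)]
  have L: "L \<le> 2 * nE" "\<And>i. i < L \<Longrightarrow> W i = lab (U i)" using assms(1) by (simp_all add: ray_result_def)
  have "tail G (U' (Suc i)) = head G (U' i) \<and> \<not> stop (tail G (U' (Suc i)))" if "Suc i < L" for i
  proof -
    have eqs: "U' (Suc i) = U (Suc i)" "U' i = U i" using assms(2) that by simp_all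
    show ?thesis unfolding eqs by (rule r(4)[OF that])
  qed
  moreover have "live_arc (U' i) \<and> W' i = lab (U' i)" if "i < L" for i
    using r(3)[OF that] L(2)[OF that] assms(2,3)[OF that] by simp
  moreover have "stop (head G (U' (L - 1))) \<or> 2 * nE \<le> L" using r(1,5) assms(2)[of "L - 1"] by simp
  moreover have "U' 0 = e" using r(1,2) assms(2)[of 0] by simp
  ultimately show ?thesis unfolding ray_result_def using r(1) L(1) by blast
qed

text \<open>The last conjunct keeps a new cycle apart from those found before. The length may reach
  \<open>2 * nE + 1\<close> because it is tested only after an arc has been stored.\<close>

definition trace_inv ::
    "nat \<Rightarrow> nat \<Rightarrow> nat \<Rightarrow> (nat \<Rightarrow> nat) \<Rightarrow> (nat \<Rightarrow> nat) \<Rightarrow> (nat \<Rightarrow> nat) \<Rightarrow> nat \<Rightarrow> nat \<Rightarrow> bool" where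
  "trace_inv e p L acc U W i v \<longleftrightarrow> ray_result e U W L \<and> least_period W p L \<and> traced e p U W i \<and>
     L \<le> i \<and> i \<le> 2 * nE + 1 \<and> v = head G (U (i - 1)) \<and> (\<forall>j. L \<le> j \<longrightarrow> j < i \<longrightarrow> acc (U j) \<noteq> p)"

definition trace_end ::
    "nat \<Rightarrow> nat \<Rightarrow> (nat \<Rightarrow> nat) \<Rightarrow> (nat \<Rightarrow> nat) \<Rightarrow> (nat \<Rightarrow> nat) \<Rightarrow> nat \<Rightarrow> nat \<Rightarrow> bool" where
  "trace_end e p acc U W i z \<longleftrightarrow>
     z = 1 \<and> (2 * nE < i \<or> (\<exists>f. continues p U W i f \<and> f \<noteq> e \<and> acc f = p) \<or> (\<forall>f. \<not> continues p U W i f)) \<or>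
     z = 2 \<and> continues p U W i e"

lemma trace_inv_extend:
  assumes inv: "trace_inv e p L acc U W i v" and c: "continues p U W i f" and f: "f \<noteq> e" "acc f \<noteq> p"
    and i: "i \<le> 2 * nE"
  shows "trace_inv e p L acc (U(i := f)) (W(i := lab f)) (Suc i) (head G f)"
proof -
  have t: "ray_result e U W L" "least_period W p L" "traced e p U W i" "L \<le> i"
    "\<forall>j. L \<le> j \<longrightarrow> j < i \<longrightarrow> acc (U j) \<noteq> p" using inv unfolding trace_inv_def by blast+
  have L: "1 \<le> L" "1 \<le> p" "p \<le> L" using t(1,2) by (simp_all add: ray_result_def least_period_def)
  have "ray_result e (U(i := f)) (W(i := lab f)) L" by (rule ray_result_cong[OF t(1)]) (use t(4) in auto)
  moreover have "least_period (W(i := lab f)) p L"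
    using t(2) least_period_cong[of L "W(i := lab f)" W p] t(4) by simp
  moreover have "traced e p (U(i := f)) (W(i := lab f)) (Suc i)"
    by (rule traced_extend[OF t(3) _ _ _ c f(1)]) (use L t(4) in auto)
  moreover have "\<forall>j. L \<le> j \<longrightarrow> j < Suc i \<longrightarrow> acc ((U(i := f)) j) \<noteq> p" using t(5) f(2) by (simp add: less_Suc_eq)
  ultimately show ?thesis unfolding trace_inv_def using t(4) i by simp
qed

lemma trace_inv_live: "trace_inv e p L acc U W i v \<Longrightarrow> live v"
proof -
  assume inv: "trace_inv e p L acc U W i v"
  then have "v = head G (U (i - 1))" "L \<le> i" "1 \<le> L" "\<forall>j<i. live_arc (U j)"
    by (simp_all add: trace_inv_def ray_result_def traced_def)
  then show ?thesis using live_arc_ends(2)[of "U (i - 1)"] by simp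
qed

lemma trace_correct:
  assumes sl: "start_list s" and e: "var s ''e0'' = e" "e \<in> starts" and N: "var s ''N'' = 2 * nE"
    and ray: "ray_result e (arr s ''U'') (arr s ''W'') (var s ''L'')"
    and lp: "least_period (arr s ''W'') (var s ''p'') (var s ''L'')"
    and v: "var s ''v'' = head G (arr s ''U'' (var s ''L'' - 1))"
  shows "wp trace_prog (\<lambda>s' _. trace_inv e (var s ''p'') (var s ''L'') (arr s ''acc'') (arr s' ''U'') (arr s' ''W'')
       (var s' ''i'') (var s' ''v'') \<and>
     trace_end e (var s ''p'') (arr s ''acc'') (arr s' ''U'') (arr s' ''W'') (var s' ''i'') (var s' ''z'')) s
    ((9 * var s ''kk'' + 24) * (2 * nE + 2) + 5)"
proof -
  define p L acc kk where defs0: "p = var s ''p''" "L = var s ''L''" "acc = arr s ''acc''" "kk = var s ''kk''"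
  let ?c = "9 * kk + 24"
  have "prefix_period (arr s ''W'') p L" using lp by (simp add: least_period_def defs0)
  then have tr: "traced e p (arr s ''U'') (arr s ''W'') L"
    using ray_traced ray e(2) by (simp add: defs0)
  have inv0: "trace_inv e p L acc (arr s ''U'') (arr s ''W'') L (var s ''v'')"
  proof -
    have "var s ''L'' \<le> 2 * nE" using ray by (simp add: ray_result_def)
    then show ?thesis using ray lp tr v by (simp add: trace_inv_def defs0)
  qed
  show ?thesis
  unfolding trace_prog_def wp_simps defs0[symmetric]
  proof (intro conjI, simp, simp, rule wp_Loop[where
      I = "\<lambda>s k. trace_inv e p L acc (arr s ''U'') (arr s ''W'') (var s ''i'') (var s ''v'') \<and>
        (var s ''z'' = 0 \<longrightarrow> var s ''i'' \<le> 2 * nE \<and> ?c * (2 * nE + 2 - var s ''i'') + 2 \<le> k) \<and>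
        (var s ''z'' \<noteq> 0 \<longrightarrow> trace_end e p acc (arr s ''U'') (arr s ''W'') (var s ''i'') (var s ''z'') \<and> 2 \<le> k)"], goal_cases)
    case 1
    have "L \<le> 2 * nE" using ray by (simp add: ray_result_def defs0)
    moreover have "?c * (2 * nE + 2 - L) \<le> ?c * (2 * nE + 2)" by (rule mult_le_mono2) simp
    ultimately show ?case using inv0 by (simp add: defs0)
  next
    case (2 s' j)
    have sl': "start_list s'" by (rule start_list_frame[OF _ 2(2)]) (simp_all add: sl scan_prog_def scan_loop_def trace_step_def)
    have g: "ginp s'" using sl' by (simp add: start_list_def stops_known_def)
    have fr: "var s' ''p'' = p" "var s' ''N'' = 2 * nE" "var s' ''kk'' = kk" "arr s' ''acc'' = acc" "var s' ''e0'' = e"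
      using N e frame_var[OF 2(2), of "''p''"] frame_var[OF 2(2), of "''N''"] frame_var[OF 2(2), of "''e0''"]
        frame_var[OF 2(2), of "''kk''"] frame_arr[OF 2(2), of "''acc''"]
      by (simp_all add: defs0 scan_prog_def scan_loop_def trace_step_def)
    define U W i v where defs: "U = arr s' ''U''" "W = arr s' ''W''" "i = var s' ''i''" "v = var s' ''v''"
    have inv: "trace_inv e p L acc U W i v" using 2(1) by (simp add: defs)
    have i: "i \<le> 2 * nE" and j: "?c * (2 * nE + 2 - i) + 2 \<le> j" using 2(1,3) by (simp_all add: defs)
    have i2: "i < 2 * nE + 2" using i by simp
    from credit_step[OF j i2] obtain R where R: "j = ?c + R" "?c * (2 * nE + 2 - Suc i) + 2 \<le> R" by blast
    have vi: "v = head G (U (i - 1))" using inv by (simp add: trace_inv_def)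
    have cand: "candidate v (W (i - p)) f \<longleftrightarrow> continues p U W i f" for f
      by (simp add: candidate_def continues_def vi)
    \<comment> \<open>One round has 9 kk + 24 credits: three for the loop test and the two
      instructions before the scan, 9 kk + 10 for the scan, and 11 for
      \<open>trace_step\<close>.\<close>
    have j3: "j - 1 - 1 - 1 = (9 * kk + 10) + (11 + R)" using R(1) by simp
    let ?s = "set_var ''a'' (W (i - p)) (set_var ''x'' (i - p) s')"
    have lv: "live (var ?s ''v'')" using trace_inv_live[OF inv] by (simp add: defs)
    have sl1: "start_list ?s" using sl' by simp
    define I where "I = (\<lambda>(s :: state) k. trace_inv e p L acc (arr s ''U'') (arr s ''W'') (var s ''i'') (var s ''v'') \<and>
        (var s ''z'' = 0 \<longrightarrow> var s ''i'' \<le> 2 * nE \<and> ?c * (2 * nE + 2 - var s ''i'') + 2 \<le> k) \<and>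
        (var s ''z'' \<noteq> 0 \<longrightarrow> trace_end e p acc (arr s ''U'') (arr s ''W'') (var s ''i'') (var s ''z'') \<and> 2 \<le> k))"
    have rest: "wp trace_step I s2 k2"
      if q: "(var s2 ''t'' = 0 \<longrightarrow> (\<forall>f. \<not> candidate v (W (i - p)) f)) \<and>
        (var s2 ''t'' \<noteq> 0 \<longrightarrow> candidate v (W (i - p)) (var s2 ''t'' - 1))"
        and fr2: "frame scan_prog ?s s2" and k2: "11 + R \<le> k2" for s2 k2
    proof -
      have f2: "var s2 ''p'' = p" "var s2 ''N'' = 2 * nE" "arr s2 ''acc'' = acc" "var s2 ''e0'' = e"
        "arr s2 ''U'' = U" "arr s2 ''W'' = W" "var s2 ''i'' = i" "var s2 ''v'' = v" "var s2 ''a'' = W (i - p)"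
        "var s2 ''z'' = 0"
        using 2(3) fr frame_var[OF fr2, of "''p''"] frame_var[OF fr2, of "''N''"] frame_var[OF fr2, of "''e0''"]
          frame_arr[OF fr2, of "''acc''"] frame_arr[OF fr2, of "''U''"] frame_arr[OF fr2, of "''W''"]
          frame_var[OF fr2, of "''i''"] frame_var[OF fr2, of "''v''"] frame_var[OF fr2, of "''a''"]
          frame_var[OF fr2, of "''z''"]
        by (simp_all add: defs scan_prog_def scan_loop_def)
      have sl2: "start_list s2" by (rule start_list_frame[OF sl1 fr2]) (simp_all add: scan_prog_def scan_loop_def)
      have g2: "ginp s2" using sl2 by (simp add: start_list_def stops_known_def)
      obtain k3 where k3: "k2 = 11 + k3" "R \<le> k3" using k2 by (metis add_diff_inverse_nat add_leD1 le_diff_conv2 add.commute leD)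
      show ?thesis
      proof (cases "var s2 ''t'' = 0")
        case True
        then have "trace_end e p acc U W i 1" using q cand by (simp add: trace_end_def)
        then show ?thesis unfolding k3(1) using True inv by (simp add: trace_step_def wp_simps I_def f2)
      next
        case False
        define f where "f = var s2 ''t'' - Suc 0"
        have cf: "continues p U W i f" using q False cand by (simp add: f_def)
        then have fE: "f < nE" and fW: "lab f = W (i - p)" by (simp_all add: continues_def live_arc_def)
        note unf = trace_step_def wp_simps I_def f2 ginpD[OF g2] fE f_def[symmetric] False
        show ?thesis
        proof (cases "f = e")
          case True
          then have "trace_end e p acc U W i 2" using cf by (simp add: trace_end_def)
          then show ?thesis unfolding k3(1) using True inv by (simp add: unf)
        next
          case fe: False
          show ?thesis
          proof (cases "acc f = p")
            case True
            then have "trace_end e p acc U W i 1" using cf fe by (auto simp: trace_end_def)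
            then show ?thesis unfolding k3(1) using True fe inv by (simp add: unf)
          next
            case False
            note new = trace_inv_extend[OF inv cf fe False i, unfolded fW]
            show ?thesis
            proof (cases "2 * nE < Suc i")
              case True
              then have "trace_end e p acc (U(i := f)) (W(i := W (i - p))) (Suc i) 1" by (simp add: trace_end_def)
              moreover have "2 \<le> k3" using R(2) k3(2) by simp
              ultimately show ?thesis unfolding k3(1) using True False fe new by (simp add: unf)
            next
              case i': False
              have "?c * (2 * nE + 2 - Suc i) + 2 \<le> k3" using R(2) k3(2) by simp
              then show ?thesis unfolding k3(1) using i' False fe new by (simp add: unf)
            qed
          qed
        qed
      qed
    qed
    have "wp scan_prog (wp trace_step I) ?s (j - 1 - 1 - 1)"
      unfolding j3
      by (rule wp_call[OF scan_correct[OF sl1 lv]], simp add: fr, rule rest) (simp_all add: defs fr)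
    moreover have "1 \<le> j" "1 \<le> j - 1" "1 \<le> j - 1 - 1" using R(1) by simp_all
    ultimately show ?case unfolding wp_simps I_def by (simp add: fr defs)
  next
    case (3 s' j)
    then show ?case by simp
  qed
qed

end

lemma block_start_append: "j \<le> length L \<Longrightarrow> block_start (L @ [us]) j = block_start L j"
  by (simp add: block_start_def)

section \<open>The list of long cycles\<close>

text \<open>Every arc is first given the next number as its head. The head of the last arc would be
  the start of the following block; it is then redirected to \<open>x\<close>, the start of this
  one.\<close>

definition emit_prog :: com where
  "emit_prog = Move ''x'' (Var ''S_arcs'') ;; Move ''k'' (Const 0) ;;
    Loop (Less (Var ''k'') (Var ''i''))
      (Load ''e'' ''U'' (Var ''k'') ;; Load ''t'' ''Gamma_tail'' (Var ''e'') ;;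
       Store ''S_tail'' (Var ''S_arcs'') (Var ''S_arcs'') ;; Store ''s_vmap'' (Var ''S_arcs'') (Var ''t'') ;;
       Store ''s_emap'' (Var ''S_arcs'') (Var ''e'') ;; Add ''y'' (Var ''S_arcs'') (Const 1) ;;
       Store ''S_head'' (Var ''S_arcs'') (Var ''y'') ;; Move ''S_arcs'' (Var ''y'') ;;
       Add ''k'' (Var ''k'') (Const 1)) ;;
    Sub ''y'' (Var ''S_arcs'') (Const 1) ;; Store ''S_head'' (Var ''y'') (Var ''x'') ;;
    Store ''acc'' (Var ''e0'') (Var ''p'')"

text \<open>There is no division: after the loop, \<open>q\<close> is the least multiple of \<open>p\<close> not below \<open>i\<close>, and \<open>d\<close> is its
  quotient by \<open>p\<close>.\<close>

definition check_prog :: com where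
  "check_prog = Branch (Equal (Var ''z'') (Const 2))
     (Move ''q'' (Const 0) ;; Move ''d'' (Const 0) ;;
      Loop (Less (Var ''q'') (Var ''i''))
        (Add ''q'' (Var ''q'') (Var ''p'') ;; Add ''d'' (Var ''d'') (Const 1)) ;;
      Branch (Equal (Var ''q'') (Var ''i''))
        (Branch (Less (Var ''d'') (Var ''b12'')) Skip emit_prog) Skip)
     Skip"

context labelled_graph begin

definition entry :: "state \<Rightarrow> nat \<Rightarrow> nat \<Rightarrow> nat \<Rightarrow> bool" where
  "entry s w h u \<longleftrightarrow> arr s ''S_tail'' w = w \<and> arr s ''S_head'' w = h \<and>
     arr s ''s_vmap'' w = tail G u \<and> arr s ''s_emap'' w = u"

definition outputs :: "state \<Rightarrow> nat list list \<Rightarrow> bool" where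
  "outputs s L \<longleftrightarrow> var s ''S_arcs'' = block_start L (length L) \<and>
     (\<forall>j<length L. \<forall>i<length (L ! j).
        entry s (block_start L j + i) (block_start L j + Suc i mod length (L ! j)) (L ! j ! i))"

definition same_below :: "state \<Rightarrow> state \<Rightarrow> nat \<Rightarrow> bool" where
  "same_below s s' n \<longleftrightarrow> (\<forall>w<n. \<forall>h u. entry s w h u \<longrightarrow> entry s' w h u)"

lemma outputs_append:
  assumes L: "outputs s L" and new: "var s' ''S_arcs'' = block_start L (length L) + length us"
    and same: "same_below s s' (block_start L (length L))"
    and us: "\<And>i. i < length us \<Longrightarrow>
      entry s' (block_start L (length L) + i) (block_start L (length L) + Suc i mod length us) (us ! i)"
  shows "outputs s' (L @ [us])"
  unfolding outputs_def
proof (intro conjI allI impI)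
  show "var s' ''S_arcs'' = block_start (L @ [us]) (length (L @ [us]))"
    using new by (simp add: block_start_def)
  fix j i assume j: "j < length (L @ [us])" and i: "i < length ((L @ [us]) ! j)"
  have bs: "block_start (L @ [us]) j = block_start L j" using j by (intro block_start_append) simp
  show "entry s' (block_start (L @ [us]) j + i)
      (block_start (L @ [us]) j + Suc i mod length ((L @ [us]) ! j)) ((L @ [us]) ! j ! i)"
  proof (cases "j < length L")
    case True
    then have nth: "(L @ [us]) ! j = L ! j" by (simp add: nth_append)
    have i': "i < length (L ! j)" using i nth by simp
    have "entry s (block_start L j + i) (block_start L j + Suc i mod length (L ! j)) (L ! j ! i)"
      using L True i' unfolding outputs_def by blast
    then show ?thesis using same block_less[OF True i'] unfolding bs nth same_below_def by blast
  next
    case False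
    then have j': "j = length L" using j by simp
    have nth: "(L @ [us]) ! j = us" by (simp add: j')
    have "i < length us" using i nth by simp
    from us[OF this] show ?thesis unfolding bs nth unfolding j' .
  qed
qed

end

context explored_graph begin

lemma emit_correct:
  assumes g: "ginp s" and L: "outputs s L" and i: "1 \<le> var s ''i''"
    and U: "\<And>k. k < var s ''i'' \<Longrightarrow> arr s ''U'' k < nE"
  shows "wp emit_prog (\<lambda>s' _. outputs s' (L @ [map (arr s ''U'') [0..<var s ''i'']]) \<and>
     arr s' ''acc'' = (arr s ''acc'')(var s ''e0'' := var s ''p'')) s (10 * var s ''i'' + 6)"
proof -
  define n U x0 where defs0: "n = var s ''i''" "U = arr s ''U''" "x0 = var s ''S_arcs''"
  have x0: "x0 = block_start L (length L)" using L by (simp add: outputs_def defs0)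
  let ?I = "\<lambda>s' k. var s' ''k'' \<le> n \<and> var s' ''S_arcs'' = x0 + var s' ''k'' \<and> same_below s s' x0 \<and>
    (\<forall>j<var s' ''k''. entry s' (x0 + j) (x0 + Suc j) (U j)) \<and> 10 * (n - var s' ''k'') + 4 \<le> k"
  show ?thesis
    unfolding emit_prog_def wp_simps
  proof (intro conjI, simp, simp, rule wp_Loop[where I = ?I], goal_cases)
    case 1
    then show ?case by (simp add: defs0 same_below_def entry_def)
  next
    case (2 s' j)
    have g': "ginp s'" by (rule ginp_frame[OF _ 2(2)]) (simp_all add: g)
    have fr: "var s' ''i'' = n" "arr s' ''U'' = U"
      using frame_var[OF 2(2), of "''i''"] frame_arr[OF 2(2), of "''U''"] by (simp_all add: defs0)
    define k where "k = var s' ''k''"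
    have k: "k < n" using 2(3) fr by (simp add: k_def)
    have "10 * (n - k) + 4 \<le> j" using 2(1) by (simp add: k_def)
    from credit_step[OF this k] obtain R where R: "j = 10 + R" "10 * (n - Suc k) + 4 \<le> R" by blast
    have Uk: "U k < nE" using U k by (simp add: defs0)
    have I: "var s' ''S_arcs'' = x0 + k" "same_below s s' x0" "\<forall>j<k. entry s' (x0 + j) (x0 + Suc j) (U j)"
      using 2(1) by (simp_all add: k_def)
    define s2 where "s2 = set_var ''k'' (Suc k) (set_var ''S_arcs'' (Suc (x0 + k)) (set_arr ''S_head'' (x0 + k) (Suc (x0 + k))
      (set_var ''y'' (Suc (x0 + k)) (set_arr ''s_emap'' (x0 + k) (U k) (set_arr ''s_vmap'' (x0 + k) (tail G (U k))
      (set_arr ''S_tail'' (x0 + k) (x0 + k) (set_var ''t'' (tail G (U k)) (set_var ''e'' (U k) s'))))))))"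
    have e2: "entry s2 w h u \<longleftrightarrow> (if w = x0 + k then h = Suc (x0 + k) \<and> u = U k else entry s' w h u)"
      if "w \<noteq> x0 + k \<or> u = U k" for w h u
      using that by (auto simp: entry_def s2_def)
    have sb: "same_below s s2 x0" using I(2) unfolding same_below_def by (simp add: e2)
    have en: "\<forall>j<Suc k. entry s2 (x0 + j) (x0 + Suc j) (U j)" using I(3) by (simp add: less_Suc_eq e2)
    have "?I s2 R" using sb en R(2) k by (simp add: s2_def)
    then show ?case unfolding R(1)
      by (simp add: wp_simps fr ginpD[OF g'] Uk I(1) k_def[symmetric] s2_def)
  next
    case (3 s' j)
    have fr: "var s' ''i'' = n" "var s' ''x'' = x0" "var s' ''e0'' = var s ''e0''" "var s' ''p'' = var s ''p''"
      "arr s' ''acc'' = arr s ''acc''"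
      using frame_var[OF 3(2), of "''i''"] frame_var[OF 3(2), of "''x''"] frame_var[OF 3(2), of "''e0''"]
        frame_var[OF 3(2), of "''p''"] frame_arr[OF 3(2), of "''acc''"] by (simp_all add: defs0)
    have k: "var s' ''k'' = n" using 3(1,3) fr by simp
    have n: "1 \<le> n" using i by (simp add: defs0)
    have I: "var s' ''S_arcs'' = x0 + n" "same_below s s' x0" "\<forall>j<n. entry s' (x0 + j) (x0 + Suc j) (U j)" "4 \<le> j"
      using 3(1) k by simp_all
    define s2 where "s2 = set_arr ''acc'' (var s ''e0'') (var s ''p'') (set_arr ''S_head'' (x0 + n - 1) x0
      (set_var ''y'' (x0 + n - 1) s'))"
    have e2: "entry s2 w h u \<longleftrightarrow> entry s' w h u" if "w \<noteq> x0 + n - 1" for w h u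
      using that by (simp add: entry_def s2_def)
    have e3: "entry s2 (x0 + n - 1) x0 u" if "entry s' (x0 + n - 1) h u" for h u
      using that by (simp add: entry_def s2_def)
    have sb: "same_below s s2 x0" using I(2) n unfolding same_below_def by (simp add: e2)
    have "entry s2 (x0 + q) (x0 + Suc q mod n) (U q)" if q: "q < n" for q
    proof (cases "Suc q = n")
      case True
      then have eq: "x0 + n - 1 = x0 + q" "Suc q mod n = 0" using n by auto
      have "entry s' (x0 + q) (x0 + Suc q) (U q)" using I(3) q by blast
      from e3[unfolded eq(1), OF this] show ?thesis by (simp add: eq(2))
    next
      case False
      then have "x0 + q \<noteq> x0 + n - 1" "Suc q mod n = Suc q" using q n by auto
      then show ?thesis using e2 I(3) q by simp
    qed
    then have "outputs s2 (L @ [map U [0..<n]])"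
      using outputs_append[OF L, of s2 "map U [0..<n]"] sb I(1) x0 by (simp add: s2_def)
    moreover obtain R where "j = 4 + R" using I(4) le_Suc_ex by blast
    ultimately show ?case unfolding wp_simps by (simp add: fr I(1) s2_def defs0)
  qed
qed

text \<open>The 13 credits per arc are three for a round of the division loop, which has at most
  \<open>i\<close> rounds because \<open>p\<close> is positive, and ten for the output of an
  arc.\<close>

lemma check_correct:
  assumes g: "ginp s" and L: "outputs s L" and i: "1 \<le> var s ''i''" and p: "1 \<le> var s ''p''"
    and U: "\<And>k. k < var s ''i'' \<Longrightarrow> arr s ''U'' k < nE" and b: "var s ''b12'' = 12 * betti1 G"
  shows "wp check_prog (\<lambda>s' _.
     if var s ''z'' = 2 \<and> var s ''p'' dvd var s ''i'' \<and> 12 * betti1 G * var s ''p'' \<le> var s ''i''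
     then outputs s' (L @ [map (arr s ''U'') [0..<var s ''i'']]) \<and>
       arr s' ''acc'' = (arr s ''acc'')(var s ''e0'' := var s ''p'')
     else outputs s' L \<and> arr s' ''acc'' = arr s ''acc'') s (13 * var s ''i'' + 12)"
proof -
  define n p where defs0: "n = var s ''i''" "p = var s ''p''"
  define Q where "Q = (\<lambda>(s' :: state) (_ :: nat). 
     if p dvd n \<and> 12 * betti1 G * p \<le> n
     then outputs s' (L @ [map (arr s ''U'') [0..<n]]) \<and> arr s' ''acc'' = (arr s ''acc'')(var s ''e0'' := p)
     else outputs s' L \<and> arr s' ''acc'' = arr s ''acc'')"
  have outL: "outputs s' L" if "frame c s s'" "''S_arcs'' \<notin> wvars c" "warrs c = {}" for c s'
    using L frame_var[OF that(1,2)] frame_arr[OF that(1)] that(3) by (simp add: outputs_def entry_def)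
  let ?body = "Add ''q'' (Var ''q'') (Var ''p'') ;; Add ''d'' (Var ''d'') (Const 1)"
  let ?pre = "Move ''q'' (Const 0) ;; Move ''d'' (Const 0) ;; Loop (Less (Var ''q'') (Var ''i'')) ?body"
  let ?end = "Branch (Equal (Var ''q'') (Var ''i'')) (Branch (Less (Var ''d'') (Var ''b12'')) Skip emit_prog) Skip"
  have pre: "wp ?pre (\<lambda>s' _. var s' ''q'' = var s' ''d'' * p \<and> n \<le> var s' ''q'' \<and> var s' ''q'' < n + p) s (3 * n + 3)"
    unfolding wp_simps
  proof (intro conjI, simp, simp, rule wp_Loop[where I = "\<lambda>s' k. var s' ''q'' = var s' ''d'' * p \<and>
      var s' ''q'' < n + p \<and> 3 * (n - var s' ''q'') + 1 \<le> k"], goal_cases)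
    case 1
    then show ?case using p by (simp add: defs0)
  next
    case (2 s' j)
    have fr: "var s' ''i'' = n" "var s' ''p'' = p"
      using frame_var[OF 2(2), of "''i''"] frame_var[OF 2(2), of "''p''"] by (simp_all add: defs0)
    have "var s' ''q'' < n" using 2(3) fr by simp
    moreover have "1 \<le> p" using p by (simp add: defs0)
    ultimately have "3 * (n - (var s' ''q'' + p)) + 3 \<le> 3 * (n - var s' ''q'')" by arith
    then have "3 + (3 * (n - (var s' ''q'' + p)) + 1) \<le> j" using 2(1) by linarith
    then obtain R where R: "j = 3 + (3 * (n - (var s' ''q'' + p)) + 1) + R" using le_Suc_ex by blast
    then show ?case using 2(1) \<open>var s' ''q'' < n\<close> by (simp add: wp_simps fr)
  next
    case (3 s' j)
    have "var s' ''i'' = n" using frame_var[OF 3(2), of "''i''"] by (simp add: defs0)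
    then show ?case using 3(1,3) by simp
  qed
  have post: "wp ?end Q s' k" if d: "var s' ''q'' = var s' ''d'' * p" "n \<le> var s' ''q''" "var s' ''q'' < n + p"
    and fr: "frame ?pre s s'" and k: "10 * n + 8 \<le> k" for s' k
  proof -
    have f: "var s' ''i'' = n" "var s' ''p'' = p" "var s' ''e0'' = var s ''e0''" "var s' ''b12'' = 12 * betti1 G"
      "arr s' = arr s"
      using b frame_var[OF fr, of "''i''"] frame_var[OF fr, of "''p''"] frame_var[OF fr, of "''e0''"]
        frame_var[OF fr, of "''b12''"] frame_arr[OF fr] by (simp_all add: defs0 fun_eq_iff)
    have p1: "1 \<le> p" using p by (simp add: defs0)
    have kk: "1 \<le> k" "1 \<le> k - 1" "1 \<le> k - 1 - 1" using k by simp_all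
    have L': "outputs s' L" by (rule outL[OF fr]) simp_all
    have g': "ginp s'" by (rule ginp_frame[OF g fr]) simp_all
    have dv: "p dvd n \<longleftrightarrow> var s' ''q'' = n"
    proof
      assume "p dvd n"
      then obtain m where m: "n = m * p" by (metis dvd_def mult.commute)
      have le: "m * p \<le> var s' ''d'' * p" and less: "var s' ''d'' * p < Suc m * p" using d m by simp_all
      have "m \<le> var s' ''d''" using le p1 by simp
      moreover have "var s' ''d'' < Suc m" using less unfolding mult_less_cancel2 by blast
      ultimately have "var s' ''d'' = m" by simp
      then show "var s' ''q'' = n" using d(1) m by simp
    next
      assume "var s' ''q'' = n"
      then show "p dvd n" using d(1) dvd_triv_right[of p "var s' ''d''"] by argo
    qed
    show ?thesis
    proof (cases "var s' ''q'' = n")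
      case False
      then show ?thesis using kk dv L' by (simp add: wp_simps f Q_def)
    next
      case q: True
      have db: "12 * betti1 G * p \<le> n \<longleftrightarrow> 12 * betti1 G \<le> var s' ''d''"
      proof -
        have "12 * betti1 G * p \<le> var s' ''d'' * p \<longleftrightarrow> 12 * betti1 G \<le> var s' ''d''"
          unfolding mult_le_cancel2 using p1 by auto
        moreover have "var s' ''d'' * p = n" using d(1) q by metis
        ultimately show ?thesis by metis
      qed
      show ?thesis
      proof (cases "var s' ''d'' < 12 * betti1 G")
        case True
        then show ?thesis using kk dv L' q db by (simp add: wp_simps f Q_def)
      next
        case False
        have "wp emit_prog Q s' (k - 1 - 1)"
        proof (rule wp_call[OF emit_correct[OF g' L']])
          show "1 \<le> var s' ''i''" using i by (simp add: f defs0)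
          show "arr s' ''U'' x < nE" if "x < var s' ''i''" for x using that U by (simp add: f defs0)
          show "10 * var s' ''i'' + 6 \<le> k - 1 - 1" using k by (simp add: f)
          fix t :: state and j
          assume "outputs t (L @ [map (arr s' ''U'') [0..<var s' ''i'']]) \<and>
            arr t ''acc'' = (arr s' ''acc'')(var s' ''e0'' := var s' ''p'')"
          then show "Q t j" using False db dv q by (simp add: Q_def f)
        qed
        then show ?thesis using kk False by (simp add: wp_simps f q)
      qed
    qed
  qed
  show ?thesis
  proof (cases "var s ''z'' = 2")
    case True
    have "wp ?pre (wp ?end Q) s (13 * n + 11)"
      by (rule wp_call[OF pre]) (use post in simp_all)
    then have "wp check_prog Q s (13 * n + 12)" unfolding check_prog_def by (simp add: wp_simps True)
    then show ?thesis unfolding Q_def defs0 by (simp only: True simp_thms)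
  next
    case False
    then show ?thesis using L by (simp add: check_prog_def wp_simps)
  qed
qed

text \<open>\<open>Es\<close> is ghost data: starting arc, label period and arc word of each
  accepted cycle, in the order of output; \<open>acc\<close> is all that the program remembers of
  it. Separation is one-sided, as in \<open>accepted_distinct\<close>: no word contains an earlier
  starting arc of the same period.\<close>

definition catalogue ::
    "nat \<Rightarrow> (nat \<Rightarrow> nat) \<Rightarrow> (nat \<Rightarrow> nat) \<Rightarrow> (nat \<times> nat \<times> nat list) list \<Rightarrow> bool" where
  "catalogue j K acc Es \<longleftrightarrow>
     (\<forall>e p us. (e, p, us) \<in> set Es \<longrightarrow> accepted e p us \<and> e \<in> K ` {..<j}) \<and>
     (\<forall>e p. 1 \<le> p \<longrightarrow> (acc e = p \<longleftrightarrow> (\<exists>us. (e, p, us) \<in> set Es))) \<and>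
     (\<forall>a b. a < b \<longrightarrow> b < length Es \<longrightarrow> fst (snd (Es ! a)) = fst (snd (Es ! b)) \<longrightarrow>
        fst (Es ! a) \<notin> set (snd (snd (Es ! b)))) \<and>
     (\<forall>T l h i. i < j \<longrightarrow> witnessed T l h \<longrightarrow> h 0 = K i \<longrightarrow>
        (\<exists>e p us. (e, p, us) \<in> set Es \<and> length us = T \<and> (\<exists>s. \<forall>n. loop_of us (n + s) = h n)))"

lemma catalogueI:
  assumes "\<And>e p us. (e, p, us) \<in> set Es \<Longrightarrow> accepted e p us \<and> e \<in> K ` {..<j}"
    and "\<And>e p. 1 \<le> p \<Longrightarrow> acc e = p \<longleftrightarrow> (\<exists>us. (e, p, us) \<in> set Es)"
    and "\<And>a b. a < b \<Longrightarrow> b < length Es \<Longrightarrow> fst (snd (Es ! a)) = fst (snd (Es ! b)) \<Longrightarrow>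
      fst (Es ! a) \<notin> set (snd (snd (Es ! b)))"
    and "\<And>T l h i. i < j \<Longrightarrow> witnessed T l h \<Longrightarrow> h 0 = K i \<Longrightarrow>
      \<exists>e p us. (e, p, us) \<in> set Es \<and> length us = T \<and> (\<exists>s. \<forall>n. loop_of us (n + s) = h n)"
  shows "catalogue j K acc Es"
  unfolding catalogue_def
proof (rule conjI[OF _ conjI[OF _ conjI]], goal_cases)
  case 1 show ?case by (intro allI impI) (rule assms(1))
next
  case 2 show ?case by (intro allI impI) (rule assms(2))
next
  case 3 show ?case by (intro allI impI) (rule assms(3))
next
  case 4 show ?case by (intro allI impI) (rule assms(4))
qed

lemma catalogueD:
  assumes "catalogue j K acc Es"
  shows "(e, p, us) \<in> set Es \<Longrightarrow> accepted e p us \<and> e \<in> K ` {..<j}"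
    and "1 \<le> p \<Longrightarrow> acc e = p \<longleftrightarrow> (\<exists>us. (e, p, us) \<in> set Es)"
    and "a < b \<Longrightarrow> b < length Es \<Longrightarrow> fst (snd (Es ! a)) = fst (snd (Es ! b)) \<Longrightarrow>
      fst (Es ! a) \<notin> set (snd (snd (Es ! b)))"
    and "i < j \<Longrightarrow> witnessed T l h \<Longrightarrow> h 0 = K i \<Longrightarrow>
      \<exists>e p us. (e, p, us) \<in> set Es \<and> length us = T \<and> (\<exists>s. \<forall>n. loop_of us (n + s) = h n)"
proof -
  note c = assms[unfolded catalogue_def]
  show "(e, p, us) \<in> set Es \<Longrightarrow> accepted e p us \<and> e \<in> K ` {..<j}"
    by (rule c[THEN conjunct1, rule_format])
  show "1 \<le> p \<Longrightarrow> acc e = p \<longleftrightarrow> (\<exists>us. (e, p, us) \<in> set Es)"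
    by (rule c[THEN conjunct2, THEN conjunct1, rule_format])
  show "a < b \<Longrightarrow> b < length Es \<Longrightarrow> fst (snd (Es ! a)) = fst (snd (Es ! b)) \<Longrightarrow>
      fst (Es ! a) \<notin> set (snd (snd (Es ! b)))"
    by (rule c[THEN conjunct2, THEN conjunct2, THEN conjunct1, rule_format])
  show "i < j \<Longrightarrow> witnessed T l h \<Longrightarrow> h 0 = K i \<Longrightarrow>
      \<exists>e p us. (e, p, us) \<in> set Es \<and> length us = T \<and> (\<exists>s. \<forall>n. loop_of us (n + s) = h n)"
    by (rule c[THEN conjunct2, THEN conjunct2, THEN conjunct2, rule_format])
qed

lemma catalogue_init: "catalogue 0 K (\<lambda>_. 0) []"
  by (rule catalogueI) simp_all

lemma witnessed_length:
  assumes "witnessed T l h" shows "l dvd T" "12 * betti1 G * l \<le> T"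
proof -
  from assms interpret r: repetitive_walk G lab T l h by (simp add: witnessed_def)
  show "l dvd T" "12 * betti1 G * l \<le> T" using r.ldvd r.deg by simp_all
qed

lemma catalogue_add:
  assumes cat: "catalogue j K acc Es" and K: "inj_on K {..<kk}" "j < kk" "K j \<in> starts"
    and inv: "trace_inv (K j) p L acc U W i v" and fin: "continues p U W i (K j)"
    and p: "p dvd i" "12 * betti1 G * p \<le> i"
  shows "catalogue (Suc j) K (acc(K j := p)) (Es @ [(K j, p, map U [0..<i])])"
proof -
  define e us where defs: "e = K j" "us = map U [0..<i]"
  note C1 = catalogueD(1)[OF cat] and C2 = catalogueD(2)[OF cat]
    and C3 = catalogueD(3)[OF cat] and C4 = catalogueD(4)[OF cat]
  have t: "ray_result e U W L" "least_period W p L" "traced e p U W i" "L \<le> i"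
    "\<forall>j. L \<le> j \<longrightarrow> j < i \<longrightarrow> acc (U j) \<noteq> p" using inv unfolding trace_inv_def defs by blast+
  have p1: "1 \<le> p" using t(2) by (simp add: least_period_def)
  have L1: "1 \<le> L" "U 0 = e" using t(1) by (simp_all add: ray_result_def)
  have i1: "1 \<le> i" using L1 t(4) by simp
  have fresh: "e \<notin> K ` {..<j}" using K(1,2) unfolding defs by (auto dest!: inj_onD)
  have cl: "tail G e = head G (U (i - 1))" using fin by (simp add: continues_def defs)
  have acc': "accepted e p us"
    unfolding defs(2) by (rule trace_accepted[OF t(1,2,3) _ t(4) cl p]) (use K in \<open>simp add: defs\<close>)
  have 1: "accepted e' p' us' \<and> e' \<in> K ` {..<Suc j}" if "(e', p', us') \<in> set (Es @ [(e, p, us)])" for e' p' us'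
    using that C1[of e' p' us'] acc' by (auto simp: lessThan_Suc defs(1))
  have none: "(e, p', us') \<notin> set Es" for p' us' using C1[of e p' us'] fresh by blast
  have 2: "(acc(e := p)) e' = p' \<longleftrightarrow> (\<exists>us'. (e', p', us') \<in> set (Es @ [(e, p, us)]))" if "1 \<le> p'" for e' p'
  proof (cases "e' = e")
    case True
    then show ?thesis using none by auto
  next
    case False
    then show ?thesis using C2[OF that, of e'] by simp
  qed
  \<comment> \<open>Beyond the ray, the trace avoided starting arcs of accepted cycles with this
    period. On the ray, all arcs but the first leave vertices that are no stops, whereas starting
    arcs leave stops; and the first arc has not been used before.\<close>
  have new: "e' \<notin> set us" if m: "(e', p, us') \<in> set Es" for e' us'
  proof
    assume "e' \<in> set us"
    then obtain k where k: "k < i" "e' = U k" by (auto simp: defs)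
    have ac: "acc e' = p" using C2[OF p1, of e'] m by blast
    have st: "e' \<in> starts" "e' \<noteq> e" using C1[OF m] fresh by (auto simp: accepted_def)
    have "\<not> L \<le> k" using t(5)[rule_format, of k] k ac by blast
    then have "k < L" by simp
    moreover have "0 < k" using st(2) k(2) L1(2) by (cases k) auto
    ultimately have "\<not> stop (tail G e')" using ray_not_stop[OF t(1)] k(2) by simp
    then show False using st(1) by (simp add: starts_def)
  qed
  have 3: "fst ((Es @ [(e, p, us)]) ! a) \<notin> set (snd (snd ((Es @ [(e, p, us)]) ! b)))"
    if ab: "a < b" "b < length (Es @ [(e, p, us)])"
      "fst (snd ((Es @ [(e, p, us)]) ! a)) = fst (snd ((Es @ [(e, p, us)]) ! b))" for a b
  proof (cases "b < length Es")
    case True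
    then show ?thesis using C3[of a b] ab by (simp add: nth_append)
  next
    case False
    then have b: "b = length Es" "a < length Es" using ab by simp_all
    obtain e' p' us' where E: "Es ! a = (e', p', us')" by (cases "Es ! a")
    then have "(e', p, us') \<in> set Es" using ab(3) b nth_mem[OF b(2)] by (simp add: nth_append)
    from new[OF this] show ?thesis using b E by (simp add: nth_append)
  qed
  have 4: "\<exists>e' p' us'. (e', p', us') \<in> set (Es @ [(e, p, us)]) \<and> length us' = T \<and> (\<exists>s. \<forall>n. loop_of us' (n + s) = h n)"
    if ij: "k < Suc j" and w: "witnessed T l h" and h0: "h 0 = K k" for T l h k
  proof (cases "k = j")
    case False
    then have "k < j" using ij by simp
    from C4[OF this w h0] show ?thesis by auto
  next
    case True
    then have he: "h 0 = e" using h0 by (simp add: defs)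
    note ray = t(1)[folded he]
    have pl: "p = l" by (rule ray_period[OF w ray t(2)])
    note tr = t(3)[folded he, unfolded pl]
    note f = trace_follows[OF w ray tr t(4)]
    have "h i = h 0" using continuation[OF w ray tr t(4), of "h 0"] fin pl he by (simp add: defs)
    then have iT: "i = T" using return_length[OF w ray] i1 f by simp
    have "loop_of us n = h n" for n
    proof -
      have "n mod T < T" using i1 iT by simp
      then have "loop_of us n = h (n mod T)" using f by (simp add: loop_of_def defs iT)
      then show ?thesis using period_mod[OF witnessed_facts(5)[OF w], of n] by simp
    qed
    moreover have "length us = T" by (simp add: defs iT)
    ultimately show ?thesis by (intro exI[of _ e] exI[of _ p] exI[of _ us] conjI exI[of _ 0]) simp_all
  qed
  show ?thesis unfolding defs[symmetric] by (rule catalogueI; rule 1 2 3 4; assumption)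
qed

text \<open>If a long cycle starts at this arc with its stop-free run, the trace follows it. It is
  then neither too long nor without continuation, and a return would pass the length tests; so the
  trace met the start of an accepted cycle, and this is the same cycle by
  \<open>duplicate\<close>.\<close>

lemma catalogue_skip:
  assumes cat: "catalogue j K acc Es" and inv: "trace_inv (K j) p L acc U W i v"
    and fin: "trace_end (K j) p acc U W i z" and rej: "\<not> (z = 2 \<and> p dvd i \<and> 12 * betti1 G * p \<le> i)"
  shows "catalogue (Suc j) K acc Es"
proof -
  note C1 = catalogueD(1)[OF cat] and C2 = catalogueD(2)[OF cat]
    and C3 = catalogueD(3)[OF cat] and C4 = catalogueD(4)[OF cat]
  have t: "ray_result (K j) U W L" "least_period W p L" "traced (K j) p U W i" "L \<le> i"
    using inv unfolding trace_inv_def by blast+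
  have p1: "1 \<le> p" using t(2) by (simp add: least_period_def)
  have i1: "1 \<le> i" using t(1,4) by (simp add: ray_result_def)
  have new: "\<exists>e p us. (e, p, us) \<in> set Es \<and> length us = T \<and> (\<exists>s. \<forall>n. loop_of us (n + s) = h n)"
    if w: "witnessed T l h" and he: "h 0 = K j" for T l h
  proof -
    note ray = t(1)[folded he]
    have pl: "p = l" by (rule ray_period[OF w ray t(2)])
    note tr = t(3)[folded he, unfolded pl]
    note f = trace_follows[OF w ray tr t(4)]
    note cont = continuation[OF w ray tr t(4), folded pl]
    have small: "\<not> 2 * nE < i" using f witnessed_facts(3)[OF w] by simp
    have "\<not> (z = 2 \<and> continues p U W i (K j))"
    proof
      assume z: "z = 2 \<and> continues p U W i (K j)"
      then have "h i = h 0" using cont[of "K j"] he by simp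
      then have "i = T" using return_length[OF w ray] i1 f by simp
      then show False using rej z witnessed_length[OF w] pl by simp
    qed
    moreover have "continues p U W i (h i)" using cont by simp
    ultimately obtain f where "continues p U W i f" "acc f = p"
      using fin small unfolding trace_end_def by blast
    then have "acc (h i) = p" using cont[of f] by simp
    then obtain us where us: "(h i, p, us) \<in> set Es" using C2[OF p1, of "h i"] by blast
    have "accepted (h i) l us" using C1[OF us] pl by simp
    note d = duplicate[OF w this]
    \<comment> \<open>The listed word begins at position \<open>i\<close> of \<open>h\<close>;
      rotating it by \<open>(T - 1) * i\<close> completes \<open>i\<close> full turns.\<close>
    have "loop_of us (n + (T - 1) * i) = h n" for n
    proof -
      have eq: "i + (n + (T - 1) * i) = n + T * i"
        using witnessed_facts(1)[OF w] by (cases T) (simp_all add: algebra_simps)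
      have "loop_of us (n + (T - 1) * i) = h (i + (n + (T - 1) * i))" using d by blast
      also have "\<dots> = h n" unfolding eq by (rule period_mult[OF witnessed_facts(5)[OF w]])
      finally show ?thesis .
    qed
    moreover have "length us = T" using d by simp
    ultimately show ?thesis using us
      by (intro exI[of _ "h i"] exI[of _ p] exI[of _ us] conjI exI[of _ "(T - 1) * i"]) simp_all
  qed
  have 4: "\<exists>e p us. (e, p, us) \<in> set Es \<and> length us = T \<and> (\<exists>s. \<forall>n. loop_of us (n + s) = h n)"
    if "k < Suc j" "witnessed T l h" "h 0 = K k" for T l h k
  proof (cases "k = j")
    case True
    then show ?thesis using new that by simp
  next
    case False
    then have "k < j" using that(1) by simp
    then show ?thesis by (rule C4[OF _ that(2,3)])
  qed
  have 1: "accepted e p us \<and> e \<in> K ` {..<Suc j}" if "(e, p, us) \<in> set Es" for e p us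
    using C1[OF that] by (simp add: lessThan_Suc)
  show ?thesis by (rule catalogueI; rule 1 C2 C3 4; assumption)
qed

end

lemma wp_then:
  assumes "wp c (\<lambda>s' _. P s') s T" and "\<And>s'. P s' \<Longrightarrow> frame c s s' \<Longrightarrow> wp d (\<lambda>s _. Q s) s' T'"
  shows "wp (c ;; d) (\<lambda>s _. Q s) s (T + T')"
  unfolding wp_Seq
  by (rule wp_call[OF assms(1)]) (simp, rule wp_weaken[OF assms(2)], assumption+, simp_all)

lemma wp_mono:
  assumes "wp c (\<lambda>s' _. P s') s T" "T \<le> T'" and "\<And>s'. P s' \<Longrightarrow> frame c s s' \<Longrightarrow> Q s'"
  shows "wp c (\<lambda>s' _. Q s') s T'"
  by (rule wp_call[OF assms(1,2)]) (rule assms(3))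

definition search_prog :: com where
  "search_prog = ray_prog ;; period_prog ;; trace_prog"

definition candidate_step :: com where
  "candidate_step = Load ''e0'' ''K'' (Var ''jj'') ;; search_prog ;; check_prog ;;
     Add ''jj'' (Var ''jj'') (Const 1)"

definition candidates_prog :: com where
  "candidates_prog = Move ''jj'' (Const 0) ;; Loop (Less (Var ''jj'') (Var ''kk'')) candidate_step"

text \<open>By Euler's formula \<open>b\<close> is the Betti number, \<open>c\<close> being the
  number of components. Repeated addition passes through 2 b, 3 b and 6 b to 12 b.\<close>

definition setup_prog :: com where
  "setup_prog = Add ''N'' (Var ''Gamma_arcs'') (Var ''Gamma_arcs'') ;;
     Add ''b'' (Var ''Gamma_arcs'') (Var ''c'') ;; Sub ''b'' (Var ''b'') (Var ''Gamma_verts'') ;;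
     Add ''x'' (Var ''b'') (Var ''b'') ;; Add ''x'' (Var ''x'') (Var ''b'') ;;
     Add ''x'' (Var ''x'') (Var ''x'') ;; Add ''b12'' (Var ''x'') (Var ''x'')"

text \<open>If neither input graph has arcs, the time bound is a constant and does not even allow a
  pass over the vertices; hence the initial test. Without arcs in \<Gamma> there are no cycles, and
  the initial state already encodes the empty output.\<close>

definition long_cycles_prog :: com where
  "long_cycles_prog = Branch (Less (Const 0) (Var ''Gamma_arcs''))
     (adjacency_prog ;; components_prog ;; setup_prog ;; explore_prog ;; stops_prog ;; starts_prog ;;
      candidates_prog ;; Move ''S_verts'' (Var ''S_arcs''))
     Skip"

lemmas prog_defs = scan_prog_def scan_loop_def trace_step_def ray_prog_def period_prog_def trace_prog_def
  search_prog_def emit_prog_def check_prog_def candidate_step_def candidates_prog_def setup_prog_def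
  adjacency_prog_def components_prog_def explore_prog_def stops_prog_def starts_prog_def

context labelled_graph begin

lemma outputs_frame:
  assumes "outputs s L" "frame c s s'" "''S_arcs'' \<notin> wvars c"
    and "''S_tail'' \<notin> warrs c" "''S_head'' \<notin> warrs c" "''s_vmap'' \<notin> warrs c" "''s_emap'' \<notin> warrs c"
  shows "outputs s' L"
  using assms(1) frame_var[OF assms(2,3)] frame_arr[OF assms(2,4)] frame_arr[OF assms(2,5)]
    frame_arr[OF assms(2,6)] frame_arr[OF assms(2,7)]
  by (simp add: outputs_def entry_def)

text \<open>\<open>26 * nE + 25\<close> is the cost of \<open>check_prog\<close> on a trace of the
  greatest length, \<open>2 * nE + 1\<close>; the 2 pays for loading the starting arc and for the
  counter.\<close>

definition candidate_time :: "nat \<Rightarrow> nat" where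
  "candidate_time kk = 2 + ((24 * nE + 10) + ((44 * nE + 5) + ((9 * kk + 24) * (2 * nE + 2) + 5)) + (26 * nE + 25))"

definition solution :: "nat list list \<Rightarrow> bool" where
  "solution L \<longleftrightarrow>
     (\<forall>us\<in>set L. us \<noteq> [] \<and> long_walk G lab (length us) (\<lambda>i. us ! (i mod length us))) \<and>
     (\<forall>a b s. a < b \<longrightarrow> b < length L \<longrightarrow> length (L ! a) = length (L ! b) \<longrightarrow>
       (\<exists>i. L ! a ! ((i + s) mod length (L ! a)) \<noteq> L ! b ! (i mod length (L ! b)))) \<and>
     (\<forall>T h. long_walk G lab T h \<longrightarrow>
       (\<exists>us\<in>set L. length us = T \<and> (\<exists>s. \<forall>i. us ! ((i + s) mod T) = h i)))"

end

context explored_graph begin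

lemma search_correct:
  assumes sl: "start_list s" and e: "var s ''e0'' \<in> starts" and N: "var s ''N'' = 2 * nE"
  shows "wp search_prog (\<lambda>s' _. \<exists>L.
     trace_inv (var s ''e0'') (var s' ''p'') L (arr s ''acc'') (arr s' ''U'') (arr s' ''W'') (var s' ''i'') (var s' ''v'') \<and>
     trace_end (var s ''e0'') (var s' ''p'') (arr s ''acc'') (arr s' ''U'') (arr s' ''W'') (var s' ''i'') (var s' ''z''))
     s ((24 * nE + 10) + ((44 * nE + 5) + ((9 * var s ''kk'' + 24) * (2 * nE + 2) + 5)))"
  unfolding search_prog_def
proof (rule wp_then)
  define e where "e = var s ''e0''"
  show "wp ray_prog (\<lambda>s' _. ray_result e (arr s' ''U'') (arr s' ''W'') (var s' ''L'') \<and>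
     var s' ''v'' = head G (arr s' ''U'' (var s' ''L'' - 1))) s (24 * nE + 10)"
    by (rule ray_correct) (use sl e N in \<open>simp_all add: e_def start_list_def\<close>)
  fix s1
  assume ray: "ray_result e (arr s1 ''U'') (arr s1 ''W'') (var s1 ''L'') \<and>
     var s1 ''v'' = head G (arr s1 ''U'' (var s1 ''L'' - 1))" and f1: "frame ray_prog s s1"
  show "wp (period_prog ;; trace_prog) (\<lambda>s' _. \<exists>L.
     trace_inv (var s ''e0'') (var s' ''p'') L (arr s ''acc'') (arr s' ''U'') (arr s' ''W'') (var s' ''i'') (var s' ''v'') \<and>
     trace_end (var s ''e0'') (var s' ''p'') (arr s ''acc'') (arr s' ''U'') (arr s' ''W'') (var s' ''i'') (var s' ''z''))
     s1 ((44 * nE + 5) + ((9 * var s ''kk'' + 24) * (2 * nE + 2) + 5))"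
  proof (rule wp_then)
    have L: "1 \<le> var s1 ''L''" "var s1 ''L'' \<le> 2 * nE" using ray by (simp_all add: ray_result_def)
    show "wp period_prog (\<lambda>s' _. least_period (arr s1 ''W'') (var s' ''p'') (var s1 ''L'')) s1 (44 * nE + 5)"
      by (rule wp_mono[OF period_correct[OF L(1)]]) (use L(2) in simp_all)
    fix s2
    assume lp: "least_period (arr s1 ''W'') (var s2 ''p'') (var s1 ''L'')" and f2: "frame period_prog s1 s2"
    have sl1: "start_list s1" by (rule start_list_frame[OF sl f1]) (simp_all add: prog_defs)
    have sl2: "start_list s2" by (rule start_list_frame[OF sl1 f2]) (simp_all add: prog_defs)
    have fr: "var s2 ''e0'' = e" "var s2 ''N'' = 2 * nE" "var s2 ''kk'' = var s ''kk''" "arr s2 ''acc'' = arr s ''acc''"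
      "arr s2 ''U'' = arr s1 ''U''" "arr s2 ''W'' = arr s1 ''W''" "var s2 ''L'' = var s1 ''L''" "var s2 ''v'' = var s1 ''v''"
      using N frame_var[OF f2, of "''e0''"] frame_var[OF f1, of "''e0''"] frame_var[OF f2, of "''N''"]
        frame_var[OF f1, of "''N''"] frame_var[OF f2, of "''kk''"] frame_var[OF f1, of "''kk''"]
        frame_arr[OF f2, of "''acc''"] frame_arr[OF f1, of "''acc''"] frame_arr[OF f2, of "''U''"]
        frame_arr[OF f2, of "''W''"] frame_var[OF f2, of "''L''"] frame_var[OF f2, of "''v''"]
      by (simp_all add: e_def prog_defs)
    have e': "e \<in> starts" using e by (simp add: e_def)
    have "wp trace_prog (\<lambda>s' _. trace_inv e (var s2 ''p'') (var s2 ''L'') (arr s2 ''acc'') (arr s' ''U'') (arr s' ''W'')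
       (var s' ''i'') (var s' ''v'') \<and>
       trace_end e (var s2 ''p'') (arr s2 ''acc'') (arr s' ''U'') (arr s' ''W'') (var s' ''i'') (var s' ''z'')) s2
      ((9 * var s2 ''kk'' + 24) * (2 * nE + 2) + 5)"
      by (rule trace_correct[OF sl2 fr(1) e' fr(2)]) (use ray lp in \<open>simp_all add: fr\<close>)
    then show "wp trace_prog (\<lambda>s' _. \<exists>L.
       trace_inv (var s ''e0'') (var s' ''p'') L (arr s ''acc'') (arr s' ''U'') (arr s' ''W'') (var s' ''i'') (var s' ''v'') \<and>
       trace_end (var s ''e0'') (var s' ''p'') (arr s ''acc'') (arr s' ''U'') (arr s' ''W'') (var s' ''i'') (var s' ''z''))
       s2 ((9 * var s ''kk'' + 24) * (2 * nE + 2) + 5)"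
    proof (rule wp_mono)
      show "(9 * var s2 ''kk'' + 24) * (2 * nE + 2) + 5 \<le> (9 * var s ''kk'' + 24) * (2 * nE + 2) + 5"
        by (simp only: fr)
      fix s3
      assume a: "trace_inv e (var s2 ''p'') (var s2 ''L'') (arr s2 ''acc'') (arr s3 ''U'') (arr s3 ''W'')
         (var s3 ''i'') (var s3 ''v'') \<and>
         trace_end e (var s2 ''p'') (arr s2 ''acc'') (arr s3 ''U'') (arr s3 ''W'') (var s3 ''i'') (var s3 ''z'')"
        and f3: "frame trace_prog s2 s3"
      have "var s3 ''p'' = var s2 ''p''" using frame_var[OF f3, of "''p''"] by (simp add: prog_defs)
      then show "\<exists>L. trace_inv (var s ''e0'') (var s3 ''p'') L (arr s ''acc'') (arr s3 ''U'') (arr s3 ''W'') (var s3 ''i'') (var s3 ''v'') \<and>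
         trace_end (var s ''e0'') (var s3 ''p'') (arr s ''acc'') (arr s3 ''U'') (arr s3 ''W'') (var s3 ''i'') (var s3 ''z'')"
        using a unfolding fr e_def by (intro exI[of _ "var s1 ''L''"]) (simp only:)
    qed
  qed
qed

definition processed :: "state \<Rightarrow> nat \<Rightarrow> bool" where
  "processed s j \<longleftrightarrow> start_list s \<and> var s ''N'' = 2 * nE \<and> var s ''b12'' = 12 * betti1 G \<and>
     (\<exists>Es. catalogue j (arr s ''K'') (arr s ''acc'') Es \<and> outputs s (map (snd \<circ> snd) Es))"

lemma candidate_correct:
  assumes pr: "processed s j" and j: "var s ''jj'' = j" "j < var s ''kk''"
  shows "wp candidate_step (\<lambda>s' _. processed s' (Suc j) \<and> var s' ''jj'' = Suc j) s (candidate_time (var s ''kk''))"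
proof -
  define K acc kk where defs: "K = arr s ''K''" "acc = arr s ''acc''" "kk = var s ''kk''"
  define e where "e = K j"
  have sl: "start_list s" and Nb: "var s ''N'' = 2 * nE" "var s ''b12'' = 12 * betti1 G"
    using pr unfolding processed_def by blast+
  obtain Es where cat: "catalogue j K acc Es" and out: "outputs s (map (snd \<circ> snd) Es)"
    using pr unfolding processed_def defs by blast
  have K: "inj_on K {..<kk}" "j < kk" "K j \<in> starts" using sl j by (auto simp: start_list_def defs)
  let ?s1 = "set_var ''e0'' e s"
  let ?T = "(24 * nE + 10) + ((44 * nE + 5) + ((9 * kk + 24) * (2 * nE + 2) + 5))"
  define P2 where "P2 = (\<lambda>s' :: state. \<exists>L.
     trace_inv e (var s' ''p'') L acc (arr s' ''U'') (arr s' ''W'') (var s' ''i'') (var s' ''v'') \<and>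
     trace_end e (var s' ''p'') acc (arr s' ''U'') (arr s' ''W'') (var s' ''i'') (var s' ''z''))"
  have sl1: "start_list ?s1" using sl by simp
  have "wp search_prog (\<lambda>s' _. P2 s') ?s1 ?T"
    using search_correct[OF sl1] K(3) Nb unfolding P2_def by (simp add: e_def defs)
  define Q where "Q = (\<lambda>s' :: state. processed s' (Suc j) \<and> var s' ''jj'' = Suc j)"
  have last: "wp (check_prog ;; Add ''jj'' (Var ''jj'') (Const 1)) (\<lambda>s' _. Q s') s2 ((26 * nE + 25) + 1)"
    if p2: "P2 s2" and f2: "frame search_prog ?s1 s2" for s2
  proof -
    define p U W i v z where d2: "p = var s2 ''p''" "U = arr s2 ''U''" "W = arr s2 ''W''" "i = var s2 ''i''"
      "v = var s2 ''v''" "z = var s2 ''z''"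
    from p2 obtain L where inv: "trace_inv e p L acc U W i v" and fin: "trace_end e p acc U W i z"
      unfolding P2_def d2 by blast
    have i: "1 \<le> i" "i \<le> 2 * nE + 1" and p: "1 \<le> p" and U: "\<And>k. k < i \<Longrightarrow> U k < nE"
    proof -
      have t: "ray_result e U W L" "least_period W p L" "traced e p U W i" "L \<le> i" "i \<le> 2 * nE + 1"
        using inv unfolding trace_inv_def by blast+
      show "1 \<le> i" "i \<le> 2 * nE + 1" "1 \<le> p" using t by (simp_all add: ray_result_def least_period_def)
      show "U k < nE" if "k < i" for k using t(3) that by (simp add: traced_def live_arc_def)
    qed
    have sl2: "start_list s2" by (rule start_list_frame[OF sl1 f2]) (simp_all add: prog_defs)
    then have g2: "ginp s2" by (simp add: start_list_def stops_known_def)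
    have out1: "outputs ?s1 (map (snd \<circ> snd) Es)" using out by (simp add: outputs_def entry_def)
    have out2: "outputs s2 (map (snd \<circ> snd) Es)"
      by (rule outputs_frame[OF out1 f2]) (simp_all add: prog_defs)
    have fr: "var s2 ''N'' = 2 * nE" "var s2 ''b12'' = 12 * betti1 G" "arr s2 ''K'' = K" "arr s2 ''acc'' = acc"
      "var s2 ''e0'' = e" "var s2 ''jj'' = j"
      using Nb j(1) frame_var[OF f2, of "''N''"] frame_var[OF f2, of "''b12''"] frame_arr[OF f2, of "''K''"]
        frame_arr[OF f2, of "''acc''"] frame_var[OF f2, of "''e0''"] frame_var[OF f2, of "''jj''"]
      by (simp_all add: prog_defs defs)
    define ok where "ok \<longleftrightarrow> z = 2 \<and> p dvd i \<and> 12 * betti1 G * p \<le> i"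
    define P3 where "P3 = (\<lambda>s' :: state. if ok
       then outputs s' (map (snd \<circ> snd) Es @ [map U [0..<i]]) \<and> arr s' ''acc'' = acc(e := p)
       else outputs s' (map (snd \<circ> snd) Es) \<and> arr s' ''acc'' = acc)"
    have c: "wp check_prog (\<lambda>s' _. P3 s') s2 (13 * i + 12)"
      using check_correct[OF g2 out2, folded d2, OF i(1) p U fr(2)]
      unfolding P3_def ok_def fr by simp
    show ?thesis
    proof (rule wp_then)
      show "wp check_prog (\<lambda>s' _. P3 s') s2 (26 * nE + 25)"
        by (rule wp_mono[OF c]) (use i(2) in simp_all)
      fix s3
      assume p3: "P3 s3" and f3: "frame check_prog s2 s3"
      have sl3: "start_list s3" by (rule start_list_frame[OF sl2 f3]) (simp_all add: prog_defs)
      have f: "var s3 ''N'' = 2 * nE" "var s3 ''b12'' = 12 * betti1 G" "arr s3 ''K'' = K" "var s3 ''jj'' = j"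
        using fr frame_var[OF f3, of "''N''"] frame_var[OF f3, of "''b12''"] frame_arr[OF f3, of "''K''"]
          frame_var[OF f3, of "''jj''"]
        by (simp_all add: prog_defs)
      have "\<exists>Es'. catalogue (Suc j) K (arr s3 ''acc'') Es' \<and> outputs s3 (map (snd \<circ> snd) Es')"
      proof (cases ok)
        case True
        have "catalogue (Suc j) K (acc(e := p)) (Es @ [(e, p, map U [0..<i])])"
          unfolding e_def
          by (rule catalogue_add[OF cat K inv[unfolded e_def]])
            (use True fin in \<open>simp_all add: ok_def trace_end_def e_def\<close>)
        then show ?thesis using p3 True
          by (intro exI[of _ "Es @ [(e, p, map U [0..<i])]"]) (simp add: P3_def)
      next
        case False
        have "catalogue (Suc j) K acc Es"
          by (rule catalogue_skip[OF cat inv[unfolded e_def] fin[unfolded e_def]]) (use False in \<open>simp add: ok_def\<close>)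
        then show ?thesis using p3 False by (intro exI[of _ Es]) (simp add: P3_def)
      qed
      then have "\<exists>Es'. catalogue (Suc j) (arr s3 ''K'') (arr s3 ''acc'') Es' \<and> outputs s3 (map (snd \<circ> snd) Es')"
        unfolding f .
      then have "processed s3 (Suc j)" using sl3 f unfolding processed_def by simp
      then have "processed (set_var ''jj'' (Suc j) s3) (Suc j)"
        by (simp add: processed_def outputs_def entry_def)
      then show "wp (Add ''jj'' (Var ''jj'') (Const 1)) (\<lambda>s' _. Q s') s3 1"
        by (simp add: wp_simps f Q_def)
    qed
  qed
  have "wp (search_prog ;; check_prog ;; Add ''jj'' (Var ''jj'') (Const 1)) (\<lambda>s' _. Q s') ?s1 (?T + ((26 * nE + 25) + 1))"
    by (rule wp_then[OF \<open>wp search_prog (\<lambda>s' _. P2 s') ?s1 ?T\<close> last])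
  moreover have "candidate_time kk = Suc (?T + ((26 * nE + 25) + 1))" by (simp add: candidate_time_def)
  ultimately have "wp candidate_step (\<lambda>s' _. Q s') s (candidate_time kk)"
    unfolding candidate_step_def wp_Seq[of "Load _ _ _"] by (simp add: wp_Load j e_def defs)
  then show ?thesis unfolding Q_def defs .
qed

lemma candidates_correct:
  assumes pr: "processed s 0"
  shows "wp candidates_prog (\<lambda>s' _. processed s' (var s ''kk'')) s ((candidate_time (var s ''kk'') + 1) * var s ''kk'' + 2)"
proof -
  define kk c where defs: "kk = var s ''kk''" "c = candidate_time kk + 1"
  have "wp candidates_prog (\<lambda>s' _. processed s' kk) s (c * kk + 2)"
    unfolding candidates_prog_def wp_simps
  proof (intro conjI, simp, rule wp_Loop[where I = "\<lambda>s' k. processed s' (var s' ''jj'') \<and> var s' ''jj'' \<le> kk \<and>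
        c * (kk - var s' ''jj'') + 1 \<le> k"], goal_cases)
    case 1
    have "processed (set_var ''jj'' 0 s) 0" using pr by (simp add: processed_def outputs_def entry_def)
    then show ?case by simp
  next
    case (2 s' j)
    have fr: "var s' ''kk'' = kk" using frame_var[OF 2(2), of "''kk''"] by (simp add: prog_defs defs(1))
    define q where "q = var s' ''jj''"
    have q: "q < kk" "processed s' q" "c * (kk - q) + 1 \<le> j" using 2(1,3) fr by (simp_all add: q_def)
    from credit_step[OF q(3,1)] obtain R where R: "j = c + R" "c * (kk - Suc q) + 1 \<le> R" by blast
    have "wp candidate_step (\<lambda>s' k. processed s' (var s' ''jj'') \<and> var s' ''jj'' \<le> kk \<and>
        c * (kk - var s' ''jj'') + 1 \<le> k) s' (j - 1)"
    proof (rule wp_call[OF candidate_correct[OF q(2)]])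
      show "var s' ''jj'' = q" by (simp add: q_def)
      show "q < var s' ''kk''" using q(1) fr by simp
      show "candidate_time (var s' ''kk'') \<le> j - 1" using R(1) unfolding fr by (simp add: defs(2))
      fix t k
      assume t: "processed t (Suc q) \<and> var t ''jj'' = Suc q" and k: "j - 1 - candidate_time (var s' ''kk'') \<le> k"
      have "R \<le> k" using k R(1) unfolding fr by (simp add: defs(2))
      then show "processed t (var t ''jj'') \<and> var t ''jj'' \<le> kk \<and> c * (kk - var t ''jj'') + 1 \<le> k"
        using t q(1) R(2) by simp
    qed
    then show ?case using R(1) by (simp add: defs(2))
  next
    case (3 s' j)
    have fr: "var s' ''kk'' = kk" using frame_var[OF 3(2), of "''kk''"] by (simp add: prog_defs defs(1))
    then have "var s' ''jj'' = kk" using 3(1,3) by simp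
    then show ?case using 3(1) by simp
  qed
  then show ?thesis unfolding defs .
qed

text \<open>For completeness, a long walk is rotated so that it begins with a starting arc and a
  stop-free run; the entry for that arc is found in the catalogue and the rotation is
  undone.\<close>

lemma catalogue_solution:
  assumes cat: "catalogue kk K acc Es" and K: "K ` {..<kk} = starts"
  shows "solution (map (snd \<circ> snd) Es)"
  unfolding solution_def
proof (rule conjI[OF _ conjI], goal_cases)
  note C1 = catalogueD(1)[OF cat] and C3 = catalogueD(3)[OF cat] and C4 = catalogueD(4)[OF cat]
  have acc: "accepted (fst (Es ! a)) (fst (snd (Es ! a))) (snd (snd (Es ! a)))" if "a < length Es" for a
    using C1[of "fst (Es ! a)" "fst (snd (Es ! a))" "snd (snd (Es ! a))"] that by simp
  {
    case 1
    show ?case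
    proof
      fix us assume "us \<in> set (map (snd \<circ> snd) Es)"
      then obtain e p where "(e, p, us) \<in> set Es" by auto
      then have "accepted e p us" using C1 by blast
      then show "us \<noteq> [] \<and> long_walk G lab (length us) (\<lambda>i. us ! (i mod length us))"
        using accepted_long[of e p us] by (simp add: loop_of_def[abs_def] accepted_def)
    qed
  next
    case 2
    show ?case
    proof (intro allI impI)
      fix a b s
      assume a: "a < b" "b < length (map (snd \<circ> snd) Es)"
        "length (map (snd \<circ> snd) Es ! a) = length (map (snd \<circ> snd) Es ! b)"
      then have ab: "a < length Es" "b < length Es" by simp_all
      from accepted_distinct[OF acc[OF ab(1)] acc[OF ab(2)], of s] a ab C3[of a b]
      show "\<exists>i. map (snd \<circ> snd) Es ! a ! ((i + s) mod length (map (snd \<circ> snd) Es ! a)) \<noteq>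
          map (snd \<circ> snd) Es ! b ! (i mod length (map (snd \<circ> snd) Es ! b))"
        by (simp add: loop_of_def)
    qed
  next
    case 3
    show ?case
    proof (intro allI impI)
      fix T h assume h: "long_walk G lab T h"
      obtain k l where w: "witnessed T l (\<lambda>n. h (k + n))" using witness_exists[OF h] by blast
      have "h k \<in> starts" using witnessed_facts(7)[OF w] by simp
      then obtain i where i: "i < kk" "h k = K i" using K by auto
      obtain e p us s where us: "(e, p, us) \<in> set Es" "length us = T" and s: "\<And>n. loop_of us (n + s) = h (k + n)"
        using C4[OF i(1) w] i(2) by auto
      have per: "period h T" "1 \<le> T" using h by (simp_all add: long_walk_def closed_walk_def)
      have "us ! ((i + (s + (T - 1) * k)) mod T) = h i" for i
      proof -
        have eq: "k + (i + (T - 1) * k) = i + T * k" using per(2) by (cases T) simp_all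
        have "us ! ((i + (s + (T - 1) * k)) mod T) = loop_of us ((i + (T - 1) * k) + s)"
          by (simp add: loop_of_def us(2) ac_simps)
        also have "\<dots> = h (k + (i + (T - 1) * k))" by (rule s)
        also have "\<dots> = h i" unfolding eq by (rule period_mult[OF per(1)])
        finally show ?thesis .
      qed
      moreover have "us \<in> set (map (snd \<circ> snd) Es)" using us(1) by force
      ultimately show "\<exists>us\<in>set (map (snd \<circ> snd) Es). length us = T \<and> (\<exists>s. \<forall>i. us ! ((i + s) mod T) = h i)"
        using us(2) by blast
    qed
  }
qed

end

context labelled_graph begin

section \<open>Assembly and running time\<close>

definition zeroed :: "name set \<Rightarrow> state \<Rightarrow> bool" where
  "zeroed X s \<longleftrightarrow> (\<forall>A\<in>X. arr s A = (\<lambda>_. 0)) \<and> var s ''S_arcs'' = 0"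

lemma zeroed_frame:
  "zeroed X s \<Longrightarrow> frame c s s' \<Longrightarrow> Y \<subseteq> X \<Longrightarrow> Y \<inter> warrs c = {} \<Longrightarrow> ''S_arcs'' \<notin> wvars c \<Longrightarrow> zeroed Y s'"
  unfolding zeroed_def frame_def by (metis disjoint_iff subset_iff)

lemma setup_correct:
  assumes "inp s" "betti1 G + nV = nE + var s ''c''"
  shows "wp setup_prog (\<lambda>s' _. var s' ''N'' = 2 * nE \<and> var s' ''b12'' = 12 * betti1 G) s 7"
proof -
  have "nE + var s ''c'' - nV = betti1 G" using assms(2) by simp
  then show ?thesis using assms(1) unfolding setup_prog_def by (simp add: wp_simps inp_def)
qed

lemma candidate_time_mono: "a \<le> b \<Longrightarrow> candidate_time a \<le> candidate_time b"
  unfolding candidate_time_def by (intro add_mono mult_mono le_refl) simp_all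

definition total_time :: nat where
  "total_time = 1 + ((12 * nE + 3) + ((18 * (3 * nV + 2 * nE) + 5) + (7 + ((18 * (3 * nV + nE) + 4) + ((14 * nE + 3) +
     ((12 * nE + 4) + (((candidate_time (3 * betti1 G) + 1) * (3 * betti1 G) + 2) + 1)))))))"

lemma main_correct:
  assumes inp: "inp s" and E: "0 < nE"
    and z: "zeroed {''first'', ''fo'', ''fi'', ''comp'', ''st'', ''stop'', ''acc''} s"
  shows "wp long_cycles_prog (\<lambda>s' _. (\<exists>L. solution L \<and> outputs s' L) \<and> var s' ''S_verts'' = var s' ''S_arcs'')
    s total_time"
proof -
  define Q where "Q = (\<lambda>s' :: state. (\<exists>L. solution L \<and> outputs s' L) \<and> var s' ''S_verts'' = var s' ''S_arcs'')"
  let ?T7 = "(candidate_time (3 * betti1 G) + 1) * (3 * betti1 G) + 2"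
  let ?T6 = "(12 * nE + 4) + (?T7 + 1)"
  let ?T5 = "(14 * nE + 3) + ?T6"
  let ?T4 = "(18 * (3 * nV + nE) + 4) + ?T5"
  let ?T3 = "7 + ?T4"
  let ?T2 = "(18 * (3 * nV + 2 * nE) + 5) + ?T3"
  let ?T1 = "(12 * nE + 3) + ?T2"
  let ?p7 = "candidates_prog ;; Move ''S_verts'' (Var ''S_arcs'')"
  let ?p6 = "starts_prog ;; ?p7"
  let ?p5 = "stops_prog ;; ?p6"
  let ?p4 = "explore_prog ;; ?p5"
  let ?p3 = "setup_prog ;; ?p4"
  let ?p2 = "components_prog ;; ?p3"
  let ?p1 = "adjacency_prog ;; ?p2"
  have "wp ?p1 (\<lambda>s' _. Q s') s ?T1"
  proof (rule wp_then)
    show "wp adjacency_prog (\<lambda>s' _. lists s' nE) s (12 * nE + 3)"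
      by (rule adjacency_correct[OF inp]) (use z in \<open>simp_all add: zeroed_def\<close>)
    fix s1 assume l1: "lists s1 nE" and f1: "frame adjacency_prog s s1"
    have i1: "inp s1" by (rule inp_frame[OF inp f1]) (simp_all add: prog_defs)
    have z1: "zeroed {''comp'', ''st'', ''stop'', ''acc''} s1"
      by (rule zeroed_frame[OF z f1]) (simp_all add: prog_defs)
    show "wp ?p2 (\<lambda>s' _. Q s') s1 ?T2"
    proof (rule wp_then)
      show "wp components_prog (\<lambda>s' _. betti1 G + nV = nE + var s' ''c'') s1 (18 * (3 * nV + 2 * nE) + 5)"
        by (rule components_correct[OF i1 l1]) (use z1 in \<open>simp add: zeroed_def\<close>)
      fix s2 assume c2: "betti1 G + nV = nE + var s2 ''c''" and f2: "frame components_prog s1 s2"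
      have i2: "inp s2" by (rule inp_frame[OF i1 f2]) (simp_all add: prog_defs)
      have z2: "zeroed {''st'', ''stop'', ''acc''} s2" by (rule zeroed_frame[OF z1 f2]) (simp_all add: prog_defs)
      show "wp ?p3 (\<lambda>s' _. Q s') s2 ?T3"
      proof (rule wp_then)
        show "wp setup_prog (\<lambda>s' _. var s' ''N'' = 2 * nE \<and> var s' ''b12'' = 12 * betti1 G) s2 7"
          by (rule setup_correct[OF i2 c2])
        fix s3 assume n3: "var s3 ''N'' = 2 * nE \<and> var s3 ''b12'' = 12 * betti1 G" and f3: "frame setup_prog s2 s3"
        have i3: "inp s3" by (rule inp_frame[OF i2 f3]) (simp_all add: prog_defs)
        have z3: "zeroed {''st'', ''stop'', ''acc''} s3" by (rule zeroed_frame[OF z2 f3]) (simp_all add: prog_defs)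
        have a3: "arr s3 ''first'' = arr s1 ''first''" "arr s3 ''nxtO'' = arr s1 ''nxtO''"
          using frame_arr[OF f3, of "''first''"] frame_arr[OF f2, of "''first''"]
            frame_arr[OF f3, of "''nxtO''"] frame_arr[OF f2, of "''nxtO''"] by (simp_all add: prog_defs)
        show "wp ?p4 (\<lambda>s' _. Q s') s3 ?T4"
        proof (rule wp_then)
          show "wp explore_prog (\<lambda>s' _. explored (arr s' ''first'') (arr s' ''st'') (arr s' ''C'')) s3
              (18 * (3 * nV + nE) + 4)"
            by (rule explore_correct[OF i3]) (use l1 z3 in \<open>simp_all add: a3 lists_def zeroed_def\<close>)
          fix s4 assume e4: "explored (arr s4 ''first'') (arr s4 ''st'') (arr s4 ''C'')" and f4: "frame explore_prog s3 s4"
          interpret ex: explored_graph G lab nV nE "arr s4 ''first''" "arr s4 ''st''" "arr s4 ''C''"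
            by unfold_locales (rule e4)
          have g4: "ex.ginp s4" using inp_frame[OF i3 f4] by (simp add: ex.ginp_def prog_defs)
          have z4: "zeroed {''stop'', ''acc''} s4" by (rule zeroed_frame[OF z3 f4]) (simp_all add: prog_defs)
          show "wp ?p5 (\<lambda>s' _. Q s') s4 ?T5"
          proof (rule wp_then)
            show "wp stops_prog (\<lambda>s' _. arr s' ''stop'' = (\<lambda>v. if ex.stop v then 1 else 0)) s4 (14 * nE + 3)"
              by (rule ex.stops_correct[OF g4]) (use z4 in \<open>simp add: zeroed_def\<close>)
            fix s5 assume t5: "arr s5 ''stop'' = (\<lambda>v. if ex.stop v then 1 else 0)" and f5: "frame stops_prog s4 s5"
            have "ex.ginp s5" by (rule ex.ginp_frame[OF g4 f5]) (simp_all add: prog_defs)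
            then have k5: "ex.stops_known s5" using t5 by (simp add: ex.stops_known_def)
            have z5: "zeroed {''acc''} s5" by (rule zeroed_frame[OF z4 f5]) (simp_all add: prog_defs)
            show "wp ?p6 (\<lambda>s' _. Q s') s5 ?T6"
            proof (rule wp_then)
              show "wp starts_prog (\<lambda>s' _. arr s' ''K'' ` {..<var s' ''kk''} = ex.starts \<and>
                inj_on (arr s' ''K'') {..<var s' ''kk''}) s5 (12 * nE + 4)"
                by (rule ex.starts_correct[OF k5])
              fix s6 assume k6: "arr s6 ''K'' ` {..<var s6 ''kk''} = ex.starts \<and> inj_on (arr s6 ''K'') {..<var s6 ''kk''}"
                and f6: "frame starts_prog s5 s6"
              have "ex.stops_known s6" by (rule ex.stops_known_frame[OF k5 f6]) (simp_all add: prog_defs)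
              then have sl6: "ex.start_list s6" using k6 by (simp add: ex.start_list_def)
              have z6: "zeroed {''acc''} s6" by (rule zeroed_frame[OF z5 f6]) (simp_all add: prog_defs)
              have n6: "var s6 ''N'' = 2 * nE" "var s6 ''b12'' = 12 * betti1 G"
                using n3 frame_var[OF f6, of "''N''"] frame_var[OF f6, of "''b12''"] frame_var[OF f5, of "''N''"]
                  frame_var[OF f5, of "''b12''"] frame_var[OF f4, of "''N''"] frame_var[OF f4, of "''b12''"]
                by (simp_all add: prog_defs)
              have "outputs s6 (map (snd \<circ> snd) [])" using z6 by (simp add: outputs_def zeroed_def block_start_def)
              moreover have "ex.catalogue 0 (arr s6 ''K'') (arr s6 ''acc'') []"
                using ex.catalogue_init z6 by (simp add: zeroed_def)
              ultimately have p6: "ex.processed s6 0" unfolding ex.processed_def using sl6 n6 by blast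
              have kk: "var s6 ''kk'' \<le> 3 * betti1 G"
                using ex.card_starts card_image[of "arr s6 ''K''" "{..<var s6 ''kk''}"] k6 by simp
              have time: "(candidate_time (var s6 ''kk'') + 1) * var s6 ''kk'' + 2 \<le> ?T7"
                by (intro add_mono mult_mono candidate_time_mono kk le_refl) simp_all
              show "wp ?p7 (\<lambda>s' _. Q s') s6 (?T7 + 1)"
              proof (rule wp_then)
                show "wp candidates_prog (\<lambda>s' _. ex.processed s' (var s6 ''kk'')) s6 ?T7"
                  by (rule wp_mono[OF ex.candidates_correct[OF p6] time])
                fix s7 assume p7: "ex.processed s7 (var s6 ''kk'')" and f7: "frame candidates_prog s6 s7"
                have sl7: "ex.start_list s7" using p7 unfolding ex.processed_def by blast
                have "var s7 ''kk'' = var s6 ''kk''" using frame_var[OF f7, of "''kk''"] by (simp add: prog_defs)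
                then have K7: "arr s7 ''K'' ` {..<var s6 ''kk''} = ex.starts" using sl7 by (simp add: ex.start_list_def)
                obtain Es where cat: "ex.catalogue (var s6 ''kk'') (arr s7 ''K'') (arr s7 ''acc'') Es"
                  and out: "outputs s7 (map (snd \<circ> snd) Es)" using p7 unfolding ex.processed_def by blast
                have sol: "solution (map (snd \<circ> snd) Es)" by (rule ex.catalogue_solution[OF cat K7])
                have "outputs (set_var ''S_verts'' (var s7 ''S_arcs'') s7) (map (snd \<circ> snd) Es)"
                  using out by (simp add: outputs_def entry_def)
                then show "wp (Move ''S_verts'' (Var ''S_arcs'')) (\<lambda>s' _. Q s') s7 1"
                  using sol by (auto simp add: wp_simps Q_def)
              qed
            qed
          qed
        qed
      qed
    qed
  qed
  moreover have "var s ''Gamma_arcs'' = nE" using inp by (simp add: inp_def)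
  moreover have "total_time = Suc ?T1" by (simp add: total_time_def)
  ultimately show ?thesis using E unfolding long_cycles_prog_def wp_Branch Q_def by simp
qed

text \<open>A vertex outside the boundary is the tail of some arc. This is how |\<partial>\<Gamma>|
  pays for the passes over the vertices.\<close>

lemma card_verts_le: "nV \<le> card (boundary G) + nE"
proof -
  have "verts G \<subseteq> boundary G \<union> tail G ` arcs G"
  proof
    fix v assume v: "v \<in> verts G"
    show "v \<in> boundary G \<union> tail G ` arcs G"
    proof (cases "out_arcs G v = {}")
      case True
      then show ?thesis using v by (simp add: boundary_def out_degree_def)
    next
      case False
      then show ?thesis by (auto simp: out_arcs_def)
    qed
  qed
  moreover have "finite (boundary G \<union> tail G ` arcs G)" by (simp add: boundary_def)
  ultimately have "card (verts G) \<le> card (boundary G \<union> tail G ` arcs G)" by (rule card_mono[rotated])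
  also have "\<dots> \<le> card (boundary G) + card (tail G ` arcs G)" by (rule card_Un_le)
  also have "card (tail G ` arcs G) \<le> card (arcs G)" by (rule card_image_le) simp
  finally show ?thesis by (simp add: vertsG arcsG)
qed

text \<open>Without boundary there are at most as many vertices as arcs, so the Euler inequality
  forces a positive Betti number.\<close>

lemma size_pos:
  assumes "0 < nE" shows "1 \<le> betti1 G + card (boundary G)"
proof (cases "card (boundary G) = 0")
  case True
  have "(\<lambda>_. 0 :: nat) ` verts G = {0}" using tail_less[OF assms] by (auto simp: vertsG)
  then have "nE + 1 \<le> betti1 G + nV"
    using betti1_ge[OF fin_digraph_axioms, of "\<lambda>_. 0 :: nat"] by (simp add: vertsG arcsG)
  then show ?thesis using card_verts_le True by simp
qed simp

text \<open>The leading term comes from at most 3 \<beta> starting arcs at a cost of O(\<beta> |E|)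
  each. All else is linear in |V| and |E|, and m and n are both at most m n since they are
  positive.\<close>

lemma total_time_le:
  assumes E: "0 < nE" and m: "betti1 G + card (boundary G) \<le> m" and n: "nE \<le> n"
  shows "total_time \<le> 1400 * (m\<^sup>2 * n)"
proof -
  have m1: "1 \<le> m" "betti1 G \<le> m" using size_pos[OF E] m by simp_all
  have n1: "1 \<le> n" using E n by simp
  have V: "nV \<le> m + n" using card_verts_le m n by simp
  define q where "q = m\<^sup>2 * n"
  have mn: "m * n \<le> q" using mult_le_mono1[OF m1(1), of "m * n"] by (simp add: q_def power2_eq_square)
  have nq: "n \<le> m * n" using mult_le_mono1[OF m1(1), of n] by simp
  have mq: "m \<le> m * n" using mult_le_mono2[OF n1, of m] by simp
  define X where "X = (27 * betti1 G + 24) * (2 * nE + 2)"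
  define Y where "Y = (candidate_time (3 * betti1 G) + 1) * (3 * betti1 G)"
  have "X \<le> (51 * m) * (4 * n)"
    unfolding X_def by (rule mult_le_mono) (use m1 n n1 in simp_all)
  then have "X \<le> 204 * (m * n)" by simp
  moreover have "candidate_time (3 * betti1 G) + 1 = X + 94 * nE + 48"
    by (simp add: candidate_time_def X_def)
  ultimately have c: "candidate_time (3 * betti1 G) + 1 \<le> 346 * (m * n)" using n n1 nq by linarith
  have "Y \<le> (346 * (m * n)) * (3 * m)"
    unfolding Y_def by (rule mult_le_mono[OF c]) (use m1 in simp)
  then have "Y \<le> 1038 * q" by (simp add: q_def power2_eq_square mult_ac)
  moreover have "n \<le> q" "m \<le> q" by (rule le_trans[OF nq mn], rule le_trans[OF mq mn])
  moreover have "total_time = 30 + 92 * nE + 108 * nV + Y" by (simp add: total_time_def Y_def)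
  \<comment> \<open>The coefficients add up to 30 + 92 + 2 * 108 + 1038 = 1376, which is rounded up
    to 1400.\<close>
  ultimately show ?thesis using V n n1 unfolding q_def[symmetric] by linarith
qed

end

theorem theorem7p2:
  shows "\<exists>(program :: com) (C :: nat).
    \<forall>(\<Gamma> :: (nat, nat) pre_digraph) (\<Lambda> :: (nat, nat) pre_digraph) (\<Delta> :: (nat, nat) pre_digraph)
      (\<gamma> :: (nat, nat, nat, nat) gmap) (l :: (nat, nat, nat, nat) gmap).
      numbered_graph \<Gamma> \<and> numbered_graph \<Lambda> \<and> numbered_graph \<Delta> \<and>
      forwards_immersion \<Gamma> \<Delta> \<gamma> \<and> forwards_immersion \<Lambda> \<Delta> l \<longrightarrow>
      (\<exists>t s. exec program (input_state \<Gamma> \<Lambda> \<Delta> \<gamma> l) t s \<and>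
        long_cycles_map \<Gamma> \<Delta> \<gamma> (output_graph s) (output_map s) \<and>
        t \<le> time_bound C (size_m \<Gamma> \<Lambda>) (size_n \<Gamma> \<Lambda>))"
proof (rule exI[of _ long_cycles_prog], rule exI[of _ 1400], intro allI impI, goal_cases)
  case (1 \<Gamma> \<Lambda> \<Delta> \<gamma> l)
  then have num: "numbered_graph \<Gamma>" and imm: "forwards_immersion \<Gamma> \<Delta> \<gamma>" by simp_all
  have gm: "graph_map \<Gamma> \<Delta> \<gamma>" using imm by (simp add: forwards_immersion_def)
  define s where "s = input_state \<Gamma> \<Lambda> \<Delta> \<gamma> l"
  define nV nE where "nV = card (verts \<Gamma>)" "nE = card (arcs \<Gamma>)"
  have fin: "fin_digraph \<Gamma>" and VE: "verts \<Gamma> = {..<nV}" "arcs \<Gamma> = {..<nE}"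
    using num unfolding numbered_graph_def nV_nE_def by blast+
  interpret fin_digraph \<Gamma> by (rule fin)
  interpret labelled_graph \<Gamma> "emap \<gamma>" nV nE
    by unfold_locales (use imm VE in \<open>simp_all add: forwards_immersion_def\<close>)
  have inp: "inp s" unfolding inp_def by (simp add: s_def input_state_def table_def nV_nE_def)
  have z: "zeroed {''first'', ''fo'', ''fi'', ''comp'', ''st'', ''stop'', ''acc''} s"
    by (simp add: zeroed_def s_def input_state_def)
  have map: "long_cycles_map \<Gamma> \<Delta> \<gamma> (output_graph s') (output_map s')"
    if sol: "solution L" and out: "outputs s' L" and SV: "var s' ''S_verts'' = var s' ''S_arcs''" for s' L
  proof (rule long_cycles_mapI[OF gm, where L = L])
    show "us \<noteq> [] \<and> long_walk \<Gamma> (emap \<gamma>) (length us) (\<lambda>i. us ! (i mod length us))" if "us \<in> set L" for us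
      using sol that unfolding solution_def by blast
    show "\<exists>i. L ! a ! ((i + k) mod length (L ! a)) \<noteq> L ! b ! (i mod length (L ! b))"
      if "a < b" "b < length L" "length (L ! a) = length (L ! b)" for a b k
      using sol[unfolded solution_def, THEN conjunct2, THEN conjunct1, rule_format, OF that] .
    show "\<exists>us\<in>set L. length us = T \<and> (\<exists>s. \<forall>i. us ! ((i + s) mod T) = h i)"
      if "long_walk \<Gamma> (emap \<gamma>) T h" for T h
      using sol[unfolded solution_def, THEN conjunct2, THEN conjunct2, rule_format, OF that] .
    show "verts (output_graph s') = {..<block_start L (length L)}" "arcs (output_graph s') = {..<block_start L (length L)}"
      using out SV by (simp_all add: output_graph_def outputs_def)
    fix j i assume ji: "j < length L" "i < length (L ! j)"
    have "entry s' (block_start L j + i) (block_start L j + Suc i mod length (L ! j)) (L ! j ! i)"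
      using out ji unfolding outputs_def by blast
    then show "tail (output_graph s') (block_start L j + i) = block_start L j + i \<and>
       head (output_graph s') (block_start L j + i) = block_start L j + Suc i mod length (L ! j) \<and>
       vmap (output_map s') (block_start L j + i) = tail \<Gamma> (L ! j ! i) \<and>
       emap (output_map s') (block_start L j + i) = L ! j ! i"
      by (simp add: entry_def output_graph_def output_map_def)
  qed
  show ?case
  proof (cases "nE = 0")
    case True
    \<comment> \<open>One step for the test and one for \<open>Skip\<close>; the state is returned
      unchanged.\<close>
    have "exec long_cycles_prog s (1 + 1) s"
      unfolding long_cycles_prog_def using True
      by (intro exec.BranchFalse exec.Skip) (simp add: s_def input_state_def nV_nE_def)
    moreover have "long_cycles_map \<Gamma> \<Delta> \<gamma> (output_graph s) (output_map s)"
    proof (rule map)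
      have "\<not> long_walk \<Gamma> (emap \<gamma>) T h" for T h using VE(2) True by (simp add: long_walk_def closed_walk_def)
      then show "solution []" by (simp add: solution_def)
      show "outputs s []" by (simp add: outputs_def block_start_def s_def input_state_def)
      show "var s ''S_verts'' = var s ''S_arcs''" by (simp add: s_def input_state_def)
    qed
    moreover have "1 + 1 \<le> time_bound 1400 (size_m \<Gamma> \<Lambda>) (size_n \<Gamma> \<Lambda>)" by (simp add: time_bound_def)
    ultimately show ?thesis unfolding s_def by blast
  next
    case False
    then have E: "0 < nE" by simp
    from main_correct[OF inp E z] obtain t s' L where t: "exec long_cycles_prog s t s'" "t \<le> total_time"
      and L: "solution L" "outputs s' L" "var s' ''S_verts'' = var s' ''S_arcs''" unfolding wp_def by blast
    have "total_time \<le> 1400 * ((size_m \<Gamma> \<Lambda>)\<^sup>2 * size_n \<Gamma> \<Lambda>)"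
      by (rule total_time_le[OF E]) (simp_all add: size_m_def size_n_def nV_nE_def)
    also have "\<dots> \<le> time_bound 1400 (size_m \<Gamma> \<Lambda>) (size_n \<Gamma> \<Lambda>)" by (simp add: time_bound_def)
    finally have "t \<le> time_bound 1400 (size_m \<Gamma> \<Lambda>) (size_n \<Gamma> \<Lambda>)" using t(2) by simp
    then show ?thesis using t(1) map[OF L] unfolding s_def by blast
  qed
qed

end
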